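(* Let $d\ge 2$, let $\Omega=[-L/2,L/2]^d$ be the flat torus (periodic boundary conditions), $G(u)=\frac14(1-u^2)^2$, $E(u)=\int_\Omega \frac12|\nabla u|^2+G(u)\,dx$, and for $\phi>0$ let $X_\phi=\{u\in H^1\cap L^4(\Omega): \frac{1}{L^d}\int_\Omega u\,dx=-1+\phi\}$ and $\bar u\equiv -1+\phi$. Define the energy barrier $$\Delta E=\inf_{\gamma\in\mathcal A}\max_{t\in[0,1]}\big(E(\gamma(t))-E(\bar u)\big),\qquad \mathcal A=\{\gamma\in C([0,1];X_\phi):\gamma(0)=\bar u,\ E(\gamma(1))<E(\bar u)\}.$$ (1) (Off-critical regime.) If $L\to\infty$ and $\phi\to 0$ with $\phi L^{d/(d+1)}\to\infty$ (i.e. $L\gg1$ and $L^{-d/(d+1)}\ll\phi\ll1$), then $$\Delta E=C_*\phi^{-d+1}+o(\phi^{-d+1}),\qquad C_*=\frac{\sigma_d c_0^d}{d}\Big(\frac{d-1}{4}\Big)^{d-1}.$$ (2) (Critical regime.) Fix $\xi>\xi_d$ and let $\phi=\xi L^{-d/(d+1)}$ with $L\to\infty$. Then $\bar u$ is not a global minimizer of $E$ on $X_\phi$, and $$\Delta E=C_\xi\phi^{-d+1}+o(\phi^{-d+1}).$$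
   Context: $c_0=\int_{-1}^1\sqrt{2G(s)}\,ds=\frac{2\sqrt2}{3}$; $\sigma_d$ is the surface area of the unit sphere $S^{d-1}\subset\mathbb R^d$. Set $\bar C_1=c_0\sigma_d^{1/d}d^{(d-1)/d}$ and, for $\xi\in(0,\infty)$, $f_\xi(\nu)=\bar C_1\nu^{(d-1)/d}-4\nu+4\xi^{-(d+1)}\nu^2$ for $\nu\ge0$. The critical constant is $\xi_d=c_0^{d/(d+1)}\sigma_d^{1/(d+1)}\frac{d+1}{4^{d/(d+1)}d^{1/(d+1)}}$. For $\xi>\xi_d$, $\nu_\xi$ denotes the first strictly positive zero of $f_\xi$ and $C_\xi=\max_{\nu\in[0,\nu_\xi]}f_\xi(\nu)$. *)

theory Defs
  imports "HOL-Analysis.Analysis"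
begin

definition G :: "real \<Rightarrow> real" where
  "G s = (1 - s^2)^2 / 4"

definition c0 :: real where
  "c0 = integral {-1..1} (\<lambda>s. sqrt (2 * G s))"

definition sphere_area :: "nat \<Rightarrow> real" where
  "sphere_area d = 2 * pi powr (real d / 2) / Gamma (real d / 2)"

definition Cbar1 :: "nat \<Rightarrow> real" where
  "Cbar1 d = c0 * sphere_area d powr (1 / real d) * real d powr ((real d - 1) / real d)"

definition f_xi :: "nat \<Rightarrow> real \<Rightarrow> real \<Rightarrow> real" where
  "f_xi d \<xi> \<nu> = Cbar1 d * \<nu> powr ((real d - 1) / real d) - 4 * \<nu>
                 + 4 * \<xi> powr (- (real d + 1)) * \<nu>^2"

definition xi_crit :: "nat \<Rightarrow> real" where
  "xi_crit d = c0 powr (real d / (real d + 1)) * sphere_area d powr (1 / (real d + 1))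
     * (real d + 1) / (4 powr (real d / (real d + 1)) * real d powr (1 / (real d + 1)))"

definition nu_xi :: "nat \<Rightarrow> real \<Rightarrow> real" where
  "nu_xi d \<xi> = Inf {\<nu>. \<nu> > 0 \<and> f_xi d \<xi> \<nu> = 0}"

definition C_xi :: "nat \<Rightarrow> real \<Rightarrow> real" where
  "C_xi d \<xi> = Sup (f_xi d \<xi> ` {0..nu_xi d \<xi>})"

definition C_star :: "nat \<Rightarrow> real" where
  "C_star d = sphere_area d * c0 ^ d / real d * ((real d - 1) / 4) ^ (d - 1)"

text \<open>Fundamental cell [-L/2,L/2]^d of the torus; functions are represented on it,
  periodicity is encoded through L-periodic test functions.\<close>
definition torus :: "real \<Rightarrow> (real^'n) set" where
  "torus L = {x. \<forall>i. - L / 2 \<le> x $ i \<and> x $ i \<le> L / 2}"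

definition partial :: "(real^'n \<Rightarrow> real) \<Rightarrow> 'n \<Rightarrow> real^'n \<Rightarrow> real" where
  "partial \<psi> i x = frechet_derivative \<psi> (at x) (axis i 1)"

definition periodic_C1_test :: "real \<Rightarrow> (real^'n \<Rightarrow> real) \<Rightarrow> bool" where
  "periodic_C1_test L \<psi> \<longleftrightarrow>
     (\<forall>x. \<psi> differentiable (at x)) \<and> (\<forall>i. continuous_on UNIV (partial \<psi> i))
     \<and> (\<forall>x i. \<psi> (x + L *\<^sub>R axis i 1) = \<psi> x)"

definition weak_grad :: "real \<Rightarrow> (real^'n \<Rightarrow> real) \<Rightarrow> (real^'n \<Rightarrow> real^'n) \<Rightarrow> bool" where
  "weak_grad L u g \<longleftrightarrow>
     g \<in> borel_measurable (lebesgue_on (torus L))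
     \<and> integrable (lebesgue_on (torus L)) (\<lambda>x. (norm (g x))^2)
     \<and> (\<forall>\<psi>. periodic_C1_test L \<psi> \<longrightarrow>
          (\<forall>i. (LINT x|lebesgue_on (torus L). u x * partial \<psi> i x)
               = - (LINT x|lebesgue_on (torus L). (g x $ i) * \<psi> x)))"

definition H1L4 :: "real \<Rightarrow> (real^'n \<Rightarrow> real) set" where
  "H1L4 L = {u. u \<in> borel_measurable (lebesgue_on (torus L))
               \<and> integrable (lebesgue_on (torus L)) (\<lambda>x. (u x)^2)
               \<and> integrable (lebesgue_on (torus L)) (\<lambda>x. (u x)^4)
               \<and> (\<exists>g. weak_grad L u g)}"

definition wgrad :: "real \<Rightarrow> (real^'n \<Rightarrow> real) \<Rightarrow> real^'n \<Rightarrow> real^'n" where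
  "wgrad L u = (SOME g. weak_grad L u g)"

definition X_phi :: "real \<Rightarrow> real \<Rightarrow> (real^'n \<Rightarrow> real) set" where
  "X_phi L \<phi> = {u \<in> H1L4 L.
      (1 / L ^ CARD('n)) * (LINT x|lebesgue_on (torus L). u x) = -1 + \<phi>}"

definition energy :: "real \<Rightarrow> (real^'n \<Rightarrow> real) \<Rightarrow> real" where
  "energy L u = (LINT x|lebesgue_on (torus L). (norm (wgrad L u x))^2 / 2 + G (u x))"

definition hdist :: "real \<Rightarrow> (real^'n \<Rightarrow> real) \<Rightarrow> (real^'n \<Rightarrow> real) \<Rightarrow> real" where
  "hdist L u v =
     sqrt ((LINT x|lebesgue_on (torus L). (u x - v x)^2)
           + (LINT x|lebesgue_on (torus L). (norm (wgrad L u x - wgrad L v x))^2))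
     + (LINT x|lebesgue_on (torus L). (u x - v x)^4) powr (1/4)"

definition admissible_paths :: "real \<Rightarrow> real \<Rightarrow> (real \<Rightarrow> real^'n \<Rightarrow> real) set" where
  "admissible_paths L \<phi> = {\<gamma>.
      (\<forall>t\<in>{0..1}. \<gamma> t \<in> X_phi L \<phi>)
    \<and> (\<forall>t\<in>{0..1}. ((\<lambda>s. hdist L (\<gamma> s) (\<gamma> t)) \<longlongrightarrow> 0) (at t within {0..1}))
    \<and> \<gamma> 0 = (\<lambda>x. -1 + \<phi>)
    \<and> energy L (\<gamma> 1) < energy L (\<lambda>x::real^'n. -1 + \<phi>)}"

definition energy_barrier :: "'n::finite itself \<Rightarrow> real \<Rightarrow> real \<Rightarrow> ereal" where
  "energy_barrier _ L \<phi> =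
     (INF \<gamma>\<in>(admissible_paths L \<phi> :: (real \<Rightarrow> real^'n \<Rightarrow> real) set).
        SUP t\<in>{0..1}. ereal (energy L (\<gamma> t) - energy L (\<lambda>x::real^'n. -1 + \<phi>)))"

end

theory Submission
  imports Defs
begin

text \<open>
  Subtracting from \<open>G\<close> its tangent at the background value \<open>- 1 + \<phi>\<close> does not change the excess energy
  of a state \<open>u\<close> of the prescribed mean.  Pointwise, the tilted energy density dominates the Modica--Mortola
  density of \<open>u\<close>, minus \<open>4 \<phi>\<close> on the droplet of \<open>u\<close>, plus the quadratic cost of the mass that the droplet
  takes out of the background.  The isoperimetric inequality on the large torus (a periodic form of
  Brunn--Minkowski, whose error is of relative order \<open>1 / L\<close> and hence small against \<open>\<phi>\<close>) then bounds the
  excess energy below, up to small relative errors, by \<open>Cbar1 * A powr ((d - 1) / d) - 4 * \<phi> * A + 4 * A\<^sup>2 / L ^ d\<close>,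
  where \<open>A\<close> is a droplet volume.  Along an admissible path \<open>A\<close> is continuous and starts at \<open>0\<close>, and the bound
  is positive up to the critical volume; hence the end state, whose energy is below that of the background,
  has a larger volume, and the path crosses the critical one.

  Conversely, radial droplets with the optimal profile \<open>tanh (s / sqrt 2)\<close>, steepened slightly so that it reaches
  \<open>\<plusminus> 1\<close> at a finite distance, and with growing radius form a path that realises the same bound.
  In the scaled variable \<open>x = \<phi> * A powr (1 / d)\<close> both bounds become \<open>x ^ (d - 1) * (Cbar1 - 4 * x + 4 * \<beta> * x ^ (d + 1))\<close>
  with \<open>\<beta>\<close> the limit of \<open>1 / (\<phi> ^ (d + 1) * L ^ d)\<close>.
\<close>

section \<open>The Brunn--Minkowski inequality for open sets\<close>

text \<open>No perimeter is ever defined. Brunn--Minkowski compares a superlevel set of the wall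
  cost of \<open>u\<close> with its \<open>h\<close>-neighbourhood, integration over the levels
  turns this into an inequality between integrals, and letting \<open>h\<close> tend to 0 produces
  the gradient with the sharp constant. This needs a quadratic Taylor remainder, hence
  \<open>u\<close> is mollified; gradient and quartic energy do not increase by Jensen, and the
  quadratic term of opposite sign converges in L2.

  The double well leaves no room for errors inside the transition layer. Its density is therefore
  lowered to vanish outside \<open>(-r, r)\<close> with \<open>r < 1\<close>: the gap
  \<open>(1 - r\<^sup>2)\<^sup>2 / 4\<close> absorbs all terms of order \<phi> and
  \<open>1 / L\<close> there, and \<open>r\<close> is taken close to 1 only at the end. The droplet
  volume is measured by a Lipschitz ramp, since the volume of a level set is not continuous in L2.

  \<open>wgrad\<close> is a choice among weak gradients, so the energy of an explicit state can be
  computed only once weak gradients are known to be unique almost everywhere.\<close>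

lemma root_prod_superadditive:
  fixes x y :: "'i \<Rightarrow> real"
  assumes I: "finite I" "I \<noteq> {}" and x: "\<And>i. i \<in> I \<Longrightarrow> x i > 0" and y: "\<And>i. i \<in> I \<Longrightarrow> y i > 0"
  shows "root (card I) (\<Prod>i\<in>I. x i) + root (card I) (\<Prod>i\<in>I. y i) \<le> root (card I) (\<Prod>i\<in>I. x i + y i)"
proof -
  let ?n = "card I"
  have n: "?n > 0" using I by (simp add: card_gt_0_iff)
  let ?S = "\<Prod>i\<in>I. x i + y i"
  have S: "?S > 0" by (rule prod_pos) (use x y in \<open>auto intro: add_pos_pos\<close>)
  \<comment> \<open>The inequality of arithmetic and geometric means for the ratios
    \<open>z i / (x i + y i)\<close>. For \<open>z = x\<close> and \<open>z = y\<close> the two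
    arithmetic means add up to 1.\<close>
  have ratio: "root ?n (\<Prod>i\<in>I. z i) / root ?n ?S \<le> (\<Sum>i\<in>I. z i / (x i + y i) / ?n)"
    if z: "\<And>i. i \<in> I \<Longrightarrow> z i > 0" for z
  proof -
    have pos: "z i / (x i + y i) \<ge> 0" if "i \<in> I" for i
      using that z x y by (simp add: less_imp_le add_nonneg_nonneg)
    have P: "(\<Prod>i\<in>I. z i / (x i + y i)) > 0"
      by (rule prod_pos) (use x y z in \<open>auto intro!: divide_pos_pos add_pos_pos\<close>)
    have "root ?n (\<Prod>i\<in>I. z i) / root ?n ?S = root ?n (\<Prod>i\<in>I. z i / (x i + y i))"
      by (simp add: prod_dividef real_root_divide)
    also have "\<dots> = (\<Prod>i\<in>I. z i / (x i + y i)) powr (1 / ?n)"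
      using P n by (simp add: root_powr_inverse)
    also have "\<dots> \<le> (\<Sum>i\<in>I. z i / (x i + y i) / ?n)"
      using arith_geom_mean[OF I, of "\<lambda>i. z i / (x i + y i)"] pos by simp
    finally show ?thesis .
  qed
  have "root ?n (\<Prod>i\<in>I. x i) / root ?n ?S + root ?n (\<Prod>i\<in>I. y i) / root ?n ?S
     \<le> (\<Sum>i\<in>I. x i / (x i + y i) / ?n) + (\<Sum>i\<in>I. y i / (x i + y i) / ?n)"
    using ratio[of x] ratio[of y] x y by (intro add_mono) auto
  also have "\<dots> = (\<Sum>i\<in>I. 1 / ?n)"
    unfolding sum.distrib[symmetric]
  proof (rule sum.cong)
    fix i assume "i \<in> I"
    then have "x i + y i > 0" using x y by (auto intro: add_pos_pos)
    then show "x i / (x i + y i) / ?n + y i / (x i + y i) / ?n = 1 / ?n"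
      by (simp add: add_divide_distrib[symmetric])
  qed simp
  also have "\<dots> = 1" using n by simp
  finally show ?thesis
    using S n by (simp add: add_divide_distrib[symmetric] divide_le_eq)
qed

abbreviation minkowski_sum :: "'a::plus set \<Rightarrow> 'a set \<Rightarrow> 'a set" where
  "minkowski_sum S T \<equiv> (\<Union>x\<in>S. \<Union>y\<in>T. {x + y})"

text \<open>A point of the sum box is split coordinate by coordinate: the summands sit at the same
  relative position \<open>l i\<close> in their own boxes.\<close>

lemma box_minkowski_sum:
  fixes a b c d :: "'a::euclidean_space"
  assumes ne: "box a b \<noteq> {}" "box c d \<noteq> {}"
  shows "box (a + c) (b + d) \<subseteq> minkowski_sum (box a b) (box c d)"
proof
  fix x assume x: "x \<in> box (a + c) (b + d)"
  define l where "l i = (x \<bullet> i - (a + c) \<bullet> i) / ((b + d) \<bullet> i - (a + c) \<bullet> i)" for i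
  have l: "0 < l i" "l i < 1" if "i \<in> Basis" for i
    using x that by (auto simp: l_def mem_box)
  define y where "y = (\<Sum>i\<in>Basis. (a \<bullet> i + l i * (b \<bullet> i - a \<bullet> i)) *\<^sub>R i)"
  have yi: "y \<bullet> i = a \<bullet> i + l i * (b \<bullet> i - a \<bullet> i)" if "i \<in> Basis" for i
    using that by (simp add: y_def inner_sum_left_Basis)
  have lt: "a \<bullet> i < b \<bullet> i" "c \<bullet> i < d \<bullet> i" if "i \<in> Basis" for i
    using ne that by (auto simp: box_ne_empty)
  have xi: "x \<bullet> i = (a + c) \<bullet> i + l i * ((b + d) \<bullet> i - (a + c) \<bullet> i)" if "i \<in> Basis" for i
  proof -
    have "(b + d) \<bullet> i - (a + c) \<bullet> i \<noteq> 0" using lt[OF that] by (simp add: inner_add_left)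
    then show ?thesis by (simp add: l_def)
  qed
  have conv: "p < p + t * (q - p) \<and> p + t * (q - p) < q" if "0 < t" "t < 1" "p < q" for p q t :: real
  proof -
    have "0 < t * (q - p)" "0 < (1 - t) * (q - p)" using that by auto
    then show ?thesis by (simp add: algebra_simps)
  qed
  have y: "y \<in> box a b"
    unfolding mem_box using conv l lt yi by auto
  have "(x - y) \<bullet> i = c \<bullet> i + l i * (d \<bullet> i - c \<bullet> i)" if "i \<in> Basis" for i
    using xi[OF that] yi[OF that] by (simp add: inner_diff_left inner_add_left algebra_simps)
  then have "x - y \<in> box c d"
    unfolding mem_box using conv l lt by auto
  with y show "x \<in> minkowski_sum (box a b) (box c d)"
    by (intro UN_I[of y] UN_I[of "x - y"]) auto
qed

lemma finite_measure_bounded: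
  assumes "bounded (S :: 'a::euclidean_space set)"
  shows "emeasure lborel S \<noteq> \<infinity>"
  using emeasure_bounded_finite[OF assms] by simp

lemma measure_lborel_mono_bounded:
  assumes "bounded (T :: 'a::euclidean_space set)" "S \<subseteq> T" "S \<in> sets borel" "T \<in> sets borel"
  shows "measure lborel S \<le> measure lborel T"
  using assms finite_measure_bounded
  by (intro measure_mono_fmeasurable) (auto simp: fmeasurable_def less_top[symmetric])

lemma brunn_minkowski_box:
  fixes a b c d :: "'a::euclidean_space"
  assumes ne: "box a b \<noteq> {}" "box c d \<noteq> {}"
  shows "root DIM('a) (measure lborel (box a b)) + root DIM('a) (measure lborel (box c d))
     \<le> root DIM('a) (measure lborel (minkowski_sum (box a b) (box c d)))"
proof -
  have lt: "a \<bullet> i < b \<bullet> i" "c \<bullet> i < d \<bullet> i" if "i \<in> Basis" for i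
    using ne that by (auto simp: box_ne_empty)
  have "root DIM('a) (measure lborel (box a b)) + root DIM('a) (measure lborel (box c d))
     = root DIM('a) (\<Prod>i\<in>Basis. (b - a) \<bullet> i) + root DIM('a) (\<Prod>i\<in>Basis. (d - c) \<bullet> i)"
    using lt by (simp add: measure_lborel_box_eq less_imp_le)
  also have "\<dots> \<le> root DIM('a) (\<Prod>i\<in>Basis. (b - a) \<bullet> i + (d - c) \<bullet> i)"
    using lt by (intro root_prod_superadditive) (auto simp: inner_diff_left)
  also have "(\<Prod>i\<in>Basis. (b - a) \<bullet> i + (d - c) \<bullet> i) = measure lborel (box (a + c) (b + d))"
    using lt by (auto simp: measure_lborel_box_eq less_imp_le inner_add_left inner_diff_left add_mono
        intro!: prod.cong)
  also have "root DIM('a) \<dots> \<le> root DIM('a) (measure lborel (minkowski_sum (box a b) (box c d)))"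
    using box_minkowski_sum[OF ne]
    by (intro real_root_le_mono measure_lborel_mono_bounded bounded_sums borel_open open_sums) auto
  finally show ?thesis .
qed

text \<open>Open boxes keep their form when a hyperplane cuts them, at the price of losing the null
  set on the hyperplane. Excluding empty boxes makes the cardinality an honest count, on which the
  induction can run.\<close>

definition box_family :: "'a::euclidean_space set set \<Rightarrow> bool" where
  "box_family F \<longleftrightarrow> finite F \<and> F \<noteq> {} \<and> (\<forall>K\<in>F. K \<noteq> {} \<and> (\<exists>a b. K = box a b)) \<and> pairwise disjnt F"

lemma box_family_open: "box_family F \<Longrightarrow> open (\<Union>F)"
  by (auto simp: box_family_def intro!: open_Union)

lemma box_family_bounded: "box_family F \<Longrightarrow> bounded (\<Union>F)"
  unfolding box_family_def by (metis bounded_Union bounded_box)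

lemma box_family_Union_ne: "box_family F \<Longrightarrow> \<Union>F \<noteq> {}"
  by (auto simp: box_family_def)

lemma measure_open_pos:
  assumes "open S" "bounded S" "S \<noteq> {}"
  shows "0 < measure lborel (S :: 'a::euclidean_space set)"
proof -
  have "S \<notin> null_sets lebesgue"
    using open_not_negligible assms negligible_iff_null_sets by blast
  then have "emeasure lborel S \<noteq> 0"
    using assms by (auto simp: null_sets_def)
  then show ?thesis
    using finite_measure_bounded[OF assms(2)]
    by (simp add: measure_def enn2real_positive_iff less_top zero_less_iff_neq_zero)
qed

text \<open>Empty pieces are dropped, so that a box missed by \<open>H\<close> lowers the
  count.\<close>

definition cut_family :: "'a set set \<Rightarrow> 'a set \<Rightarrow> 'a set set" where
  "cut_family F H = (\<lambda>K. K \<inter> H) ` F - {{}}"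

lemma Union_cut_family: "\<Union>(cut_family F H) = \<Union>F \<inter> H"
  by (auto simp: cut_family_def)

lemma box_family_cut:
  assumes F: "box_family F" and H: "\<And>a b :: 'a::euclidean_space. \<exists>a' b'. box a b \<inter> H = box a' b'"
    and ne: "\<Union>F \<inter> H \<noteq> {}"
  shows "box_family (cut_family F H)"
  unfolding box_family_def
proof (intro conjI ballI)
  show "finite (cut_family F H)" using F by (auto simp: cut_family_def box_family_def)
  show "cut_family F H \<noteq> {}" using ne Union_cut_family[of F H] by auto
  show "K \<noteq> {}" if "K \<in> cut_family F H" for K using that by (auto simp: cut_family_def)
  show "\<exists>a b. K = box a b" if "K \<in> cut_family F H" for K
    using that F H unfolding cut_family_def box_family_def by (metis DiffD1 imageE)
  show "pairwise disjnt (cut_family F H)"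
  proof (rule pairwiseI)
    fix X Y assume "X \<in> cut_family F H" "Y \<in> cut_family F H" "X \<noteq> Y"
    then obtain K L where "K \<in> F" "L \<in> F" "X = K \<inter> H" "Y = L \<inter> H" "K \<noteq> L"
      by (auto simp: cut_family_def)
    then show "disjnt X Y" using F by (auto simp: box_family_def pairwise_def disjnt_def)
  qed
qed

lemma card_cut_family_le: "finite F \<Longrightarrow> card (cut_family F H) \<le> card F"
  unfolding cut_family_def
  by (metis card_Diff1_le card_image_le finite_imageI le_trans)

lemma card_cut_family_less:
  assumes "finite F" "K \<in> F" "K \<inter> H = {}"
  shows "card (cut_family F H) < card F"
proof -
  have "cut_family F H \<subseteq> (\<lambda>K. K \<inter> H) ` (F - {K})"
    using assms by (auto simp: cut_family_def)
  then have "card (cut_family F H) \<le> card ((\<lambda>K. K \<inter> H) ` (F - {K}))"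
    using assms by (intro card_mono) auto
  also have "\<dots> \<le> card (F - {K})" using assms by (intro card_image_le) auto
  also have "\<dots> < card F" using assms by (meson card_Diff1_less)
  finally show ?thesis .
qed

lemma box_Int_less:
  fixes a b :: "'a::euclidean_space"
  assumes i: "i \<in> Basis"
  shows "\<exists>a' b'. box a b \<inter> {x. x \<bullet> i < c} = box a' b'"
proof -
  have "box a b \<inter> {x. x \<bullet> i < c} = box a (b + (min (b \<bullet> i) c - b \<bullet> i) *\<^sub>R i)"
  proof (rule set_eqI)
    fix x
    have "x \<in> box a (b + (min (b \<bullet> i) c - b \<bullet> i) *\<^sub>R i) \<longleftrightarrow>
      (\<forall>j\<in>Basis. a \<bullet> j < x \<bullet> j \<and> x \<bullet> j < (if j = i then min (b \<bullet> i) c else b \<bullet> j))"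
      unfolding mem_box using i by (intro ball_cong) (auto simp: inner_add_left inner_Basis)
    also have "\<dots> \<longleftrightarrow> x \<in> box a b \<inter> {x. x \<bullet> i < c}"
      using i by (auto simp: mem_box split: if_splits)
    finally show "x \<in> box a b \<inter> {x. x \<bullet> i < c} \<longleftrightarrow> x \<in> box a (b + (min (b \<bullet> i) c - b \<bullet> i) *\<^sub>R i)" by simp
  qed
  then show ?thesis by blast
qed

lemma box_Int_greater:
  fixes a b :: "'a::euclidean_space"
  assumes i: "i \<in> Basis"
  shows "\<exists>a' b'. box a b \<inter> {x. c < x \<bullet> i} = box a' b'"
proof -
  have "box a b \<inter> {x. c < x \<bullet> i} = box (a + (max (a \<bullet> i) c - a \<bullet> i) *\<^sub>R i) b"
  proof (rule set_eqI)
    fix x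
    have "x \<in> box (a + (max (a \<bullet> i) c - a \<bullet> i) *\<^sub>R i) b \<longleftrightarrow>
      (\<forall>j\<in>Basis. (if j = i then max (a \<bullet> i) c else a \<bullet> j) < x \<bullet> j \<and> x \<bullet> j < b \<bullet> j)"
      unfolding mem_box using i by (intro ball_cong) (auto simp: inner_add_left inner_Basis)
    also have "\<dots> \<longleftrightarrow> x \<in> box a b \<inter> {x. c < x \<bullet> i}"
      using i by (auto simp: mem_box split: if_splits)
    finally show "x \<in> box a b \<inter> {x. c < x \<bullet> i} \<longleftrightarrow> x \<in> box (a + (max (a \<bullet> i) c - a \<bullet> i) *\<^sub>R i) b" by simp
  qed
  then show ?thesis by blast
qed

lemma measure_slab_le:
  fixes T :: "'a::euclidean_space set"
  assumes i: "i \<in> Basis" and T: "\<And>x j. x \<in> T \<Longrightarrow> j \<in> Basis \<Longrightarrow> \<bar>x \<bullet> j\<bar> \<le> M" and "s \<le> t" "0 \<le> M"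
    and [measurable]: "T \<in> sets borel"
  shows "measure lborel (T \<inter> {x. s \<le> x \<bullet> i \<and> x \<bullet> i < t}) \<le> (t - s) * (2 * M) ^ (DIM('a) - 1)"
proof -
  define u where "u = (\<Sum>j\<in>Basis. (if j = i then s else - M) *\<^sub>R (j::'a))"
  define v where "v = (\<Sum>j\<in>Basis. (if j = i then t else M) *\<^sub>R (j::'a))"
  have uj: "u \<bullet> j = (if j = i then s else - M)" and vj: "v \<bullet> j = (if j = i then t else M)"
    if "j \<in> Basis" for j
    using that by (simp_all add: u_def v_def inner_sum_left_Basis)
  have "T \<inter> {x. s \<le> x \<bullet> i \<and> x \<bullet> i < t} \<subseteq> cbox u v"
    using T uj vj by (fastforce simp: mem_box abs_le_iff)
  then have "measure lborel (T \<inter> {x. s \<le> x \<bullet> i \<and> x \<bullet> i < t}) \<le> measure lborel (cbox u v)"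
    by (intro measure_lborel_mono_bounded) auto
  also have "\<dots> = (\<Prod>j\<in>Basis. (v - u) \<bullet> j)"
    using assms uj vj by (auto simp: measure_lborel_cbox_eq)
  also have "\<dots> = (\<Prod>j\<in>Basis. if j = i then t - s else 2 * M)"
    by (intro prod.cong) (auto simp: inner_diff_left uj vj)
  also have "\<dots> = (t - s) * (2 * M) ^ (DIM('a) - 1)"
    using i by (subst prod.remove[of _ i]) (auto cong: prod.cong_simp)
  finally show ?thesis .
qed

text \<open>Intermediate value theorem: the volume cut off by a moving hyperplane is Lipschitz in
  its position, because the slab between two positions is thin.\<close>

lemma exists_proportional_cut:
  fixes T :: "'a::euclidean_space set"
  assumes i: "i \<in> Basis" and T: "open T" "bounded T" and \<theta>: "0 < \<theta>" "\<theta> < 1"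
  shows "\<exists>t. measure lborel (T \<inter> {x. x \<bullet> i < t}) = \<theta> * measure lborel T"
proof -
  obtain M0 where M0: "\<And>x. x \<in> T \<Longrightarrow> norm x \<le> M0" using T(2) by (auto simp: bounded_iff)
  define M where "M = max M0 0"
  have M: "\<bar>x \<bullet> j\<bar> \<le> M" if "x \<in> T" "j \<in> Basis" for x j
    using Basis_le_norm[OF that(2), of x] M0[OF that(1)] by (simp add: M_def)
  have M0: "0 \<le> M" by (simp add: M_def)
  define C where "C = (2 * M) ^ (DIM('a) - 1)"
  have [measurable]: "T \<in> sets borel" using T by simp
  let ?g = "\<lambda>t. measure lborel (T \<inter> {x. x \<bullet> i < t})"
  have fm: "S \<in> sets borel \<Longrightarrow> T \<inter> S \<in> fmeasurable lborel" for S
    using T finite_measure_bounded[of "T \<inter> S"] by (auto simp: fmeasurable_def less_top[symmetric])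
  have diff: "?g t = ?g s + measure lborel (T \<inter> {x. s \<le> x \<bullet> i \<and> x \<bullet> i < t})" if "s \<le> t" for s t
  proof -
    have eq: "T \<inter> {x. x \<bullet> i < t} = (T \<inter> {x. x \<bullet> i < s}) \<union> (T \<inter> {x. s \<le> x \<bullet> i \<and> x \<bullet> i < t})"
      using that by auto
    show ?thesis unfolding eq
      using fm[of "{x. x \<bullet> i < s}"] fm[of "{x. s \<le> x \<bullet> i \<and> x \<bullet> i < t}"]
      by (intro measure_Union) (auto simp: fmeasurable_def)
  qed
  have lip: "dist (?g s) (?g t) \<le> C * dist s t" for s t
  proof -
    have *: "\<bar>?g t - ?g s\<bar> \<le> C * (t - s)" if "s \<le> t" for s t
      using diff[OF that] measure_slab_le[OF i M that M0] by (simp add: C_def mult.commute)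
    show ?thesis
      using *[of s t] *[of t s] by (cases "s \<le> t") (auto simp: dist_real_def abs_minus_commute)
  qed
  have cont: "continuous_on {-M..M+1} ?g"
    using lip by (intro lipschitz_on_continuous_on[of C] lipschitz_onI) (auto simp: C_def M0)
  \<comment> \<open>The right end is \<open>M + 1\<close> because the half space is open and
    \<open>T\<close> may reach the coordinate \<open>M\<close> itself.\<close>
  have e: "T \<inter> {x. x \<bullet> i < -M} = {}" "T \<inter> {x. x \<bullet> i < M + 1} = T"
    using M i by (auto simp: abs_le_iff) (smt (verit))+
  have "\<exists>t\<ge>-M. t \<le> M+1 \<and> ?g t = \<theta> * measure lborel T"
  proof (rule IVT')
    show "?g (-M) \<le> \<theta> * measure lborel T" using e \<theta> by simp
    have "\<theta> * measure lborel T \<le> 1 * measure lborel T" using \<theta> by (intro mult_right_mono) auto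
    then show "\<theta> * measure lborel T \<le> ?g (M+1)" using e by simp
  qed (use M0 cont in auto)
  then show ?thesis by blast
qed

lemma measure_cut_hyperplane:
  fixes S :: "'a::euclidean_space set"
  assumes i: "i \<in> Basis" and S: "open S" "bounded S"
  shows "measure lborel S = measure lborel (S \<inter> {x. x \<bullet> i < c}) + measure lborel (S \<inter> {x. c < x \<bullet> i})"
proof -
  have fin: "emeasure lborel (S \<inter> H) \<noteq> \<infinity>" for H
    using S by (intro finite_measure_bounded) auto
  have null: "{x::'a. x \<bullet> i = c} \<in> null_sets lborel"
    using negligible_standard_hyperplane[OF i, of c]
    by (simp add: negligible_iff_null_sets null_sets_completion_iff)
  have "measure lborel S = measure lborel (S - {x. x \<bullet> i = c})"
    using null S by (subst measure_Diff_null_set) auto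
  also have "S - {x. x \<bullet> i = c} = (S \<inter> {x. x \<bullet> i < c}) \<union> (S \<inter> {x. c < x \<bullet> i})" by auto
  also have "measure lborel \<dots> = measure lborel (S \<inter> {x. x \<bullet> i < c}) + measure lborel (S \<inter> {x. c < x \<bullet> i})"
    using S fin by (intro measure_Union) auto
  finally show ?thesis .
qed

text \<open>The argument of Hadwiger and Ohmann: a hyperplane separating two boxes of \<open>F\<close> leaves fewer boxes on either
  side, and \<open>G\<close> can be translated so that the hyperplane divides it in the same ratio of volumes.\<close>
lemma brunn_minkowski_cut_step:
  fixes F G :: "'a::euclidean_space set set"
  assumes F: "box_family F" and G: "box_family G" and "1 < card F"
    and IH: "\<And>F' G' :: 'a set set. box_family F' \<Longrightarrow> box_family G' \<Longrightarrow> card F' + card G' < card F + card G \<Longrightarrow>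
      root DIM('a) (measure lborel (\<Union>F')) + root DIM('a) (measure lborel (\<Union>G'))
        \<le> root DIM('a) (measure lborel (minkowski_sum (\<Union>F') (\<Union>G')))"
  shows "root DIM('a) (measure lborel (\<Union>F)) + root DIM('a) (measure lborel (\<Union>G))
        \<le> root DIM('a) (measure lborel (minkowski_sum (\<Union>F) (\<Union>G)))"
proof -
  let ?n = "DIM('a)"
  let ?\<mu> = "measure (lborel :: 'a measure)"
  define S T where "S = \<Union>F" and "T = \<Union>G"
  have fin: "finite F" "finite G" using F G by (auto simp: box_family_def)
  obtain K K' where K: "K \<in> F" "K' \<in> F" "K \<noteq> K'"
    using \<open>1 < card F\<close> fin by (metis card_le_Suc0_iff_eq not_le One_nat_def)
  then have dj: "K \<inter> K' = {}" and ne: "K \<noteq> {}" "K' \<noteq> {}"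
    using F by (auto simp: box_family_def pairwise_def disjnt_def)
  obtain a b a' b' where ab: "K = box a b" "K' = box a' b'"
    using K F unfolding box_family_def by metis
  have "\<exists>i\<in>Basis. \<exists>K1\<in>F. \<exists>K2\<in>F. \<exists>c. K1 \<noteq> {} \<and> K2 \<noteq> {} \<and> K1 \<subseteq> {x. x \<bullet> i < c} \<and> K2 \<subseteq> {x. c < x \<bullet> i}"
  proof -
    have lt: "a \<bullet> i < b \<bullet> i" "a' \<bullet> i < b' \<bullet> i" if "i \<in> Basis" for i
      using ne that by (auto simp: ab box_ne_empty)
    obtain i where i: "i \<in> Basis" "b \<bullet> i \<le> a \<bullet> i \<or> b' \<bullet> i \<le> a' \<bullet> i \<or> b \<bullet> i \<le> a' \<bullet> i \<or> b' \<bullet> i \<le> a \<bullet> i"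
      using dj unfolding ab disjoint_interval by blast
    then consider "b \<bullet> i \<le> a' \<bullet> i" | "b' \<bullet> i \<le> a \<bullet> i" using lt[OF i(1)] by force
    then show ?thesis
    proof cases
      case 1
      then have "K \<subseteq> {x. x \<bullet> i < b \<bullet> i}" "K' \<subseteq> {x. b \<bullet> i < x \<bullet> i}"
        using i(1) by (force simp: ab mem_box)+
      then show ?thesis using i(1) K ne by blast
    next
      case 2
      then have "K' \<subseteq> {x. x \<bullet> i < b' \<bullet> i}" "K \<subseteq> {x. b' \<bullet> i < x \<bullet> i}"
        using i(1) by (force simp: ab mem_box)+
      then show ?thesis using i(1) K ne by blast
    qed
  qed
  then obtain i K1 K2 c where i: "i \<in> Basis" and K12: "K1 \<in> F" "K2 \<in> F" "K1 \<noteq> {}" "K2 \<noteq> {}"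
    and sub: "K1 \<subseteq> {x. x \<bullet> i < c}" "K2 \<subseteq> {x. c < x \<bullet> i}" by blast
  have oS: "open S" "bounded S" "S \<noteq> {}" and oT: "open T" "bounded T" "T \<noteq> {}"
    unfolding S_def T_def
    by (rule box_family_open[OF F] box_family_bounded[OF F] box_family_Union_ne[OF F]
        box_family_open[OF G] box_family_bounded[OF G] box_family_Union_ne[OF G])+
  define Sl Sr where "Sl = S \<inter> {x. x \<bullet> i < c}" and "Sr = S \<inter> {x. c < x \<bullet> i}"
  have ol: "open {x::'a. x \<bullet> i < t}" and og: "open {x::'a. t < x \<bullet> i}" for t
    by (simp_all add: open_halfspace_component_lt open_halfspace_component_gt)
  have ne': "Sl \<noteq> {}" "Sr \<noteq> {}" using K12 sub by (auto simp: Sl_def Sr_def S_def)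
  have pS: "?\<mu> S > 0" "?\<mu> Sl > 0" "?\<mu> Sr > 0" and pT: "?\<mu> T > 0"
    using oS oT ne' ol og by (auto intro!: measure_open_pos simp: Sl_def Sr_def)
  define \<theta> where "\<theta> = ?\<mu> Sl / ?\<mu> S"
  have sumS: "?\<mu> S = ?\<mu> Sl + ?\<mu> Sr"
    unfolding Sl_def Sr_def by (rule measure_cut_hyperplane[OF i oS(1,2)])
  have \<theta>: "0 < \<theta>" "\<theta> < 1" and Sl: "?\<mu> Sl = \<theta> * ?\<mu> S" and Sr: "?\<mu> Sr = (1 - \<theta>) * ?\<mu> S"
    using pS sumS by (auto simp: \<theta>_def field_simps)
  obtain t where t: "?\<mu> (T \<inter> {x. x \<bullet> i < t}) = \<theta> * ?\<mu> T"
    using exists_proportional_cut[OF i oT(1,2) \<theta>] by blast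
  define Tl Tr where "Tl = T \<inter> {x. x \<bullet> i < t}" and "Tr = T \<inter> {x. t < x \<bullet> i}"
  have sumT: "?\<mu> T = ?\<mu> Tl + ?\<mu> Tr"
    unfolding Tl_def Tr_def by (rule measure_cut_hyperplane[OF i oT(1,2)])
  have Tl: "?\<mu> Tl = \<theta> * ?\<mu> T" and Tr: "?\<mu> Tr = (1 - \<theta>) * ?\<mu> T"
    using t sumT by (auto simp: Tl_def field_simps)
  have "?\<mu> Tl > 0" "?\<mu> Tr > 0" using Tl Tr \<theta> pT by auto
  then have neT: "Tl \<noteq> {}" "Tr \<noteq> {}" by auto
  define E where "E = (root ?n (?\<mu> S) + root ?n (?\<mu> T)) ^ ?n"
  \<comment> \<open>Both pieces are scaled by the same ratio \<tau>, so
    \<open>root ?n \<tau>\<close> factors out of the induction hypothesis. After taking powers the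
    two sides of the cut contribute \<open>\<theta> * E\<close> and
    \<open>(1 - \<theta>) * E\<close>.\<close>
  have part: "\<tau> * E \<le> ?\<mu> (minkowski_sum (S \<inter> H) (T \<inter> H'))"
    if H: "\<And>a b :: 'a. \<exists>a' b'. box a b \<inter> H = box a' b'" "\<And>a b :: 'a. \<exists>a' b'. box a b \<inter> H' = box a' b'"
      and ne: "S \<inter> H \<noteq> {}" "T \<inter> H' \<noteq> {}"
      and "?\<mu> (S \<inter> H) = \<tau> * ?\<mu> S" "?\<mu> (T \<inter> H') = \<tau> * ?\<mu> T" and "0 < \<tau>"
      and L: "L \<in> F" "L \<inter> H = {}"
    for \<tau> H H' L
  proof -
    have "card (cut_family F H) + card (cut_family G H') < card F + card G"
      using card_cut_family_less[OF fin(1) L] card_cut_family_le[OF fin(2), of H'] by linarith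
    then have "root ?n (\<tau> * ?\<mu> S) + root ?n (\<tau> * ?\<mu> T) \<le> root ?n (?\<mu> (minkowski_sum (S \<inter> H) (T \<inter> H')))"
      using IH[OF box_family_cut[OF F H(1)] box_family_cut[OF G H(2)]] that
      by (simp add: Union_cut_family S_def T_def)
    then have "root ?n \<tau> * (root ?n (?\<mu> S) + root ?n (?\<mu> T)) \<le> root ?n (?\<mu> (minkowski_sum (S \<inter> H) (T \<inter> H')))"
      by (simp add: real_root_mult distrib_left)
    then have "(root ?n \<tau> * (root ?n (?\<mu> S) + root ?n (?\<mu> T))) ^ ?n \<le> (root ?n (?\<mu> (minkowski_sum (S \<inter> H) (T \<inter> H')))) ^ ?n"
      using \<open>0 < \<tau>\<close> by (intro power_mono) (auto intro!: mult_nonneg_nonneg add_nonneg_nonneg)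
    then show ?thesis
      using \<open>0 < \<tau>\<close> by (simp add: E_def power_mult_distrib)
  qed
  have pl: "\<theta> * E \<le> ?\<mu> (minkowski_sum Sl Tl)"
    unfolding Sl_def Tl_def
    by (rule part[where L = K2]) (use i box_Int_less ne' neT Sl Tl \<theta> K12 sub in \<open>auto simp: Sl_def Tl_def\<close>)
  have pr: "(1 - \<theta>) * E \<le> ?\<mu> (minkowski_sum Sr Tr)"
    unfolding Sr_def Tr_def
    by (rule part[where L = K1]) (use i box_Int_greater ne' neT Sr Tr \<theta> K12 sub in \<open>auto simp: Sr_def Tr_def\<close>)
  have bd: "bounded Sl" "bounded Sr" "bounded Tl" "bounded Tr"
    using oS oT by (auto simp: Sl_def Sr_def Tl_def Tr_def)
  have op: "open Sl" "open Sr" "open Tl" "open Tr"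
    using oS oT ol og by (auto simp: Sl_def Sr_def Tl_def Tr_def)
  \<comment> \<open>Sums of left pieces have their coordinate below \<open>c + t\<close>, sums of
    right pieces above it; hence the volumes of the two sums may be added.\<close>
  have dj: "minkowski_sum Sl Tl \<inter> minkowski_sum Sr Tr = {}"
    by (auto simp: Sl_def Sr_def Tl_def Tr_def inner_add_left) (smt (verit) inner_add_left)
  have "E = \<theta> * E + (1 - \<theta>) * E" by (simp add: algebra_simps)
  also have "\<dots> \<le> ?\<mu> (minkowski_sum Sl Tl) + ?\<mu> (minkowski_sum Sr Tr)"
    using pl pr by linarith
  also have "\<dots> = ?\<mu> (minkowski_sum Sl Tl \<union> minkowski_sum Sr Tr)"
    using bd op dj by (intro measure_Union[symmetric] finite_measure_bounded bounded_sums)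
      (auto intro!: borel_open open_sums)
  also have "\<dots> \<le> ?\<mu> (minkowski_sum S T)"
    using oS oT op
    by (intro measure_lborel_mono_bounded bounded_sums borel_open open_sums open_Un)
      (auto simp: Sl_def Sr_def Tl_def Tr_def)
  finally have "root ?n E \<le> root ?n (?\<mu> (minkowski_sum S T))" by simp
  moreover have "root ?n E = root ?n (?\<mu> S) + root ?n (?\<mu> T)"
    unfolding E_def by (rule real_root_power_cancel) auto
  ultimately show ?thesis by (simp add: S_def T_def)
qed

lemma minkowski_sum_commute: "minkowski_sum S T = minkowski_sum T (S :: 'a::ab_semigroup_add set)"
proof -
  have "minkowski_sum S T \<subseteq> minkowski_sum T S" for S T :: "'a set"
  proof
    fix z assume "z \<in> minkowski_sum S T"
    then obtain x y where "x \<in> S" "y \<in> T" "z = y + x" by (auto simp: add.commute)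
    then show "z \<in> minkowski_sum T S" by blast
  qed
  from this[of T S] this[of S T] show ?thesis by (rule subset_antisym)
qed

text \<open>Induction on the total number of boxes. Two single boxes are the base case; otherwise a
  family with more than one box is cut, and commutativity of the sum lets it play the part of the
  first one.\<close>

lemma brunn_minkowski_families:
  fixes F G :: "'a::euclidean_space set set"
  assumes "box_family F" "box_family G"
  shows "root DIM('a) (measure lborel (\<Union>F)) + root DIM('a) (measure lborel (\<Union>G))
        \<le> root DIM('a) (measure lborel (minkowski_sum (\<Union>F) (\<Union>G)))"
  using assms
proof (induction "card F + card G" arbitrary: F G rule: less_induct)
  case less
  have pos: "card F > 0" "card G > 0"
    using less.prems by (auto simp: box_family_def card_gt_0_iff)
  then consider "card F = 1" "card G = 1" | "1 < card F" | "1 < card G" by linarith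
  then show ?case
  proof cases
    case 1
    then obtain K L where KL: "F = {K}" "G = {L}" by (auto simp: card_1_singleton_iff)
    have "K \<noteq> {}" "\<exists>a b. K = box a b" "L \<noteq> {}" "\<exists>a b. L = box a b"
      using less.prems by (auto simp: box_family_def KL)
    then obtain a b c d where "K = box a b" "L = box c d" "box a b \<noteq> {}" "box c d \<noteq> {}" by blast
    then show ?thesis using brunn_minkowski_box[of a b c d] KL by simp
  next
    case 2
    then show ?thesis
      by (rule brunn_minkowski_cut_step[OF less.prems]) (rule less.hyps)
  next
    case 3
    have "root DIM('a) (measure lborel (\<Union>G)) + root DIM('a) (measure lborel (\<Union>F))
        \<le> root DIM('a) (measure lborel (minkowski_sum (\<Union>G) (\<Union>F)))"
      by (rule brunn_minkowski_cut_step[OF less.prems(2,1) 3]) (rule less.hyps, simp_all add: add.commute)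
    then show ?thesis
      unfolding minkowski_sum_commute[of "\<Union>G" "\<Union>F"] add.commute[of "root DIM('a) (measure lborel (\<Union>G))"] .
  qed
qed

text \<open>An open set is a countable union of closed boxes with disjoint interiors. Passing to the
  interiors of finitely many of them loses a null set and, in the limit, no volume.\<close>

lemma box_family_inner_approx:
  fixes A :: "'a::euclidean_space set"
  assumes A: "open A" "bounded A" "A \<noteq> {}"
  shows "\<exists>F. (\<forall>k::nat. box_family (F k) \<and> \<Union>(F k) \<subseteq> A) \<and> (\<lambda>k. measure lborel (\<Union>(F k))) \<longlonglongrightarrow> measure lborel A"
proof -
  obtain a b where ab0: "A \<subseteq> cbox a b" using A bounded_subset_cbox_symmetric by metis
  obtain a b where ab: "A \<subseteq> cbox a b" "box a b \<noteq> {}"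
  proof -
    have "A \<subseteq> cbox (a - One) (b + One)" using ab0 by (force simp: mem_box inner_diff_left inner_add_left)
    moreover have "box (a - One) (b + One) \<noteq> {}"
    proof -
      have "a \<bullet> i \<le> b \<bullet> i" if "i \<in> Basis" for i
        using ab0 A(3) that by (force simp: mem_box)
      then have "(a - One) \<bullet> i < (b + One) \<bullet> i" if "i \<in> Basis" for i
        using that by (smt (verit) inner_diff_left inner_add_left inner_Basis inner_sum_Basis)
      then show ?thesis by (auto simp: box_ne_empty)
    qed
    ultimately show ?thesis using that by blast
  qed
  \<comment> \<open>With this gauge the covering lemma returns boxes contained in \<open>A\<close>,
    so their union is exactly \<open>A\<close>.\<close>
  have "gauge (\<lambda>x. if x \<in> A then A else UNIV)" using A by (auto simp: gauge_def)
  from covering_lemma[OF ab this] obtain D where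
    D: "countable D" "\<And>K. K \<in> D \<Longrightarrow> interior K \<noteq> {} \<and> (\<exists>c d. K = cbox c d)"
    "pairwise (\<lambda>A B. interior A \<inter> interior B = {}) D"
    "\<And>K. K \<in> D \<Longrightarrow> \<exists>x \<in> A \<inter> K. K \<subseteq> (if x \<in> A then A else UNIV)" "A \<subseteq> \<Union>D" by metis
  have AD: "A = \<Union>D" using D(4,5) by (auto split: if_splits)
  have Dne: "D \<noteq> {}" using AD A(3) by auto
  define d where "d = from_nat_into D"
  have dD: "d k \<in> D" for k unfolding d_def using Dne by (rule from_nat_into)
  have rd: "range d = D" unfolding d_def using Dne D(1) by (rule range_from_nat_into)
  \<comment> \<open>The enumeration repeats boxes when \<open>D\<close> is finite; as a set of boxes
    \<open>F k\<close> does not notice the repetitions.\<close>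
  define F where "F k = interior ` (d ` {..k})" for k
  have dbox: "\<exists>p q. d k = cbox p q" for k using D(2)[OF dD[of k]] by blast
  have bf: "box_family (F k)" for k
    unfolding box_family_def
  proof (intro conjI ballI)
    show "finite (F k)" "F k \<noteq> {}" by (auto simp: F_def)
    show "K \<noteq> {}" if K: "K \<in> F k" for K
    proof -
      obtain j where "K = interior (d j)" using K by (auto simp: F_def)
      then show ?thesis using D(2)[OF dD[of j]] by auto
    qed
    show "\<exists>a b. K = box a b" if K: "K \<in> F k" for K
    proof -
      obtain j where "K = interior (d j)" using K by (auto simp: F_def)
      then show ?thesis using dbox[of j] interior_cbox by metis
    qed
    show "pairwise disjnt (F k)"
      unfolding F_def
    proof (intro pairwiseI)
      fix X Y assume "X \<in> interior ` d ` {..k}" "Y \<in> interior ` d ` {..k}" "X \<noteq> Y"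
      then obtain i j where ij: "X = interior (d i)" "Y = interior (d j)" by blast
      with \<open>X \<noteq> Y\<close> have "d i \<noteq> d j" by auto
      with ij show "disjnt X Y" using D(3) dD unfolding pairwise_def disjnt_def by blast
    qed
  qed
  have sub: "\<Union>(F k) \<subseteq> A" for k
    using interior_subset dD by (fastforce simp: F_def AD)
  have meas: "measure lborel (\<Union>(F k)) = measure lborel (\<Union>j\<le>k. d j)" for k
  proof -
    have null: "d j - interior (d j) \<in> null_sets lborel" for j
    proof -
      obtain p q where "d j = cbox p q" using dbox by blast
      then show ?thesis
        using negligible_frontier_interval[of p q]
        by (simp add: interior_cbox negligible_iff_null_sets null_sets_completion_iff)
    qed
    have "(\<Union>j\<le>k. d j - interior (d j)) \<in> null_sets lborel"
      using null by (intro null_sets_UN') auto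
    then have "measure lborel (\<Union>(F k) \<union> (\<Union>j\<le>k. d j - interior (d j))) = measure lborel (\<Union>(F k))"
      using bf[of k] by (intro measure_Un_null_set) (auto intro: borel_open box_family_open)
    moreover have "\<Union>(F k) \<union> (\<Union>j\<le>k. d j - interior (d j)) = (\<Union>j\<le>k. d j)"
      using interior_subset by (auto simp: F_def)
    ultimately show ?thesis by simp
  qed
  have Ad: "A = (\<Union>k. \<Union>j\<le>k. d j)" using AD rd by auto
  have "(\<lambda>k. measure lborel (\<Union>j\<le>k. d j)) \<longlonglongrightarrow> measure lborel (\<Union>k. \<Union>j\<le>k. d j)"
  proof (rule Lim_measure_incseq)
    show "range (\<lambda>k. \<Union>j\<le>k. d j) \<subseteq> sets lborel"
    proof
      fix X assume "X \<in> range (\<lambda>k. \<Union>j\<le>k. d j)"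
      then obtain k where "X = (\<Union>j\<le>k. d j)" by blast
      moreover have "d j \<in> sets borel" for j using dbox[of j] by auto
      ultimately show "X \<in> sets lborel" by auto
    qed
    show "incseq (\<lambda>k. \<Union>j\<le>k. d j)" by (force simp: incseq_def)
    show "emeasure lborel (\<Union>k. \<Union>j\<le>k. d j) \<noteq> \<infinity>"
      using finite_measure_bounded[OF A(2)] Ad by simp
  qed
  then have "(\<lambda>k. measure lborel (\<Union>(F k))) \<longlonglongrightarrow> measure lborel A"
    by (simp add: meas Ad[symmetric])
  then show ?thesis using bf sub by blast
qed

theorem brunn_minkowski_open:
  fixes A B :: "'a::euclidean_space set"
  assumes A: "open A" "bounded A" "A \<noteq> {}" and B: "open B" "bounded B" "B \<noteq> {}"
  shows "root DIM('a) (measure lborel A) + root DIM('a) (measure lborel B)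
    \<le> root DIM('a) (measure lborel (minkowski_sum A B))"
proof -
  obtain F where F: "\<And>k::nat. box_family (F k)" "\<And>k. \<Union>(F k) \<subseteq> A"
    "(\<lambda>k. measure lborel (\<Union>(F k))) \<longlonglongrightarrow> measure lborel A"
    using box_family_inner_approx[OF A] by blast
  obtain G where G: "\<And>k::nat. box_family (G k)" "\<And>k. \<Union>(G k) \<subseteq> B"
    "(\<lambda>k. measure lborel (\<Union>(G k))) \<longlonglongrightarrow> measure lborel B"
    using box_family_inner_approx[OF B] by blast
  have "root DIM('a) (measure lborel (\<Union>(F k))) + root DIM('a) (measure lborel (\<Union>(G k)))
    \<le> root DIM('a) (measure lborel (minkowski_sum A B))" for k
  proof -
    have "measure lborel (minkowski_sum (\<Union>(F k)) (\<Union>(G k))) \<le> measure lborel (minkowski_sum A B)"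
    proof (rule measure_lborel_mono_bounded)
      show "minkowski_sum (\<Union>(F k)) (\<Union>(G k)) \<subseteq> minkowski_sum A B"
        using F(2)[of k] G(2)[of k] by blast
      show "bounded (minkowski_sum A B)" using A B by (intro bounded_sums)
      show "minkowski_sum (\<Union>(F k)) (\<Union>(G k)) \<in> sets borel"
        using box_family_open[OF F(1)] by (intro borel_open open_sums) blast
      show "minkowski_sum A B \<in> sets borel"
        using A by (intro borel_open open_sums) blast
    qed
    then show ?thesis
      using brunn_minkowski_families[OF F(1)[of k] G(1)[of k]]
      by (meson DIM_positive order_trans real_root_le_mono)
  qed
  moreover have "(\<lambda>k. root DIM('a) (measure lborel (\<Union>(F k))) + root DIM('a) (measure lborel (\<Union>(G k))))
     \<longlonglongrightarrow> root DIM('a) (measure lborel A) + root DIM('a) (measure lborel B)"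
    by (intro tendsto_add tendsto_real_root F G)
  ultimately show ?thesis by (intro LIMSEQ_le_const2) auto
qed

section \<open>The isoperimetric inequality on the torus\<close>

definition lattice :: "real \<Rightarrow> (real^'n) set" where
  "lattice L = range (\<lambda>z :: 'n \<Rightarrow> int. \<chi> i. L * of_int (z i))"

text \<open>Half open, so that the lattice translates tile the space exactly. It differs from
  \<open>torus\<close> by a null set.\<close>

definition cell :: "real \<Rightarrow> (real^'n) set" where
  "cell L = {x. \<forall>i. - L / 2 \<le> x $ i \<and> x $ i < L / 2}"

definition lattice_periodic :: "real \<Rightarrow> (real^'n \<Rightarrow> 'b) \<Rightarrow> bool" where
  "lattice_periodic L f \<longleftrightarrow> (\<forall>x. \<forall>k\<in>lattice L. f (x + k) = f x)"

lemma lattice_periodicD: "lattice_periodic L f \<Longrightarrow> k \<in> lattice L \<Longrightarrow> f (x + k) = f x"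
  by (simp add: lattice_periodic_def)

lemma torus_eq_cbox: "torus L = cbox (\<chi> i. - L / 2) (\<chi> i. L / 2)"
  by (auto simp: torus_def mem_box_cart)

lemma torus_borel [measurable, simp]: "torus L \<in> sets borel"
  by (simp add: torus_eq_cbox)

lemma cell_borel [measurable, simp]: "(cell L :: (real^'n) set) \<in> sets borel"
proof -
  have "cell L = (\<Inter>i. {x::real^'n. - L / 2 \<le> x $ i \<and> x $ i < L / 2})"
    by (auto simp: cell_def)
  moreover have "{x::real^'n. - L / 2 \<le> x $ i \<and> x $ i < L / 2} \<in> sets borel" for i
    by measurable
  ultimately show ?thesis by auto
qed

lemma measure_torus:
  assumes "L \<ge> 0"
  shows "measure lborel (torus L :: (real^'n) set) = L ^ CARD('n)"
    and "emeasure lborel (torus L :: (real^'n) set) = ennreal (L ^ CARD('n))"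
proof -
  let ?u = "(\<chi> i. - (L / 2)) :: real^'n" and ?v = "(\<chi> i. L / 2) :: real^'n"
  have uv: "?u \<bullet> b = - (L / 2)" "?v \<bullet> b = L / 2" if "b \<in> Basis" for b
    using that by (auto simp: Basis_vec_def inner_axis)
  have prod_eq: "(\<Prod>b\<in>Basis. (?v - ?u) \<bullet> b) = (\<Prod>b\<in>(Basis :: (real^'n) set). L)"
    by (intro prod.cong refl) (simp add: inner_diff_left uv)
  have le: "\<forall>b\<in>Basis. ?u \<bullet> b \<le> ?v \<bullet> b"
  proof
    fix b :: "real^'n" assume "b \<in> Basis"
    from uv[OF this] assms show "?u \<bullet> b \<le> ?v \<bullet> b" by linarith
  qed
  have eq: "torus L = cbox ?u ?v" by (simp add: torus_eq_cbox)
  have *: "(\<Prod>b\<in>Basis. (?v - ?u) \<bullet> b) = L ^ CARD('n)" using prod_eq by simp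
  show "measure lborel (torus L :: (real^'n) set) = L ^ CARD('n)"
    and "emeasure lborel (torus L :: (real^'n) set) = ennreal (L ^ CARD('n))"
    unfolding eq measure_lborel_cbox_eq emeasure_lborel_cbox_eq using le * by simp_all
qed

lemma box_torus_null: "torus L - box (\<chi> i. - L / 2) (\<chi> i. L / 2) \<in> null_sets (lborel :: (real^'n) measure)"
  using negligible_frontier_interval[of "\<chi> i. - L / 2" "\<chi> i. L / 2"]
  by (simp add: torus_eq_cbox negligible_iff_null_sets null_sets_completion_iff)

lemma torus_cell_null: "torus L - cell L \<in> null_sets (lborel :: (real^'n) measure)"
proof (rule null_sets_subset[OF box_torus_null[of L]])
  show "torus L - cell L \<subseteq> torus L - box (\<chi> i. - L / 2) (\<chi> i. L / 2)"
    by (auto simp: cell_def mem_box_cart less_imp_le)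
qed (auto simp: torus_eq_cbox)

lemma AE_indicator_torus_cell: "AE x in lborel. indicator (torus L) x = (indicator (cell L :: (real^'n) set) x :: ennreal)"
proof (rule AE_I'[OF torus_cell_null])
  have "cell L \<subseteq> (torus L :: (real^'n) set)" by (auto simp: cell_def torus_def less_imp_le)
  then show "{x \<in> space lborel. indicator (torus L) x \<noteq> (indicator (cell L :: (real^'n) set) x :: ennreal)} \<subseteq> torus L - cell L"
    by (auto split: split_indicator)
qed

lemma nn_integral_lborel_translate:
  fixes f :: "'a::euclidean_space \<Rightarrow> ennreal"
  assumes [measurable]: "f \<in> borel_measurable borel"
  shows "(\<integral>\<^sup>+x. f (x + a) \<partial>lborel) = (\<integral>\<^sup>+x. f x \<partial>lborel)"
proof -
  have "(\<integral>\<^sup>+x. f x \<partial>lborel) = (\<integral>\<^sup>+x. f x \<partial>distr lborel borel ((+) a))"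
    by (simp add: lborel_distr_plus)
  also have "\<dots> = (\<integral>\<^sup>+x. f (a + x) \<partial>lborel)"
    by (subst nn_integral_distr) auto
  finally show ?thesis by (simp add: add.commute)
qed

lemma lattice_uminus: "k \<in> lattice L \<Longrightarrow> - k \<in> lattice L"
proof -
  assume "k \<in> lattice L"
  then obtain z where "k = (\<chi> i. L * of_int (z i))" by (auto simp: lattice_def)
  then show ?thesis unfolding lattice_def
    by (intro range_eqI[of _ _ "\<lambda>i. - z i"]) (simp add: vec_eq_iff)
qed

lemma lattice_cell_unique:
  assumes "L > 0"
  shows "\<exists>!k\<in>lattice L. (x::real^'n) + k \<in> cell L"
proof -
  have iff: "x + (\<chi> i. L * of_int (z i)) \<in> cell L \<longleftrightarrow> (\<forall>i. z i = - \<lfloor>x $ i / L + 1 / 2\<rfloor>)" for z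
  proof -
    have "x + (\<chi> i. L * of_int (z i)) \<in> cell L \<longleftrightarrow> (\<forall>i. \<lfloor>x $ i / L + 1 / 2\<rfloor> = - z i)"
      using assms unfolding cell_def floor_eq_iff by (simp add: field_simps) (smt (verit, best))
    then show ?thesis by (metis minus_equation_iff)
  qed
  define k where "k = (\<chi> i. L * of_int (- \<lfloor>x $ i / L + 1 / 2\<rfloor>))"
  show ?thesis
  proof (intro ex1I[of _ k] conjI)
    show "k \<in> lattice L" unfolding k_def lattice_def by (rule rangeI)
    show "x + k \<in> cell L" unfolding k_def by (subst iff) simp
    fix k' assume k': "k' \<in> lattice L \<and> x + k' \<in> cell L"
    then obtain z where z: "k' = (\<chi> i. L * of_int (z i))" by (auto simp: lattice_def)
    with k' have "\<forall>i. z i = - \<lfloor>x $ i / L + 1 / 2\<rfloor>" using iff[of z] by simp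
    then show "k' = k" by (simp add: z k_def)
  qed
qed

lemma lattice_enum:
  assumes "L > 0"
  obtains e :: "nat \<Rightarrow> real^'n" where "bij_betw e UNIV (lattice L)"
proof -
  have "countable (lattice L :: (real^'n) set)" by (simp add: lattice_def)
  moreover have "infinite (lattice L :: (real^'n) set)"
  proof
    assume fin: "finite (lattice L :: (real^'n) set)"
    have "range (\<lambda>m::int. (\<chi> i. L * of_int m) :: real^'n) \<subseteq> lattice L"
      by (auto simp: lattice_def)
    then have "finite (range (\<lambda>m::int. (\<chi> i. L * of_int m) :: real^'n))"
      using fin finite_subset by blast
    moreover have "inj (\<lambda>m::int. (\<chi> i. L * of_int m) :: real^'n)"
      using assms by (auto simp: inj_def vec_eq_iff)
    ultimately have "finite (UNIV :: int set)" by (metis finite_imageD)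
    then show False by simp
  qed
  ultimately have "bij_betw (from_nat_into (lattice L)) UNIV (lattice L :: (real^'n) set)"
    by (rule bij_betw_from_nat_into)
  then show ?thesis by (rule that)
qed

lemma lattice_tiling:
  assumes "L > 0" and e: "bij_betw e UNIV (lattice L :: (real^'n) set)"
  shows "(\<Sum>j::nat. indicator (cell L) (x + a + e j)) = (1::ennreal)"
proof -
  define A where "A j = {y. y + a + e j \<in> cell L}" for j
  obtain k where k: "k \<in> lattice L" "x + a + k \<in> cell L" using lattice_cell_unique[OF assms(1), of "x + a"] by blast
  have ei: "inj e" "range e = lattice L" using e by (auto simp: bij_betw_def)
  have "i = j" if "y \<in> A i" "y \<in> A j" for i j y
  proof -
    have "e i = e j"
      using that lattice_cell_unique[OF assms(1), of "y + a"] ei(2) unfolding A_def by blast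
    then show ?thesis using ei(1) by (simp add: inj_eq)
  qed
  then have "disjoint_family A" by (auto simp: disjoint_family_on_def)
  then have "(\<Sum>j. indicator (A j) x) = (indicator (\<Union>j. A j) x :: ennreal)"
    by (rule suminf_indicator)
  moreover obtain j where "k = e j" using k(1) ei(2) by blast
  then have "x \<in> (\<Union>j. A j)" using k by (auto simp: A_def)
  ultimately show ?thesis by (simp add: A_def indicator_def)
qed

text \<open>The shifted cell is cut along the lattice translates of the cell, each piece is moved
  back by its own lattice vector, which a periodic integrand does not notice, and the pieces are put
  together again. Both regroupings are the tiling identity.\<close>

lemma nn_integral_periodic_shift_cell:
  fixes f :: "real^'n \<Rightarrow> ennreal"
  assumes L: "L > 0" and [measurable]: "f \<in> borel_measurable borel" and per: "lattice_periodic L f"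
  shows "(\<integral>\<^sup>+x. f x * indicator (cell L) (x + a) \<partial>lborel) = (\<integral>\<^sup>+x. f x * indicator (cell L) x \<partial>lborel)"
proof -
  obtain e :: "nat \<Rightarrow> real^'n" where e: "bij_betw e UNIV (lattice L)" by (rule lattice_enum[OF L])
  then have el: "e j \<in> lattice L" for j by (auto simp: bij_betw_def)
  have em: "bij_betw (\<lambda>j. - e j) UNIV (lattice L)"
  proof -
    have "bij_betw uminus (lattice L) (lattice L :: (real^'n) set)"
      by (rule bij_betwI[where g = uminus]) (auto intro: lattice_uminus)
    from bij_betw_trans[OF e this] show ?thesis by (simp add: comp_def)
  qed
  have "(\<integral>\<^sup>+x. f x * indicator (cell L) (x + a) \<partial>lborel)
    = (\<integral>\<^sup>+x. (\<Sum>j. f x * indicator (cell L) (x + a) * indicator (cell L) (x + 0 + - e j)) \<partial>lborel)"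
    by (subst ennreal_suminf_cmult) (simp only: lattice_tiling[OF L em] mult_1_right)
  also have "\<dots> = (\<Sum>j. \<integral>\<^sup>+x. f x * indicator (cell L) (x + a) * indicator (cell L) (x + 0 + - e j) \<partial>lborel)"
    by (rule nn_integral_suminf) measurable
  also have "\<dots> = (\<Sum>j. \<integral>\<^sup>+x. f (x + e j) * indicator (cell L) (x + e j + a) * indicator (cell L) (x + e j + 0 + - e j) \<partial>lborel)"
    by (intro suminf_cong nn_integral_lborel_translate[symmetric]) measurable
  also have "\<dots> = (\<Sum>j. \<integral>\<^sup>+x. f x * indicator (cell L) x * indicator (cell L) (x + a + e j) \<partial>lborel)"
    using lattice_periodicD[OF per el] by (simp add: ac_simps)
  also have "\<dots> = (\<integral>\<^sup>+x. (\<Sum>j. f x * indicator (cell L) x * indicator (cell L) (x + a + e j)) \<partial>lborel)"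
    by (rule nn_integral_suminf[symmetric]) measurable
  also have "\<dots> = (\<integral>\<^sup>+x. f x * indicator (cell L) x \<partial>lborel)"
    by (subst ennreal_suminf_cmult) (simp only: lattice_tiling[OF L e] mult_1_right)
  finally show ?thesis .
qed

lemma nn_integral_torus_cell:
  fixes f :: "real^'n \<Rightarrow> ennreal"
  shows "(\<integral>\<^sup>+x. f x * indicator (torus L) x \<partial>lborel) = (\<integral>\<^sup>+x. f x * indicator (cell L) x \<partial>lborel)"
proof (rule nn_integral_cong_AE)
  show "AE x in lborel. f x * indicator (torus L) x = f x * indicator (cell L) x"
    using AE_indicator_torus_cell[of L] by eventually_elim simp
qed

lemma nn_integral_periodic_translate:
  fixes f :: "real^'n \<Rightarrow> ennreal"
  assumes L: "L > 0" and [measurable]: "f \<in> borel_measurable borel" and per: "lattice_periodic L f"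
  shows "(\<integral>\<^sup>+x. f (x + a) * indicator (torus L) x \<partial>lborel) = (\<integral>\<^sup>+x. f x * indicator (torus L) x \<partial>lborel)"
proof -
  have "(\<integral>\<^sup>+x. f (x + a) * indicator (cell L) x \<partial>lborel)
      = (\<integral>\<^sup>+x. f (x + a) * indicator (cell L) (x + a + - a) \<partial>lborel)" by simp
  also have "\<dots> = (\<integral>\<^sup>+x. f x * indicator (cell L) (x + - a) \<partial>lborel)"
    by (rule nn_integral_lborel_translate[of "\<lambda>x. f x * indicator (cell L) (x + - a)"]) measurable
  also have "\<dots> = (\<integral>\<^sup>+x. f x * indicator (cell L) x \<partial>lborel)"
    by (rule nn_integral_periodic_shift_cell[OF L _ per]) measurable
  finally show ?thesis by (simp add: nn_integral_torus_cell)
qed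

text \<open>Brunn--Minkowski is applied to the part of \<open>A\<close> in a translate of the cell and averaged over the translates;
  the neighbourhood of that part lies in the cell enlarged by \<open>h\<close> on each side.\<close>
lemma torus_brunn_minkowski:
  fixes A :: "(real^'n) set"
  assumes L: "L > 0" and A: "open A" "lattice_periodic L (\<lambda>x. x \<in> A)" and h: "h > 0"
    and ne: "measure lborel (A \<inter> torus L) > 0"
  shows "(root CARD('n) (measure lborel (A \<inter> torus L)) + h * root CARD('n) (unit_ball_vol (CARD('n)))) ^ CARD('n) * L ^ CARD('n)
      \<le> (L + 2 * h) ^ CARD('n) * measure lborel (minkowski_sum A (ball 0 h) \<inter> torus L)"
proof -
  let ?n = "CARD('n)" and ?B = "ball (0::real^'n) h" and ?\<omega> = "unit_ball_vol (CARD('n))"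
  let ?\<mu> = "measure (lborel :: (real^'n) measure)"
  define Ah where "Ah = minkowski_sum A ?B"
  have oAh: "open Ah" unfolding Ah_def by (intro open_sums) simp
  have [measurable]: "Ah \<in> sets borel" "A \<in> sets borel" using oAh A by auto
  have Ahk: "x + k \<in> Ah \<longleftrightarrow> x \<in> Ah" if k: "k \<in> lattice L" for x k
  proof -
    have *: "x + k \<in> Ah" if "x \<in> Ah" "k \<in> lattice L" for x k
    proof -
      obtain y z where yz: "y \<in> A" "z \<in> ?B" "x = y + z" using \<open>x \<in> Ah\<close> by (auto simp: Ah_def)
      have "y + k \<in> A" using lattice_periodicD[OF A(2) that(2), of y] yz by simp
      moreover have "x + k = (y + k) + z" using yz by simp
      ultimately show ?thesis using yz(2) unfolding Ah_def by blast
    qed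
    show ?thesis using *[of x k] *[of "x + k" "- k"] k lattice_uminus[OF k] by auto
  qed
  have perAh: "lattice_periodic L (indicator Ah :: _ \<Rightarrow> ennreal)"
    using Ahk by (simp add: lattice_periodic_def indicator_def)
  have perA: "lattice_periodic L (indicator A :: _ \<Rightarrow> ennreal)"
    using lattice_periodicD[OF A(2)] by (simp add: lattice_periodic_def indicator_def)
  define E where "E = (root ?n (?\<mu> (A \<inter> torus L)) + h * root ?n ?\<omega>) ^ ?n"
  have E0: "E \<ge> 0" unfolding E_def using h by (intro zero_le_power add_nonneg_nonneg mult_nonneg_nonneg) auto
  have fin: "emeasure lborel (S \<inter> torus l) \<noteq> \<infinity>" for S l
    by (intro finite_measure_bounded) (auto simp: torus_eq_cbox)
  have slice: "ennreal E \<le> (\<integral>\<^sup>+y. indicator Ah (y + a) * indicator (torus (L + 2 * h)) y \<partial>lborel)" for a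
  proof -
    define Q where "Q = (+) a ` box (\<chi> i. - L / 2) (\<chi> i. L / 2)"
    have Qmem: "x \<in> Q \<longleftrightarrow> x - a \<in> box (\<chi> i. - L / 2) (\<chi> i. L / 2)" for x
      unfolding Q_def by (auto simp: image_iff intro: bexI[of _ "x - a"])
    have oQ: "open Q" "bounded Q" unfolding Q_def by (auto intro: open_translation bounded_translation)
    have "emeasure lborel (A \<inter> Q) = (\<integral>\<^sup>+x. indicator (A \<inter> Q) x \<partial>lborel)"
      using oQ by simp
    also have "\<dots> = (\<integral>\<^sup>+x. indicator (A \<inter> Q) (x + a) \<partial>lborel)"
      using oQ A by (intro nn_integral_lborel_translate[symmetric] borel_measurable_indicator) auto
    also have "\<dots> = (\<integral>\<^sup>+x. indicator A (x + a) * indicator (torus L) x \<partial>lborel)"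
    proof (rule nn_integral_cong_AE)
      have "AE x in lborel. x \<notin> torus L - box (\<chi> i. - L / 2) (\<chi> i. L / 2)"
        by (rule AE_not_in[OF box_torus_null])
      then show "AE x in lborel. indicator (A \<inter> Q) (x + a) = (indicator A (x + a) * indicator (torus L) x :: ennreal)"
      proof eventually_elim
        case (elim x)
        then have "x + a \<in> Q \<longleftrightarrow> x \<in> torus L"
          unfolding Qmem using box_subset_cbox by (force simp: torus_eq_cbox)
        then show ?case by (auto simp: indicator_def)
      qed
    qed
    also have "\<dots> = (\<integral>\<^sup>+x. indicator A x * indicator (torus L) x \<partial>lborel)"
      by (rule nn_integral_periodic_translate[OF L _ perA]) simp
    also have "\<dots> = (\<integral>\<^sup>+x. indicator (A \<inter> torus L) x \<partial>lborel)"
      by (intro nn_integral_cong) (auto simp: indicator_def)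
    also have "\<dots> = emeasure lborel (A \<inter> torus L)" by simp
    finally have eq: "?\<mu> (A \<inter> Q) = ?\<mu> (A \<inter> torus L)" by (simp add: measure_def)
    have "A \<inter> Q \<noteq> {}" using ne eq by auto
    then have "root DIM(real^'n) (?\<mu> (A \<inter> Q)) + root DIM(real^'n) (?\<mu> ?B)
       \<le> root DIM(real^'n) (?\<mu> (minkowski_sum (A \<inter> Q) ?B))"
      using A oQ h by (intro brunn_minkowski_open) auto
    moreover have "root ?n (?\<mu> ?B) = h * root ?n ?\<omega>"
      using h by (simp add: measure_def emeasure_ball real_root_mult real_root_power_cancel)
    ultimately have "(root ?n (?\<mu> (A \<inter> torus L)) + h * root ?n ?\<omega>) \<le> root ?n (?\<mu> (minkowski_sum (A \<inter> Q) ?B))"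
      using eq by simp
    then have "E \<le> root ?n (?\<mu> (minkowski_sum (A \<inter> Q) ?B)) ^ ?n"
      unfolding E_def using h by (intro power_mono add_nonneg_nonneg mult_nonneg_nonneg) auto
    then have "E \<le> ?\<mu> (minkowski_sum (A \<inter> Q) ?B)" by simp
    then have "ennreal E \<le> emeasure lborel (minkowski_sum (A \<inter> Q) ?B)"
      using finite_measure_bounded[of "minkowski_sum (A \<inter> Q) ?B"] oQ
      by (subst emeasure_eq_ennreal_measure) (auto intro!: bounded_sums ennreal_leI)
    also have "\<dots> = (\<integral>\<^sup>+x. indicator (minkowski_sum (A \<inter> Q) ?B) x \<partial>lborel)"
      by (intro nn_integral_indicator[symmetric]) (simp add: borel_open open_sums)
    also have "\<dots> \<le> (\<integral>\<^sup>+x. indicator Ah x * indicator (torus (L + 2 * h)) (x - a) \<partial>lborel)"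
    proof (rule nn_integral_mono)
      fix x :: "real^'n"
      have "x - a \<in> torus (L + 2 * h) \<and> x \<in> Ah" if "x \<in> minkowski_sum (A \<inter> Q) ?B"
      proof -
        from that obtain y z where yz: "y \<in> A" "y \<in> Q" "z \<in> ?B" "x = y + z" by auto
        have "- (L + 2 * h) / 2 \<le> (x - a) $ i \<and> (x - a) $ i \<le> (L + 2 * h) / 2" for i
        proof -
          have "- L / 2 < y $ i - a $ i" "y $ i - a $ i < L / 2" using yz(2) by (auto simp: Qmem mem_box_cart)
          moreover have "\<bar>z $ i\<bar> < h" using component_le_norm_cart[of z i] yz(3) by simp
          ultimately show ?thesis by (simp add: yz(4)) linarith
        qed
        moreover have "x \<in> Ah" unfolding Ah_def yz(4) using yz by blast
        ultimately show ?thesis by (auto simp: torus_def)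
      qed
      then show "indicator (minkowski_sum (A \<inter> Q) ?B) x \<le> (indicator Ah x * indicator (torus (L + 2 * h)) (x - a) :: ennreal)"
        by (auto split: split_indicator)
    qed
    also have "\<dots> = (\<integral>\<^sup>+x. indicator Ah (x + a) * indicator (torus (L + 2 * h)) (x + a - a) \<partial>lborel)"
      by (rule nn_integral_lborel_translate[symmetric]) measurable
    finally show ?thesis by simp
  qed
  have "ennreal (E * L ^ ?n) = (\<integral>\<^sup>+a. ennreal E * indicator (torus L :: (real^'n) set) a \<partial>lborel)"
    using L E0 by (simp add: nn_integral_cmult_indicator measure_torus ennreal_mult)
  also have "\<dots> \<le> (\<integral>\<^sup>+a. (\<integral>\<^sup>+y. indicator Ah (y + a) * indicator (torus (L + 2 * h)) y \<partial>lborel) * indicator (torus L) a \<partial>lborel)"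
    by (intro nn_integral_mono mult_right_mono slice) auto
  also have "\<dots> = (\<integral>\<^sup>+a. (\<integral>\<^sup>+y. indicator Ah (y + a) * indicator (torus (L + 2 * h)) y * indicator (torus L) a \<partial>lborel) \<partial>lborel)"
    by (intro nn_integral_cong nn_integral_multc[symmetric]) measurable
  \<comment> \<open>After the exchange the inner integral runs over the translation
    \<open>a\<close>. By periodicity it is the volume of \<open>Ah\<close> in one period for every
    \<open>y\<close>, which leaves only the volume of the enlarged cell as a factor.\<close>
  also have "\<dots> = (\<integral>\<^sup>+y. (\<integral>\<^sup>+a. indicator Ah (y + a) * indicator (torus (L + 2 * h)) y * indicator (torus L) a \<partial>lborel) \<partial>lborel)"
    by (rule lborel_pair.Fubini') measurable
  also have "\<dots> = (\<integral>\<^sup>+y. (\<integral>\<^sup>+a. indicator Ah (a + y) * indicator (torus L) a \<partial>lborel) * indicator (torus (L + 2 * h)) y \<partial>lborel)"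
    by (subst nn_integral_multc[symmetric]) (auto simp: ac_simps)
  also have "\<dots> = (\<integral>\<^sup>+y. (\<integral>\<^sup>+a. indicator Ah a * indicator (torus L) a \<partial>lborel) * indicator (torus (L + 2 * h) :: (real^'n) set) y \<partial>lborel)"
    by (subst nn_integral_periodic_translate[OF L _ perAh]) auto
  also have "(\<integral>\<^sup>+a. indicator Ah a * indicator (torus L) a \<partial>lborel) = (\<integral>\<^sup>+a. indicator (Ah \<inter> torus L) a \<partial>lborel)"
    by (intro nn_integral_cong) (auto simp: indicator_def)
  also have "\<dots> = ennreal (?\<mu> (Ah \<inter> torus L))"
    using fin[of Ah L] by (simp add: emeasure_eq_ennreal_measure)
  also have "(\<integral>\<^sup>+y. ennreal (?\<mu> (Ah \<inter> torus L)) * indicator (torus (L + 2 * h) :: (real^'n) set) y \<partial>lborel)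
     = ennreal ((L + 2 * h) ^ ?n * ?\<mu> (Ah \<inter> torus L))"
    using L h by (simp add: nn_integral_cmult_indicator measure_torus ennreal_mult mult.commute)
  finally show ?thesis
    using L h by (simp add: E_def Ah_def ennreal_le_iff)
qed

section \<open>From superlevel sets to integrals\<close>

lemma layer_cake:
  fixes f :: "'a \<Rightarrow> real"
  assumes "sigma_finite_measure M" and [measurable]: "f \<in> borel_measurable M" "A \<in> sets M" and nn: "\<And>x. f x \<ge> 0"
  shows "(\<integral>\<^sup>+x. ennreal (f x) * indicator A x \<partial>M)
    = (\<integral>\<^sup>+s. emeasure M {x \<in> A. s < f x} * indicator {0..} s \<partial>lborel)"
proof -
  interpret sigma_finite_measure M by fact
  interpret pair_sigma_finite M "lborel :: real measure" ..
  have "(\<integral>\<^sup>+x. ennreal (f x) * indicator A x \<partial>M)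
      = (\<integral>\<^sup>+x. (\<integral>\<^sup>+s. indicator {0..<f x} s * indicator A x \<partial>lborel) \<partial>M)"
    by (intro nn_integral_cong) (simp add: nn_integral_multc nn)
  also have "\<dots> = (\<integral>\<^sup>+x. (\<integral>\<^sup>+s. (if 0 \<le> s \<and> s < f x \<and> x \<in> A then 1 else 0) \<partial>lborel) \<partial>M)"
    by (intro nn_integral_cong) (auto simp: indicator_def)
  also have "\<dots> = (\<integral>\<^sup>+s. (\<integral>\<^sup>+x. (if 0 \<le> s \<and> s < f x \<and> x \<in> A then 1 else 0) \<partial>M) \<partial>lborel)"
    by (rule Fubini'[symmetric]) measurable
  also have "\<dots> = (\<integral>\<^sup>+s. emeasure M {x \<in> A. s < f x} * indicator {0..} s \<partial>lborel)"
  proof (rule nn_integral_cong)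
    fix s :: real
    have S: "{x \<in> A. s < f x} \<in> sets M"
    proof -
      have "{x \<in> A. s < f x} = A \<inter> {x \<in> space M. s < f x}"
        using sets.sets_into_space[OF \<open>A \<in> sets M\<close>] by auto
      then show ?thesis by simp
    qed
    have "(\<integral>\<^sup>+x. (if 0 \<le> s \<and> s < f x \<and> x \<in> A then 1 else 0) \<partial>M)
       = (\<integral>\<^sup>+x. indicator {x \<in> A. s < f x} x * indicator {0..} s \<partial>M)"
      by (intro nn_integral_cong) (auto simp: indicator_def)
    also have "\<dots> = emeasure M {x \<in> A. s < f x} * indicator {0..} s"
      using S by (simp add: nn_integral_multc)
    finally show "(\<integral>\<^sup>+x. (if 0 \<le> s \<and> s < f x \<and> x \<in> A then 1 else 0) \<partial>M)
       = emeasure M {x \<in> A. s < f x} * indicator {0..} s" .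
  qed
  finally show ?thesis .
qed

text \<open>Keeps the two terms of the binomial expansion that still count after division by
  \<open>h\<close> when \<open>h\<close> tends to 0.\<close>

lemma power_add_ge_two_terms:
  fixes x y :: real
  assumes "x \<ge> 0" "y \<ge> 0"
  shows "x ^ n + real n * y * x ^ (n - 1) \<le> (x + y) ^ n"
proof (cases n)
  case (Suc k)
  have "x ^ Suc k + real (Suc k) * y * x ^ k \<le> (x + y) ^ Suc k"
  proof (induction k)
    case (Suc k)
    have "x ^ Suc (Suc k) + real (Suc (Suc k)) * y * x ^ Suc k
       \<le> (x + y) * (x ^ Suc k + real (Suc k) * y * x ^ k)"
    proof -
      have "0 \<le> real (Suc k) * y * y * x ^ k" using assms by simp
      then show ?thesis by (simp add: algebra_simps)
    qed
    also have "\<dots> \<le> (x + y) * (x + y) ^ Suc k"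
      using assms Suc.IH by (intro mult_left_mono) auto
    finally show ?case by simp
  qed simp
  then show ?thesis using Suc by simp
qed simp

lemma root_power_pred:
  assumes "n > 0" "a > 0"
  shows "root n a ^ (n - 1) = a powr ((real n - 1) / real n)"
  using assms by (simp add: root_powr_inverse powr_realpow[symmetric] powr_powr of_nat_diff divide_simps
      flip: powr_realpow)

text \<open>The \<open>h\<close>-neighbourhood of a superlevel set of \<open>w\<close> lies in the
  superlevel set of \<open>v\<close> at the same level. Brunn--Minkowski for each level is
  integrated by the layer cake formula; for levels below \<open>M\<close> the gain is at least that
  of a set of volume \<open>a\<close>.\<close>

lemma torus_isoperimetric_step:
  fixes w v :: "real^'n \<Rightarrow> real"
  assumes L: "L > 0" and h: "h > 0"
    and w: "continuous_on UNIV w" "lattice_periodic L w" "\<And>x. w x \<ge> 0"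
    and v[measurable]: "v \<in> borel_measurable borel" and v0: "\<And>x. v x \<ge> 0"
    and step: "\<And>x y. x \<in> torus L \<Longrightarrow> norm (y - x) < h \<Longrightarrow> w y \<le> v x"
    and level: "\<And>s. 0 \<le> s \<Longrightarrow> s < M \<Longrightarrow> a \<le> measure lborel {x \<in> torus L. s < w x}"
    and M: "M \<ge> 0" and a: "a > 0"
  shows "(\<integral>\<^sup>+x. ennreal (w x) * indicator (torus L) x \<partial>lborel) * ennreal (L ^ CARD('n))
      + ennreal (real CARD('n) * h * root CARD('n) (unit_ball_vol CARD('n)) * a powr ((real CARD('n) - 1) / real CARD('n))
            * L ^ CARD('n) * M)
    \<le> ennreal ((L + 2 * h) ^ CARD('n)) * (\<integral>\<^sup>+x. ennreal (v x) * indicator (torus L) x \<partial>lborel)"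
proof -
  let ?n = "CARD('n)" and ?\<omega> = "unit_ball_vol (CARD('n))" and ?T = "torus L :: (real^'n) set"
  let ?\<mu> = "measure (lborel :: (real^'n) measure)"
  let ?\<beta> = "(real CARD('n) - 1) / real CARD('n)"
  have [measurable]: "w \<in> borel_measurable borel" by (rule borel_measurable_continuous_onI[OF w(1)])
  define c where "c = real ?n * h * root ?n ?\<omega> * a powr ?\<beta> * L ^ ?n"
  have c0: "c \<ge> 0" using h L by (auto simp: c_def intro!: mult_nonneg_nonneg)
  have meas[measurable]: "(\<lambda>s. emeasure lborel {x \<in> ?T. s < f x}) \<in> borel_measurable borel"
    if f: "f \<in> borel_measurable borel" for f :: "real^'n \<Rightarrow> real"
  proof (rule lborel.measurable_emeasure)
    note f[measurable]
    have "{x \<in> space (borel \<Otimes>\<^sub>M lborel). snd x \<in> {xa \<in> ?T. fst x < f xa}}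
      = {x \<in> space (borel \<Otimes>\<^sub>M lborel). snd x \<in> ?T \<and> fst x < f (snd x)}" by auto
    also have "\<dots> \<in> sets (borel \<Otimes>\<^sub>M lborel)" by measurable
    finally show "{x \<in> space (borel \<Otimes>\<^sub>M lborel). snd x \<in> {xa \<in> ?T. fst x < f xa}} \<in> sets (borel \<Otimes>\<^sub>M lborel)" .
  qed simp
  have fin: "emeasure lborel {x \<in> ?T. P x} = ennreal (?\<mu> {x \<in> ?T. P x})" for P
  proof (rule emeasure_eq_ennreal_measure)
    have "bounded {x \<in> ?T. P x}" by (rule bounded_subset[of ?T]) (auto simp: torus_eq_cbox)
    from finite_measure_bounded[OF this] show "emeasure lborel {x \<in> ?T. P x} \<noteq> top" by simp
  qed
  have level_step: "emeasure lborel {x \<in> ?T. s < w x} * indicator {0..} s * ennreal (L ^ ?n) + ennreal c * indicator {0..<M} s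
      \<le> ennreal ((L + 2 * h) ^ ?n) * (emeasure lborel {x \<in> ?T. s < v x} * indicator {0..} s)" for s
  proof (cases "s \<ge> 0 \<and> ?\<mu> {x \<in> ?T. s < w x} > 0")
    case True
    define A where "A = {x. s < w x}"
    define \<mu>s where "\<mu>s = ?\<mu> {x \<in> ?T. s < w x}"
    have AT: "{x \<in> ?T. s < w x} = A \<inter> ?T" by (auto simp: A_def)
    have oA: "open A" unfolding A_def using w(1) by (intro open_Collect_less) auto
    have pA: "lattice_periodic L (\<lambda>x. x \<in> A)"
      using lattice_periodicD[OF w(2)] by (simp add: A_def lattice_periodic_def)
    have \<mu>s: "\<mu>s > 0" using True by (simp add: \<mu>s_def)
    have "(root ?n \<mu>s + h * root ?n ?\<omega>) ^ ?n * L ^ ?n \<le> (L + 2 * h) ^ ?n * ?\<mu> (minkowski_sum A (ball 0 h) \<inter> ?T)"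
      using torus_brunn_minkowski[OF L oA pA h] \<mu>s unfolding \<mu>s_def AT by simp
    also have "?\<mu> (minkowski_sum A (ball 0 h) \<inter> ?T) \<le> ?\<mu> {x \<in> ?T. s < v x}"
    proof (rule measure_lborel_mono_bounded)
      show "bounded {x \<in> ?T. s < v x}" by (rule bounded_subset[of ?T]) (auto simp: torus_eq_cbox)
      show "minkowski_sum A (ball 0 h) \<inter> ?T \<subseteq> {x \<in> ?T. s < v x}"
      proof
        fix x assume x: "x \<in> minkowski_sum A (ball 0 h) \<inter> ?T"
        then obtain y z where yz: "y \<in> A" "norm z < h" "x = y + z" by auto
        then have "norm (y - x) < h" by simp
        from step[OF _ this] x yz(1) show "x \<in> {x \<in> ?T. s < v x}" by (auto simp: A_def)
      qed
      have "open (minkowski_sum A (ball 0 h))" using oA by (intro open_sums) simp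
      then show "minkowski_sum A (ball 0 h) \<inter> ?T \<in> sets borel" by auto
    qed measurable
    finally have 1: "(root ?n \<mu>s + h * root ?n ?\<omega>) ^ ?n * L ^ ?n \<le> (L + 2 * h) ^ ?n * ?\<mu> {x \<in> ?T. s < v x}"
      using L h by (simp add: mult_left_mono)
    have "root ?n \<mu>s ^ ?n + real ?n * (h * root ?n ?\<omega>) * root ?n \<mu>s ^ (?n - 1) \<le> (root ?n \<mu>s + h * root ?n ?\<omega>) ^ ?n"
      using \<mu>s h by (intro power_add_ge_two_terms) auto
    then have "(\<mu>s + real ?n * (h * root ?n ?\<omega>) * \<mu>s powr ?\<beta>) * L ^ ?n \<le> (root ?n \<mu>s + h * root ?n ?\<omega>) ^ ?n * L ^ ?n"
      using \<mu>s L root_power_pred[of ?n \<mu>s] by (intro mult_right_mono) simp_all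
    with 1 have 2: "\<mu>s * L ^ ?n + real ?n * h * root ?n ?\<omega> * \<mu>s powr ?\<beta> * L ^ ?n \<le> (L + 2 * h) ^ ?n * ?\<mu> {x \<in> ?T. s < v x}"
      by (simp add: algebra_simps)
    have 3: "\<mu>s * L ^ ?n + c * indicator {0..<M} s \<le> (L + 2 * h) ^ ?n * ?\<mu> {x \<in> ?T. s < v x}"
    proof (cases "s < M")
      case sM: True
      have "a powr ?\<beta> \<le> \<mu>s powr ?\<beta>"
        using level[of s] True sM a by (intro powr_mono2) (auto simp: \<mu>s_def)
      then have "c \<le> real ?n * h * root ?n ?\<omega> * \<mu>s powr ?\<beta> * L ^ ?n"
        unfolding c_def using h L by (intro mult_right_mono mult_left_mono) auto
      then show ?thesis using 2 True sM by simp
    next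
      case False
      have "0 \<le> real ?n * h * root ?n ?\<omega> * \<mu>s powr ?\<beta> * L ^ ?n"
        using h L by (intro mult_nonneg_nonneg) auto
      then show ?thesis using 2 False by simp
    qed
    have "ennreal (\<mu>s * L ^ ?n) + ennreal (c * indicator {0..<M} s) \<le> ennreal ((L + 2 * h) ^ ?n * ?\<mu> {x \<in> ?T. s < v x})"
    proof -
      have "0 \<le> \<mu>s * L ^ ?n" "0 \<le> c * indicator {0..<M} s" using c0 \<mu>s L by auto
      from ennreal_plus[OF this, symmetric] show ?thesis using 3 by (simp only: ennreal_leI)
    qed
    then show ?thesis
      using True c0 \<mu>s L h unfolding fin \<mu>s_def[symmetric]
      by (simp add: ennreal_mult ennreal_indicator)
  next
    case False
    \<comment> \<open>A level in \<open>{0..<M}\<close> has a superlevel set of volume at least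
      \<open>a > 0\<close>. If the volume vanishes, both terms on the left are therefore 0.\<close>
    have "\<not> (0 \<le> s \<and> s < M)" using False level[of s] a by fastforce
    moreover have "?\<mu> {x \<in> ?T. s < w x} = 0" if "s \<ge> 0"
      using False that measure_nonneg[of lborel "{x \<in> ?T. s < w x}"] by linarith
    ultimately show ?thesis unfolding fin by (cases "s \<ge> 0") auto
  qed
  have "(\<integral>\<^sup>+x. ennreal (w x) * indicator ?T x \<partial>lborel) * ennreal (L ^ ?n) + ennreal (c * M)
    = (\<integral>\<^sup>+s. emeasure lborel {x \<in> ?T. s < w x} * indicator {0..} s * ennreal (L ^ ?n) + ennreal c * indicator {0..<M} s \<partial>lborel)"
    using M c0 by (subst layer_cake)
      (auto simp: w(3) lborel.sigma_finite_measure_axioms nn_integral_add nn_integral_multc nn_integral_cmult_indicator ennreal_mult)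
  also have "\<dots> \<le> (\<integral>\<^sup>+s. ennreal ((L + 2 * h) ^ ?n) * (emeasure lborel {x \<in> ?T. s < v x} * indicator {0..} s) \<partial>lborel)"
    by (intro nn_integral_mono level_step)
  also have "\<dots> = ennreal ((L + 2 * h) ^ ?n) * (\<integral>\<^sup>+x. ennreal (v x) * indicator ?T x \<partial>lborel)"
    by (subst layer_cake) (auto simp: v0 lborel.sigma_finite_measure_axioms nn_integral_cmult)
  finally show ?thesis by (simp add: c_def)
qed

lemma set_integrable_torus_continuous:
  "continuous_on (torus L) w \<Longrightarrow> set_integrable lborel (torus L :: (real^'n) set) (w :: _ \<Rightarrow> real)"
  unfolding set_integrable_def by (intro borel_integrable_compact) (auto simp: torus_eq_cbox)

text \<open>An integrated isoperimetric inequality in which \<kappa> plays the part of the slope of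
  \<open>w\<close>. It is the previous step with
  \<open>v = w + h * \<kappa> + C * h\<^sup>2\<close>, divided by \<open>h\<close> as
  \<open>h\<close> tends to 0. The correction \<open>2 * n / L\<close> is the derivative at 0 of
  \<open>(1 + 2 * h / L) ^ n\<close>, the relative volume of the enlarged cell.\<close>

theorem torus_isoperimetric_functional:
  fixes w \<kappa> :: "real^'n \<Rightarrow> real"
  assumes L: "L > 0"
    and w: "continuous_on UNIV w" "lattice_periodic L w" "\<And>x. w x \<ge> 0"
    and \<kappa>[measurable]: "\<kappa> \<in> borel_measurable borel" and \<kappa>0: "\<And>x. \<kappa> x \<ge> 0"
    and \<kappa>int: "set_integrable lborel (torus L) \<kappa>"
    and step: "\<And>h x y. 0 < h \<Longrightarrow> h \<le> 1 \<Longrightarrow> x \<in> torus L \<Longrightarrow> norm (y - x) < h \<Longrightarrow> w y \<le> w x + h * \<kappa> x + C * h\<^sup>2"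
    and level: "\<And>s. 0 \<le> s \<Longrightarrow> s < M \<Longrightarrow> a \<le> measure lborel {x \<in> torus L. s < w x}"
    and M: "M \<ge> 0" and a: "a > 0" and C: "C \<ge> 0"
  shows "real CARD('n) * root CARD('n) (unit_ball_vol CARD('n)) * a powr ((real CARD('n) - 1) / real CARD('n)) * M
    \<le> (LINT x:torus L|lborel. \<kappa> x) + 2 * real CARD('n) / L * (LINT x:torus L|lborel. w x)"
proof -
  let ?n = "CARD('n)" and ?T = "torus L :: (real^'n) set"
  have [measurable]: "w \<in> borel_measurable borel" by (rule borel_measurable_continuous_onI[OF w(1)])
  define D where "D = real ?n * root ?n (unit_ball_vol ?n) * a powr ((real ?n - 1) / real ?n) * M"
  define K W where "K = (LINT x:?T|lborel. \<kappa> x)" and "W = (LINT x:?T|lborel. w x)"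
  have D0: "D \<ge> 0" using M by (auto simp: D_def intro!: mult_nonneg_nonneg)
  have wint: "set_integrable lborel ?T w"
    using w(1) by (intro set_integrable_torus_continuous continuous_on_subset[OF w(1)]) auto
  have cint: "set_integrable lborel ?T (\<lambda>x. c :: real)" for c
    by (intro set_integrable_torus_continuous continuous_on_const)
  have main: "W + h * D \<le> (1 + 2 * h / L) ^ ?n * (W + h * K + C * h\<^sup>2 * L ^ ?n)" if h: "0 < h" "h \<le> 1" for h
  proof -
    let ?v = "\<lambda>x. w x + h * \<kappa> x + C * h\<^sup>2"
    have vi: "set_integrable lborel ?T ?v"
      by (intro set_integral_add wint cint set_integrable_mult_right \<kappa>int)
    have nn: "(\<integral>\<^sup>+x. ennreal (f x) * indicator ?T x \<partial>lborel) = ennreal (LINT x:?T|lborel. f x)"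
      if "set_integrable lborel ?T f" "\<And>x. f x \<ge> 0" for f
    proof -
      have "(\<integral>\<^sup>+x. ennreal (f x) * indicator ?T x \<partial>lborel) = (\<integral>\<^sup>+x. ennreal (indicator ?T x *\<^sub>R f x) \<partial>lborel)"
        by (intro nn_integral_cong) (auto simp: indicator_def)
      also have "\<dots> = ennreal (LINT x:?T|lborel. f x)"
        unfolding set_lebesgue_integral_def using that
        by (intro nn_integral_eq_integral) (auto simp: set_integrable_def)
      finally show ?thesis .
    qed
    have v0: "?v x \<ge> 0" for x using w(3) \<kappa>0 h C by (auto intro!: add_nonneg_nonneg mult_nonneg_nonneg)
    have W0: "W \<ge> 0" and V0: "0 \<le> (LINT x:?T|lborel. ?v x)"
      unfolding W_def set_lebesgue_integral_def using w(3) v0 by (auto intro!: Bochner_Integration.integral_nonneg)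
    have V: "(LINT x:?T|lborel. ?v x) = W + h * K + C * h\<^sup>2 * L ^ ?n"
      using L by (simp add: set_integral_add wint cint set_integrable_mult_right \<kappa>int W_def K_def)
        (simp add: set_lebesgue_integral_def measure_torus)
    have "(\<integral>\<^sup>+x. ennreal (w x) * indicator ?T x \<partial>lborel) * ennreal (L ^ ?n)
      + ennreal (real ?n * h * root ?n (unit_ball_vol ?n) * a powr ((real ?n - 1) / real ?n) * L ^ ?n * M)
      \<le> ennreal ((L + 2 * h) ^ ?n) * (\<integral>\<^sup>+x. ennreal (?v x) * indicator ?T x \<partial>lborel)"
      by (rule torus_isoperimetric_step[OF L h(1) w _ v0 _ level M a]) (use step h in auto)
    then have "ennreal W * ennreal (L ^ ?n) + ennreal (h * D * L ^ ?n)
       \<le> ennreal ((L + 2 * h) ^ ?n) * ennreal (W + h * K + C * h\<^sup>2 * L ^ ?n)"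
      unfolding nn[OF wint w(3)] nn[OF vi v0] V by (simp add: W_def D_def ac_simps)
    then have "ennreal (W * L ^ ?n + h * D * L ^ ?n) \<le> ennreal ((L + 2 * h) ^ ?n * (W + h * K + C * h\<^sup>2 * L ^ ?n))"
      using W0 V0 D0 L h V by (simp add: ennreal_mult ennreal_plus)
    then have "W * L ^ ?n + h * D * L ^ ?n \<le> (L + 2 * h) ^ ?n * (W + h * K + C * h\<^sup>2 * L ^ ?n)"
      using V0 V L h by (subst (asm) ennreal_le_iff) auto
    then have "(W + h * D) * L ^ ?n \<le> ((1 + 2 * h / L) ^ ?n * (W + h * K + C * h\<^sup>2 * L ^ ?n)) * L ^ ?n"
    proof -
      have "(L + 2 * h) ^ ?n = (1 + 2 * h / L) ^ ?n * L ^ ?n"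
        using L by (simp add: power_mult_distrib[symmetric] field_simps)
      then show ?thesis using \<open>W * L ^ ?n + h * D * L ^ ?n \<le> _\<close> by (simp add: algebra_simps)
    qed
    then show ?thesis using L by simp
  qed
  let ?g = "\<lambda>h. (1 + 2 * h / L) ^ ?n"
  have "((\<lambda>h. (?g h - ?g 0) / (h - 0)) \<longlongrightarrow> 2 * real ?n / L) (at 0)"
  proof -
    have "(?g has_field_derivative 2 * real ?n / L) (at 0)"
      using L by (auto intro!: derivative_eq_intros)
    then show ?thesis by (simp add: has_field_derivative_iff)
  qed
  then have lim1: "((\<lambda>h. (?g h - 1) / h) \<longlongrightarrow> 2 * real ?n / L) (at_right 0)"
    by (simp add: filterlim_at_split)
  have lim2: "((\<lambda>h. (?g h - 1) / h * W + ?g h * (K + C * h * L ^ ?n)) \<longlongrightarrow> 2 * real ?n / L * W + (1 + 2 * 0 / L) ^ ?n * (K + C * 0 * L ^ ?n)) (at_right 0)"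
    by (intro tendsto_intros lim1) (use L in auto)
  have "D \<le> 2 * real ?n / L * W + (1 + 2 * 0 / L) ^ ?n * (K + C * 0 * L ^ ?n)"
  proof (rule tendsto_lowerbound[OF lim2])
    have "eventually (\<lambda>h. 0 < h \<and> h < (1::real)) (at_right 0)"
      by (auto simp: eventually_at_right_field intro: exI[of _ 1])
    then show "\<forall>\<^sub>F h in at_right 0. D \<le> (?g h - 1) / h * W + ?g h * (K + C * h * L ^ ?n)"
    proof eventually_elim
      case (elim h)
      have "h * D \<le> h * ((?g h - 1) / h * W + ?g h * (K + C * h * L ^ ?n))"
      proof -
        have "h * ((?g h - 1) / h * W + ?g h * (K + C * h * L ^ ?n))
           = (?g h - 1) * W + ?g h * (h * K + C * h\<^sup>2 * L ^ ?n)"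
          using elim by (simp add: distrib_left power2_eq_square)
        then show ?thesis using main[of h] elim by (simp add: algebra_simps)
      qed
      then show ?case using elim by simp
    qed
  qed simp
  then show ?thesis by (simp add: D_def K_def W_def add.commute)
qed

section \<open>Mollification on the torus\<close>

text \<open>A trigonometric polynomial with maximal value \<eta>, attained on the lattice. Being
  periodic itself, it yields a convolution kernel on the torus without summing over lattice
  translates, and small \<eta> concentrates its positive part at the lattice.\<close>

definition bump_level :: "real \<Rightarrow> real \<Rightarrow> real^'n \<Rightarrow> real" where
  "bump_level L \<eta> x = (\<Sum>i\<in>UNIV. cos (2 * pi / L * x $ i)) - real CARD('n) + \<eta>"

text \<open>The square of a positive part still has a Lipschitz derivative. That is the regularity
  required of test functions and, through the quadratic Taylor remainder, of the isoperimetric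
  argument.\<close>

definition bump :: "real \<Rightarrow> real \<Rightarrow> real^'n \<Rightarrow> real" where
  "bump L \<eta> x = (max 0 (bump_level L \<eta> x))\<^sup>2"

definition bump_grad :: "real \<Rightarrow> real \<Rightarrow> real^'n \<Rightarrow> real^'n" where
  "bump_grad L \<eta> x = (\<chi> i. - 2 * max 0 (bump_level L \<eta> x) * (2 * pi / L) * sin (2 * pi / L * x $ i))"

lemma sin_diff_le: "\<bar>sin v - v\<bar> \<le> v\<^sup>2 / 2" for v :: real
proof -
  have "\<bar>sin v - (\<Sum>m<2. sin_coeff m * v ^ m)\<bar> \<le> inverse (fact 2) * \<bar>v\<bar> ^ 2"
    by (rule Maclaurin_sin_bound)
  then show ?thesis by (simp add: numeral_2_eq_2 sin_coeff_def)
qed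

lemma cos_diff_one_le: "\<bar>cos v - 1\<bar> \<le> v\<^sup>2 / 2" for v :: real
proof -
  obtain t where "cos v = (\<Sum>m<2. cos_coeff m * v ^ m) + cos (t + 1 / 2 * real 2 * pi) / fact 2 * v ^ 2"
    using Maclaurin_cos_expansion[of v 2] by blast
  then have "\<bar>cos v - 1\<bar> = \<bar>cos (t + 1 / 2 * real 2 * pi)\<bar> * v\<^sup>2 / 2"
    by (simp add: numeral_2_eq_2 cos_coeff_def abs_mult)
  also have "\<dots> \<le> 1 * v\<^sup>2 / 2"
    by (intro divide_right_mono mult_right_mono abs_cos_le_one) auto
  finally show ?thesis by simp
qed

lemma cos_taylor: "\<bar>cos (u + v) - cos u + v * sin u\<bar> \<le> v\<^sup>2" for u v :: real
proof -
  have "cos (u + v) - cos u + v * sin u = cos u * (cos v - 1) - sin u * (sin v - v)"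
    by (simp add: cos_add algebra_simps)
  also have "\<bar>\<dots>\<bar> \<le> \<bar>cos u\<bar> * \<bar>cos v - 1\<bar> + \<bar>sin u\<bar> * \<bar>sin v - v\<bar>"
    unfolding abs_mult[symmetric] by (rule abs_triangle_ineq4)
  also have "\<dots> \<le> 1 * (v\<^sup>2 / 2) + 1 * (v\<^sup>2 / 2)"
    by (intro add_mono mult_mono abs_cos_le_one abs_sin_le_one cos_diff_one_le sin_diff_le) auto
  finally show ?thesis by simp
qed

lemma pos_part_square_taylor:
  fixes a b :: real
  shows "\<bar>(max 0 b)\<^sup>2 - (max 0 a)\<^sup>2 - 2 * max 0 a * (b - a)\<bar> \<le> (b - a)\<^sup>2"
proof (cases "a \<ge> 0"; cases "b \<ge> 0")
  assume "a \<ge> 0" "b \<ge> 0"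
  then have "(max 0 b)\<^sup>2 - (max 0 a)\<^sup>2 - 2 * max 0 a * (b - a) = (b - a)\<^sup>2"
    by (simp add: max_def power2_eq_square algebra_simps)
  then show ?thesis by simp
next
  assume ab: "a \<ge> 0" "\<not> b \<ge> 0"
  then have ab': "a * b \<le> 0" by (auto simp: mult_nonneg_nonpos)
  have "(max 0 b)\<^sup>2 - (max 0 a)\<^sup>2 - 2 * max 0 a * (b - a) = a\<^sup>2 - 2 * (a * b)"
    using ab by (simp add: max_def power2_eq_square algebra_simps)
  moreover have "\<bar>a\<^sup>2 - 2 * (a * b)\<bar> = a\<^sup>2 - 2 * (a * b)" using ab' zero_le_power2[of a] by linarith
  moreover have "(b - a)\<^sup>2 = a\<^sup>2 - 2 * (a * b) + b\<^sup>2" by (simp add: power2_eq_square algebra_simps)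
  ultimately show ?thesis by simp
next
  assume ab: "\<not> a \<ge> 0" "b \<ge> 0"
  then have ab': "a * b \<le> 0" by (auto simp: mult_nonpos_nonneg)
  have "(max 0 b)\<^sup>2 - (max 0 a)\<^sup>2 - 2 * max 0 a * (b - a) = b\<^sup>2"
    using ab by (simp add: max_def)
  moreover have "(b - a)\<^sup>2 = a\<^sup>2 - 2 * (a * b) + b\<^sup>2" by (simp add: power2_eq_square algebra_simps)
  moreover have "2 * (a * b) \<le> a\<^sup>2" using ab' zero_le_power2[of a] by linarith
  ultimately show ?thesis by simp
qed (auto simp: max_def)

lemma bump_nonneg: "bump L \<eta> x \<ge> 0" by (simp add: bump_def)

lemma bump_level_minus: "bump_level L \<eta> (- x) = bump_level L \<eta> x"
  by (simp add: bump_level_def)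

lemma bump_minus: "bump L \<eta> (x - y) = bump L \<eta> (y - x)"
  using bump_level_minus[of L \<eta> "x - y"] by (simp add: bump_def)

lemma bump_level_lattice:
  assumes "L > 0" "k \<in> lattice L"
  shows "bump_level L \<eta> (x + k) = bump_level L \<eta> x" "bump_grad L \<eta> (x + k) = bump_grad L \<eta> x"
proof -
  obtain z where z: "k = (\<chi> i. L * of_int (z i))" using assms by (auto simp: lattice_def)
  have *: "2 * pi / L * (x + k) $ i = 2 * pi / L * x $ i + 2 * pi * of_int (z i)" for i
    using assms by (simp add: z field_simps)
  have c: "cos (t + 2 * pi * of_int m) = cos t" "sin (t + 2 * pi * of_int m) = sin t" for t :: real and m
    by (simp_all add: cos_add sin_add cos_int_2pin sin_int_2pin)
  show 1: "bump_level L \<eta> (x + k) = bump_level L \<eta> x"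
    unfolding bump_level_def * c ..
  show "bump_grad L \<eta> (x + k) = bump_grad L \<eta> x"
    unfolding bump_grad_def 1 * c ..
qed

lemma bump_lattice_periodic: "L > 0 \<Longrightarrow> lattice_periodic L (bump L \<eta>)"
  by (simp add: lattice_periodic_def bump_def bump_level_lattice)

lemma continuous_bump_level [continuous_intros]: "continuous_on S (bump_level L \<eta>)"
  unfolding bump_level_def by (intro continuous_intros)

lemma continuous_bump: "continuous_on S (bump L \<eta>)"
  unfolding bump_def by (intro continuous_intros)

lemma continuous_bump_grad: "continuous_on S (bump_grad L \<eta>)"
  unfolding bump_grad_def by (intro continuous_intros continuous_on_vec_lambda)

lemma bump_level_le: "bump_level L \<eta> (x :: real^'n) \<le> \<eta>"
proof -
  have "(\<Sum>i\<in>UNIV. cos (2 * pi / L * x $ i)) \<le> (\<Sum>i\<in>(UNIV :: 'n set). 1)" by (intro sum_mono) simp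
  then show ?thesis by (simp add: bump_level_def)
qed

lemma bump_le: "0 \<le> \<eta> \<Longrightarrow> bump L \<eta> x \<le> \<eta>\<^sup>2"
  unfolding bump_def using bump_level_le[of L \<eta> x] by (intro power_mono) auto

text \<open>The remainder constant is the same for all \<open>x\<close>, so it survives integration
  against any integrable function.\<close>

lemma bump_taylor:
  assumes L: "L > 0" and \<eta>: "\<eta> \<ge> 0"
  shows "\<exists>C\<ge>0. \<forall>x h :: real^'n. \<bar>bump L \<eta> (x + h) - bump L \<eta> x - bump_grad L \<eta> x \<bullet> h\<bar> \<le> C * (norm h)\<^sup>2"
proof -
  let ?c = "2 * pi / L" and ?n = "real CARD('n)"
  \<comment> \<open>The first term bounds the squared increment of the level. The second bounds the
    distance of that increment from its linear part, weighted by twice the maximal level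
    \<eta>.\<close>
  define C where "C = (?n * ?c)\<^sup>2 + 2 * \<eta> * (?n * ?c\<^sup>2)"
  have "\<bar>bump L \<eta> (x + h) - bump L \<eta> x - bump_grad L \<eta> x \<bullet> h\<bar> \<le> C * (norm h)\<^sup>2" for x h :: "real^'n"
  proof -
    define a b where "a = bump_level L \<eta> x" and "b = bump_level L \<eta> (x + h)"
    define l where "l = (\<Sum>i\<in>UNIV. - (?c * h $ i) * sin (?c * x $ i))"
    have ba: "b - a = (\<Sum>i\<in>UNIV. cos (?c * x $ i + ?c * h $ i) - cos (?c * x $ i))"
      by (simp add: a_def b_def bump_level_def sum_subtractf distrib_left)
    have hi: "\<bar>h $ i\<bar> \<le> norm h" for i by (rule component_le_norm_cart)
    have c0: "?c \<ge> 0" using L by simp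
    have "\<bar>b - a - l\<bar> \<le> (\<Sum>i\<in>UNIV. \<bar>cos (?c * x $ i + ?c * h $ i) - cos (?c * x $ i) + ?c * h $ i * sin (?c * x $ i)\<bar>)"
      unfolding ba l_def sum_subtractf[symmetric] by (rule order_trans[OF sum_abs]) simp
    also have "\<dots> \<le> (\<Sum>i\<in>(UNIV::'n set). ?c\<^sup>2 * (norm h)\<^sup>2)"
    proof (rule sum_mono)
      fix i
      have "(?c * h $ i)\<^sup>2 \<le> ?c\<^sup>2 * (norm h)\<^sup>2"
        unfolding power_mult_distrib[symmetric] abs_le_square_iff[symmetric] abs_mult
        using hi[of i] c0 by (intro mult_left_mono) (simp_all only: abs_of_nonneg abs_norm_cancel abs_ge_zero order_refl)
      then show "\<bar>cos (?c * x $ i + ?c * h $ i) - cos (?c * x $ i) + ?c * h $ i * sin (?c * x $ i)\<bar> \<le> ?c\<^sup>2 * (norm h)\<^sup>2"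
        using cos_taylor[of "?c * x $ i" "?c * h $ i"] by linarith
    qed
    finally have 1: "\<bar>b - a - l\<bar> \<le> ?n * ?c\<^sup>2 * (norm h)\<^sup>2" by simp
    have cosd: "\<bar>cos (u + v) - cos u\<bar> \<le> \<bar>v\<bar>" for u v :: real
    proof -
      have "cos (u + v) - cos u = 2 * sin (u + v / 2) * sin (- v / 2)"
        by (simp add: cos_diff_cos field_simps)
      also have "\<bar>\<dots>\<bar> = 2 * \<bar>sin (u + v / 2)\<bar> * \<bar>sin (v / 2)\<bar>" by (simp add: abs_mult)
      also have "\<dots> \<le> 2 * 1 * \<bar>v / 2\<bar>"
        by (intro mult_mono abs_sin_le_one abs_sin_x_le_abs_x) auto
      finally show ?thesis by simp
    qed
    have "\<bar>b - a\<bar> \<le> (\<Sum>i\<in>UNIV. \<bar>cos (?c * x $ i + ?c * h $ i) - cos (?c * x $ i)\<bar>)"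
      unfolding ba by (rule sum_abs)
    also have "\<dots> \<le> (\<Sum>i\<in>(UNIV::'n set). ?c * norm h)"
    proof (rule sum_mono)
      fix i
      have "\<bar>?c * h $ i\<bar> \<le> ?c * norm h" using hi[of i] c0 mult_left_mono abs_mult[of ?c "h $ i"] abs_of_nonneg[OF c0] by metis
      then show "\<bar>cos (?c * x $ i + ?c * h $ i) - cos (?c * x $ i)\<bar> \<le> ?c * norm h"
        using cosd[of "?c * x $ i" "?c * h $ i"] by linarith
    qed
    finally have "\<bar>b - a\<bar> \<le> ?n * ?c * norm h" by simp
    then have 2: "(b - a)\<^sup>2 \<le> (?n * ?c)\<^sup>2 * (norm h)\<^sup>2"
      using c0 by (simp add: power_mult_distrib[symmetric] abs_le_square_iff[symmetric] del: times_divide_eq_left times_divide_eq_right)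
    have gl: "bump_grad L \<eta> x \<bullet> h = 2 * max 0 a * l"
      by (simp add: bump_grad_def inner_vec_def l_def a_def sum_distrib_left mult_ac)
    have a\<eta>: "max 0 a \<le> \<eta>" using bump_level_le[of L \<eta> x] \<eta> by (simp add: a_def)
    have "bump L \<eta> (x + h) - bump L \<eta> x - bump_grad L \<eta> x \<bullet> h
      = ((max 0 b)\<^sup>2 - (max 0 a)\<^sup>2 - 2 * max 0 a * (b - a)) + 2 * max 0 a * (b - a - l)"
      unfolding gl by (simp add: bump_def a_def b_def algebra_simps)
    also have "\<bar>\<dots>\<bar> \<le> (b - a)\<^sup>2 + 2 * max 0 a * \<bar>b - a - l\<bar>"
      using pos_part_square_taylor[of b a] by (intro order_trans[OF abs_triangle_ineq] add_mono) (auto simp: abs_mult)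
    also have "\<dots> \<le> (?n * ?c)\<^sup>2 * (norm h)\<^sup>2 + 2 * \<eta> * (?n * ?c\<^sup>2 * (norm h)\<^sup>2)"
      using 1 2 a\<eta> \<eta> by (intro add_mono mult_mono) auto
    finally show ?thesis by (simp add: C_def algebra_simps)
  qed
  moreover have "C \<ge> 0" using L \<eta> by (simp add: C_def)
  ultimately show ?thesis by blast
qed

lemma has_derivative_quadratic_remainder:
  fixes f :: "'a::real_inner \<Rightarrow> real"
  assumes "\<And>h. \<bar>f (x + h) - f x - g \<bullet> h\<bar> \<le> C * (norm h)\<^sup>2"
  shows "(f has_derivative (\<lambda>h. g \<bullet> h)) (at x)"
proof -
  have C: "C * (norm h)\<^sup>2 \<ge> 0" for h :: 'a using assms[of h] by linarith
  have "((\<lambda>h::'a. \<bar>C\<bar> * norm h) \<longlongrightarrow> \<bar>C\<bar> * norm (0::'a)) (at 0)"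
    by (rule tendsto_mult[OF tendsto_const tendsto_norm[OF tendsto_ident_at]])
  then have "((\<lambda>h. \<bar>C\<bar> * norm (h::'a)) \<longlongrightarrow> 0) (at 0)" by simp
  then have "((\<lambda>h. norm (f (x + h) - f x - g \<bullet> h) / norm h) \<longlongrightarrow> 0) (at 0)"
  proof (rule real_tendsto_sandwich[rotated 3, of _ _ _ "\<lambda>_. 0"])
    show "\<forall>\<^sub>F h in at 0. norm (f (x + h) - f x - g \<bullet> h) / norm h \<le> \<bar>C\<bar> * norm h"
    proof (rule eventually_at_topological[THEN iffD2], intro exI[of _ UNIV] conjI ballI impI)
      fix h :: 'a assume h: "h \<noteq> 0"
      have "norm (f (x + h) - f x - g \<bullet> h) \<le> C * (norm h)\<^sup>2" using assms[of h] by simp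
      also have "\<dots> \<le> \<bar>C\<bar> * (norm h)\<^sup>2" by (intro mult_right_mono) auto
      finally show "norm (f (x + h) - f x - g \<bullet> h) / norm h \<le> \<bar>C\<bar> * norm h"
        using h by (simp add: divide_le_eq power2_eq_square mult.assoc)
    qed auto
  qed auto
  then show ?thesis
    by (simp add: has_derivative_at bounded_linear_inner_right)
qed

lemma bump_has_derivative:
  assumes "L > 0" "\<eta> \<ge> 0"
  shows "(bump L \<eta> has_derivative (\<lambda>h. bump_grad L \<eta> x \<bullet> h)) (at x)"
  using bump_taylor[OF assms] has_derivative_quadratic_remainder by metis

lemma partial_eqI:
  assumes "(\<psi> has_derivative (\<lambda>h. g \<bullet> h)) (at x)"
  shows "partial \<psi> i x = g $ i"
proof -
  have "frechet_derivative \<psi> (at x) = (\<lambda>h. g \<bullet> h)" by (rule frechet_derivative_at[OF assms, symmetric])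
  then show ?thesis by (simp add: partial_def inner_axis)
qed

text \<open>As a function of \<open>y\<close>, the bump centred at \<open>x\<close> is an admissible
  test function for weak gradients. The sign of its derivative comes from the reflected argument and
  cancels the sign in \<open>weak_grad\<close>.\<close>

lemma bump_test:
  fixes x :: "real^'n"
  assumes L: "L > 0" and \<eta>: "\<eta> \<ge> 0"
  shows "periodic_C1_test L (\<lambda>y. bump L \<eta> (x - y))"
    and "partial (\<lambda>y. bump L \<eta> (x - y)) i y = - bump_grad L \<eta> (x - y) $ i"
proof -
  have D: "((\<lambda>y. bump L \<eta> (x - y)) has_derivative (\<lambda>h. (- bump_grad L \<eta> (x - y)) \<bullet> h)) (at y)" for y
  proof -
    have "((\<lambda>y. x - y) has_derivative (\<lambda>h. - h)) (at y)" by (auto intro!: derivative_eq_intros)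
    from has_derivative_compose[OF this bump_has_derivative[OF L \<eta>]]
    show ?thesis by simp
  qed
  show p: "partial (\<lambda>y. bump L \<eta> (x - y)) i y = - bump_grad L \<eta> (x - y) $ i" for i y
    using partial_eqI[OF D] by simp
  show "periodic_C1_test L (\<lambda>y. bump L \<eta> (x - y))"
    unfolding periodic_C1_test_def
  proof (intro conjI allI)
    show "(\<lambda>y. bump L \<eta> (x - y)) differentiable at y" for y using D differentiable_def by blast
    show "continuous_on UNIV (partial (\<lambda>y. bump L \<eta> (x - y)) i)" for i
    proof -
      have "continuous_on UNIV (\<lambda>y. - bump_grad L \<eta> (x - y) $ i)"
        by (intro continuous_intros continuous_on_compose2[OF continuous_bump_grad[of UNIV]]) auto
      then show ?thesis using p by presburger
    qed
    fix y :: "real^'n" and i :: 'n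
    have "- (L *\<^sub>R axis i 1) \<in> lattice L"
      unfolding lattice_def
      by (intro range_eqI[of _ _ "\<lambda>j. if j = i then - 1 else 0"]) (simp add: vec_eq_iff axis_def)
    from lattice_periodicD[OF bump_lattice_periodic[OF L, of \<eta>] this, of "x - y"]
    show "bump L \<eta> (x - (y + L *\<^sub>R axis i 1)) = bump L \<eta> (x - y)" by (simp add: algebra_simps)
  qed
qed

lemma cos_le_cos_away:
  assumes "0 \<le> a" "a \<le> pi" "a \<le> t" "t \<le> 2 * pi - a"
  shows "cos t \<le> cos a"
proof (cases "t \<le> pi")
  case True
  then show ?thesis using assms by (intro cos_monotone_0_pi_le) auto
next
  case False
  have "cos (2 * pi - t) \<le> cos a" using False assms by (intro cos_monotone_0_pi_le) auto
  then show ?thesis by (simp add: cos_diff)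
qed

text \<open>The bound on \<open>\<bar>z $ i\<bar>\<close> by \<open>L - \<epsilon>\<close> excludes the copies of the peak at the other lattice points.\<close>
lemma bump_support:
  assumes L: "L > 0" and e: "0 < \<epsilon>" "\<epsilon> \<le> L / 2" and \<eta>: "\<eta> \<le> 1 - cos (2 * pi / L * \<epsilon>)"
    and z: "\<And>i. \<bar>z $ i\<bar> \<le> L - \<epsilon>" and k: "bump L \<eta> (z :: real^'n) \<noteq> 0"
  shows "\<bar>z $ i\<bar> < \<epsilon>"
proof (rule ccontr)
  assume n: "\<not> \<bar>z $ i\<bar> < \<epsilon>"
  have "cos (2 * pi / L * \<bar>z $ i\<bar>) \<le> cos (2 * pi / L * \<epsilon>)"
  proof (rule cos_le_cos_away)
    show "2 * pi / L * \<epsilon> \<le> pi" using e L by (simp add: field_simps)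
    show "2 * pi / L * \<epsilon> \<le> 2 * pi / L * \<bar>z $ i\<bar>" using n L by (intro mult_left_mono) auto
    have "2 * pi / L * \<bar>z $ i\<bar> \<le> 2 * pi / L * (L - \<epsilon>)" using z[of i] L by (intro mult_left_mono) auto
    also have "\<dots> = 2 * pi - 2 * pi / L * \<epsilon>" using L by (simp add: field_simps)
    finally show "2 * pi / L * \<bar>z $ i\<bar> \<le> 2 * pi - 2 * pi / L * \<epsilon>" .
  qed (use e L in auto)
  moreover have "cos (2 * pi / L * \<bar>z $ i\<bar>) = cos (2 * pi / L * z $ i)"
    by (cases "z $ i \<ge> 0") (auto simp: abs_if)
  ultimately have c: "cos (2 * pi / L * z $ i) \<le> 1 - \<eta>" using \<eta> by linarith
  have "(\<Sum>j\<in>UNIV. cos (2 * pi / L * z $ j)) \<le> (\<Sum>j\<in>UNIV. if j = i then 1 - \<eta> else 1)"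
    using c by (intro sum_mono) auto
  also have "\<dots> = real CARD('n) - \<eta>"
    by (subst sum.remove[of _ i]) (auto simp: card_Diff_singleton of_nat_diff cong: sum.cong_simp)
  finally have "bump_level L \<eta> z \<le> 0" by (simp add: bump_level_def)
  then show False using k by (simp add: bump_def)
qed

section \<open>Lebesgue measure on the torus and convolution with the bump\<close>

abbreviation torus_measure :: "real \<Rightarrow> (real^'n) measure" where
  "torus_measure L \<equiv> lebesgue_on (torus L)"

lemma finite_torus_measure: "finite_measure (torus_measure L :: (real^'n) measure)"
  by (simp add: finite_measure_lebesgue_on torus_eq_cbox)

lemma sigma_finite_torus_measure: "sigma_finite_measure (torus_measure L :: (real^'n) measure)"
  using finite_torus_measure by (rule finite_measure.axioms(1))

lemma pair_sigma_finite_torus: "pair_sigma_finite (torus_measure L :: (real^'n) measure) (torus_measure L :: (real^'n) measure)"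
  by (intro pair_sigma_finite.intro sigma_finite_torus_measure)

lemma measurable_borel_torus: "f \<in> measurable borel N \<Longrightarrow> f \<in> measurable (torus_measure L) N"
  by (intro measurable_restrict_space1 measurable_completion) simp

lemma measurable_ident_torus [measurable]: "(\<lambda>x. x) \<in> borel_measurable (torus_measure L)"
  by (rule measurable_borel_torus) simp

lemma nn_integral_torus:
  fixes f :: "real^'n \<Rightarrow> ennreal"
  assumes "f \<in> borel_measurable borel"
  shows "(\<integral>\<^sup>+x. f x \<partial>torus_measure L) = (\<integral>\<^sup>+x. f x * indicator (torus L) x \<partial>lborel)"
  using assms by (simp add: nn_integral_restrict_space nn_integral_completion)

lemma integral_torus:
  fixes f :: "real^'n \<Rightarrow> real"
  assumes "f \<in> borel_measurable borel"
  shows "(LINT x|torus_measure L. f x) = (LINT x:torus L|lborel. f x)"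
  unfolding set_lebesgue_integral_def using assms
  by (simp add: integral_restrict_space integral_completion)

lemma integrable_torus_iff:
  fixes f :: "real^'n \<Rightarrow> real"
  assumes "f \<in> borel_measurable borel"
  shows "integrable (torus_measure L) f \<longleftrightarrow> set_integrable lborel (torus L) f"
  unfolding set_integrable_def using assms
  by (simp add: integrable_restrict_space integrable_completion)

lemma measure_torus_measure: "L \<ge> 0 \<Longrightarrow> measure (torus_measure L) (torus L :: (real^'n) set) = L ^ CARD('n)"
  by (simp add: measure_restrict_space measure_torus)

lemma integrable_torus_const [simp]: "integrable (torus_measure L :: (real^'n) measure) (\<lambda>x. c :: real)"
  using finite_measure.integrable_const[OF finite_torus_measure] by blast

lemma integrable_torus_bounded:
  fixes f :: "real^'n \<Rightarrow> real"
  assumes "f \<in> borel_measurable (torus_measure L)" "\<And>x. x \<in> torus L \<Longrightarrow> \<bar>f x\<bar> \<le> B"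
  shows "integrable (torus_measure L) f"
  by (rule Bochner_Integration.integrable_bound[OF integrable_torus_const[of L B]])
    (use assms in \<open>auto intro!: AE_I2 intro: order_trans[OF _ abs_ge_self]\<close>)

lemma integrable_mult_bounded:
  fixes u f :: "'a \<Rightarrow> real"
  assumes "integrable M u" "f \<in> borel_measurable M" "\<And>x. x \<in> space M \<Longrightarrow> \<bar>f x\<bar> \<le> B"
  shows "integrable M (\<lambda>x. u x * f x)"
proof (rule Bochner_Integration.integrable_bound)
  show "integrable M (\<lambda>x. B * u x)" using assms by simp
  show "(\<lambda>x. u x * f x) \<in> borel_measurable M" using assms by auto
  show "AE x in M. norm (u x * f x) \<le> norm (B * u x)"
  proof (rule AE_I2)
    fix x assume "x \<in> space M"
    then have "\<bar>f x\<bar> \<le> \<bar>B\<bar>" using assms(3) by fastforce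
    then have "\<bar>u x\<bar> * \<bar>f x\<bar> \<le> \<bar>u x\<bar> * \<bar>B\<bar>" by (intro mult_left_mono) auto
    then show "norm (u x * f x) \<le> norm (B * u x)" by (simp add: abs_mult mult.commute)
  qed
qed

lemma integrable_if_square_integrable:
  fixes u :: "real^'n \<Rightarrow> real"
  assumes "u \<in> borel_measurable (torus_measure L)" "integrable (torus_measure L) (\<lambda>x. (u x)\<^sup>2)"
  shows "integrable (torus_measure L) u"
proof (rule Bochner_Integration.integrable_bound)
  show "integrable (torus_measure L) (\<lambda>x. 1 + (u x)\<^sup>2)" using assms by simp
  have "\<bar>t\<bar> \<le> \<bar>1 + t\<^sup>2\<bar>" for t :: real
  proof -
    have "0 \<le> (\<bar>t\<bar> - 1)\<^sup>2" by simp
    then have "2 * \<bar>t\<bar> \<le> 1 + t\<^sup>2" by (simp add: power2_diff)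
    then show ?thesis by linarith
  qed
  then show "AE x in torus_measure L. norm (u x) \<le> norm (1 + (u x)\<^sup>2)" by simp
qed (use assms in auto)

lemma measurable_bump_diff [measurable]:
  "(\<lambda>y. bump L \<eta> (x - y)) \<in> borel_measurable (torus_measure l)"
  "(\<lambda>y. bump L \<eta> (y - x)) \<in> borel_measurable (torus_measure l)"
  by (intro measurable_borel_torus borel_measurable_continuous_onI continuous_on_compose2[OF continuous_bump[of UNIV]]
      continuous_intros; simp)+

lemma measurable_bump_pair [measurable]:
  "(\<lambda>(x, y). bump L \<eta> (x - y)) \<in> borel_measurable (torus_measure l \<Otimes>\<^sub>M torus_measure l)"
proof -
  have "bump L \<eta> \<in> borel_measurable borel" by (intro borel_measurable_continuous_onI continuous_bump)
  moreover have "(\<lambda>p. fst p - snd p) \<in> measurable (torus_measure l \<Otimes>\<^sub>M torus_measure l) borel"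
    using measurable_compose[OF measurable_fst measurable_ident_torus] measurable_compose[OF measurable_snd measurable_ident_torus]
    by (intro borel_measurable_diff)
  ultimately show ?thesis unfolding split_beta by (rule measurable_compose[rotated])
qed

definition bump_mass :: "'n::finite itself \<Rightarrow> real \<Rightarrow> real \<Rightarrow> real" where
  "bump_mass _ L \<eta> = (LINT x|(torus_measure L :: (real^'n) measure). bump L \<eta> x)"

definition mollifier :: "real \<Rightarrow> real \<Rightarrow> real^'n \<Rightarrow> real" where
  "mollifier L \<eta> x = bump L \<eta> x / bump_mass TYPE('n) L \<eta>"

definition mollify :: "real \<Rightarrow> real \<Rightarrow> (real^'n \<Rightarrow> real) \<Rightarrow> real^'n \<Rightarrow> real" where
  "mollify L \<eta> u x = (LINT y|torus_measure L. u y * mollifier L \<eta> (x - y))"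

text \<open>The supporting line from which Jensen's inequality follows, for the two powers that
  occur in the energy.\<close>

lemma even_power_tangent:
  fixes a c :: real
  assumes "p = 2 \<or> p = 4"
  shows "c ^ p + real p * c ^ (p - 1) * (a - c) \<le> a ^ p"
proof -
  have "a ^ 4 - (c ^ 4 + 4 * c ^ 3 * (a - c)) = (a - c)\<^sup>2 * ((a + c)\<^sup>2 + 2 * c\<^sup>2)"
    by (simp add: power2_eq_square power4_eq_xxxx power3_eq_cube algebra_simps)
  also have "\<dots> \<ge> 0" by simp
  finally have 4: "c ^ 4 + 4 * c ^ 3 * (a - c) \<le> a ^ 4" by simp
  have "a\<^sup>2 - (c\<^sup>2 + 2 * c * (a - c)) = (a - c)\<^sup>2" by (simp add: power2_eq_square algebra_simps)
  also have "\<dots> \<ge> 0" by simp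
  finally have "c\<^sup>2 + 2 * c * (a - c) \<le> a\<^sup>2" by simp
  with 4 assms show ?thesis by auto
qed

context
  fixes L \<eta> :: real
  assumes L: "L > 0" and \<eta>: "\<eta> > 0"
begin

lemma bump_abs_le: "\<bar>bump L \<eta> x\<bar> \<le> \<eta>\<^sup>2"
  using bump_le[of \<eta> L x] bump_nonneg[of L \<eta> x] \<eta> by simp

lemma integrable_bump:
  "integrable (torus_measure L) (\<lambda>y. bump L \<eta> (x - y))" "integrable (torus_measure L) (\<lambda>y. bump L \<eta> (y - x))"
  by (rule integrable_torus_bounded[where B = "\<eta>\<^sup>2"], measurable, rule bump_abs_le)+

lemma nn_integral_bump_diff:
  "(\<integral>\<^sup>+y. ennreal (bump L \<eta> (y - x)) \<partial>(torus_measure L :: (real^'n) measure)) = ennreal (bump_mass TYPE('n) L \<eta>)"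
proof -
  have [measurable]: "bump L \<eta> \<in> borel_measurable borel" by (intro borel_measurable_continuous_onI continuous_bump)
  have "(\<integral>\<^sup>+y. ennreal (bump L \<eta> (y - x)) \<partial>torus_measure L) = (\<integral>\<^sup>+y. ennreal (bump L \<eta> (y + - x)) * indicator (torus L) y \<partial>lborel)"
    by (subst nn_integral_torus) auto
  also have "\<dots> = (\<integral>\<^sup>+y. ennreal (bump L \<eta> y) * indicator (torus L :: (real^'n) set) y \<partial>lborel)"
    by (rule nn_integral_periodic_translate[OF L, of "\<lambda>y. ennreal (bump L \<eta> y)" "- x"])
      (auto simp: lattice_periodic_def lattice_periodicD[OF bump_lattice_periodic[OF L]])
  also have "\<dots> = (\<integral>\<^sup>+y. ennreal (bump L \<eta> y) \<partial>(torus_measure L :: (real^'n) measure))"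
    by (subst nn_integral_torus) auto
  also have "\<dots> = ennreal (bump_mass TYPE('n) L \<eta>)"
    unfolding bump_mass_def using integrable_bump(2)[of 0]
    by (intro nn_integral_eq_integral) (auto simp: bump_nonneg)
  finally show ?thesis .
qed

lemma bump_mass_pos: "bump_mass TYPE('n::finite) L \<eta> > 0"
proof (rule ccontr)
  assume n: "\<not> bump_mass TYPE('n) L \<eta> > 0"
  have "continuous_on UNIV (bump L \<eta> :: real^'n \<Rightarrow> real)" by (rule continuous_bump)
  have i: "integrable (torus_measure L) (bump L \<eta> :: real^'n \<Rightarrow> real)" using integrable_bump(2)[of 0] by simp
  have "(\<integral>\<^sup>+x. ennreal (bump L \<eta> (x - 0)) \<partial>(torus_measure L :: (real^'n) measure)) = 0"
    using n nn_integral_bump_diff[of "0 :: real^'n"] by (simp add: ennreal_neg)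
  then have z: "AE x in torus_measure L. bump L \<eta> (x :: real^'n) = 0"
    using borel_measurable_integrable[OF i] by (subst (asm) nn_integral_0_iff_AE) (auto simp: bump_nonneg ennreal_eq_0_iff order_antisym)
  define A where "A = {x :: real^'n. bump L \<eta> x > 0} \<inter> box (\<chi> i. - L / 2) (\<chi> i. L / 2)"
  have oA: "open A" unfolding A_def
    by (intro open_Int open_Collect_less continuous_intros continuous_bump open_box)
  have "0 \<in> A" using \<eta> L by (auto simp: A_def bump_def bump_level_def mem_box_cart)
  then have "\<not> negligible A" using oA open_not_negligible by blast
  moreover have "A \<in> null_sets lebesgue"
  proof -
    have "AE x in lebesgue. x \<in> torus L \<longrightarrow> bump L \<eta> (x :: real^'n) = 0"
      using z by (subst (asm) AE_restrict_space_iff) auto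
    then have "AE x in lebesgue. x \<notin> A"
    proof eventually_elim
      case (elim x)
      then show ?case using box_subset_cbox by (auto simp: A_def torus_eq_cbox)
    qed
    then show ?thesis using oA by (simp add: AE_iff_null_sets)
  qed
  ultimately show False by (simp add: negligible_iff_null_sets)
qed

lemma mollifier_nonneg: "mollifier L \<eta> (x :: real^'n) \<ge> 0"
  using bump_mass_pos[where 'n = 'n] by (simp add: mollifier_def bump_nonneg)

lemma mollifier_le: "\<bar>mollifier L \<eta> (x :: real^'n)\<bar> \<le> \<eta>\<^sup>2 / bump_mass TYPE('n) L \<eta>"
  unfolding mollifier_def abs_divide using bump_mass_pos[where 'n = 'n] bump_abs_le[of x]
  by (simp add: divide_right_mono)

lemma mollifier_minus: "mollifier L \<eta> (x - y) = mollifier L \<eta> (y - x)"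
  by (simp add: mollifier_def bump_minus)

lemma measurable_mollifier [measurable]:
  "(\<lambda>y. mollifier L \<eta> (x - y)) \<in> borel_measurable (torus_measure l)"
  "(\<lambda>y. mollifier L \<eta> (y - x)) \<in> borel_measurable (torus_measure l)"
  "(\<lambda>(x, y). mollifier L \<eta> (x - y :: real^'n)) \<in> borel_measurable (torus_measure l \<Otimes>\<^sub>M torus_measure l)"
proof -
  show "(\<lambda>y. mollifier L \<eta> (x - y)) \<in> borel_measurable (torus_measure l)"
    "(\<lambda>y. mollifier L \<eta> (y - x)) \<in> borel_measurable (torus_measure l)"
    unfolding mollifier_def by measurable
  have "(\<lambda>p. (\<lambda>(x, y). bump L \<eta> (x - y :: real^'n)) p / bump_mass TYPE('n) L \<eta>) \<in> borel_measurable (torus_measure l \<Otimes>\<^sub>M torus_measure l)"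
    by measurable
  then show "(\<lambda>(x, y). mollifier L \<eta> (x - y :: real^'n)) \<in> borel_measurable (torus_measure l \<Otimes>\<^sub>M torus_measure l)"
    by (simp add: mollifier_def split_beta)
qed

lemma nn_integral_mollifier:
  "(\<integral>\<^sup>+y. ennreal (mollifier L \<eta> (y - x)) \<partial>(torus_measure L :: (real^'n) measure)) = 1"
proof -
  let ?Z = "bump_mass TYPE('n) L \<eta>"
  have "(\<integral>\<^sup>+y. ennreal (mollifier L \<eta> (y - x)) \<partial>(torus_measure L :: (real^'n) measure))
    = (\<integral>\<^sup>+y. ennreal (1 / ?Z) * ennreal (bump L \<eta> (y - x)) \<partial>torus_measure L)"
    using bump_mass_pos[where 'n = 'n]
    by (intro nn_integral_cong) (simp add: mollifier_def ennreal_mult[symmetric] bump_nonneg)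
  also have "\<dots> = ennreal (1 / ?Z) * ennreal ?Z"
    by (subst nn_integral_cmult) (auto simp: nn_integral_bump_diff)
  also have "\<dots> = 1" using bump_mass_pos[where 'n = 'n] by (simp add: ennreal_mult[symmetric])
  finally show ?thesis .
qed

lemma integral_mollifier:
  "integrable (torus_measure L) (\<lambda>y. mollifier L \<eta> (x - y))"
  "(LINT y|torus_measure L. mollifier L \<eta> (x - y :: real^'n)) = 1"
proof -
  show i: "integrable (torus_measure L) (\<lambda>y. mollifier L \<eta> (x - y))"
    unfolding mollifier_def by (intro integrable_divide integrable_bump)
  have "ennreal (LINT y|torus_measure L. mollifier L \<eta> (x - y)) = (\<integral>\<^sup>+y. ennreal (mollifier L \<eta> (x - y)) \<partial>torus_measure L)"
    by (rule nn_integral_eq_integral[OF i, symmetric]) (simp add: mollifier_nonneg)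
  also have "\<dots> = 1" using nn_integral_mollifier[of x] by (simp add: mollifier_minus[of x])
  finally show "(LINT y|torus_measure L. mollifier L \<eta> (x - y :: real^'n)) = 1"
    by (simp add: ennreal_eq_1)
qed

lemma integrable_mollify:
  assumes "integrable (torus_measure L) u"
  shows "integrable (torus_measure L) (\<lambda>y. u y * mollifier L \<eta> (x - y))"
  by (rule integrable_mult_bounded[OF assms]) (auto intro: mollifier_le)

lemma mollify_taylor:
  fixes u :: "real^'n \<Rightarrow> real"
  assumes u: "integrable (torus_measure L) u"
  shows "\<exists>C\<ge>0. \<forall>x h. \<bar>mollify L \<eta> u (x + h) - mollify L \<eta> u x
     - (\<Sum>i\<in>UNIV. (LINT y|torus_measure L. u y * bump_grad L \<eta> (x - y) $ i) / bump_mass TYPE('n) L \<eta> * h $ i)\<bar> \<le> C * (norm h)\<^sup>2"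
proof -
  let ?Z = "bump_mass TYPE('n) L \<eta>"
  have Z: "?Z > 0" by (rule bump_mass_pos)
  obtain C where C: "C \<ge> 0" "\<And>x h :: real^'n. \<bar>bump L \<eta> (x + h) - bump L \<eta> x - bump_grad L \<eta> x \<bullet> h\<bar> \<le> C * (norm h)\<^sup>2"
    using bump_taylor[OF L, of \<eta>] \<eta> by (metis less_imp_le)
  have gi: "integrable (torus_measure L) (\<lambda>y. u y * bump_grad L \<eta> (x - y) $ i)" for x i
  proof (rule integrable_mult_bounded[OF u])
    have "continuous_on UNIV (\<lambda>y. bump_grad L \<eta> (x - y) $ i)"
      by (intro continuous_intros continuous_on_compose2[OF continuous_bump_grad[of UNIV]]) auto
    then show "(\<lambda>y. bump_grad L \<eta> (x - y) $ i) \<in> borel_measurable (torus_measure L)"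
      by (intro measurable_borel_torus borel_measurable_continuous_onI)
    fix y
    have "\<bar>bump_grad L \<eta> z $ i\<bar> \<le> 2 * \<eta> * (2 * pi / L)" for z
    proof -
      have "\<bar>bump_grad L \<eta> z $ i\<bar> = 2 * max 0 (bump_level L \<eta> z) * (2 * pi / L) * \<bar>sin (2 * pi / L * z $ i)\<bar>"
        using L by (simp add: bump_grad_def abs_mult)
      also have "\<dots> \<le> 2 * \<eta> * (2 * pi / L) * 1"
        using L \<eta> bump_level_le[of L \<eta> z] by (intro mult_mono) auto
      finally show ?thesis by simp
    qed
    then show "\<bar>bump_grad L \<eta> (x - y) $ i\<bar> \<le> 2 * \<eta> * (2 * pi / L)" .
  qed
  define D where "D = C / ?Z * (LINT y|torus_measure L. \<bar>u y\<bar>)"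
  have "\<bar>mollify L \<eta> u (x + h) - mollify L \<eta> u x
     - (\<Sum>i\<in>UNIV. (LINT y|torus_measure L. u y * bump_grad L \<eta> (x - y) $ i) / ?Z * h $ i)\<bar> \<le> D * (norm h)\<^sup>2" for x h
  proof -
    let ?r = "\<lambda>y. u y * mollifier L \<eta> (x + h - y) - u y * mollifier L \<eta> (x - y)
        - (\<Sum>i\<in>UNIV. u y * bump_grad L \<eta> (x - y) $ i / ?Z * h $ i)"
    have ri: "integrable (torus_measure L) ?r"
      by (intro Bochner_Integration.integrable_diff integrable_mollify u Bochner_Integration.integrable_sum
          integrable_mult_left integrable_divide gi)
    have eq: "mollify L \<eta> u (x + h) - mollify L \<eta> u x
     - (\<Sum>i\<in>UNIV. (LINT y|torus_measure L. u y * bump_grad L \<eta> (x - y) $ i) / ?Z * h $ i) = (LINT y|torus_measure L. ?r y)"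
      unfolding mollify_def
      by (simp add: Bochner_Integration.integral_diff Bochner_Integration.integral_sum integrable_mollify u gi
          Bochner_Integration.integrable_diff Bochner_Integration.integrable_sum)
    have "\<bar>LINT y|torus_measure L. ?r y\<bar> \<le> (LINT y|torus_measure L. \<bar>?r y\<bar>)"
      using integral_norm_bound[of "torus_measure L" ?r] unfolding real_norm_def .
    also have "\<dots> \<le> (LINT y|torus_measure L. C / ?Z * (norm h)\<^sup>2 * \<bar>u y\<bar>)"
    proof (rule integral_mono)
      fix y
      have "?r y = u y / ?Z * (bump L \<eta> ((x - y) + h) - bump L \<eta> (x - y) - bump_grad L \<eta> (x - y) \<bullet> h)"
      proof -
        have "(\<Sum>i\<in>UNIV. u y * bump_grad L \<eta> (x - y) $ i / ?Z * h $ i) = u y / ?Z * (bump_grad L \<eta> (x - y) \<bullet> h)"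
          unfolding inner_vec_def sum_distrib_left by (intro sum.cong) (simp_all add: mult_ac)
        moreover have "x + h - y = (x - y) + h" by simp
        ultimately show ?thesis by (simp only: mollifier_def) (simp add: right_diff_distrib)
      qed
      then have "\<bar>?r y\<bar> = \<bar>u y\<bar> / ?Z * \<bar>bump L \<eta> ((x - y) + h) - bump L \<eta> (x - y) - bump_grad L \<eta> (x - y) \<bullet> h\<bar>"
        using Z by (simp add: abs_mult)
      also have "\<dots> \<le> \<bar>u y\<bar> / ?Z * (C * (norm h)\<^sup>2)"
        using C(2) Z by (intro mult_left_mono) auto
      finally show "\<bar>?r y\<bar> \<le> C / ?Z * (norm h)\<^sup>2 * \<bar>u y\<bar>" by (simp add: mult_ac)
    qed (use ri u in auto)
    also have "\<dots> = D * (norm h)\<^sup>2" by (simp add: D_def)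
    finally show ?thesis unfolding eq .
  qed
  moreover have "D \<ge> 0" using C Z by (auto simp: D_def intro!: mult_nonneg_nonneg Bochner_Integration.integral_nonneg)
  ultimately show ?thesis by blast
qed

text \<open>Testing the weak gradient with the bump centred at \<open>x\<close> moves the derivative
  from the kernel to \<open>u\<close>: the gradient of the mollification is the mollification of the
  weak gradient.\<close>

lemma mollify_weak_taylor:
  fixes u :: "real^'n \<Rightarrow> real"
  assumes u: "integrable (torus_measure L) u" and g: "weak_grad L u g"
  shows "\<exists>C\<ge>0. \<forall>x h. \<bar>mollify L \<eta> u (x + h) - mollify L \<eta> u x - (\<chi> i. mollify L \<eta> (\<lambda>y. g y $ i) x) \<bullet> h\<bar> \<le> C * (norm h)\<^sup>2"
proof -
  let ?Z = "bump_mass TYPE('n) L \<eta>"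
  have "(LINT y|torus_measure L. u y * bump_grad L \<eta> (x - y) $ i) / ?Z = mollify L \<eta> (\<lambda>y. g y $ i) x" for x i
  proof -
    have "(LINT y|torus_measure L. u y * partial (\<lambda>y. bump L \<eta> (x - y)) i y) = - (LINT y|torus_measure L. g y $ i * bump L \<eta> (x - y))"
      using g bump_test(1)[OF L, of \<eta> x] \<eta> by (simp add: weak_grad_def)
    then have "(LINT y|torus_measure L. u y * bump_grad L \<eta> (x - y) $ i) = (LINT y|torus_measure L. g y $ i * bump L \<eta> (x - y))"
      using bump_test(2)[OF L, of \<eta> x i] \<eta> by simp
    then show ?thesis by (simp add: mollify_def mollifier_def)
  qed
  then show ?thesis using mollify_taylor[OF u] by (simp add: inner_vec_def)
qed

lemma mollify_continuous:
  fixes u :: "real^'n \<Rightarrow> real"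
  assumes u: "integrable (torus_measure L) u"
  shows "continuous_on UNIV (mollify L \<eta> u)"
proof -
  obtain C where C: "\<And>x h. \<bar>mollify L \<eta> u (x + h) - mollify L \<eta> u x
     - (\<chi> i. (LINT y|torus_measure L. u y * bump_grad L \<eta> (x - y) $ i) / bump_mass TYPE('n) L \<eta>) \<bullet> h\<bar> \<le> C * (norm h)\<^sup>2"
    using mollify_taylor[OF u] by (auto simp: inner_vec_def)
  have "isCont (mollify L \<eta> u) x" for x
    using has_derivative_quadratic_remainder[OF C[of x]] by (rule has_derivative_continuous)
  then show ?thesis by (simp add: continuous_at_imp_continuous_on)
qed

lemma mollify_measurable:
  "integrable (torus_measure L) u \<Longrightarrow> mollify L \<eta> u \<in> borel_measurable borel"
  "integrable (torus_measure L) u \<Longrightarrow> mollify L \<eta> u \<in> borel_measurable (torus_measure l)"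
  by (auto intro!: measurable_borel_torus borel_measurable_continuous_onI mollify_continuous)

lemma mollify_periodic: "lattice_periodic L (mollify L \<eta> (u :: real^'n \<Rightarrow> real))"
proof -
  have "bump L \<eta> (x + k - y) = bump L \<eta> (x - y)" if "k \<in> lattice L" for x y k :: "real^'n"
    using lattice_periodicD[OF bump_lattice_periodic[OF L, of \<eta>] that, of "x - y"] by (simp add: algebra_simps)
  then show ?thesis by (simp add: lattice_periodic_def mollify_def mollifier_def)
qed

text \<open>Jensen's inequality for the probability density \<open>mollifier\<close>, followed by an
  exchange of integrals, since the kernel has mass 1 in either variable. It keeps the quartic and
  the gradient energy of a mollified state below those of the original one.\<close>

lemma mollify_power_integral:
  fixes u :: "real^'n \<Rightarrow> real"
  assumes p: "p = 2 \<or> p = 4" and u: "integrable (torus_measure L) u" and up: "integrable (torus_measure L) (\<lambda>x. u x ^ p)"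
  shows "integrable (torus_measure L) (\<lambda>x. mollify L \<eta> u x ^ p)"
    and "(LINT x|torus_measure L. mollify L \<eta> u x ^ p) \<le> (LINT x|torus_measure L. u x ^ p)"
proof -
  interpret pair_sigma_finite "torus_measure L :: (real^'n) measure" "torus_measure L :: (real^'n) measure"
    by (rule pair_sigma_finite_torus)
  have nnp: "0 \<le> t ^ p" for t :: real using p by auto
  have m: "(\<lambda>x. u x) \<in> borel_measurable (torus_measure L)" using u by auto
  have jensen: "mollify L \<eta> u x ^ p \<le> (LINT y|torus_measure L. u y ^ p * mollifier L \<eta> (x - y))" for x
  proof -
    define c where "c = mollify L \<eta> u x"
    have i: "integrable (torus_measure L) (\<lambda>y. (c ^ p - real p * c ^ (p - 1) * c) * mollifier L \<eta> (x - y) + real p * c ^ (p - 1) * (u y * mollifier L \<eta> (x - y)))"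
      using integral_mollifier(1)[of x] integrable_mollify[OF u, of x] by simp
    have "c ^ p = (LINT y|torus_measure L. (c ^ p - real p * c ^ (p - 1) * c) * mollifier L \<eta> (x - y) + real p * c ^ (p - 1) * (u y * mollifier L \<eta> (x - y)))"
      using integral_mollifier[of x] integrable_mollify[OF u, of x] by (simp add: c_def[symmetric, unfolded mollify_def])
    also have "\<dots> \<le> (LINT y|torus_measure L. u y ^ p * mollifier L \<eta> (x - y))"
    proof (rule integral_mono[OF i integrable_mollify[OF up]])
      fix y
      have "(c ^ p + real p * c ^ (p - 1) * (u y - c)) * mollifier L \<eta> (x - y) \<le> u y ^ p * mollifier L \<eta> (x - y)"
        by (intro mult_right_mono even_power_tangent p mollifier_nonneg)
      then show "(c ^ p - real p * c ^ (p - 1) * c) * mollifier L \<eta> (x - y) + real p * c ^ (p - 1) * (u y * mollifier L \<eta> (x - y))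
         \<le> u y ^ p * mollifier L \<eta> (x - y)" by (simp add: algebra_simps)
    qed
    finally show ?thesis by (simp add: c_def)
  qed
  have "(\<integral>\<^sup>+x. ennreal (mollify L \<eta> u x ^ p) \<partial>torus_measure L)
     \<le> (\<integral>\<^sup>+x. (\<integral>\<^sup>+y. ennreal (u y ^ p) * ennreal (mollifier L \<eta> (x - y)) \<partial>torus_measure L) \<partial>torus_measure L)"
  proof (rule nn_integral_mono)
    fix x :: "real^'n"
    have "ennreal (mollify L \<eta> u x ^ p) \<le> ennreal (LINT y|torus_measure L. u y ^ p * mollifier L \<eta> (x - y))"
      by (rule ennreal_leI[OF jensen])
    also have "\<dots> = (\<integral>\<^sup>+y. ennreal (u y ^ p * mollifier L \<eta> (x - y)) \<partial>torus_measure L)"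
      by (rule nn_integral_eq_integral[symmetric, OF integrable_mollify[OF up]])
        (auto intro!: AE_I2 mult_nonneg_nonneg nnp mollifier_nonneg)
    finally show "ennreal (mollify L \<eta> u x ^ p) \<le> (\<integral>\<^sup>+y. ennreal (u y ^ p) * ennreal (mollifier L \<eta> (x - y)) \<partial>torus_measure L)"
      by (simp add: ennreal_mult nnp mollifier_nonneg)
  qed
  also have "\<dots> = (\<integral>\<^sup>+y. (\<integral>\<^sup>+x. ennreal (u y ^ p) * ennreal (mollifier L \<eta> (x - y)) \<partial>torus_measure L) \<partial>torus_measure L)"
  proof (rule Fubini'[symmetric])
    have [measurable]: "(\<lambda>p. mollifier L \<eta> (fst p - snd p)) \<in> borel_measurable (torus_measure L \<Otimes>\<^sub>M (torus_measure L :: (real^'n) measure))"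
      using measurable_mollifier(3)[of L] by (simp add: split_beta)
    have [measurable]: "(\<lambda>q. u (snd q)) \<in> borel_measurable (torus_measure L \<Otimes>\<^sub>M (torus_measure L :: (real^'n) measure))"
      by (rule measurable_compose[OF measurable_snd m])
    show "(\<lambda>(x, y). ennreal (u y ^ p) * ennreal (mollifier L \<eta> (x - y))) \<in> borel_measurable (torus_measure L \<Otimes>\<^sub>M torus_measure L)"
      unfolding split_beta by measurable
  qed
  also have "\<dots> = (\<integral>\<^sup>+y. ennreal (u y ^ p) \<partial>torus_measure L)"
    by (intro nn_integral_cong, subst nn_integral_cmult) (auto simp: nn_integral_mollifier)
  also have "\<dots> = ennreal (LINT x|torus_measure L. u x ^ p)"
    by (rule nn_integral_eq_integral[OF up]) (simp add: nnp)
  finally have le: "(\<integral>\<^sup>+x. ennreal (mollify L \<eta> u x ^ p) \<partial>torus_measure L) \<le> ennreal (LINT x|torus_measure L. u x ^ p)" .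
  show i: "integrable (torus_measure L) (\<lambda>x. mollify L \<eta> u x ^ p)"
  proof (rule integrableI_nonneg)
    show "(\<lambda>x. mollify L \<eta> u x ^ p) \<in> borel_measurable (torus_measure L)"
      using mollify_measurable(2)[OF u] by auto
    show "(\<integral>\<^sup>+x. ennreal (mollify L \<eta> u x ^ p) \<partial>torus_measure L) < \<infinity>"
      using le_less_trans[OF le ennreal_less_top] by simp
  qed (simp add: nnp)
  have "ennreal (LINT x|torus_measure L. mollify L \<eta> u x ^ p) \<le> ennreal (LINT x|torus_measure L. u x ^ p)"
    using le by (subst (asm) nn_integral_eq_integral[OF i]) (auto simp: nnp)
  then show "(LINT x|torus_measure L. mollify L \<eta> u x ^ p) \<le> (LINT x|torus_measure L. u x ^ p)"
    by (subst (asm) ennreal_le_iff) (auto intro!: Bochner_Integration.integral_nonneg nnp)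
qed

lemma mollify_integral:
  fixes u :: "real^'n \<Rightarrow> real"
  assumes u: "integrable (torus_measure L) u"
  shows "integrable (torus_measure L) (mollify L \<eta> u)"
    and "(LINT x|torus_measure L. mollify L \<eta> u x) = (LINT x|torus_measure L. u x)"
proof -
  interpret pair_sigma_finite "torus_measure L :: (real^'n) measure" "torus_measure L :: (real^'n) measure"
    by (rule pair_sigma_finite_torus)
  let ?f = "\<lambda>(y, x). u y * mollifier L \<eta> (x - y)"
  have m: "(\<lambda>x. u x) \<in> borel_measurable (torus_measure L)" using u by auto
  have fm: "?f \<in> borel_measurable (torus_measure L \<Otimes>\<^sub>M torus_measure L)"
  proof -
    have [measurable]: "(\<lambda>p. mollifier L \<eta> (fst p - snd p)) \<in> borel_measurable (torus_measure L \<Otimes>\<^sub>M (torus_measure L :: (real^'n) measure))"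
      using measurable_mollifier(3)[of L] by (simp add: split_beta)
    have [measurable]: "(\<lambda>q. u (fst q)) \<in> borel_measurable (torus_measure L \<Otimes>\<^sub>M (torus_measure L :: (real^'n) measure))"
      by (rule measurable_compose[OF measurable_fst m])
    have "(\<lambda>p. u (fst p) * mollifier L \<eta> (fst p - snd p)) \<in> borel_measurable (torus_measure L \<Otimes>\<^sub>M torus_measure L)" by measurable
    then show ?thesis by (simp add: split_beta mollifier_minus)
  qed
  have one: "(LINT x|torus_measure L. mollifier L \<eta> (x - y)) = 1" for y :: "real^'n"
    using integral_mollifier(2)[of y] by (simp add: mollifier_minus)
  have mi: "integrable (torus_measure L) (\<lambda>x. mollifier L \<eta> (x - y))" for y :: "real^'n"
    using integral_mollifier(1)[of y] by (simp add: mollifier_minus)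
  have fi: "integrable (torus_measure L \<Otimes>\<^sub>M torus_measure L) ?f"
  proof (rule Fubini_integrable[OF fm])
    have "(LINT x|torus_measure L. norm (?f (y, x))) = \<bar>u y\<bar>" for y
      using one[of y] by (simp add: abs_mult mollifier_nonneg)
    then show "integrable (torus_measure L) (\<lambda>y. LINT x|torus_measure L. norm (?f (y, x)))" using u by simp
    show "AE y in torus_measure L. integrable (torus_measure L) (\<lambda>x. ?f (y, x))" using mi by simp
  qed
  have "integrable (torus_measure L) (\<lambda>x. LINT y|torus_measure L. u y * mollifier L \<eta> (x - y))"
    using integrable_snd[of "\<lambda>y x. u y * mollifier L \<eta> (x - y)"] fi by simp
  then show "integrable (torus_measure L) (mollify L \<eta> u)" unfolding mollify_def .
  have "(LINT x|torus_measure L. mollify L \<eta> u x) = (LINT y|torus_measure L. (LINT x|torus_measure L. u y * mollifier L \<eta> (x - y)))"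
    unfolding mollify_def using Fubini_integral[of "\<lambda>y x. u y * mollifier L \<eta> (x - y)"] fi by simp
  also have "\<dots> = (LINT y|torus_measure L. u y)" using one by simp
  finally show "(LINT x|torus_measure L. mollify L \<eta> u x) = (LINT x|torus_measure L. u x)" .
qed

end

section \<open>Convergence of mollifications in L2 and uniqueness of weak gradients\<close>

definition sq_int :: "real \<Rightarrow> (real^'n \<Rightarrow> real) \<Rightarrow> bool" where
  "sq_int L u \<longleftrightarrow> u \<in> borel_measurable (torus_measure L) \<and> integrable (torus_measure L) (\<lambda>x. (u x)\<^sup>2)"

lemma sq_int_integrable: "sq_int L u \<Longrightarrow> integrable (torus_measure L) u"
  by (simp add: sq_int_def integrable_if_square_integrable)

lemma sum_sq_le: "(a + b)\<^sup>2 \<le> 2 * a\<^sup>2 + 2 * b\<^sup>2" for a b :: real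
  using zero_le_power2[of "a - b"] by (simp add: power2_eq_square algebra_simps)

lemma sq_int_mult:
  assumes "sq_int L u" "sq_int L v"
  shows "integrable (torus_measure L) (\<lambda>x. u x * v x)"
proof (rule Bochner_Integration.integrable_bound)
  show "integrable (torus_measure L) (\<lambda>x. (u x)\<^sup>2 + (v x)\<^sup>2)" using assms by (simp add: sq_int_def)
  show "(\<lambda>x. u x * v x) \<in> borel_measurable (torus_measure L)"
    using assms unfolding sq_int_def by (intro borel_measurable_times) auto
  have "\<bar>a * b\<bar> \<le> a\<^sup>2 + b\<^sup>2" for a b :: real
  proof -
    have "0 \<le> (\<bar>a\<bar> - \<bar>b\<bar>)\<^sup>2" by simp
    then have "2 * (\<bar>a\<bar> * \<bar>b\<bar>) \<le> a\<^sup>2 + b\<^sup>2" by (simp add: power2_diff)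
    moreover have "0 \<le> \<bar>a\<bar> * \<bar>b\<bar>" by simp
    ultimately show ?thesis unfolding abs_mult by linarith
  qed
  then show "AE x in torus_measure L. norm (u x * v x) \<le> norm ((u x)\<^sup>2 + (v x)\<^sup>2)" by simp
qed

lemma sq_int_add: "sq_int L u \<Longrightarrow> sq_int L v \<Longrightarrow> sq_int L (\<lambda>x. u x + v x)"
  using sq_int_mult[of L u v] unfolding sq_int_def by (auto simp: power2_sum mult.assoc)

lemma sq_int_cmult: "sq_int L u \<Longrightarrow> sq_int L (\<lambda>x. c * u x)"
  unfolding sq_int_def by (auto simp: power_mult_distrib)

lemma sq_int_diff: "sq_int L u \<Longrightarrow> sq_int L v \<Longrightarrow> sq_int L (\<lambda>x. u x - v x)"
  using sq_int_add[of L u "\<lambda>x. (-1) * v x"] sq_int_cmult[of L v "-1"] by simp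

lemma sq_int_bounded:
  assumes "u \<in> borel_measurable (torus_measure L)" "\<And>x. \<bar>u x\<bar> \<le> B"
  shows "sq_int L u"
  unfolding sq_int_def
proof (intro conjI assms)
  have "(u x)\<^sup>2 \<le> B\<^sup>2" for x using power_mono[OF assms(2)[of x] abs_ge_zero, of 2] by simp
  then have "\<bar>(u x)\<^sup>2\<bar> \<le> B\<^sup>2" for x by simp
  then show "integrable (torus_measure L) (\<lambda>x. (u x)\<^sup>2)"
    using assms(1) by (intro integrable_torus_bounded[where B = "B\<^sup>2"] borel_measurable_power)
qed

lemma sq_int_mollify:
  assumes "L > 0" "\<eta> > 0" and u: "sq_int L u"
  shows "sq_int L (mollify L \<eta> u)"
  unfolding sq_int_def
proof
  show "mollify L \<eta> u \<in> borel_measurable (torus_measure L)"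
    by (rule mollify_measurable(2)[OF assms(1,2) sq_int_integrable[OF u]])
  show "integrable (torus_measure L) (\<lambda>x. (mollify L \<eta> u x)\<^sup>2)"
    by (rule mollify_power_integral(1)[OF assms(1,2) _ sq_int_integrable[OF u]]) (use u in \<open>auto simp: sq_int_def\<close>)
qed

lemma mollify_linear_diff:
  assumes "L > 0" "\<eta> > 0" "integrable (torus_measure L) u" "integrable (torus_measure L) v"
  shows "mollify L \<eta> (\<lambda>y. u y - v y) x = mollify L \<eta> u x - mollify L \<eta> v x"
  using integrable_mollify[OF assms(1,2,3), of x] integrable_mollify[OF assms(1,2,4), of x]
  by (simp add: mollify_def left_diff_distrib)

text \<open>At an interior point the kernel, for \<open>y\<close> in the torus, sees only its peak
  at \<open>x\<close> and none of the lattice copies. The boundary of the cell is a null set and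
  does not affect convergence in L2.\<close>

lemma mollify_pointwise:
  fixes c :: "real^'n \<Rightarrow> real"
  assumes L: "L > 0" and c: "continuous_on UNIV c" "\<And>x. \<bar>c x\<bar> \<le> B"
    and x: "x \<in> box (\<chi> i. - L / 2) (\<chi> i. L / 2)"
  shows "(\<lambda>N. mollify L (1 / real (Suc N)) c x) \<longlonglongrightarrow> c x"
proof (rule LIMSEQ_I)
  fix r :: real assume r: "r > 0"
  have cm[measurable]: "c \<in> borel_measurable (torus_measure L)"
    by (intro measurable_borel_torus borel_measurable_continuous_onI c)
  have ci: "integrable (torus_measure L) c" using c by (intro integrable_torus_bounded) auto
  have "isCont c x" using c(1) by (simp add: continuous_on_eq_continuous_at)
  then obtain d where d: "d > 0" "\<And>y. norm (y - x) < d \<Longrightarrow> \<bar>c y - c x\<bar> < r / 2"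
    using r unfolding continuous_at_eps_delta dist_norm real_norm_def by (meson half_gt_zero)
  define m where "m = Min (range (\<lambda>i. L / 2 - \<bar>x $ i\<bar>))"
  have m: "m > 0" "\<And>i. \<bar>x $ i\<bar> \<le> L / 2 - m"
  proof -
    have "L / 2 - \<bar>x $ i\<bar> > 0" for i
    proof -
      have "- L / 2 < x $ i" "x $ i < L / 2" using x by (auto simp: mem_box_cart)
      then show ?thesis by linarith
    qed
    then show "m > 0" by (simp add: m_def)
    fix i
    have "m \<le> L / 2 - \<bar>x $ i\<bar>" unfolding m_def by (rule Min_le) auto
    then show "\<bar>x $ i\<bar> \<le> L / 2 - m" by simp
  qed
  \<comment> \<open>Three requirements: the sum of the coordinates of \<open>x - y\<close> must stay
    below the radius \<open>d\<close> of continuity, the cosine must be monotone up to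
    \<open>e\<close>, and \<open>e\<close> may not exceed the margin \<open>m\<close> of
    \<open>x\<close> from the boundary of the cell.\<close>
  define e where "e = min (d / (2 * real CARD('n))) (min (L / 2) m)"
  have e: "e > 0" "e \<le> L / 2" "e \<le> m" "real CARD('n) * e < d"
  proof -
    show "e > 0" "e \<le> L / 2" "e \<le> m" using d L m by (auto simp: e_def)
    have "real CARD('n) * e \<le> real CARD('n) * (d / (2 * real CARD('n)))"
      by (intro mult_left_mono) (auto simp: e_def)
    also have "\<dots> < d" using d by simp
    finally show "real CARD('n) * e < d" .
  qed
  define \<eta>0 where "\<eta>0 = 1 - cos (2 * pi / L * e)"
  have "cos (2 * pi / L * e) < cos 0"
    using e L by (intro cos_monotone_0_pi) (auto simp: field_simps)
  then have "\<eta>0 > 0" by (simp add: \<eta>0_def)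
  then obtain N0 where N0: "1 / real (Suc N0) < \<eta>0" using nat_approx_posE by blast
  show "\<exists>N0. \<forall>N\<ge>N0. norm (mollify L (1 / real (Suc N)) c x - c x) < r"
  proof (intro exI[of _ N0] allI impI)
    fix N assume N: "N \<ge> N0"
    define \<eta> where "\<eta> = 1 / real (Suc N)"
    have \<eta>: "\<eta> > 0" "\<eta> \<le> \<eta>0"
    proof -
      have "1 / real (Suc N) \<le> 1 / real (Suc N0)" using N by (intro divide_left_mono) auto
      then show "\<eta> \<le> \<eta>0" using N0 by (simp add: \<eta>_def)
    qed (simp add: \<eta>_def)
    have near: "\<bar>c y - c x\<bar> * mollifier L \<eta> (x - y) \<le> r / 2 * mollifier L \<eta> (x - y)" if y: "y \<in> torus L" for y
    proof (cases "bump L \<eta> (x - y) = 0")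
      case True
      then show ?thesis by (simp add: mollifier_def)
    next
      case False
      have "\<bar>(x - y) $ i\<bar> \<le> L - e" for i
      proof -
        have "\<bar>y $ i\<bar> \<le> L / 2" 
        proof -
          have "- L / 2 \<le> y $ i" "y $ i \<le> L / 2" using y by (auto simp: torus_def)
          then show ?thesis by linarith
        qed
        then show ?thesis using m(2)[of i] e by simp
      qed
      then have "\<bar>(x - y) $ i\<bar> < e" for i
        by (rule bump_support[OF L e(1,2) \<eta>(2)[unfolded \<eta>0_def] _ False])
      then have "(\<Sum>i\<in>UNIV. \<bar>(x - y) $ i\<bar>) \<le> (\<Sum>i\<in>(UNIV :: 'n set). e)" by (intro sum_mono) (simp add: less_imp_le)
      then have "norm (x - y) \<le> real CARD('n) * e" using norm_le_l1_cart[of "x - y"] by simp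
      then have "norm (y - x) < d" using e by (simp add: norm_minus_commute)
      then show ?thesis
        using d(2)[of y] mollifier_nonneg[OF L \<eta>(1), of "x - y"] by (intro mult_right_mono) auto
    qed
    have i1: "integrable (torus_measure L) (\<lambda>y. (c y - c x) * mollifier L \<eta> (x - y))"
      using ci by (intro integrable_mollify[OF L \<eta>(1)]) auto
    have "mollify L \<eta> c x - c x = (LINT y|torus_measure L. (c y - c x) * mollifier L \<eta> (x - y))"
      using integral_mollifier[OF L \<eta>(1), of x] integrable_mollify[OF L \<eta>(1) ci, of x]
      by (simp add: mollify_def left_diff_distrib)
    also have "\<bar>\<dots>\<bar> \<le> (LINT y|torus_measure L. \<bar>(c y - c x) * mollifier L \<eta> (x - y)\<bar>)"
      using integral_norm_bound[of "torus_measure L" "\<lambda>y. (c y - c x) * mollifier L \<eta> (x - y)"] unfolding real_norm_def .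
    also have "\<dots> \<le> (LINT y|torus_measure L. r / 2 * mollifier L \<eta> (x - y))"
      using near integrable_abs[OF i1] integral_mollifier(1)[OF L \<eta>(1), of x]
      by (intro integral_mono) (auto simp: abs_mult mollifier_nonneg[OF L \<eta>(1)])
    also have "\<dots> = r / 2" using integral_mollifier(2)[OF L \<eta>(1), of x] by simp
    finally show "norm (mollify L (1 / real (Suc N)) c x - c x) < r" using r by (simp add: \<eta>_def)
  qed
qed

lemma AE_torus_interior: "AE x in (torus_measure L :: (real^'n) measure). x \<in> box (\<chi> i. - L / 2) (\<chi> i. L / 2)"
proof -
  have "torus L - box (\<chi> i. - L / 2) (\<chi> i. L / 2) \<in> null_sets (lebesgue :: (real^'n) measure)"
    using box_torus_null by (rule null_sets_completionI)
  then have "AE x in (lebesgue :: (real^'n) measure). x \<notin> torus L - box (\<chi> i. - L / 2) (\<chi> i. L / 2)" by (rule AE_not_in)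
  then show ?thesis by (subst AE_restrict_space_iff) (auto elim: eventually_mono)
qed

lemma mollify_L2_continuous:
  fixes c :: "real^'n \<Rightarrow> real"
  assumes L: "L > 0" and c: "continuous_on UNIV c" "\<And>x. \<bar>c x\<bar> \<le> B"
  shows "(\<lambda>N. LINT x|torus_measure L. (mollify L (1 / real (Suc N)) c x - c x)\<^sup>2) \<longlonglongrightarrow> 0"
proof -
  have cm[measurable]: "c \<in> borel_measurable (torus_measure L)"
    by (intro measurable_borel_torus borel_measurable_continuous_onI c)
  have ci: "integrable (torus_measure L) c" using c by (intro integrable_torus_bounded) auto
  have mm: "mollify L (1 / real (Suc N)) c \<in> borel_measurable (torus_measure L)" for N
    using mollify_measurable(2)[OF L _ ci] by simp
  have mb: "\<bar>mollify L (1 / real (Suc N)) c x\<bar> \<le> B" for N x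
  proof -
    define \<eta> where "\<eta> = 1 / real (Suc N)"
    have \<eta>: "\<eta> > 0" by (simp add: \<eta>_def)
    have "\<bar>mollify L \<eta> c x\<bar> \<le> (LINT y|torus_measure L. \<bar>c y * mollifier L \<eta> (x - y)\<bar>)"
      using integral_norm_bound[of "torus_measure L" "\<lambda>y. c y * mollifier L \<eta> (x - y)"] unfolding real_norm_def mollify_def .
    also have "\<dots> \<le> (LINT y|torus_measure L. B * mollifier L \<eta> (x - y))"
      using integrable_abs[OF integrable_mollify[OF L \<eta> ci, of x]] integral_mollifier(1)[OF L \<eta>, of x] c(2)
      by (intro integral_mono) (auto simp: abs_mult mollifier_nonneg[OF L \<eta>] intro!: mult_right_mono mollifier_nonneg[OF L \<eta>])
    also have "\<dots> = B" using integral_mollifier(2)[OF L \<eta>, of x] by simp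
    finally show ?thesis by (simp add: \<eta>_def)
  qed
  have "(\<lambda>N. LINT x|torus_measure L. (mollify L (1 / real (Suc N)) c x - c x)\<^sup>2) \<longlonglongrightarrow> (LINT x|(torus_measure L :: (real^'n) measure). 0)"
  proof (rule integral_dominated_convergence[where w = "\<lambda>_. (2 * B)\<^sup>2"])
    show "AE x in torus_measure L. (\<lambda>N. (mollify L (1 / real (Suc N)) c x - c x)\<^sup>2) \<longlonglongrightarrow> 0"
      using AE_torus_interior[of L]
    proof eventually_elim
      case (elim x)
      have "(\<lambda>N. (mollify L (1 / real (Suc N)) c x - c x)\<^sup>2) \<longlonglongrightarrow> (c x - c x)\<^sup>2"
        by (intro tendsto_intros mollify_pointwise[OF L c elim])
      then show ?case by simp
    qed
    show "AE x in torus_measure L. norm ((mollify L (1 / real (Suc N)) c x - c x)\<^sup>2) \<le> (2 * B)\<^sup>2" for N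
    proof (rule AE_I2)
      fix x
      have "\<bar>mollify L (1 / real (Suc N)) c x - c x\<bar> \<le> \<bar>2 * B\<bar>" using mb[of N x] c(2)[of x] by linarith
      then show "norm ((mollify L (1 / real (Suc N)) c x - c x)\<^sup>2) \<le> (2 * B)\<^sup>2"
        by (simp only: abs_le_square_iff real_norm_def abs_power2)
    qed
  qed (use mm in auto)
  then show ?thesis by simp
qed

lemma clip_diff_le: "\<bar>max (- B) (min B t) - t\<bar> \<le> \<bar>t\<bar>" "\<bar>max (- B) (min B t)\<bar> \<le> B" if "B \<ge> 0" for B t :: real
  using that by (auto simp: max_def min_def)

text \<open>Truncating \<open>u\<close> costs little in L2. Continuous functions converging to
  \<open>u\<close> almost everywhere may then be truncated at the same height, and dominated
  convergence applies on the finite measure of the torus.\<close>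

lemma continuous_dense_L2:
  fixes u :: "real^'n \<Rightarrow> real"
  assumes u: "sq_int L u" and e: "e > 0"
  shows "\<exists>c B. continuous_on UNIV c \<and> (\<forall>x. \<bar>c x\<bar> \<le> B) \<and> (LINT x|torus_measure L. (u x - c x)\<^sup>2) < e"
proof -
  have um[measurable]: "u \<in> borel_measurable (torus_measure L)" and u2: "integrable (torus_measure L) (\<lambda>x. (u x)\<^sup>2)"
    using u by (auto simp: sq_int_def)
  have "(\<lambda>k. LINT x|torus_measure L. (max (- real k) (min (real k) (u x)) - u x)\<^sup>2) \<longlonglongrightarrow> (LINT x|(torus_measure L :: (real^'n) measure). 0)"
  proof (rule integral_dominated_convergence[where w = "\<lambda>x. (u x)\<^sup>2"])
    show "AE x in torus_measure L. (\<lambda>k. (max (- real k) (min (real k) (u x)) - u x)\<^sup>2) \<longlonglongrightarrow> 0"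
    proof (rule AE_I2)
      fix x
      obtain K where K: "\<bar>u x\<bar> \<le> real K" using real_arch_simple by blast
      have "eventually (\<lambda>k. (max (- real k) (min (real k) (u x)) - u x)\<^sup>2 = 0) sequentially"
        using eventually_ge_at_top[of K]
      proof eventually_elim
        case (elim k)
        then have "\<bar>u x\<bar> \<le> real k" using K by linarith
        then show ?case by (simp add: max_def min_def abs_le_iff)
      qed
      then show "(\<lambda>k. (max (- real k) (min (real k) (u x)) - u x)\<^sup>2) \<longlonglongrightarrow> 0" by (rule tendsto_eventually)
    qed
    show "AE x in torus_measure L. norm ((max (- real k) (min (real k) (u x)) - u x)\<^sup>2) \<le> (u x)\<^sup>2" for k
    proof (rule AE_I2)
      fix x
      have "\<bar>max (- real k) (min (real k) (u x)) - u x\<bar> \<le> \<bar>u x\<bar>" by (rule clip_diff_le) simp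
      then show "norm ((max (- real k) (min (real k) (u x)) - u x)\<^sup>2) \<le> (u x)\<^sup>2"
        by (simp add: abs_le_square_iff[symmetric])
    qed
  qed (use u2 in auto)
  then have "eventually (\<lambda>k. (LINT x|torus_measure L. (max (- real k) (min (real k) (u x)) - u x)\<^sup>2) < e / 4) sequentially"
    using e by (intro order_tendstoD(2)) auto
  then obtain k where k: "(LINT x|torus_measure L. (max (- real k) (min (real k) (u x)) - u x)\<^sup>2) < e / 4"
    by (auto simp: eventually_sequentially)
  define ub where "ub x = max (- real k) (min (real k) (u x))" for x
  have ubm[measurable]: "ub \<in> borel_measurable (torus_measure L)" unfolding ub_def by measurable
  have ubb: "\<bar>ub x\<bar> \<le> real k" for x unfolding ub_def by (rule clip_diff_le) simp
  have "u measurable_on torus L" using um by (subst measurable_on_iff_borel_measurable) auto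
  then obtain N g where N: "negligible N" and g: "\<And>n. continuous_on UNIV (g n)"
    and gl: "\<And>x. x \<notin> N \<Longrightarrow> (\<lambda>n. g n x) \<longlonglongrightarrow> (if x \<in> torus L then u x else 0)"
    unfolding measurable_on_def by blast
  define c where "c n x = max (- real k) (min (real k) (g n x))" for n :: nat and x
  have cc: "continuous_on UNIV (c n)" for n unfolding c_def by (intro continuous_intros g)
  have cb: "\<bar>c n x\<bar> \<le> real k" for n x unfolding c_def by (rule clip_diff_le) simp
  have cm[measurable]: "c n \<in> borel_measurable (torus_measure L)" for n
    by (intro measurable_borel_torus borel_measurable_continuous_onI cc)
  have AEN: "AE x in torus_measure L. x \<notin> N"
  proof -
    have "AE x in lebesgue. x \<notin> N" using N by (intro AE_not_in) (simp add: negligible_iff_null_sets)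
    then show ?thesis by (subst AE_restrict_space_iff) (auto elim: eventually_mono)
  qed
  have "(\<lambda>n. LINT x|torus_measure L. (ub x - c n x)\<^sup>2) \<longlonglongrightarrow> (LINT x|(torus_measure L :: (real^'n) measure). 0)"
  proof (rule integral_dominated_convergence[where w = "\<lambda>_. (2 * real k)\<^sup>2"])
    have "AE x in torus_measure L. x \<in> torus L \<and> x \<notin> N" using AEN by auto
    then show "AE x in torus_measure L. (\<lambda>n. (ub x - c n x)\<^sup>2) \<longlonglongrightarrow> 0"
    proof eventually_elim
      case (elim x)
      then have "(\<lambda>n. g n x) \<longlonglongrightarrow> u x" using gl[of x] by simp
      then have "(\<lambda>n. c n x) \<longlonglongrightarrow> ub x" unfolding c_def ub_def by (intro tendsto_intros)
      then have "(\<lambda>n. (ub x - c n x)\<^sup>2) \<longlonglongrightarrow> (ub x - ub x)\<^sup>2" by (intro tendsto_intros)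
      then show ?case by simp
    qed
    show "AE x in torus_measure L. norm ((ub x - c n x)\<^sup>2) \<le> (2 * real k)\<^sup>2" for n
    proof (rule AE_I2)
      fix x
      have "\<bar>ub x - c n x\<bar> \<le> \<bar>2 * real k\<bar>" using ubb[of x] cb[of n x] by linarith
      then show "norm ((ub x - c n x)\<^sup>2) \<le> (2 * real k)\<^sup>2" by (simp only: abs_le_square_iff real_norm_def abs_power2)
    qed
  qed auto
  then have "eventually (\<lambda>n. (LINT x|torus_measure L. (ub x - c n x)\<^sup>2) < e / 4) sequentially"
    using e by (intro order_tendstoD(2)) auto
  then obtain n where n: "(LINT x|torus_measure L. (ub x - c n x)\<^sup>2) < e / 4"
    by (auto simp: eventually_sequentially)
  have s: "sq_int L ub" "sq_int L (c n)" by (rule sq_int_bounded[OF ubm ubb] sq_int_bounded[OF cm cb])+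
  have "(LINT x|torus_measure L. (u x - c n x)\<^sup>2) \<le> (LINT x|torus_measure L. 2 * (ub x - u x)\<^sup>2 + 2 * (ub x - c n x)\<^sup>2)"
  proof (rule integral_mono)
    show "integrable (torus_measure L) (\<lambda>x. (u x - c n x)\<^sup>2)"
      using sq_int_diff[OF u s(2)] by (simp add: sq_int_def)
    show "integrable (torus_measure L) (\<lambda>x. 2 * (ub x - u x)\<^sup>2 + 2 * (ub x - c n x)\<^sup>2)"
      using sq_int_diff[OF s(1) u] sq_int_diff[OF s] by (simp add: sq_int_def)
    fix x
    show "(u x - c n x)\<^sup>2 \<le> 2 * (ub x - u x)\<^sup>2 + 2 * (ub x - c n x)\<^sup>2"
      using sum_sq_le[of "u x - ub x" "ub x - c n x"] by (simp add: power2_commute)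
  qed
  also have "\<dots> = 2 * (LINT x|torus_measure L. (ub x - u x)\<^sup>2) + 2 * (LINT x|torus_measure L. (ub x - c n x)\<^sup>2)"
    using sq_int_diff[OF s(1) u] sq_int_diff[OF s] by (simp add: sq_int_def)
  also have "\<dots> < e" using k n unfolding ub_def by linarith
  finally show ?thesis using cc cb by blast
qed

text \<open>Known for bounded continuous functions, which are dense, and carried over to all of L2
  because mollification is a contraction.\<close>

theorem mollify_L2:
  fixes u :: "real^'n \<Rightarrow> real"
  assumes L: "L > 0" and u: "sq_int L u"
  shows "(\<lambda>N. LINT x|torus_measure L. (mollify L (1 / real (Suc N)) u x - u x)\<^sup>2) \<longlonglongrightarrow> 0"
proof (rule LIMSEQ_I)
  fix r :: real assume r: "r > 0"
  obtain c B where c: "continuous_on UNIV c" "\<And>x. \<bar>c x\<bar> \<le> B" "(LINT x|torus_measure L. (u x - c x)\<^sup>2) < r / 16"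
    using continuous_dense_L2[OF u, of "r / 16"] r by auto
  have cm: "c \<in> borel_measurable (torus_measure L)"
    by (intro measurable_borel_torus borel_measurable_continuous_onI c)
  have sc: "sq_int L c" by (rule sq_int_bounded[OF cm c(2)])
  have "eventually (\<lambda>N. (LINT x|torus_measure L. (mollify L (1 / real (Suc N)) c x - c x)\<^sup>2) < r / 16) sequentially"
    using mollify_L2_continuous[OF L c(1,2)] r by (intro order_tendstoD(2)) auto
  then obtain N0 where N0: "\<And>N. N \<ge> N0 \<Longrightarrow> (LINT x|torus_measure L. (mollify L (1 / real (Suc N)) c x - c x)\<^sup>2) < r / 16"
    by (auto simp: eventually_sequentially)
  show "\<exists>N0. \<forall>N\<ge>N0. norm ((LINT x|torus_measure L. (mollify L (1 / real (Suc N)) u x - u x)\<^sup>2) - 0) < r"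
  proof (intro exI[of _ N0] allI impI)
    fix N assume N: "N \<ge> N0"
    define \<eta> where "\<eta> = 1 / real (Suc N)"
    have \<eta>: "\<eta> > 0" by (simp add: \<eta>_def)
    let ?m = "mollify L \<eta>"
    have sd: "sq_int L (\<lambda>x. u x - c x)" by (rule sq_int_diff[OF u sc])
    have md: "?m (\<lambda>x. u x - c x) x = ?m u x - ?m c x" for x
      by (rule mollify_linear_diff[OF L \<eta> sq_int_integrable[OF u] sq_int_integrable[OF sc]])
    have i1: "integrable (torus_measure L) (\<lambda>x. (?m (\<lambda>x. u x - c x) x)\<^sup>2)"
      using sq_int_mollify[OF L \<eta> sd] by (simp add: sq_int_def)
    have i2: "integrable (torus_measure L) (\<lambda>x. (?m c x - c x)\<^sup>2)"
      using sq_int_diff[OF sq_int_mollify[OF L \<eta> sc] sc] by (simp add: sq_int_def)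
    have i3: "integrable (torus_measure L) (\<lambda>x. (u x - c x)\<^sup>2)" using sd by (simp add: sq_int_def)
    have "(LINT x|torus_measure L. (?m u x - u x)\<^sup>2)
       \<le> (LINT x|torus_measure L. 2 * (?m (\<lambda>x. u x - c x) x)\<^sup>2 + (4 * (?m c x - c x)\<^sup>2 + 4 * (u x - c x)\<^sup>2))"
    proof (rule integral_mono)
      show "integrable (torus_measure L) (\<lambda>x. (?m u x - u x)\<^sup>2)"
        using sq_int_diff[OF sq_int_mollify[OF L \<eta> u] u] by (simp add: sq_int_def)
      fix x
      show "(?m u x - u x)\<^sup>2 \<le> 2 * (?m (\<lambda>x. u x - c x) x)\<^sup>2 + (4 * (?m c x - c x)\<^sup>2 + 4 * (u x - c x)\<^sup>2)"
        using sum_sq_le[of "?m u x - ?m c x" "?m c x - u x"] sum_sq_le[of "?m c x - c x" "c x - u x"]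
        by (simp add: md power2_commute[of "c x" "u x"])
    qed (use i1 i2 i3 in simp)
    also have "\<dots> = 2 * (LINT x|torus_measure L. (?m (\<lambda>x. u x - c x) x)\<^sup>2)
      + (4 * (LINT x|torus_measure L. (?m c x - c x)\<^sup>2) + 4 * (LINT x|torus_measure L. (u x - c x)\<^sup>2))"
      using i1 i2 i3 by simp
    also have "\<dots> \<le> 2 * (LINT x|torus_measure L. (u x - c x)\<^sup>2)
      + (4 * (LINT x|torus_measure L. (?m c x - c x)\<^sup>2) + 4 * (LINT x|torus_measure L. (u x - c x)\<^sup>2))"
      using mollify_power_integral(2)[OF L \<eta> _ sq_int_integrable[OF sd], of 2] i3 by simp
    also have "\<dots> < r" using c(3) N0[OF N] r unfolding \<eta>_def by linarith
    finally have "(LINT x|torus_measure L. (?m u x - u x)\<^sup>2) < r" .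
    moreover have "(LINT x|torus_measure L. (?m u x - u x)\<^sup>2) \<ge> 0" by (rule Bochner_Integration.integral_nonneg) simp
    ultimately show "norm ((LINT x|torus_measure L. (mollify L (1 / real (Suc N)) u x - u x)\<^sup>2) - 0) < r"
      by (simp add: \<eta>_def)
  qed
qed

lemma weak_grad_sq_int:
  fixes g :: "real^'n \<Rightarrow> real^'n"
  assumes "weak_grad L u g"
  shows "sq_int L (\<lambda>x. g x $ i)"
proof -
  have gm[measurable]: "g \<in> borel_measurable (torus_measure L)" and gi: "integrable (torus_measure L) (\<lambda>x. (norm (g x))\<^sup>2)"
    using assms by (auto simp: weak_grad_def)
  have m: "(\<lambda>x. g x $ i) \<in> borel_measurable (torus_measure L)"
    using measurable_compose[OF gm borel_measurable_continuous_onI[of "\<lambda>v. v $ i"]]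
    by (simp add: continuous_on_component)
  moreover have "integrable (torus_measure L) (\<lambda>x. (g x $ i)\<^sup>2)"
  proof (rule Bochner_Integration.integrable_bound[OF gi])
    show "AE x in torus_measure L. norm ((g x $ i)\<^sup>2) \<le> norm ((norm (g x))\<^sup>2)"
    proof (rule AE_I2)
      fix x
      have "\<bar>g x $ i\<bar>\<^sup>2 \<le> (norm (g x))\<^sup>2" by (intro power_mono component_le_norm_cart) auto
      then show "norm ((g x $ i)\<^sup>2) \<le> norm ((norm (g x))\<^sup>2)" by simp
    qed
  qed (use m in auto)
  ultimately show ?thesis by (simp add: sq_int_def)
qed

text \<open>The bumps are test functions, so each mollified component of the difference vanishes
  identically. Since mollifications converge in L2, the component itself vanishes almost
  everywhere.\<close>

theorem weak_grad_unique:
  fixes g g' :: "real^'n \<Rightarrow> real^'n"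
  assumes L: "L > 0" and g: "weak_grad L u g" and g': "weak_grad L u g'"
  shows "AE x in torus_measure L. g x = g' x"
proof -
  have "AE x in torus_measure L. g x $ i = g' x $ i" for i
  proof -
    define f where "f x = g x $ i - g' x $ i" for x
    have s: "sq_int L (\<lambda>x. g x $ i)" "sq_int L (\<lambda>x. g' x $ i)" using weak_grad_sq_int g g' by blast+
    then have sf: "sq_int L f" unfolding f_def by (rule sq_int_diff)
    have z: "mollify L \<eta> f x = 0" if "\<eta> > 0" for \<eta> x
    proof -
      have "(LINT y|torus_measure L. g y $ i * bump L \<eta> (x - y)) = (LINT y|torus_measure L. g' y $ i * bump L \<eta> (x - y))"
      proof -
        have t: "periodic_C1_test L (\<lambda>y. bump L \<eta> (x - y))" by (rule bump_test(1)[OF L less_imp_le[OF that]])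
        have "- (LINT y|torus_measure L. g y $ i * bump L \<eta> (x - y)) = - (LINT y|torus_measure L. g' y $ i * bump L \<eta> (x - y))"
          using g g' t unfolding weak_grad_def by presburger
        then show ?thesis by simp
      qed
      then have "mollify L \<eta> (\<lambda>y. g y $ i) x = mollify L \<eta> (\<lambda>y. g' y $ i) x"
        by (simp add: mollify_def mollifier_def)
      then show ?thesis
        unfolding f_def using mollify_linear_diff[OF L that sq_int_integrable[OF s(1)] sq_int_integrable[OF s(2)]] by simp
    qed
    have "(\<lambda>N. LINT x|torus_measure L. (mollify L (1 / real (Suc N)) f x - f x)\<^sup>2) \<longlonglongrightarrow> 0" by (rule mollify_L2[OF L sf])
    then have "(LINT x|torus_measure L. (f x)\<^sup>2) = 0" using z by (simp add: LIMSEQ_const_iff)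
    then have "AE x in torus_measure L. (f x)\<^sup>2 = 0"
      using sf by (subst (asm) integral_nonneg_eq_0_iff_AE) (auto simp: sq_int_def)
    then show ?thesis by eventually_elim (simp add: f_def)
  qed
  then have "AE x in torus_measure L. \<forall>i\<in>UNIV. g x $ i = g' x $ i" by (intro AE_finite_allI) auto
  then show ?thesis by eventually_elim (simp add: vec_eq_iff)
qed

section \<open>Lower bounds for the energy\<close>

definition clip :: "real \<Rightarrow> real \<Rightarrow> real" where
  "clip r s = max (- r) (min r s)"

text \<open>The density \<open>sqrt (2 * G s)\<close>, lowered so that it vanishes outside \<open>(-r, r)\<close>, and its primitive.\<close>
definition wall_density :: "real \<Rightarrow> real \<Rightarrow> real" where
  "wall_density r s = max 0 (r\<^sup>2 - s\<^sup>2) / sqrt 2"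

definition wall_cost :: "real \<Rightarrow> real \<Rightarrow> real" where
  "wall_cost r s = (r\<^sup>2 * clip r s - (clip r s) ^ 3 / 3 + 2 * r ^ 3 / 3) / sqrt 2"

text \<open>A Lipschitz substitute for the indicator of the droplet phase; it makes the droplet
  volume continuous along paths.\<close>

definition ramp :: "real \<Rightarrow> real \<Rightarrow> real \<Rightarrow> real" where
  "ramp a b s = max 0 (min 1 ((s - a) / (b - a)))"

lemma wall_density_clip:
  assumes "0 < r"
  shows "wall_density r s = (r\<^sup>2 - (clip r s)\<^sup>2) / sqrt 2"
proof -
  consider "s \<le> - r" | "- r < s" "s < r" | "r \<le> s" by linarith
  then show ?thesis
  proof cases
    case 1
    then have "r\<^sup>2 \<le> s\<^sup>2" using assms by (simp add: abs_le_square_iff[symmetric])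
    then show ?thesis using 1 assms by (simp add: wall_density_def clip_def)
  next
    case 2
    then have "s\<^sup>2 \<le> r\<^sup>2" by (simp add: abs_le_square_iff[symmetric])
    then show ?thesis using 2 by (simp add: wall_density_def clip_def)
  next
    case 3
    then have "r\<^sup>2 \<le> s\<^sup>2" using assms by (simp add: abs_le_square_iff[symmetric])
    then show ?thesis using 3 assms by (simp add: wall_density_def clip_def)
  qed
qed

lemma wall_density_nonneg: "wall_density r s \<ge> 0"
  by (simp add: wall_density_def)

lemma wall_density_le_1:
  assumes "0 < r" "r \<le> 1"
  shows "wall_density r s \<le> 1"
proof -
  have "r\<^sup>2 - s\<^sup>2 \<le> 1" using assms power_le_one[of r 2] zero_le_power2[of s] by linarith
  then have "max 0 (r\<^sup>2 - s\<^sup>2) \<le> 1" by simp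
  then have "max 0 (r\<^sup>2 - s\<^sup>2) / sqrt 2 \<le> 1 / 1"
    by (intro frac_le) auto
  then show ?thesis by (simp add: wall_density_def)
qed

lemma clip_bounds: "0 \<le> r \<Longrightarrow> \<bar>clip r s\<bar> \<le> r" "\<bar>clip r s - clip r t\<bar> \<le> \<bar>s - t\<bar>"
  by (auto simp: clip_def max_def min_def)

text \<open>The primitive of a Lipschitz density has a quadratic remainder. The clipping contributes
  at most 2 and the cubic term at most 2 to the constant 5.\<close>

lemma wall_cost_taylor:
  assumes r: "0 < r" "r \<le> 1"
  shows "\<bar>wall_cost r b - wall_cost r a - wall_density r a * (b - a)\<bar> \<le> 5 * (b - a)\<^sup>2"
proof -
  define x y where "x = clip r a" and "y = clip r b"
  have sq2: "1 \<le> sqrt 2" by simp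
  have xb: "\<bar>x\<bar> \<le> r" "\<bar>y\<bar> \<le> r" using clip_bounds r by (auto simp: x_def y_def)
  have d: "\<bar>y - x\<bar> \<le> \<bar>b - a\<bar>" unfolding x_def y_def by (rule clip_bounds)
  then have d2: "(y - x)\<^sup>2 \<le> (b - a)\<^sup>2" by (simp add: abs_le_square_iff)
  have dens: "wall_density r a = (r\<^sup>2 - x\<^sup>2) / sqrt 2" using wall_density_clip r by (simp add: x_def)
  have diff: "wall_cost r b - wall_cost r a = (r\<^sup>2 * (y - x) - (y ^ 3 - x ^ 3) / 3) / sqrt 2"
    by (simp add: wall_cost_def x_def[symmetric] y_def[symmetric] diff_divide_distrib add_divide_distrib right_diff_distrib)
  have cub: "r\<^sup>2 * (y - x) - (y ^ 3 - x ^ 3) / 3 = (r\<^sup>2 - x\<^sup>2) * (y - x) - (y - x)\<^sup>2 * (x + (y - x) / 3)"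
    by (simp add: power2_eq_square power3_eq_cube field_simps)
  have e1: "wall_cost r b - wall_cost r a - wall_density r a * (b - a)
     = ((r\<^sup>2 - x\<^sup>2) * ((y - x) - (b - a)) - (y - x)\<^sup>2 * (x + (y - x) / 3)) / sqrt 2"
    unfolding diff dens cub by (simp add: diff_divide_distrib right_diff_distrib left_diff_distrib)
  have "\<bar>x + (y - x) / 3\<bar> \<le> 2" 
  proof -
    have "x \<le> 1" "- 1 \<le> x" "y \<le> 1" "- 1 \<le> y" using xb r by linarith+
    moreover define z where "z = (y - x) / 3"
    then have "3 * z = y - x" by simp
    ultimately show ?thesis unfolding z_def[symmetric] by linarith
  qed
  then have t2: "\<bar>(y - x)\<^sup>2 * (x + (y - x) / 3)\<bar> \<le> (b - a)\<^sup>2 * 2"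
    unfolding abs_mult using d2 by (intro mult_mono) auto
  \<comment> \<open>The term is nonzero only if \<open>a\<close> lies inside \<open>(-r, r)\<close>
    and \<open>b\<close> outside. Then \<open>r\<^sup>2 - a\<^sup>2\<close> contains the distance
    from \<open>a\<close> to the end that \<open>b\<close> has passed, and the overshoot of
    \<open>b\<close> is a second factor of that size.\<close>
  have t1: "\<bar>(r\<^sup>2 - x\<^sup>2) * ((y - x) - (b - a))\<bar> \<le> 2 * (b - a)\<^sup>2"
  proof (cases "- r < a \<and> a < r")
    case False
    then have "x = r \<or> x = - r" using r by (auto simp: x_def clip_def)
    then show ?thesis by auto
  next
    case True
    then have xa: "x = a" by (simp add: x_def clip_def)
    have ra: "r\<^sup>2 - a\<^sup>2 = (r - a) * (r + a)" by (simp add: power2_eq_square algebra_simps)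
    consider "b < - r" | "- r \<le> b" "b \<le> r" | "r < b" by linarith
    then show ?thesis
    proof cases
      case 1
      then have y: "y = - r" using r by (simp add: y_def clip_def)
      have "\<bar>(r\<^sup>2 - x\<^sup>2) * ((y - x) - (b - a))\<bar> = (r - a) * ((r + a) * (- r - b))"
        unfolding xa y ra using True 1 by (simp add: abs_mult)
      also have "\<dots> \<le> 2 * ((a - b) * (a - b))"
        using True 1 r by (intro mult_mono) auto
      also have "\<dots> = 2 * (b - a)\<^sup>2" by (simp add: power2_eq_square algebra_simps)
      finally show ?thesis .
    next
      case 2
      then show ?thesis by (simp add: xa y_def clip_def)
    next
      case 3
      then have y: "y = r" using r by (simp add: y_def clip_def)
      have "\<bar>(r\<^sup>2 - x\<^sup>2) * ((y - x) - (b - a))\<bar> = (r + a) * ((r - a) * (b - r))"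
        unfolding xa y ra using True 3 by (simp add: abs_mult)
      also have "\<dots> \<le> 2 * ((b - a) * (b - a))"
        using True 3 r by (intro mult_mono) auto
      also have "\<dots> = 2 * (b - a)\<^sup>2" by (simp add: power2_eq_square)
      finally show ?thesis .
    qed
  qed
  have "\<bar>wall_cost r b - wall_cost r a - wall_density r a * (b - a)\<bar>
     = \<bar>(r\<^sup>2 - x\<^sup>2) * ((y - x) - (b - a)) - (y - x)\<^sup>2 * (x + (y - x) / 3)\<bar> / sqrt 2"
    unfolding e1 by simp
  also have "\<dots> \<le> \<bar>(r\<^sup>2 - x\<^sup>2) * ((y - x) - (b - a)) - (y - x)\<^sup>2 * (x + (y - x) / 3)\<bar> / 1"
    using sq2 by (intro divide_left_mono) auto
  also have "\<dots> \<le> 5 * (b - a)\<^sup>2"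
    unfolding div_by_1 using t1 t2 zero_le_power2[of "b - a"] by linarith
  finally show ?thesis .
qed

lemma wall_cost_mono:
  assumes "0 < r" "s \<le> t"
  shows "wall_cost r s \<le> wall_cost r t"
proof -
  define x y where "x = clip r s" and "y = clip r t"
  have xy: "x \<le> y" using assms by (auto simp: x_def y_def clip_def)
  have b: "\<bar>x\<bar> \<le> r" "\<bar>y\<bar> \<le> r" using clip_bounds assms by (auto simp: x_def y_def)
  then have sq: "x\<^sup>2 \<le> r\<^sup>2" "y\<^sup>2 \<le> r\<^sup>2" "x * y \<le> r\<^sup>2"
  proof -
    show "x\<^sup>2 \<le> r\<^sup>2" "y\<^sup>2 \<le> r\<^sup>2" using b assms by (auto simp: abs_le_square_iff[symmetric])
    have "\<bar>x\<bar> * \<bar>y\<bar> \<le> r * r" using b assms by (intro mult_mono) auto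
    then show "x * y \<le> r\<^sup>2" by (simp add: power2_eq_square abs_mult[symmetric])
  qed
  have "(r\<^sup>2 * y - y ^ 3 / 3) - (r\<^sup>2 * x - x ^ 3 / 3) = (y - x) * (r\<^sup>2 - (x\<^sup>2 + x * y + y\<^sup>2) / 3)"
    by (simp add: power2_eq_square power3_eq_cube field_simps)
  also have "\<dots> \<ge> 0" using xy sq by (intro mult_nonneg_nonneg) auto
  finally have "r\<^sup>2 * x - x ^ 3 / 3 + 2 * r ^ 3 / 3 \<le> r\<^sup>2 * y - y ^ 3 / 3 + 2 * r ^ 3 / 3" by simp
  then show ?thesis
    unfolding wall_cost_def x_def[symmetric] y_def[symmetric] by (intro divide_right_mono) auto
qed

lemma wall_cost_low: "0 < r \<Longrightarrow> s \<le> - r \<Longrightarrow> wall_cost r s = 0"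
  by (simp add: wall_cost_def clip_def power2_eq_square power3_eq_cube)

lemma wall_cost_nonneg: "0 < r \<Longrightarrow> wall_cost r s \<ge> 0"
  using wall_cost_mono[of r "min s (- r)" s] wall_cost_low[of r "min s (- r)"] by simp

lemma wall_cost_le_1:
  assumes "0 < r" "r \<le> 1"
  shows "wall_cost r s \<le> 1"
proof -
  have "wall_cost r s \<le> wall_cost r (max s r)" using assms by (intro wall_cost_mono) auto
  also have "\<dots> = (4 / 3 * r ^ 3) / sqrt 2"
    using assms by (simp add: wall_cost_def clip_def power2_eq_square power3_eq_cube field_simps)
  also have "\<dots> \<le> (4 / 3 * 1) / (4 / 3)"
  proof (rule frac_le)
    show "4 / 3 * r ^ 3 \<le> 4 / 3 * (1 :: real)" using assms power_le_one[of r 3] by simp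
    show "4 / 3 \<le> sqrt (2 :: real)" by (rule real_le_rsqrt) (simp add: power2_eq_square)
  qed auto
  finally show ?thesis by simp
qed

lemma continuous_clip [continuous_intros]: "continuous_on S f \<Longrightarrow> continuous_on S (\<lambda>x. clip r (f x))"
  unfolding clip_def by (intro continuous_intros)

lemma continuous_wall_cost [continuous_intros]: "continuous_on S f \<Longrightarrow> continuous_on S (\<lambda>x. wall_cost r (f x))"
  unfolding wall_cost_def by (intro continuous_intros) auto

lemma continuous_wall_density [continuous_intros]: "continuous_on S f \<Longrightarrow> continuous_on S (\<lambda>x. wall_density r (f x))"
  unfolding wall_density_def by (intro continuous_intros) auto

lemma continuous_ramp [continuous_intros]: "a < b \<Longrightarrow> continuous_on S f \<Longrightarrow> continuous_on S (\<lambda>x. ramp a b (f x))"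
  unfolding ramp_def by (intro continuous_intros) auto

lemma ramp_bounds: "0 \<le> ramp a b s" "ramp a b s \<le> 1"
  by (auto simp: ramp_def)

lemma ramp_low: "a < b \<Longrightarrow> s \<le> a \<Longrightarrow> ramp a b s = 0"
  by (simp add: ramp_def divide_nonpos_pos max_absorb1 min_le_iff_disj)

lemma ramp_high: "a < b \<Longrightarrow> b \<le> s \<Longrightarrow> ramp a b s = 1"
  by (simp add: ramp_def)

lemma ramp_lipschitz:
  assumes "a < b"
  shows "\<bar>ramp a b s - ramp a b t\<bar> \<le> \<bar>s - t\<bar> / (b - a)"
proof -
  have "\<bar>ramp a b s - ramp a b t\<bar> \<le> \<bar>(s - a) / (b - a) - (t - a) / (b - a)\<bar>"
    unfolding ramp_def by (auto simp: max_def min_def)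
  also have "\<dots> = \<bar>s - t\<bar> / (b - a)" using assms by (simp add: diff_divide_distrib[symmetric])
  finally show ?thesis .
qed

text \<open>The coefficient \<open>m ^ 3 - m\<close> is the derivative of \<open>G\<close> at
  \<open>m\<close>.\<close>

definition tilted_G :: "real \<Rightarrow> real \<Rightarrow> real" where
  "tilted_G m u = G u - G m - (m ^ 3 - m) * (u - m)"

lemma tilted_G_factor: "tilted_G m u = (u - m)\<^sup>2 * ((u\<^sup>2 + 2 * u * m + 3 * m\<^sup>2 - 2) / 4)"
  by (simp add: tilted_G_def G_def power2_eq_square power3_eq_cube field_simps)

text \<open>The three regimes of a state. Near the background the tilted potential is at least
  quadratic, with a coefficient that tends to 1 as \<open>r\<close> does. In the layer the lowered
  potential remains, and the gap \<open>(1 - r\<^sup>2)\<^sup>2 / 4\<close> is to pay for terms of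
  order \<phi>. In the droplet phase the tangent of slope about \<open>2 * \<phi>\<close> has run
  over the distance 2 between the wells, which gives \<open>- 4 * \<phi>\<close> at leading
  order.\<close>

lemma tilted_G_lower:
  assumes r: "1 / 2 \<le> r" "r < 1" and \<phi>: "0 < \<phi>" "\<phi> \<le> 1 - r" and m: "m = - 1 + \<phi>"
  shows "u \<le> - r \<Longrightarrow> tilted_G m u \<ge> (3 * r\<^sup>2 - 1) / 2 * (u - m)\<^sup>2"
    and "- r < u \<Longrightarrow> u < r \<Longrightarrow> tilted_G m u \<ge> (r\<^sup>2 - u\<^sup>2)\<^sup>2 / 4 + (1 - r\<^sup>2)\<^sup>2 / 4 - 5 * \<phi>"
    and "r \<le> u \<Longrightarrow> tilted_G m u \<ge> - 4 * \<phi> - 5 * \<phi>\<^sup>2"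
proof -
  have mr: "m \<le> - r" using \<phi> m by simp
  define g where "g = m ^ 3 - m"
  have geq: "g = \<phi> * (1 - \<phi>) * (2 - \<phi>)"
    by (simp add: g_def m power3_eq_cube algebra_simps)
  have g0: "0 \<le> g" unfolding geq using \<phi> r by (intro mult_nonneg_nonneg) auto
  have "(1 - \<phi>) * (2 - \<phi>) \<le> 1 * 2" using \<phi> r by (intro mult_mono) auto
  then have g2: "g \<le> 2 * \<phi>" unfolding geq mult.assoc using \<phi> by (subst mult.commute[of 2]) (intro mult_left_mono, auto)
  have Gm: "G m = \<phi>\<^sup>2 * (2 - \<phi>)\<^sup>2 / 4"
    by (simp add: G_def m power2_eq_square algebra_simps)
  have "(2 - \<phi>)\<^sup>2 \<le> 2\<^sup>2" using \<phi> r by (intro power_mono) auto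
  then have "\<phi>\<^sup>2 * (2 - \<phi>)\<^sup>2 \<le> \<phi>\<^sup>2 * 4" by (intro mult_left_mono) auto
  then have Gm2: "G m \<le> \<phi>\<^sup>2" unfolding Gm by simp
  show "tilted_G m u \<ge> (3 * r\<^sup>2 - 1) / 2 * (u - m)\<^sup>2" if u: "u \<le> - r"
  proof -
    have le: "r \<le> - u" "r \<le> - m" "0 \<le> r" "0 \<le> - u" using u mr r by auto
    have "r * r \<le> (- u) * (- u)" "r * r \<le> (- u) * (- m)" "r * r \<le> (- m) * (- m)"
      using le by (intro mult_mono; linarith)+
    then have "(3 * r\<^sup>2 - 1) / 2 \<le> (u\<^sup>2 + 2 * u * m + 3 * m\<^sup>2 - 2) / 4"
      by (simp add: power2_eq_square)
    then show ?thesis unfolding tilted_G_factor by (subst mult.commute) (intro mult_left_mono, auto)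
  qed
  show "tilted_G m u \<ge> (r\<^sup>2 - u\<^sup>2)\<^sup>2 / 4 + (1 - r\<^sup>2)\<^sup>2 / 4 - 5 * \<phi>" if u: "- r < u" "u < r"
  proof -
    have "u\<^sup>2 \<le> r\<^sup>2" using u by (simp add: abs_le_square_iff[symmetric])
    moreover have "r\<^sup>2 \<le> 1" using r by (simp add: power_le_one)
    ultimately have "0 \<le> (r\<^sup>2 - u\<^sup>2) * (1 - r\<^sup>2)" by simp
    moreover have "(1 - u\<^sup>2)\<^sup>2 = (r\<^sup>2 - u\<^sup>2)\<^sup>2 + (1 - r\<^sup>2)\<^sup>2 + 2 * ((r\<^sup>2 - u\<^sup>2) * (1 - r\<^sup>2))"
      by (simp add: power2_eq_square algebra_simps)
    ultimately have Gu: "G u \<ge> (r\<^sup>2 - u\<^sup>2)\<^sup>2 / 4 + (1 - r\<^sup>2)\<^sup>2 / 4" by (simp add: G_def)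
    have "g * (u - m) \<le> (2 * \<phi>) * 2" using g0 g2 u mr r m \<phi> by (intro mult_mono) auto
    moreover have "\<phi>\<^sup>2 \<le> \<phi>" using \<phi> r by (simp add: power2_eq_square mult_left_le)
    ultimately show ?thesis using Gu Gm2 unfolding tilted_G_def g_def[symmetric] by linarith
  qed
  show "tilted_G m u \<ge> - 4 * \<phi> - 5 * \<phi>\<^sup>2" if u: "r \<le> u"
  proof -
    define z where "z = u - 1"
    have "1 * 1 \<le> (1 + u) * (1 + u)" using u r by (intro mult_mono) auto
    then have "z\<^sup>2 * 1 \<le> z\<^sup>2 * (1 + u)\<^sup>2" by (intro mult_left_mono) (auto simp: power2_eq_square)
    moreover have "G u = z\<^sup>2 * (1 + u)\<^sup>2 / 4" by (simp add: G_def z_def power2_eq_square algebra_simps)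
    ultimately have Gu: "G u \<ge> z\<^sup>2 / 4" by simp
    \<comment> \<open>Values above 1 would profit from the tilt without bound, were it not for the
      quadratic growth of \<open>G\<close>; completing the square limits the profit to
      \<open>g\<^sup>2\<close>, which is of order \<open>\<phi>\<^sup>2\<close>.\<close>
    have "z\<^sup>2 / 4 - g * z + g\<^sup>2 = (z / 2 - g)\<^sup>2" by (simp add: power2_eq_square field_simps)
    then have "z\<^sup>2 / 4 - g * z \<ge> - g\<^sup>2" using zero_le_power2[of "z / 2 - g"] by linarith
    moreover have "g\<^sup>2 \<le> 4 * \<phi>\<^sup>2" using power_mono[OF g2 g0, of 2] by (simp add: power_mult_distrib)
    moreover have "g * (2 - \<phi>) \<le> 2 * \<phi> * 2" using g0 g2 \<phi> r by (intro mult_mono) auto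
    moreover have "g * (u - m) = g * z + g * (2 - \<phi>)" by (simp add: z_def m algebra_simps)
    ultimately show ?thesis using Gu Gm2 unfolding tilted_G_def g_def[symmetric] by linarith
  qed
qed

text \<open>The free parameter \<open>\<tau>\<close> linearises the quadratic cost of depleting the background; its optimal value is the
  depth \<open>(a - m) * A / L ^ d\<close> of the depletion, which is known only after integration.\<close>
lemma pointwise_energy_bound:
  assumes r: "3 / 5 \<le> a" "a < r" "r < 1" and \<phi>: "0 < \<phi>" "\<phi> \<le> 1 - r" and m: "m = - 1 + \<phi>"
    and K: "0 \<le> K" "5 * \<phi> + K \<le> (1 - r\<^sup>2)\<^sup>2 / 4" and \<tau>: "0 \<le> \<tau>" and t: "0 \<le> t"
  shows "t\<^sup>2 / 2 + tilted_G m u \<ge> wall_density r u * t + K * wall_cost r u - (4 * \<phi> + 5 * \<phi>\<^sup>2 + K) * ramp a r u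
     + (3 * r\<^sup>2 - 1) / 2 * (2 * \<tau> * (m - u) + 2 * \<tau> * (a - m) * ramp a r u - \<tau>\<^sup>2)"
proof -
  have r0: "0 < r" "r \<le> 1" "1 / 2 \<le> r" using r by auto
  have mr: "m \<le> - r" using \<phi> m by simp
  define l where "l = (3 * r\<^sup>2 - 1) / 2"
  have "(3 / 5)\<^sup>2 \<le> r\<^sup>2" using r by (intro power_mono) auto
  then have l0: "0 \<le> l" by (simp add: l_def power2_eq_square)
  note lower = tilted_G_lower[OF r0(3) r(3) \<phi> m, of u]
  define B where "B = 2 * \<tau> * (m - u) + 2 * \<tau> * (a - m) * ramp a r u - \<tau>\<^sup>2"
  have KP: "K * wall_cost r u \<le> K" using wall_cost_le_1[OF r0(1,2), of u] K by (simp add: mult_left_le)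
  have c0: "0 \<le> 4 * \<phi> + 5 * \<phi>\<^sup>2 + K" using \<phi> K by simp
  consider "u \<le> - r" | "- r < u" "u < r" | "r \<le> u" by linarith
  then have "wall_density r u * t + K * wall_cost r u - (4 * \<phi> + 5 * \<phi>\<^sup>2 + K) * ramp a r u + l * B
      \<le> t\<^sup>2 / 2 + tilted_G m u"
  proof cases
    case 1
    have "r\<^sup>2 \<le> u\<^sup>2" using 1 r0 by (simp add: abs_le_square_iff[symmetric])
    then have z: "wall_density r u = 0" "wall_cost r u = 0" "ramp a r u = 0"
      using 1 r wall_cost_low[OF r0(1) 1] by (auto simp: wall_density_def intro!: ramp_low)
    have "0 \<le> (\<tau> - (m - u))\<^sup>2" by simp
    then have "B \<le> (u - m)\<^sup>2" unfolding B_def z by (simp add: power2_eq_square algebra_simps)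
    then have "l * B \<le> l * (u - m)\<^sup>2" using l0 by (rule mult_left_mono)
    also have "\<dots> \<le> tilted_G m u" using lower(1)[OF 1] by (simp add: l_def)
    finally have "l * B \<le> t\<^sup>2 / 2 + tilted_G m u" using zero_le_power2[of t] by linarith
    then show ?thesis unfolding z by simp
  next
    case 2
    \<comment> \<open>The ramp vanishes below \<open>a\<close>, so the excess mass
      \<open>(a - m) * ramp a r u\<close> credited to the droplet never exceeds the true excess
      \<open>u - m\<close>.\<close>
    have "(a - m) * ramp a r u \<le> u - m"
    proof (cases "u \<le> a")
      case True
      then show ?thesis using ramp_low[OF r(2)] 2 mr by simp
    next
      case False
      then have "(a - m) * ramp a r u \<le> (a - m) * 1"
        using ramp_bounds mr r0 r by (intro mult_left_mono) auto
      then show ?thesis using False by simp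
    qed
    then have "2 * \<tau> * ((m - u) + (a - m) * ramp a r u) \<le> 0" using \<tau> by (simp add: mult_nonneg_nonpos)
    moreover have "B = 2 * \<tau> * ((m - u) + (a - m) * ramp a r u) - \<tau>\<^sup>2" by (simp add: B_def algebra_simps)
    ultimately have "B \<le> 0" using zero_le_power2[of \<tau>] by linarith
    then have lB: "l * B \<le> 0" using l0 by (simp add: mult_nonneg_nonpos)
    have "u\<^sup>2 \<le> r\<^sup>2" using 2 by (simp add: abs_le_square_iff[symmetric])
    then have "(wall_density r u)\<^sup>2 = (r\<^sup>2 - u\<^sup>2)\<^sup>2 / 2" by (simp add: wall_density_def power_divide)
    moreover have "0 \<le> (wall_density r u)\<^sup>2 - 2 * wall_density r u * t + t\<^sup>2"
      using zero_le_power2[of "wall_density r u - t"] unfolding power2_diff by linarith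
    ultimately have pt: "wall_density r u * t \<le> t\<^sup>2 / 2 + (r\<^sup>2 - u\<^sup>2)\<^sup>2 / 4"
      by linarith
    have "0 \<le> (4 * \<phi> + 5 * \<phi>\<^sup>2 + K) * ramp a r u" using c0 ramp_bounds by simp
    then show ?thesis using lB pt KP lower(2)[OF 2] K by linarith
  next
    case 3
    have "r\<^sup>2 \<le> u\<^sup>2" using 3 r0 by (simp add: abs_le_square_iff[symmetric])
    then have z: "wall_density r u = 0" "ramp a r u = 1"
      using 3 r by (auto simp: wall_density_def intro!: ramp_high)
    have "2 * \<tau> * (a - u) \<le> 0" using \<tau> 3 r by (simp add: mult_nonneg_nonpos)
    moreover have "B = 2 * \<tau> * (a - u) - \<tau>\<^sup>2" by (simp add: B_def z algebra_simps)
    ultimately have "B \<le> 0" using zero_le_power2[of \<tau>] by linarith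
    then have lB: "l * B \<le> 0" using l0 by (simp add: mult_nonneg_nonpos)
    have "K * wall_cost r u - (4 * \<phi> + 5 * \<phi>\<^sup>2 + K) + l * B \<le> t\<^sup>2 / 2 + tilted_G m u"
      using lB KP lower(3)[OF 3] zero_le_power2[of t] by linarith
    then show ?thesis unfolding z by simp
  qed
  then show ?thesis by (simp add: l_def B_def)
qed

section \<open>The integrated lower bound\<close>

definition droplet_volume :: "real \<Rightarrow> real \<Rightarrow> real \<Rightarrow> (real^'n \<Rightarrow> real) \<Rightarrow> real" where
  "droplet_volume L a r u = (LINT x|torus_measure L. ramp a r (u x))"

lemma set_lborel_integrable_imp_torus:
  fixes f :: "real^'n \<Rightarrow> real"
  assumes "continuous_on UNIV f"
  shows "integrable (torus_measure L) f" "set_integrable lborel (torus L) f"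
proof -
  show s: "set_integrable lborel (torus L) f"
    by (rule set_integrable_torus_continuous) (rule continuous_on_subset[OF assms], simp)
  show "integrable (torus_measure L) f"
    by (subst integrable_torus_iff) (auto simp: s intro: borel_measurable_continuous_onI assms)
qed

lemma ramp_measurable [measurable]:
  "u \<in> borel_measurable M \<Longrightarrow> (\<lambda>x. ramp a r (u x)) \<in> borel_measurable M"
  unfolding ramp_def
  by (intro borel_measurable_max borel_measurable_min borel_measurable_divide borel_measurable_diff borel_measurable_const)

lemma integrable_ramp:
  fixes u :: "real^'n \<Rightarrow> real"
  assumes "u \<in> borel_measurable (torus_measure L)"
  shows "integrable (torus_measure L) (\<lambda>x. ramp a r (u x))"
  using assms ramp_bounds[of a r] by (intro integrable_torus_bounded[where B = 1]) auto

text \<open>The functional inequality for \<open>wall_cost r (U x)\<close>. Wherever the ramp is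
  positive, \<open>U\<close> exceeds \<open>a\<close>, so every level below
  \<open>wall_cost r a\<close> has a superlevel set of volume at least
  \<open>droplet_volume\<close>.\<close>

lemma smooth_isoperimetric:
  fixes U :: "real^'n \<Rightarrow> real" and g :: "real^'n \<Rightarrow> real^'n"
  assumes L: "L > 0" and U: "continuous_on UNIV U" "lattice_periodic L U" and g: "continuous_on UNIV g"
    and C: "C \<ge> 0" "\<And>x h. \<bar>U (x + h) - U x - g x \<bullet> h\<bar> \<le> C * (norm h)\<^sup>2"
    and r: "0 < a" "a < r" "r \<le> 1" and n: "CARD('n) \<ge> 2"
  shows "real CARD('n) * root CARD('n) (unit_ball_vol CARD('n))
        * droplet_volume L a r U powr ((real CARD('n) - 1) / real CARD('n)) * wall_cost r a
    \<le> (LINT x|torus_measure L. wall_density r (U x) * norm (g x))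
      + 2 * real CARD('n) / L * (LINT x|torus_measure L. wall_cost r (U x))"
proof -
  let ?n = "CARD('n)"
  define A where "A = droplet_volume L a r U"
  define w where "w x = wall_cost r (U x)" for x
  define \<kappa> where "\<kappa> x = wall_density r (U x) * norm (g x)" for x
  have r0: "0 < r" using r by simp
  have cw: "continuous_on UNIV w" unfolding w_def by (intro continuous_intros U)
  have c\<kappa>: "continuous_on UNIV \<kappa>" unfolding \<kappa>_def by (intro continuous_intros U g)
  have \<kappa>0: "\<kappa> x \<ge> 0" for x by (simp add: \<kappa>_def wall_density_nonneg)
  have w0: "w x \<ge> 0" for x using wall_cost_nonneg[OF r0] by (simp add: w_def)
  have Um: "U \<in> borel_measurable borel" by (rule borel_measurable_continuous_onI[OF U(1)])
  note UM = measurable_borel_torus[OF Um]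
  have A0: "A \<ge> 0" unfolding A_def droplet_volume_def using ramp_bounds by (intro Bochner_Integration.integral_nonneg) auto
  have rhs0: "0 \<le> (LINT x|torus_measure L. \<kappa> x) + 2 * real ?n / L * (LINT x|torus_measure L. w x)"
    using L \<kappa>0 w0 by (intro add_nonneg_nonneg mult_nonneg_nonneg Bochner_Integration.integral_nonneg) auto
  show ?thesis
  \<comment> \<open>The functional inequality asks for a positive volume. For \<open>A = 0\<close>
    the left side vanishes because \<open>0 powr\<close> any exponent is 0.\<close>
  proof (cases "A = 0")
    case True
    then show ?thesis using rhs0 by (simp add: A_def w_def \<kappa>_def)
  next
    case False
    then have Apos: "A > 0" using A0 by simp
    have "compact (torus L :: (real^'n) set)" by (simp add: torus_eq_cbox)
    then have "compact (g ` torus L)" by (intro compact_continuous_image continuous_on_subset[OF g]) auto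
    then obtain B where B: "B > 0" "\<And>x. x \<in> torus L \<Longrightarrow> norm (g x) \<le> B"
      using compact_imp_bounded bounded_pos by (metis imageI)
    \<comment> \<open>\<open>C\<close> is the Taylor constant of \<open>U\<close>, 5 that of the
      wall cost, and \<open>B + C\<close> a Lipschitz bound for \<open>U\<close> over steps of
      length at most 1.\<close>
    define D where "D = C + 5 * (B + C)\<^sup>2"
    have D0: "D \<ge> 0" using C by (simp add: D_def)
    have step: "w y \<le> w x + h * \<kappa> x + D * h\<^sup>2" if h: "0 < h" "h \<le> 1" "x \<in> torus L" "norm (y - x) < h" for h x y
    proof -
      define k where "k = norm (y - x)"
      have k: "0 \<le> k" "k \<le> h" using h by (auto simp: k_def)
      have tay: "\<bar>U y - U x - g x \<bullet> (y - x)\<bar> \<le> C * k\<^sup>2" using C(2)[of x "y - x"] by (simp add: k_def)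
      have gk: "\<bar>g x \<bullet> (y - x)\<bar> \<le> norm (g x) * k" unfolding k_def by (rule Cauchy_Schwarz_ineq2)
      have kh: "k\<^sup>2 \<le> h\<^sup>2" using k by (intro power_mono) auto
      have "norm (g x) * k \<le> norm (g x) * h" using k by (intro mult_left_mono) auto
      moreover have "C * k\<^sup>2 \<le> C * h\<^sup>2" using kh C by (intro mult_left_mono) auto
      ultimately have du: "\<bar>U y - U x\<bar> \<le> norm (g x) * h + C * h\<^sup>2" using tay gk by linarith
      have "C * h\<^sup>2 \<le> C * h" using C h by (intro mult_left_mono) (auto simp: power2_eq_square mult_left_le)
      moreover have "norm (g x) * h \<le> B * h" using B(2)[OF h(3)] h by (intro mult_right_mono) auto
      ultimately have "\<bar>U y - U x\<bar> \<le> \<bar>(B + C) * h\<bar>"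
        using du abs_ge_self[of "(B + C) * h"] distrib_right[of B C h] by linarith
      then have sq: "(U y - U x)\<^sup>2 \<le> (B + C)\<^sup>2 * h\<^sup>2" by (simp only: abs_le_square_iff power_mult_distrib)
      have p: "0 \<le> wall_density r (U x)" "wall_density r (U x) \<le> 1"
        using wall_density_nonneg wall_density_le_1[OF r0 r(3)] by auto
      have "w y - w x \<le> wall_density r (U x) * (U y - U x) + 5 * (U y - U x)\<^sup>2"
        using wall_cost_taylor[OF r0 r(3), of "U y" "U x"] by (simp add: w_def)
      also have "\<dots> \<le> wall_density r (U x) * (norm (g x) * h + C * h\<^sup>2) + 5 * ((B + C)\<^sup>2 * h\<^sup>2)"
        using p du sq by (intro add_mono mult_left_mono) auto
      also have "\<dots> = h * \<kappa> x + (wall_density r (U x) * (C * h\<^sup>2) + 5 * ((B + C)\<^sup>2 * h\<^sup>2))"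
        by (simp add: \<kappa>_def algebra_simps)
      also have "\<dots> \<le> h * \<kappa> x + (1 * (C * h\<^sup>2) + 5 * ((B + C)\<^sup>2 * h\<^sup>2))"
        using p C by (intro add_left_mono add_right_mono mult_right_mono) auto
      finally show ?thesis by (simp add: D_def algebra_simps)
    qed
    have level: "A \<le> measure lborel {x \<in> torus L. s < w x}" if s: "0 \<le> s" "s < wall_cost r a" for s
    proof -
      have S: "{x \<in> torus L. s < w x} \<in> sets borel"
      proof -
        have "{x. s < w x} \<in> sets borel" using cw by (intro borel_open open_Collect_less) auto
        then have "torus L \<inter> {x. s < w x} \<in> sets borel" by auto
        then show ?thesis by (simp add: Int_def)
      qed
      have SM: "{x \<in> torus L. s < w x} \<in> sets (torus_measure L)"
        using S by (subst sets_restrict_space_iff) auto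
      have "A \<le> (LINT x|torus_measure L. indicator {x \<in> torus L. s < w x} x)"
        unfolding A_def droplet_volume_def
      proof (rule integral_mono)
        show "integrable (torus_measure L) (\<lambda>x. ramp a r (U x))" by (rule integrable_ramp[OF UM])
        show "integrable (torus_measure L) (\<lambda>x. indicator {x \<in> torus L. s < w x} x :: real)"
          using SM by (intro integrable_torus_bounded[where B = 1]) auto
        fix x assume x: "x \<in> space (torus_measure L :: (real^'n) measure)"
        show "ramp a r (U x) \<le> indicator {x \<in> torus L. s < w x} x"
        proof (cases "U x \<le> a")
          case True
          then show ?thesis using ramp_low[OF r(2)] by simp
        next
          case False
          then have "wall_cost r a \<le> w x" unfolding w_def by (intro wall_cost_mono r0) auto
          then show ?thesis using s x ramp_bounds by auto
        qed
      qed
      also have "\<dots> = measure lborel {x \<in> torus L. s < w x}"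
      proof -
        have "{x \<in> torus L. s < w x} \<inter> torus L = {x \<in> torus L. s < w x}" by auto
        then show ?thesis using SM S by (simp add: measure_restrict_space)
      qed
      finally show ?thesis .
    qed
    have "real ?n * root ?n (unit_ball_vol ?n) * A powr ((real ?n - 1) / real ?n) * wall_cost r a
      \<le> (LINT x:torus L|lborel. \<kappa> x) + 2 * real ?n / L * (LINT x:torus L|lborel. w x)"
    proof (rule torus_isoperimetric_functional[where C = D])
      show "lattice_periodic L w" using U(2) by (simp add: lattice_periodic_def w_def)
      show "\<kappa> \<in> borel_measurable borel" by (rule borel_measurable_continuous_onI[OF c\<kappa>])
      show "set_integrable lborel (torus L) \<kappa>" by (rule set_lborel_integrable_imp_torus[OF c\<kappa>])
    qed (use L cw w0 \<kappa>0 step level D0 Apos wall_cost_nonneg[OF r0] in auto)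
    also have "(LINT x:torus L|lborel. \<kappa> x) = (LINT x|torus_measure L. \<kappa> x)"
      by (rule integral_torus[symmetric]) (rule borel_measurable_continuous_onI[OF c\<kappa>])
    also have "(LINT x:torus L|lborel. w x) = (LINT x|torus_measure L. w x)"
      by (rule integral_torus[symmetric]) (rule borel_measurable_continuous_onI[OF cw])
    finally show ?thesis by (simp add: A_def w_def \<kappa>_def)
  qed
qed

text \<open>Cauchy--Schwarz against the constant 1, read off from the nonnegative variance of
  \<open>\<bar>f x\<bar>\<close> around its mean \<open>c\<close>.\<close>

lemma integral_abs_le_L2:
  fixes f :: "real^'n \<Rightarrow> real"
  assumes L: "L > 0" and f: "sq_int L f"
  shows "(LINT x|torus_measure L. \<bar>f x\<bar>) \<le> sqrt (L ^ CARD('n) * (LINT x|torus_measure L. (f x)\<^sup>2))"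
proof -
  let ?V = "L ^ CARD('n)"
  define I where "I = (LINT x|torus_measure L. \<bar>f x\<bar>)"
  define c where "c = I / ?V"
  have V: "?V > 0" using L by simp
  have fi: "integrable (torus_measure L) f" by (rule sq_int_integrable[OF f])
  have f2: "integrable (torus_measure L) (\<lambda>x. (f x)\<^sup>2)" using f by (simp add: sq_int_def)
  have "0 \<le> (LINT x|torus_measure L. (\<bar>f x\<bar> - c)\<^sup>2)" by (intro Bochner_Integration.integral_nonneg) simp
  also have "\<dots> = (LINT x|torus_measure L. (f x)\<^sup>2 - 2 * c * \<bar>f x\<bar> + c\<^sup>2)"
    by (intro Bochner_Integration.integral_cong) (auto simp: power2_diff algebra_simps)
  also have "\<dots> = (LINT x|torus_measure L. (f x)\<^sup>2) - 2 * c * I + c\<^sup>2 * ?V"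
    using fi f2 L by (simp add: I_def measure_torus_measure)
  finally have "2 * c * I - c\<^sup>2 * ?V \<le> (LINT x|torus_measure L. (f x)\<^sup>2)" by simp
  moreover have "2 * c * I - c\<^sup>2 * ?V = I\<^sup>2 / ?V" using V by (simp add: c_def power2_eq_square field_simps)
  ultimately have "I\<^sup>2 \<le> ?V * (LINT x|torus_measure L. (f x)\<^sup>2)" using V by (simp add: divide_le_eq mult.commute)
  then show ?thesis unfolding I_def[symmetric] by (rule real_le_rsqrt)
qed

lemma droplet_volume_lipschitz:
  fixes u v :: "real^'n \<Rightarrow> real"
  assumes L: "L > 0" and u: "sq_int L u" and v: "sq_int L v" and ar: "a < r"
  shows "\<bar>droplet_volume L a r u - droplet_volume L a r v\<bar>
    \<le> sqrt (L ^ CARD('n) * (LINT x|torus_measure L. (u x - v x)\<^sup>2)) / (r - a)"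
proof -
  have ui: "integrable (torus_measure L) (\<lambda>x. ramp a r (u x))" and vi: "integrable (torus_measure L) (\<lambda>x. ramp a r (v x))"
    using u v by (auto simp: sq_int_def intro: integrable_ramp)
  have d: "sq_int L (\<lambda>x. u x - v x)" by (rule sq_int_diff[OF u v])
  have "\<bar>droplet_volume L a r u - droplet_volume L a r v\<bar> = \<bar>LINT x|torus_measure L. ramp a r (u x) - ramp a r (v x)\<bar>"
    using ui vi by (simp add: droplet_volume_def)
  also have "\<dots> \<le> (LINT x|torus_measure L. \<bar>ramp a r (u x) - ramp a r (v x)\<bar>)"
    using integral_norm_bound[of "torus_measure L" "\<lambda>x. ramp a r (u x) - ramp a r (v x)"] unfolding real_norm_def .
  also have "\<dots> \<le> (LINT x|torus_measure L. \<bar>u x - v x\<bar> / (r - a))"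
    using ui vi sq_int_integrable[OF d] ramp_lipschitz[OF ar] by (intro integral_mono) auto
  also have "\<dots> = (LINT x|torus_measure L. \<bar>u x - v x\<bar>) / (r - a)" by simp
  also have "\<dots> \<le> sqrt (L ^ CARD('n) * (LINT x|torus_measure L. (u x - v x)\<^sup>2)) / (r - a)"
    using ar by (intro divide_right_mono integral_abs_le_L2[OF L d]) auto
  finally show ?thesis .
qed

lemma mollify_norm_tendsto:
  fixes u :: "real^'n \<Rightarrow> real"
  assumes L: "L > 0" and u: "sq_int L u"
  shows "(\<lambda>N. LINT x|torus_measure L. (mollify L (1 / real (Suc N)) u x)\<^sup>2) \<longlonglongrightarrow> (LINT x|torus_measure L. (u x)\<^sup>2)"
proof (rule LIMSEQ_I)
  fix r :: real assume r: "r > 0"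
  define S where "S = (LINT x|torus_measure L. (u x)\<^sup>2)"
  have S0: "S \<ge> 0" unfolding S_def by (intro Bochner_Integration.integral_nonneg) simp
  \<comment> \<open>The weight in the Young inequality that compares \<open>(u x)\<^sup>2\<close>
    with the square of the mollification; \<open>S + 1\<close> keeps the denominator
    positive.\<close>
  define e where "e = r / (2 * (S + 1))"
  have e: "e > 0" "e * S < r / 2"
  proof -
    show "e > 0" using r S0 by (simp add: e_def)
    have "e * S < e * (S + 1)" using \<open>e > 0\<close> by simp
    also have "\<dots> = r / 2" using S0 by (simp add: e_def field_simps)
    finally show "e * S < r / 2" .
  qed
  let ?m = "\<lambda>N. mollify L (1 / real (Suc N)) u"
  have "eventually (\<lambda>N. (LINT x|torus_measure L. (?m N x - u x)\<^sup>2) < (r / 2) / (1 + 1 / e)) sequentially"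
    using mollify_L2[OF L u] r e by (intro order_tendstoD(2)) (auto intro!: divide_pos_pos add_pos_pos)
  then obtain N0 where N0: "\<And>N. N \<ge> N0 \<Longrightarrow> (LINT x|torus_measure L. (?m N x - u x)\<^sup>2) < (r / 2) / (1 + 1 / e)"
    by (auto simp: eventually_sequentially)
  show "\<exists>N0. \<forall>N\<ge>N0. norm ((LINT x|torus_measure L. (?m N x)\<^sup>2) - (LINT x|torus_measure L. (u x)\<^sup>2)) < r"
  proof (intro exI[of _ N0] allI impI)
    fix N assume N: "N \<ge> N0"
    define M where "M = ?m N"
    have sM: "sq_int L M" unfolding M_def by (rule sq_int_mollify[OF L _ u]) simp
    have M2: "integrable (torus_measure L) (\<lambda>x. (M x)\<^sup>2)" and u2: "integrable (torus_measure L) (\<lambda>x. (u x)\<^sup>2)"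
      and d2: "integrable (torus_measure L) (\<lambda>x. (M x - u x)\<^sup>2)"
      using sM u sq_int_diff[OF sM u] by (auto simp: sq_int_def)
    define T where "T = (LINT x|torus_measure L. (M x)\<^sup>2)"
    define D where "D = (LINT x|torus_measure L. (M x - u x)\<^sup>2)"
    have TS: "T \<le> S" unfolding T_def S_def M_def
      using mollify_power_integral(2)[OF L _ _ sq_int_integrable[OF u], of _ 2] u2 by simp
    have "S \<le> (LINT x|torus_measure L. (1 + e) * (M x)\<^sup>2 + (1 + 1 / e) * (M x - u x)\<^sup>2)"
      unfolding S_def
    proof (rule integral_mono[OF u2])
      fix x
      have "0 \<le> (e * M x + (M x - u x))\<^sup>2 / e" using e by simp
      also have "\<dots> = e * (M x)\<^sup>2 + 2 * M x * (M x - u x) + (M x - u x)\<^sup>2 / e"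
        using e by (simp add: power2_eq_square field_simps)
      finally have "0 \<le> e * (M x)\<^sup>2 + 2 * M x * (M x - u x) + (M x - u x)\<^sup>2 / e" .
      moreover have "(u x)\<^sup>2 = (M x)\<^sup>2 - 2 * M x * (M x - u x) + (M x - u x)\<^sup>2"
        by (simp add: power2_eq_square algebra_simps)
      ultimately show "(u x)\<^sup>2 \<le> (1 + e) * (M x)\<^sup>2 + (1 + 1 / e) * (M x - u x)\<^sup>2"
        by (simp add: distrib_right)
    qed (use M2 d2 in auto)
    also have "\<dots> = (1 + e) * T + (1 + 1 / e) * D" using M2 d2 by (simp add: T_def D_def)
    finally have "S \<le> (1 + e) * T + (1 + 1 / e) * D" .
    moreover have "e * T \<le> e * S" using TS e by simp
    moreover have "(1 + 1 / e) * D < r / 2"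
    proof -
      have p: "1 + 1 / e > 0" using e by (simp add: add_pos_pos)
      have "D < (r / 2) / (1 + 1 / e)" using N0[OF N] by (simp add: D_def M_def)
      then show ?thesis unfolding pos_less_divide_eq[OF p] by (subst mult.commute)
    qed
    moreover have "(1 + e) * T = T + e * T" by (simp add: distrib_right)
    ultimately have "\<bar>T - S\<bar> < r" using TS e by linarith
    then show "norm ((LINT x|torus_measure L. (?m N x)\<^sup>2) - (LINT x|torus_measure L. (u x)\<^sup>2)) < r"
      by (simp add: T_def S_def M_def)
  qed
qed

lemma norm_sq_vec: "(norm (x :: real^'n))\<^sup>2 = (\<Sum>i\<in>UNIV. (x $ i)\<^sup>2)"
  unfolding power2_norm_eq_inner inner_vec_def by (simp add: power2_eq_square)

text \<open>The pointwise bound is integrated for the mollified states and passed to the limit. No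
  convergence of gradients is required: gradient and quartic terms of the mollifications are bounded
  by those of \<open>u\<close>, and only the quadratic term, which enters with a negative sign, has
  to converge.\<close>

theorem energy_lower_bound:
  fixes u :: "real^'n \<Rightarrow> real"
  assumes L: "L > 0" and n: "CARD('n) \<ge> 2" and u: "u \<in> X_phi L \<phi>"
    and r: "3 / 5 \<le> a" "a < r" "r < 1" and \<phi>: "0 < \<phi>" "\<phi> \<le> 1 - r"
    and K: "5 * \<phi> + 2 * real CARD('n) / L \<le> (1 - r\<^sup>2)\<^sup>2 / 4"
    and A: "A = droplet_volume L a r u"
  shows "energy L u - L ^ CARD('n) * G (- 1 + \<phi>)
    \<ge> real CARD('n) * root CARD('n) (unit_ball_vol CARD('n)) * A powr ((real CARD('n) - 1) / real CARD('n)) * wall_cost r a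
      - (4 * \<phi> + 5 * \<phi>\<^sup>2 + 2 * real CARD('n) / L) * A
      + (3 * r\<^sup>2 - 1) / 2 * ((a + 1 - \<phi>)\<^sup>2 * A\<^sup>2 / L ^ CARD('n))"
proof -
  let ?n = "CARD('n)" and ?V = "L ^ CARD('n)"
  let ?M = "torus_measure L :: (real^'n) measure"
  define m where "m = - 1 + \<phi>"
  \<comment> \<open>The pointwise bound carries the wall cost with this very weight, so that the
    correction \<open>2 * n / L\<close> of the isoperimetric inequality is already paid for.\<close>
  define k where "k = 2 * real ?n / L"
  define g where "g = wgrad L u"
  define Q where "Q = real ?n * root ?n (unit_ball_vol ?n) * wall_cost r a"
  define \<beta> where "\<beta> = (real ?n - 1) / real ?n"
  define l where "l = (3 * r\<^sup>2 - 1) / 2"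
  define c where "c = 4 * \<phi> + 5 * \<phi>\<^sup>2 + k"
  have r0: "0 < r" "0 < a" "r \<le> 1" using r by auto
  have V: "?V > 0" using L by simp
  have k0: "0 \<le> k" using L by (simp add: k_def)
  have uH: "u \<in> H1L4 L" and mean: "(LINT x|?M. u x) = m * ?V"
    using u L V by (auto simp: X_phi_def m_def field_simps)
  have us: "sq_int L u" and u4: "integrable ?M (\<lambda>x. u x ^ 4)" and wg: "weak_grad L u g"
    using uH someI_ex[of "weak_grad L u"] by (auto simp: H1L4_def sq_int_def g_def wgrad_def)
  have ui: "integrable ?M u" by (rule sq_int_integrable[OF us])
  have u2: "integrable ?M (\<lambda>x. (u x)\<^sup>2)" using us by (simp add: sq_int_def)
  have gs: "sq_int L (\<lambda>x. g x $ i)" for i by (rule weak_grad_sq_int[OF wg])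
  have g2: "integrable ?M (\<lambda>x. (norm (g x))\<^sup>2)" using wg by (simp add: weak_grad_def)
  define U where "U N = mollify L (1 / real (Suc N)) u" for N
  define h where "h N x = (\<chi> i. mollify L (1 / real (Suc N)) (\<lambda>y. g y $ i) x)" for N x
  define AN where "AN N = droplet_volume L a r (U N)" for N
  have sU: "sq_int L (U N)" for N unfolding U_def by (rule sq_int_mollify[OF L _ us]) simp
  have lim2: "(\<lambda>N. LINT x|?M. (U N x)\<^sup>2) \<longlonglongrightarrow> (LINT x|?M. (u x)\<^sup>2)"
    unfolding U_def by (rule mollify_norm_tendsto[OF L us])
  have limA: "AN \<longlonglongrightarrow> A"
  proof (rule LIM_zero_cancel)
    show "(\<lambda>N. AN N - A) \<longlonglongrightarrow> 0"
    proof (rule tendsto_rabs_zero_cancel, rule real_tendsto_sandwich[where f = "\<lambda>_. 0"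
          and h = "\<lambda>N. sqrt (?V * (LINT x|?M. (U N x - u x)\<^sup>2)) / (r - a)"])
      show "eventually (\<lambda>N. \<bar>AN N - A\<bar> \<le> sqrt (?V * (LINT x|?M. (U N x - u x)\<^sup>2)) / (r - a)) sequentially"
        using droplet_volume_lipschitz[OF L sU us r(2)] by (simp add: AN_def A)
      have "(\<lambda>N. sqrt (?V * (LINT x|?M. (U N x - u x)\<^sup>2)) / (r - a)) \<longlonglongrightarrow> sqrt (?V * 0) / (r - a)"
        unfolding U_def using r by (intro tendsto_intros mollify_L2[OF L us]) auto
      then show "(\<lambda>N. sqrt (?V * (LINT x|?M. (U N x - u x)\<^sup>2)) / (r - a)) \<longlonglongrightarrow> 0" by simp
    qed auto
  qed
  have bound: "Q * AN N powr \<beta> - c * AN N + l * (2 * \<tau> * (a - m) * AN N - \<tau>\<^sup>2 * ?V)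
     \<le> (LINT x|?M. (norm (g x))\<^sup>2) / 2 + (LINT x|?M. u x ^ 4) / 4 - (LINT x|?M. (U N x)\<^sup>2) / 2 + ?V / 4 - ?V * G m"
    if \<tau>: "\<tau> \<ge> 0" for N \<tau>
  proof -
    define \<eta> where "\<eta> = 1 / real (Suc N)"
    have \<eta>: "\<eta> > 0" by (simp add: \<eta>_def)
    define W where "W = U N"
    define p where "p = h N"
    have WU: "W = mollify L \<eta> u" by (simp add: W_def U_def \<eta>_def)
    have ph: "p x = (\<chi> i. mollify L \<eta> (\<lambda>y. g y $ i) x)" for x by (simp add: p_def h_def \<eta>_def)
    have cW: "continuous_on UNIV W" unfolding WU by (rule mollify_continuous[OF L \<eta> ui])
    have cp: "continuous_on UNIV p" unfolding ph[abs_def]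
      by (intro continuous_on_vec_lambda mollify_continuous[OF L \<eta>] sq_int_integrable gs)
    note ci = set_lborel_integrable_imp_torus(1)
    have i1: "integrable ?M (\<lambda>x. (norm (p x))\<^sup>2)" by (intro ci continuous_intros cp)
    have i2: "integrable ?M (\<lambda>x. tilted_G m (W x))"
      unfolding tilted_G_factor by (intro ci continuous_intros cW) auto
    have i3: "integrable ?M (\<lambda>x. wall_density r (W x) * norm (p x))" by (intro ci continuous_intros cW cp)
    have i4: "integrable ?M (\<lambda>x. wall_cost r (W x))" by (intro ci continuous_intros cW)
    have i5: "integrable ?M (\<lambda>x. ramp a r (W x))" by (intro ci continuous_intros cW r)
    have i6: "integrable ?M W" by (intro ci cW)
    have i7: "integrable ?M (\<lambda>x. W x ^ 4)" "integrable ?M (\<lambda>x. (W x)\<^sup>2)" by (intro ci continuous_intros cW)+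
    have meanW: "(LINT x|?M. W x) = m * ?V" unfolding WU using mollify_integral(2)[OF L \<eta> ui] mean by simp
    have iso: "Q * AN N powr \<beta> \<le> (LINT x|?M. wall_density r (W x) * norm (p x)) + k * (LINT x|?M. wall_cost r (W x))"
    proof -
      obtain C where C: "C \<ge> 0" "\<And>x h. \<bar>W (x + h) - W x - p x \<bullet> h\<bar> \<le> C * (norm h)\<^sup>2"
        using mollify_weak_taylor[OF L \<eta> ui wg] unfolding WU ph by blast
      have "lattice_periodic L W" unfolding WU by (rule mollify_periodic[OF L \<eta>])
      from smooth_isoperimetric[OF L cW this cp C r0(2) r(2) r0(3) n]
      show ?thesis by (simp add: Q_def \<beta>_def k_def AN_def W_def mult_ac)
    qed
    \<comment> \<open>The term with \<open>m * ?V\<close> minus the integral of \<open>W\<close> is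
      zero, since mollification preserves the mean. It is inserted to give the integrand the form of
      the pointwise bound.\<close>
    have "Q * AN N powr \<beta> - c * AN N + l * (2 * \<tau> * (a - m) * AN N - \<tau>\<^sup>2 * ?V)
       \<le> (LINT x|?M. wall_density r (W x) * norm (p x)) + k * (LINT x|?M. wall_cost r (W x))
          - c * (LINT x|?M. ramp a r (W x))
          + l * (2 * \<tau> * (m * ?V - (LINT x|?M. W x)) + 2 * \<tau> * (a - m) * (LINT x|?M. ramp a r (W x)) - \<tau>\<^sup>2 * ?V)"
      using iso unfolding meanW by (simp add: AN_def droplet_volume_def W_def)
    also have "\<dots> = (LINT x|?M. wall_density r (W x) * norm (p x) + k * wall_cost r (W x) - c * ramp a r (W x)
          + l * (2 * \<tau> * (m - W x) + 2 * \<tau> * (a - m) * ramp a r (W x) - \<tau>\<^sup>2))"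
      using i3 i4 i5 i6 L by (simp add: measure_torus_measure mult.commute)
    also have "\<dots> \<le> (LINT x|?M. (norm (p x))\<^sup>2 / 2 + tilted_G m (W x))"
    proof (rule integral_mono)
      fix x
      show "wall_density r (W x) * norm (p x) + k * wall_cost r (W x) - c * ramp a r (W x)
          + l * (2 * \<tau> * (m - W x) + 2 * \<tau> * (a - m) * ramp a r (W x) - \<tau>\<^sup>2) \<le> (norm (p x))\<^sup>2 / 2 + tilted_G m (W x)"
        using pointwise_energy_bound[OF r \<phi> m_def k0 _ \<tau> norm_ge_zero[of "p x"], of "W x"] K
        by (simp add: k_def c_def l_def)
    qed (use i1 i2 i3 i4 i5 i6 in auto)
    also have "\<dots> = (LINT x|?M. (norm (p x))\<^sup>2) / 2 + (LINT x|?M. tilted_G m (W x))" using i1 i2 by simp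
    also have "(LINT x|?M. tilted_G m (W x)) = (LINT x|?M. W x ^ 4 / 4 - (W x)\<^sup>2 / 2 + (1 / 4 - G m + (m ^ 3 - m) * m) - (m ^ 3 - m) * W x)"
      by (intro Bochner_Integration.integral_cong refl)
        (simp add: tilted_G_def G_def power2_eq_square power4_eq_xxxx field_simps)
    also have "\<dots> = (LINT x|?M. W x ^ 4) / 4 - (LINT x|?M. (W x)\<^sup>2) / 2 + (1 / 4 - G m + (m ^ 3 - m) * m) * ?V - (m ^ 3 - m) * (LINT x|?M. W x)"
      using i6 i7 L by (simp add: measure_torus_measure)
    also have "\<dots> = (LINT x|?M. W x ^ 4) / 4 - (LINT x|?M. (W x)\<^sup>2) / 2 + ?V / 4 - ?V * G m"
      unfolding meanW by (simp add: algebra_simps)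
    also have "(LINT x|?M. W x ^ 4) \<le> (LINT x|?M. u x ^ 4)"
      unfolding WU by (rule mollify_power_integral(2)[OF L \<eta> _ ui u4]) simp
    also have "(LINT x|?M. (norm (p x))\<^sup>2) \<le> (LINT x|?M. (norm (g x))\<^sup>2)"
    proof -
      have mi: "integrable ?M (\<lambda>x. (mollify L \<eta> (\<lambda>y. g y $ i) x)\<^sup>2)" for i
        using sq_int_mollify[OF L \<eta> gs] by (simp add: sq_int_def)
      have "(LINT x|?M. (norm (p x))\<^sup>2) = (\<Sum>i\<in>UNIV. LINT x|?M. (mollify L \<eta> (\<lambda>y. g y $ i) x)\<^sup>2)"
        unfolding norm_sq_vec ph using mi by simp
      also have "\<dots> \<le> (\<Sum>i\<in>UNIV. LINT x|?M. (g x $ i)\<^sup>2)"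
      proof (rule sum_mono)
        fix i
        show "(LINT x|?M. (mollify L \<eta> (\<lambda>y. g y $ i) x)\<^sup>2) \<le> (LINT x|?M. (g x $ i)\<^sup>2)"
          using gs[of i] by (intro mollify_power_integral(2)[OF L \<eta> _ sq_int_integrable[OF gs]]) (auto simp: sq_int_def)
      qed
      also have "\<dots> = (LINT x|?M. (norm (g x))\<^sup>2)"
        unfolding norm_sq_vec using gs by (subst Bochner_Integration.integral_sum) (auto simp: sq_int_def)
      finally show ?thesis .
    qed
    finally show ?thesis by (simp add: W_def)
  qed
  have A0: "A \<ge> 0" unfolding A droplet_volume_def using ramp_bounds by (intro Bochner_Integration.integral_nonneg) auto
  have "\<beta> > 0" using n by (simp add: \<beta>_def)
  \<comment> \<open>Built from the limit volume \<open>A\<close> and not from \<open>AN N\<close>,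
    so that one value serves all mollifications.\<close>
  define \<tau> where "\<tau> = (a - m) * A / ?V"
  have \<tau>: "\<tau> \<ge> 0" using A0 V r \<phi> by (simp add: \<tau>_def m_def)
  have "Q * A powr \<beta> - c * A + l * (2 * \<tau> * (a - m) * A - \<tau>\<^sup>2 * ?V)
     \<le> (LINT x|?M. (norm (g x))\<^sup>2) / 2 + (LINT x|?M. u x ^ 4) / 4 - (LINT x|?M. (u x)\<^sup>2) / 2 + ?V / 4 - ?V * G m"
  proof (rule LIMSEQ_le)
    show "(\<lambda>N. Q * AN N powr \<beta> - c * AN N + l * (2 * \<tau> * (a - m) * AN N - \<tau>\<^sup>2 * ?V))
      \<longlonglongrightarrow> Q * A powr \<beta> - c * A + l * (2 * \<tau> * (a - m) * A - \<tau>\<^sup>2 * ?V)"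
    proof -
      have limp: "(\<lambda>N. AN N powr \<beta>) \<longlonglongrightarrow> A powr \<beta>"
      proof (rule tendsto_powr'[OF limA tendsto_const])
        have "AN N \<ge> 0" for N unfolding AN_def droplet_volume_def using ramp_bounds by (intro Bochner_Integration.integral_nonneg) auto
        then show "A \<noteq> 0 \<or> \<beta> > 0 \<and> (\<forall>\<^sub>F x in sequentially. 0 \<le> AN x)" using \<open>\<beta> > 0\<close> by simp
      qed
      show ?thesis by (intro tendsto_add tendsto_diff tendsto_mult tendsto_const limA limp)
    qed
    show "(\<lambda>N. (LINT x|?M. (norm (g x))\<^sup>2) / 2 + (LINT x|?M. u x ^ 4) / 4 - (LINT x|?M. (U N x)\<^sup>2) / 2 + ?V / 4 - ?V * G m)
      \<longlonglongrightarrow> (LINT x|?M. (norm (g x))\<^sup>2) / 2 + (LINT x|?M. u x ^ 4) / 4 - (LINT x|?M. (u x)\<^sup>2) / 2 + ?V / 4 - ?V * G m"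
      by (intro tendsto_intros lim2) auto
    show "\<exists>N0. \<forall>N\<ge>N0. Q * AN N powr \<beta> - c * AN N + l * (2 * \<tau> * (a - m) * AN N - \<tau>\<^sup>2 * ?V)
     \<le> (LINT x|?M. (norm (g x))\<^sup>2) / 2 + (LINT x|?M. u x ^ 4) / 4 - (LINT x|?M. (U N x)\<^sup>2) / 2 + ?V / 4 - ?V * G m"
      using bound[OF \<tau>] by blast
  qed
  also have "\<dots> = energy L u - ?V * G m"
  proof -
    have "energy L u = (LINT x|?M. (norm (g x))\<^sup>2 / 2 + (u x ^ 4 / 4 - (u x)\<^sup>2 / 2 + 1 / 4))"
      unfolding energy_def g_def[symmetric]
      by (intro Bochner_Integration.integral_cong refl) (simp add: G_def power2_eq_square power4_eq_xxxx field_simps)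
    then show ?thesis using g2 u2 u4 L by (simp add: measure_torus_measure)
  qed
  also have "2 * \<tau> * (a - m) * A - \<tau>\<^sup>2 * ?V = (a - m)\<^sup>2 * A\<^sup>2 / ?V"
  proof -
    have "\<tau> * ?V = (a - m) * A" using V L by (simp add: \<tau>_def)
    then have "\<tau>\<^sup>2 * ?V = \<tau> * ((a - m) * A)" by (simp add: power2_eq_square)
    then have "2 * \<tau> * (a - m) * A - \<tau>\<^sup>2 * ?V = \<tau> * ((a - m) * A)" by simp
    then show ?thesis by (simp add: \<tau>_def power2_eq_square)
  qed
  finally have final: "Q * A powr \<beta> - c * A + l * ((a - m)\<^sup>2 * A\<^sup>2 / ?V) \<le> energy L u - ?V * G m" .
  have am: "a + 1 - \<phi> = a - m" by (simp add: m_def)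
  show ?thesis
    using final unfolding am m_def[symmetric] by (simp add: Q_def \<beta>_def c_def k_def l_def mult_ac)
qed

section \<open>Weak gradients of radial functions\<close>

lemma axis_periodic_imp_lattice_periodic:
  fixes f :: "real^'n \<Rightarrow> 'b"
  assumes f: "\<And>x i. f (x + L *\<^sub>R axis i 1) = f x"
  shows "lattice_periodic L f"
proof -
  have nat: "f (x + (real m * L) *\<^sub>R axis i 1) = f x" for m x i
  proof (induction m)
    case (Suc m)
    have "x + (real (Suc m) * L) *\<^sub>R axis i 1 = (x + (real m * L) *\<^sub>R axis i 1) + L *\<^sub>R axis i 1"
      by (simp add: algebra_simps scaleR_left_distrib)
    then show ?case by (simp only: f Suc)
  qed simp
  have int: "f (x + (of_int z * L) *\<^sub>R axis i 1) = f x" for z x i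
  proof (cases "z \<ge> 0")
    case True
    then show ?thesis using nat[of x "nat z" i] by simp
  next
    case False
    then have "f (x + (of_int z * L) *\<^sub>R axis i 1) = f ((x + (of_int z * L) *\<^sub>R axis i 1) + (real (nat (- z)) * L) *\<^sub>R axis i 1)"
      by (simp only: nat)
    also have "(x + (of_int z * L) *\<^sub>R axis i 1) + (real (nat (- z)) * L) *\<^sub>R axis i 1 = x"
      using False by simp
    finally show ?thesis .
  qed
  have sum: "f (x + (\<Sum>i\<in>I. (of_int (z i) * L) *\<^sub>R axis i 1)) = f x" if "finite I" for I and z :: "'n \<Rightarrow> int" and x
    using that
  proof (induction I)
    case (insert j I)
    have "x + (\<Sum>i\<in>insert j I. (of_int (z i) * L) *\<^sub>R axis i 1)
      = (x + (\<Sum>i\<in>I. (of_int (z i) * L) *\<^sub>R axis i 1)) + (of_int (z j) * L) *\<^sub>R axis j 1"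
      using insert by simp
    then show ?case by (simp only: int insert.IH)
  qed simp
  have expand: "(\<chi> i. L * of_int (z i)) = (\<Sum>i\<in>UNIV. (of_int (z i) * L) *\<^sub>R axis i 1 :: real^'n)" for z
  proof (subst vec_eq_iff, intro allI)
    fix j
    have "(\<Sum>i\<in>UNIV. (of_int (z i) * L) *\<^sub>R axis i 1 :: real^'n) $ j = (\<Sum>i\<in>UNIV. if j = i then of_int (z i) * L else 0)"
      unfolding sum_component by (intro sum.cong) (auto simp: axis_def)
    then show "(\<chi> i. L * of_int (z i)) $ j = (\<Sum>i\<in>UNIV. (of_int (z i) * L) *\<^sub>R axis i 1 :: real^'n) $ j"
      by (simp add: mult.commute)
  qed
  show ?thesis
    unfolding lattice_periodic_def lattice_def using sum[OF finite] by (auto simp: expand)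
qed

section \<open>Integration by parts on the torus\<close>

lemma test_directional_derivative:
  assumes "periodic_C1_test L \<psi>"
  shows "((\<lambda>t. \<psi> (x + t *\<^sub>R axis i 1)) has_real_derivative partial \<psi> i (x + s *\<^sub>R axis i 1)) (at s)"
proof -
  let ?y = "x + s *\<^sub>R axis i 1"
  let ?D = "frechet_derivative \<psi> (at ?y)"
  have D: "(\<psi> has_derivative ?D) (at ?y)"
    using assms by (simp add: periodic_C1_test_def frechet_derivative_works[symmetric])
  have "((\<lambda>t. x + t *\<^sub>R axis i 1) has_derivative (\<lambda>h. h *\<^sub>R axis i 1)) (at s)"
    by (auto intro!: derivative_eq_intros)
  from has_derivative_compose[OF this D]
  have "((\<lambda>t. \<psi> (x + t *\<^sub>R axis i 1)) has_derivative (\<lambda>h. ?D (h *\<^sub>R axis i 1))) (at s)" .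
  moreover have "?D (h *\<^sub>R axis i 1) = partial \<psi> i ?y * h" for h
    using linear_cmul[OF has_derivative_linear[OF D]] by (simp add: partial_def mult.commute)
  ultimately show ?thesis by (simp add: has_field_derivative_def)
qed

lemma test_continuous:
  assumes "periodic_C1_test L \<psi>"
  shows "continuous_on UNIV \<psi>" "continuous_on UNIV (partial \<psi> i)"
proof -
  have "isCont \<psi> x" for x
    using assms by (auto simp: periodic_C1_test_def intro: differentiable_imp_continuous_within)
  then show "continuous_on UNIV \<psi>" by (simp add: continuous_at_imp_continuous_on)
  show "continuous_on UNIV (partial \<psi> i)" using assms by (simp add: periodic_C1_test_def)
qed

lemma continuous_bounded_cball:
  fixes f :: "real^'n \<Rightarrow> real"
  assumes "continuous_on UNIV f"
  shows "\<exists>B>0. \<forall>x. norm x \<le> R \<longrightarrow> \<bar>f x\<bar> \<le> B"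
proof -
  have "compact (f ` cball 0 R)" by (intro compact_continuous_image continuous_on_subset[OF assms]) auto
  then obtain B where "B > 0" "\<And>y. y \<in> f ` cball 0 R \<Longrightarrow> norm y \<le> B"
    using compact_imp_bounded bounded_pos by metis
  then show ?thesis by (intro exI[of _ B]) auto
qed

lemma test_lipschitz:
  fixes \<psi> :: "real^'n \<Rightarrow> real"
  assumes "periodic_C1_test L \<psi>"
  shows "\<exists>B>0. \<forall>x h. norm x \<le> R \<longrightarrow> 0 < h \<longrightarrow> h \<le> 1 \<longrightarrow> \<bar>\<psi> (x + h *\<^sub>R axis i 1) - \<psi> x\<bar> \<le> B * h"
proof -
  obtain B where B: "B > 0" "\<And>x. norm x \<le> R + 1 \<Longrightarrow> \<bar>partial \<psi> i x\<bar> \<le> B"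
    using continuous_bounded_cball[OF test_continuous(2)[OF assms], of "R + 1" i] by blast
  have "\<bar>\<psi> (x + h *\<^sub>R axis i 1) - \<psi> x\<bar> \<le> B * h" if x: "norm x \<le> R" and h: "0 < h" "h \<le> 1" for x h
  proof -
    have "norm (\<psi> (x + h *\<^sub>R axis i 1) - \<psi> (x + 0 *\<^sub>R axis i 1)) \<le> B * norm (h - 0)"
    proof (rule field_differentiable_bound[where S = "{0..1}" and f' = "\<lambda>t. partial \<psi> i (x + t *\<^sub>R axis i 1)"])
      fix t :: real assume t: "t \<in> {0..1}"
      show "((\<lambda>t. \<psi> (x + t *\<^sub>R axis i 1)) has_field_derivative partial \<psi> i (x + t *\<^sub>R axis i 1)) (at t within {0..1})"
        using test_directional_derivative[OF assms] by (rule has_field_derivative_at_within)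
      have "norm (x + t *\<^sub>R axis i 1) \<le> norm x + norm (t *\<^sub>R axis i (1::real))" by (rule norm_triangle_ineq)
      also have "\<dots> \<le> R + 1" using x t by (simp add: norm_axis_1)
      finally show "norm (partial \<psi> i (x + t *\<^sub>R axis i 1)) \<le> B" using B(2) by simp
    qed (use h in auto)
    then show ?thesis using h by simp
  qed
  then show ?thesis using B(1) by blast
qed

lemma torus_norm_bounded: "\<exists>R. \<forall>x \<in> (torus L :: (real^'n) set). norm x \<le> R"
proof -
  have "bounded (torus L :: (real^'n) set)" by (simp add: torus_eq_cbox)
  then show ?thesis by (auto simp: bounded_iff)
qed

text \<open>Integration by parts is reduced to translation invariance, which makes the mean of every difference quotient vanish.\<close>
lemma integral_directional_derivative_zero:
  fixes F f :: "real^'n \<Rightarrow> real"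
  assumes F: "continuous_on UNIV F" and f: "f \<in> borel_measurable (torus_measure L)"
    and lip: "\<And>x h. x \<in> torus L \<Longrightarrow> 0 < h \<Longrightarrow> h \<le> 1 \<Longrightarrow> \<bar>F (x + h *\<^sub>R e) - F x\<bar> \<le> B * h"
    and deriv: "AE x in torus_measure L. ((\<lambda>t. F (x + t *\<^sub>R e)) has_real_derivative f x) (at 0)"
    and inv: "\<And>h. 0 < h \<Longrightarrow> h \<le> \<delta> \<Longrightarrow> (LINT x|torus_measure L. F (x + h *\<^sub>R e)) = (LINT x|torus_measure L. F x)"
    and \<delta>: "\<delta> > 0"
  shows "(LINT x|torus_measure L. f x) = 0"
proof -
  define h where "h k = 1 / real (Suc k)" for k
  have h: "0 < h k" "h k \<le> 1" for k by (auto simp: h_def)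
  have hlim: "h \<longlonglongrightarrow> 0" unfolding h_def by (rule LIMSEQ_Suc[OF lim_1_over_n])
  define s where "s k x = (F (x + h k *\<^sub>R e) - F x) / h k" for k x
  have cFh: "continuous_on UNIV (\<lambda>x. F (x + t *\<^sub>R e))" for t
    by (intro continuous_on_compose2[OF F] continuous_intros) auto
  have cs: "continuous_on UNIV (s k)" for k
    unfolding s_def using h[of k] by (intro continuous_intros cFh F) auto
  have "(\<lambda>k. LINT x|torus_measure L. s k x) \<longlonglongrightarrow> (LINT x|torus_measure L. f x)"
  proof (rule integral_dominated_convergence[where w = "\<lambda>_. B"])
    show "s k \<in> borel_measurable (torus_measure L)" for k
      by (intro measurable_borel_torus borel_measurable_continuous_onI cs)
    show "AE x in torus_measure L. (\<lambda>k. s k x) \<longlonglongrightarrow> f x"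
      using deriv
    proof eventually_elim
      case (elim x)
      then have "((\<lambda>t. (F (x + t *\<^sub>R e) - F x) / t) \<longlongrightarrow> f x) (at 0)"
        by (simp add: has_field_derivative_iff)
      moreover have "filterlim h (at 0) sequentially"
      proof (subst filterlim_at, intro conjI hlim always_eventually allI)
        show "h k \<in> UNIV" "h k \<noteq> 0" for k using h(1)[of k] by auto
      qed
      ultimately show ?case unfolding s_def by (rule filterlim_compose)
    qed
    show "AE x in torus_measure L. norm (s k x) \<le> B" for k
    proof (rule AE_I2)
      fix x assume "x \<in> space (torus_measure L :: (real^'n) measure)"
      then have "\<bar>F (x + h k *\<^sub>R e) - F x\<bar> \<le> B * h k" using lip h by simp
      then show "norm (s k x) \<le> B" using h(1)[of k] by (simp add: s_def abs_divide divide_le_eq)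
    qed
  qed (use f in auto)
  moreover have "(\<lambda>k. LINT x|torus_measure L. s k x) \<longlonglongrightarrow> 0"
  proof (rule tendsto_eventually)
    have "eventually (\<lambda>k. h k < \<delta>) sequentially" using hlim \<delta> by (rule order_tendstoD(2))
    then show "\<forall>\<^sub>F k in sequentially. (LINT x|torus_measure L. s k x) = 0"
    proof eventually_elim
      case (elim k)
      have "(LINT x|torus_measure L. s k x) = ((LINT x|torus_measure L. F (x + h k *\<^sub>R e)) - (LINT x|torus_measure L. F x)) / h k"
        unfolding s_def using set_lborel_integrable_imp_torus(1)[OF cFh] set_lborel_integrable_imp_torus(1)[OF F] by simp
      then show ?case using inv[of "h k"] h(1)[of k] elim by simp
    qed
  qed
  ultimately show ?thesis by (rule LIMSEQ_unique)
qed

lemma integral_periodic_translate: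
  fixes f :: "real^'n \<Rightarrow> real"
  assumes L: "L > 0" and f: "continuous_on UNIV f" and per: "lattice_periodic L f" and b: "\<And>x. \<bar>f x\<bar> \<le> B"
  shows "(LINT x|torus_measure L. f (x + a)) = (LINT x|torus_measure L. f x)"
proof -
  have cfa: "continuous_on UNIV (\<lambda>x. f (x + a))"
    by (intro continuous_on_compose2[OF f] continuous_intros) auto
  \<comment> \<open>Adding the bound \<open>B\<close> makes the integrands nonnegative, where
    invariance under translations is already available.\<close>
  have nn: "(\<integral>\<^sup>+x. ennreal (g x + B) \<partial>torus_measure L) = ennreal (LINT x|torus_measure L. g x + B)"
    if "continuous_on UNIV g" "\<And>x. \<bar>g x\<bar> \<le> B" for g :: "real^'n \<Rightarrow> real"
  proof (rule nn_integral_eq_integral)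
    show "integrable (torus_measure L) (\<lambda>x. g x + B)" by (intro set_lborel_integrable_imp_torus(1) continuous_intros that)
    show "AE x in torus_measure L. 0 \<le> g x + B"
    proof (rule AE_I2)
      fix x show "0 \<le> g x + B" using that(2)[of x] by linarith
    qed
  qed
  have fm[measurable]: "f \<in> borel_measurable borel" by (rule borel_measurable_continuous_onI[OF f])
  have "(\<integral>\<^sup>+x. ennreal (f (x + a) + B) \<partial>torus_measure L) = (\<integral>\<^sup>+x. ennreal (f (x + a) + B) * indicator (torus L) x \<partial>lborel)"
    by (rule nn_integral_torus) measurable
  also have "\<dots> = (\<integral>\<^sup>+x. ennreal (f x + B) * indicator (torus L) x \<partial>lborel)"
    using per by (intro nn_integral_periodic_translate[OF L, of "\<lambda>x. ennreal (f x + B)"])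
      (auto simp: lattice_periodic_def)
  also have "\<dots> = (\<integral>\<^sup>+x. ennreal (f x + B) \<partial>torus_measure L)"
    by (rule nn_integral_torus[symmetric]) measurable
  finally have "ennreal (LINT x|torus_measure L. f (x + a) + B) = ennreal (LINT x|torus_measure L. f x + B)"
    using nn[OF cfa b] nn[OF f b] by simp
  moreover have "0 \<le> (LINT x|torus_measure L. f (x + a) + B)" "0 \<le> (LINT x|torus_measure L. f x + B)"
  proof -
    have "0 \<le> f x + B" for x using b[of x] by linarith
    then show "0 \<le> (LINT x|torus_measure L. f (x + a) + B)" "0 \<le> (LINT x|torus_measure L. f x + B)"
      by (auto intro!: Bochner_Integration.integral_nonneg)
  qed
  ultimately have "(LINT x|torus_measure L. f (x + a) + B) = (LINT x|torus_measure L. f x + B)"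
    by (simp add: ennreal_inj)
  then show ?thesis
    using set_lborel_integrable_imp_torus(1)[OF cfa, of L] set_lborel_integrable_imp_torus(1)[OF f, of L] by simp
qed

lemma lattice_periodic_bounded:
  fixes f :: "real^'n \<Rightarrow> real"
  assumes L: "L > 0" and f: "continuous_on UNIV f" and per: "lattice_periodic L f"
  shows "\<exists>B. \<forall>x. \<bar>f x\<bar> \<le> B"
proof -
  obtain R where R: "\<And>x. x \<in> (torus L :: (real^'n) set) \<Longrightarrow> norm x \<le> R" using torus_norm_bounded by blast
  obtain B where B: "\<And>x. norm x \<le> R \<Longrightarrow> \<bar>f x\<bar> \<le> B" using continuous_bounded_cball[OF f] by blast
  have "\<bar>f x\<bar> \<le> B" for x
  proof -
    obtain k where k: "k \<in> lattice L" "x + k \<in> cell L" using lattice_cell_unique[OF L, of x] by blast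
    then have "x + k \<in> torus L" by (auto simp: cell_def torus_def less_imp_le)
    then show ?thesis using B[OF R] lattice_periodicD[OF per k(1), of x] by metis
  qed
  then show ?thesis by blast
qed

lemma integral_partial_test:
  fixes \<psi> :: "real^'n \<Rightarrow> real"
  assumes L: "L > 0" and t: "periodic_C1_test L \<psi>"
  shows "(LINT x|torus_measure L. partial \<psi> i x) = 0"
proof -
  obtain R where R: "\<And>x. x \<in> (torus L :: (real^'n) set) \<Longrightarrow> norm x \<le> R" using torus_norm_bounded by blast
  obtain B where B: "\<And>x h. norm x \<le> R \<Longrightarrow> 0 < h \<Longrightarrow> h \<le> 1 \<Longrightarrow> \<bar>\<psi> (x + h *\<^sub>R axis i 1) - \<psi> x\<bar> \<le> B * h"
    using test_lipschitz[OF t, of R i] by blast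
  have per: "lattice_periodic L \<psi>"
    using t by (intro axis_periodic_imp_lattice_periodic) (simp add: periodic_C1_test_def)
  obtain M where M: "\<And>x. \<bar>\<psi> x\<bar> \<le> M" using lattice_periodic_bounded[OF L test_continuous(1)[OF t] per] by blast
  show ?thesis
  proof (rule integral_directional_derivative_zero[where F = \<psi> and e = "axis i 1" and B = B and \<delta> = 1])
    show "partial \<psi> i \<in> borel_measurable (torus_measure L)"
      by (intro measurable_borel_torus borel_measurable_continuous_onI test_continuous(2)[OF t])
    show "AE x in torus_measure L. ((\<lambda>s. \<psi> (x + s *\<^sub>R axis i 1)) has_real_derivative partial \<psi> i x) (at 0)"
      using test_directional_derivative[OF t, of _ i 0] by simp
    show "(LINT x|torus_measure L. \<psi> (x + h *\<^sub>R axis i 1)) = (LINT x|torus_measure L. \<psi> x)" for h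
      by (rule integral_periodic_translate[OF L test_continuous(1)[OF t] per M])
  qed (use R B test_continuous(1)[OF t] in auto)
qed

text \<open>Serves for the product of a radial function with a test function. It is not periodic,
  but it and its small translates are supported in the cell, so the integral may be extended to the
  whole space.\<close>

lemma integral_compact_translate:
  fixes F :: "real^'n \<Rightarrow> real"
  assumes F: "continuous_on UNIV F" and supp: "\<And>x. \<rho> \<le> norm x \<Longrightarrow> F x = 0" and h: "norm a + \<rho> \<le> L / 2"
  shows "(LINT x|torus_measure L. F (x + a)) = (LINT x|torus_measure L. F x)"
proof -
  have Fm[measurable]: "F \<in> borel_measurable borel" by (rule borel_measurable_continuous_onI[OF F])
  have *: "(LINT x|torus_measure L. F (x + b)) = (LINT x|lborel. F (x + b))" if "norm b \<le> norm a" for b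
  proof -
    have "(LINT x|torus_measure L. F (x + b)) = (LINT x:torus L|lborel. F (x + b))"
      by (rule integral_torus) measurable
    also have "\<dots> = (LINT x|lborel. F (x + b))"
      unfolding set_lebesgue_integral_def
    proof (intro Bochner_Integration.integral_cong refl)
      fix x :: "real^'n"
      show "indicator (torus L) x *\<^sub>R F (x + b) = F (x + b)"
      proof (cases "norm (x + b) < \<rho>")
        case True
        have "norm x \<le> norm (x + b) + norm b" using norm_triangle_ineq4[of "x + b" b] by simp
        then have nx: "norm x \<le> L / 2" using True that h by linarith
        have "- L / 2 \<le> x $ i \<and> x $ i \<le> L / 2" for i
          using component_le_norm_cart[of x i] nx by (simp add: abs_le_iff)
        then have "x \<in> torus L" by (simp add: torus_def)
        then show ?thesis by simp
      next
        case False
        then show ?thesis using supp[of "x + b"] by simp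
      qed
    qed
    finally show ?thesis .
  qed
  have "(LINT x|lborel. F x) = (LINT x|distr lborel borel ((+) a). F x)" by (simp add: lborel_distr_plus)
  also have "\<dots> = (LINT x|lborel. F (a + x))" by (subst integral_distr) auto
  finally show ?thesis using *[of a] *[of 0] by (simp add: add.commute)
qed

lemma sphere_null: "sphere (0::real^'n) r \<in> null_sets lebesgue"
  using negligible_sphere[of 0 r] by (simp add: negligible_iff_null_sets)

lemma AE_norm_not_in:
  assumes "finite S"
  shows "AE x in (torus_measure L :: (real^'n) measure). norm x \<notin> S \<and> x \<noteq> 0"
proof -
  have "(\<Union>r\<in>S. sphere (0::real^'n) r) \<union> sphere 0 0 \<in> null_sets lebesgue"
    using assms by (intro null_sets.Un null_sets.finite_UN sphere_null) auto
  then have "AE x in lebesgue. x \<notin> (\<Union>r\<in>S. sphere (0::real^'n) r) \<union> sphere 0 0" by (rule AE_not_in)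
  then have "AE x in lebesgue. norm (x :: real^'n) \<notin> S \<and> x \<noteq> 0"
    by eventually_elim auto
  then show ?thesis by (subst AE_restrict_space_iff) (auto elim: eventually_mono)
qed

text \<open>The derivative \<open>D\<close> is prescribed only off the finite set \<open>S\<close>
  and off 0. This admits profiles with corners, which are null sets of points in space. The
  condition \<open>\<rho> < L / 2\<close> leaves room to shift the support inside the cell.\<close>

locale radial_profile =
  fixes L \<rho> B :: real and \<zeta> D :: "real \<Rightarrow> real" and S :: "real set"
  assumes L: "0 < L" and \<rho>: "\<rho> < L / 2" and B: "0 \<le> B"
    and lip: "\<bar>\<zeta> s - \<zeta> t\<bar> \<le> B * \<bar>s - t\<bar>"
    and supp: "\<rho> \<le> s \<Longrightarrow> \<zeta> s = 0"
    and S: "finite S"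
    and deriv: "0 < s \<Longrightarrow> s \<notin> S \<Longrightarrow> (\<zeta> has_real_derivative D s) (at s)"
    and D_measurable: "D \<in> borel_measurable borel" and D_bound: "\<bar>D s\<bar> \<le> B"
begin

definition radial :: "real^'n \<Rightarrow> real" where "radial x = \<zeta> (norm x)"

definition radial_grad :: "real^'n \<Rightarrow> real^'n" where "radial_grad x = D (norm x) *\<^sub>R sgn x"

lemma radial_lipschitz: "\<bar>radial x - radial y\<bar> \<le> B * norm (x - y)"
proof -
  have "\<bar>radial x - radial y\<bar> \<le> B * \<bar>norm x - norm y\<bar>" unfolding radial_def by (rule lip)
  also have "\<dots> \<le> B * norm (x - y)" using B norm_triangle_ineq3 by (intro mult_left_mono) auto
  finally show ?thesis .
qed

lemma continuous_radial: "continuous_on UNIV radial"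
  by (rule lipschitz_on_continuous_on[of B]) (auto intro!: lipschitz_onI B simp: dist_norm radial_lipschitz)

lemma measurable_radial_grad: "radial_grad \<in> borel_measurable borel"
proof -
  have "(\<lambda>x::real^'n. sgn x) \<in> borel_measurable borel"
    unfolding sgn_div_norm by measurable
  moreover have "(\<lambda>x::real^'n. D (norm x)) \<in> borel_measurable borel"
    by (rule measurable_compose[OF _ D_measurable]) measurable
  ultimately show ?thesis unfolding radial_grad_def[abs_def] by (rule borel_measurable_scaleR[rotated])
qed

lemma norm_radial_grad: "x \<noteq> 0 \<Longrightarrow> norm (radial_grad x) = \<bar>D (norm x)\<bar>" "norm (radial_grad x) \<le> B"
proof -
  show "x \<noteq> 0 \<Longrightarrow> norm (radial_grad x) = \<bar>D (norm x)\<bar>" by (simp add: radial_grad_def norm_sgn)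
  show "norm (radial_grad x) \<le> B" using D_bound[of "norm x"] B by (simp add: radial_grad_def norm_sgn)
qed

lemma radial_directional_derivative:
  assumes "norm x \<notin> S" "x \<noteq> 0"
  shows "((\<lambda>t. radial (x + t *\<^sub>R axis i 1)) has_real_derivative radial_grad x $ i) (at 0)"
proof -
  have 1: "((\<lambda>t. x + t *\<^sub>R axis i 1) has_derivative (\<lambda>h. h *\<^sub>R axis i 1)) (at 0)"
    by (auto intro!: derivative_eq_intros)
  have "(norm has_derivative (\<lambda>h. h \<bullet> sgn x)) (at (x + 0 *\<^sub>R axis i 1))"
    using has_derivative_norm[of x] assms by (simp add: inner_commute)
  from has_derivative_compose[OF 1 this]
  have "((\<lambda>t. norm (x + t *\<^sub>R axis i 1)) has_real_derivative sgn x $ i) (at 0)"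
    by (simp add: has_field_derivative_def inner_axis' mult_commute_abs)
  moreover have "(\<zeta> has_real_derivative D (norm x)) (at (norm (x + 0 *\<^sub>R axis i 1)))"
    using assms deriv[of "norm x"] by simp
  ultimately have "((\<lambda>t. \<zeta> (norm (x + t *\<^sub>R axis i 1))) has_real_derivative D (norm x) * sgn x $ i) (at 0)"
    by (intro DERIV_chain2)
  then show ?thesis by (simp add: radial_def radial_grad_def)
qed

text \<open>The difference quotients of \<open>radial * \<psi>\<close> have mean zero because its
  support can be shifted inside the cell, and in the limit this is the product rule. The constant
  \<open>c\<close> contributes the mean of a derivative of the periodic \<open>\<psi>\<close>, which
  is zero as well.\<close>

theorem weak_grad_radial: "weak_grad L (\<lambda>x. c + radial x) (radial_grad :: real^'n \<Rightarrow> real^'n)"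
  unfolding weak_grad_def
proof (intro conjI allI impI)
  let ?M = "torus_measure L :: (real^'n) measure"
  have gm: "radial_grad \<in> borel_measurable ?M" by (intro measurable_borel_torus measurable_radial_grad)
  show "radial_grad \<in> borel_measurable ?M" by (rule gm)
  show "integrable ?M (\<lambda>x. (norm (radial_grad x))\<^sup>2)"
  proof (rule integrable_torus_bounded[where B = "B\<^sup>2"])
    show "(\<lambda>x. (norm (radial_grad x))\<^sup>2) \<in> borel_measurable ?M" using gm by auto
    show "\<bar>(norm (radial_grad x))\<^sup>2\<bar> \<le> B\<^sup>2" for x :: "real^'n" using norm_radial_grad(2)[of x] by (simp add: power_mono)
  qed
  fix \<psi> :: "real^'n \<Rightarrow> real" and i
  assume t: "periodic_C1_test L \<psi>"
  note c\<psi> = test_continuous[OF t]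
  define F where "F x = radial x * \<psi> x" for x
  define f where "f x = radial_grad x $ i * \<psi> x + radial x * partial \<psi> i x" for x
  have gmi: "(\<lambda>x. radial_grad x $ i) \<in> borel_measurable ?M"
    using measurable_compose[OF gm borel_measurable_continuous_onI[of "\<lambda>v. v $ i"]] by (simp add: continuous_on_component)
  have gbi: "\<bar>radial_grad x $ i\<bar> \<le> B" for x :: "real^'n"
    using component_le_norm_cart[of "radial_grad x" i] norm_radial_grad(2)[of x] by linarith
  obtain R where R: "\<And>x. x \<in> (torus L :: (real^'n) set) \<Longrightarrow> norm x \<le> R" using torus_norm_bounded by blast
  obtain B1 where B1: "B1 > 0" "\<And>x h. norm x \<le> R \<Longrightarrow> 0 < h \<Longrightarrow> h \<le> 1 \<Longrightarrow> \<bar>\<psi> (x + h *\<^sub>R axis i 1) - \<psi> x\<bar> \<le> B1 * h"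
    using test_lipschitz[OF t, of R i] by blast
  obtain B2 where B2: "B2 > 0" "\<And>x. norm x \<le> R \<Longrightarrow> \<bar>\<psi> x\<bar> \<le> B2" using continuous_bounded_cball[OF c\<psi>(1), of R] by blast
  obtain B3 where B3: "B3 > 0" "\<And>x :: real^'n. norm x \<le> R + 1 \<Longrightarrow> \<bar>radial x\<bar> \<le> B3"
    using continuous_bounded_cball[OF continuous_radial, of "R + 1"] by blast
  have cF: "continuous_on UNIV F" unfolding F_def by (intro continuous_intros continuous_radial c\<psi>)
  have ig: "integrable ?M (\<lambda>x. radial_grad x $ i * \<psi> x)"
  proof -
    have "integrable ?M (\<lambda>x. \<psi> x * radial_grad x $ i)"
      by (rule integrable_mult_bounded[OF set_lborel_integrable_imp_torus(1)[OF c\<psi>(1)] gmi gbi])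
    then show ?thesis by (simp add: mult.commute)
  qed
  have ir: "integrable ?M (\<lambda>x. radial x * partial \<psi> i x)"
    by (intro set_lborel_integrable_imp_torus(1) continuous_intros continuous_radial c\<psi>)
  have ip: "integrable ?M (\<lambda>x. partial \<psi> i x)"
    using set_lborel_integrable_imp_torus(1)[OF c\<psi>(2)] .
  have "(LINT x|?M. f x) = 0"
  \<comment> \<open>\<open>B * B2 + B3 * B1\<close> is the product rule for Lipschitz constants, and
    \<open>L / 2 - \<rho>\<close> is how far the support may move without leaving the cell.\<close>
  proof (rule integral_directional_derivative_zero[where F = F and e = "axis i 1" and B = "B * B2 + B3 * B1" and \<delta> = "L / 2 - \<rho>"])
    show "f \<in> borel_measurable ?M" unfolding f_def using ig ir by auto
    show "\<bar>F (x + h *\<^sub>R axis i 1) - F x\<bar> \<le> (B * B2 + B3 * B1) * h" if x: "x \<in> torus L" and h: "0 < h" "h \<le> 1" for x h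
    proof -
      let ?y = "x + h *\<^sub>R axis i 1"
      have "norm ?y \<le> norm x + norm (h *\<^sub>R axis i (1::real) :: real^'n)" by (rule norm_triangle_ineq)
      then have ny: "norm ?y \<le> R + 1" using R[OF x] h by (simp add: norm_axis_1)
      have "\<bar>radial ?y - radial x\<bar> \<le> B * norm (?y - x)" by (rule radial_lipschitz)
      also have "\<dots> = B * h" using h by (simp add: norm_axis_1)
      finally have d: "\<bar>radial ?y - radial x\<bar> \<le> B * h" .
      have "F ?y - F x = radial ?y * (\<psi> ?y - \<psi> x) + (radial ?y - radial x) * \<psi> x"
        by (simp add: F_def algebra_simps)
      also have "\<bar>\<dots>\<bar> \<le> \<bar>radial ?y\<bar> * \<bar>\<psi> ?y - \<psi> x\<bar> + \<bar>radial ?y - radial x\<bar> * \<bar>\<psi> x\<bar>"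
        unfolding abs_mult[symmetric] by (rule abs_triangle_ineq)
      also have "\<dots> \<le> B3 * (B1 * h) + (B * h) * B2"
        using B3(1) B3(2)[OF ny] B1(1) B1(2)[OF R[OF x] h] B2(1) B2(2)[OF R[OF x]] B d h
        by (intro add_mono mult_mono) auto
      finally show ?thesis by (simp add: algebra_simps)
    qed
    show "AE x in ?M. ((\<lambda>s. F (x + s *\<^sub>R axis i 1)) has_real_derivative f x) (at 0)"
      using AE_norm_not_in[OF S]
    proof eventually_elim
      case (elim x)
      have "((\<lambda>s. radial (x + s *\<^sub>R axis i 1) * \<psi> (x + s *\<^sub>R axis i 1)) has_real_derivative
         radial_grad x $ i * \<psi> (x + 0 *\<^sub>R axis i 1) + partial \<psi> i (x + 0 *\<^sub>R axis i 1) * radial (x + 0 *\<^sub>R axis i 1)) (at 0)"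
        using elim by (intro DERIV_mult radial_directional_derivative test_directional_derivative[OF t]) auto
      then show ?case by (simp add: F_def f_def mult.commute)
    qed
    show "(LINT x|?M. F (x + h *\<^sub>R axis i 1)) = (LINT x|?M. F x)" if h: "0 < h" "h \<le> L / 2 - \<rho>" for h
    proof (rule integral_compact_translate[OF cF, where \<rho> = \<rho>])
      show "F x = 0" if "\<rho> \<le> norm x" for x using supp[OF that] by (simp add: F_def radial_def)
      show "norm (h *\<^sub>R axis i (1::real) :: real^'n) + \<rho> \<le> L / 2" using h by (simp add: norm_axis_1)
    qed
  qed (use cF \<rho> in auto)
  then have "(LINT x|?M. radial_grad x $ i * \<psi> x) + (LINT x|?M. radial x * partial \<psi> i x) = 0"
    unfolding f_def using ig ir by simp
  moreover have "(LINT x|?M. (c + radial x) * partial \<psi> i x) = c * (LINT x|?M. partial \<psi> i x) + (LINT x|?M. radial x * partial \<psi> i x)"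
    using ip ir by (simp add: distrib_right)
  ultimately show "(LINT x|?M. (c + radial x) * partial \<psi> i x) = - (LINT x|?M. radial_grad x $ i * \<psi> x)"
    using integral_partial_test[OF L t] by simp
qed

lemma wgrad_radial: "AE x in torus_measure L. wgrad L (\<lambda>x. c + radial x) x = (radial_grad x :: real^'n)"
proof (rule weak_grad_unique[OF L])
  show "weak_grad L (\<lambda>x. c + radial x) (wgrad L (\<lambda>x::real^'n. c + radial x))"
    unfolding wgrad_def by (rule someI[of "weak_grad L (\<lambda>x::real^'n. c + radial x)"]) (rule weak_grad_radial)
qed (rule weak_grad_radial)

end

text \<open>A constant is the radial state with profile 0, which pins down its chosen weak gradient
  almost everywhere.\<close>

lemma energy_const:
  assumes L: "L > 0"
  shows "energy L (\<lambda>x :: real^'n. c) = L ^ CARD('n) * G c"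
proof -
  interpret z: radial_profile L 0 0 "\<lambda>_. 0" "\<lambda>_. 0" "{}"
    using L by unfold_locales auto
  have "AE x in torus_measure L. wgrad L (\<lambda>x. c) x = (0 :: real^'n)"
    using z.wgrad_radial[of c] by (simp add: z.radial_def[abs_def] z.radial_grad_def)
  then have ae: "AE x in torus_measure L. (norm (wgrad L (\<lambda>x. c) x :: real^'n))\<^sup>2 / 2 + G c = G c"
    by eventually_elim simp
  have "energy L (\<lambda>x :: real^'n. c) = (LINT x|(torus_measure L :: (real^'n) measure). G c)"
  proof -
    have "weak_grad L (\<lambda>x. c) (\<lambda>x :: real^'n. 0 :: real^'n)"
      using z.weak_grad_radial[of c] by (simp add: z.radial_def[abs_def] z.radial_grad_def[abs_def])
    then have "weak_grad L (\<lambda>x :: real^'n. c) (wgrad L (\<lambda>x. c))" unfolding wgrad_def by (rule someI[of "weak_grad L (\<lambda>x :: real^'n. c)"])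
    then have "(\<lambda>x. (norm (wgrad L (\<lambda>x. c) x :: real^'n))\<^sup>2 / 2 + G c) \<in> borel_measurable (torus_measure L)"
      unfolding weak_grad_def by auto
    then show ?thesis unfolding energy_def using ae by (intro integral_cong_AE) auto
  qed
  then show ?thesis using L by (simp add: measure_torus_measure)
qed

text \<open>Polar coordinates for radial integrands. The image of the measure on the ball under the
  norm and the measure with the density of spheres agree on every half line: one side is a
  difference of ball volumes, the other its expression by the fundamental theorem of
  calculus.\<close>

lemma polar_upper_bound:
  fixes h :: "real \<Rightarrow> ennreal"
  assumes h[measurable]: "h \<in> borel_measurable borel" and b: "0 \<le> b"
  shows "(\<integral>\<^sup>+x. h (norm (x :: 'a::euclidean_space)) * indicator (cball 0 b) x \<partial>lborel)
     = (\<integral>\<^sup>+r. h r * ennreal (real DIM('a) * unit_ball_vol DIM('a) * r ^ (DIM('a) - 1)) * indicator {0..b} r \<partial>lborel)"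
proof -
  let ?n = "DIM('a)" and ?\<omega> = "unit_ball_vol DIM('a)"
  define M1 where "M1 = distr (density lborel (indicator (cball (0::'a) b))) borel norm"
  define M2 where "M2 = density lborel (\<lambda>r::real. ennreal (real ?n * ?\<omega> * r ^ (?n - 1)) * indicator {0..b} r)"
  have w: "?\<omega> \<ge> 0" by simp
  have e1: "emeasure M1 {x<..} = ennreal (?\<omega> * b ^ ?n) - ennreal (?\<omega> * (max 0 x) ^ ?n)" if "x \<le> b" for x
  proof -
    have sub: "cball (0::'a) (max 0 x) \<subseteq> cball 0 b" using that b by auto
    have "emeasure M1 {x<..} = emeasure (density lborel (indicator (cball (0::'a) b))) {y. x < norm y}"
      unfolding M1_def by (subst emeasure_distr) (auto simp: vimage_def)
    also have "\<dots> = emeasure lborel (cball 0 b \<inter> {y::'a. x < norm y})"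
      by (subst emeasure_density) (auto intro!: borel_measurable_indicator simp: indicator_inter_arith[symmetric] mult.commute)
    also have "\<dots> = emeasure lborel (cball (0::'a) b - (if x < 0 then {} else cball 0 x))"
      by (intro arg_cong[where f = "emeasure lborel"]) (use norm_ge_zero in \<open>auto intro: less_le_trans\<close>)
    also have "\<dots> = emeasure lborel (cball (0::'a) b) - emeasure lborel (if x < 0 then {} else cball (0::'a) x)"
      using that by (intro emeasure_Diff) (auto simp: emeasure_cball)
    also have "emeasure lborel (if x < 0 then {} else cball (0::'a) x) = ennreal (?\<omega> * (max 0 x) ^ ?n)"
      by (auto simp: emeasure_cball)
    finally show ?thesis using b by (simp add: emeasure_cball)
  qed
  have e2: "emeasure M2 {x<..} = ennreal (?\<omega> * b ^ ?n) - ennreal (?\<omega> * (max 0 x) ^ ?n)" if "x \<le> b" for x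
  proof -
    let ?x = "max 0 x"
    have xb: "?x \<le> b" using that b by simp
    have "emeasure M2 {x<..} = (\<integral>\<^sup>+r. ennreal (real ?n * ?\<omega> * r ^ (?n - 1)) * indicator {0..b} r * indicator {x<..} r \<partial>lborel)"
      unfolding M2_def by (subst emeasure_density) auto
    also have "\<dots> = (\<integral>\<^sup>+r. ennreal (real ?n * ?\<omega> * r ^ (?n - 1)) * indicator {?x..b} r \<partial>lborel)"
    proof (rule nn_integral_cong_AE)
      have "AE r in lborel. r \<noteq> x" by (rule AE_lborel_singleton)
      then show "AE r in lborel. ennreal (real ?n * ?\<omega> * r ^ (?n - 1)) * indicator {0..b} r * indicator {x<..} r
          = ennreal (real ?n * ?\<omega> * r ^ (?n - 1)) * indicator {?x..b} r"
        by eventually_elim (auto simp: indicator_def)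
    qed
    also have "\<dots> = ennreal (?\<omega> * b ^ ?n - ?\<omega> * ?x ^ ?n)"
    proof (rule nn_integral_FTC_Icc)
      show "DERIV (\<lambda>r. ?\<omega> * r ^ ?n) r :> real ?n * ?\<omega> * r ^ (?n - 1)" for r
        by (auto intro!: derivative_eq_intros)
    qed (use xb w in \<open>auto intro!: mult_nonneg_nonneg\<close>)
    also have "\<dots> = ennreal (?\<omega> * b ^ ?n) - ennreal (?\<omega> * ?x ^ ?n)"
      by (rule ennreal_minus[symmetric]) simp
    finally show ?thesis .
  qed
  have big: "emeasure M1 {x<..} = 0" "emeasure M2 {x<..} = 0" if "\<not> x \<le> b" for x
  proof -
    have "emeasure M1 {x<..} = emeasure lborel (cball 0 b \<inter> {y::'a. x < norm y})"
      unfolding M1_def by (subst emeasure_distr, simp, simp, subst emeasure_density)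
        (auto intro!: borel_measurable_indicator simp: indicator_inter_arith[symmetric] mult.commute vimage_def)
    also have "cball 0 b \<inter> {y::'a. x < norm y} = {}" using that by auto
    finally show "emeasure M1 {x<..} = 0" by simp
    have "emeasure M2 {x<..} = (\<integral>\<^sup>+r. ennreal (real ?n * ?\<omega> * r ^ (?n - 1)) * indicator {0..b} r * indicator {x<..} r \<partial>lborel)"
      unfolding M2_def by (subst emeasure_density) auto
    also have "\<dots> = (\<integral>\<^sup>+r. 0 \<partial>(lborel :: real measure))"
      using that by (intro nn_integral_cong) (auto simp: indicator_def)
    finally show "emeasure M2 {x<..} = 0" by simp
  qed
  have "M1 = M2"
  proof (rule measure_eqI_lessThan)
    show "sets M1 = sets borel" "sets M2 = sets borel" by (auto simp: M1_def M2_def)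
    show "emeasure M1 {x<..} < \<infinity>" for x
      by (cases "x \<le> b") (auto simp: e1 big intro: le_less_trans[OF diff_le_self_ennreal])
    show "emeasure M1 {x<..} = emeasure M2 {x<..}" for x
      by (cases "x \<le> b") (auto simp: e1 e2 big)
  qed
  have "(\<integral>\<^sup>+x. h (norm (x :: 'a)) * indicator (cball 0 b) x \<partial>lborel) = (\<integral>\<^sup>+r. h r \<partial>M1)"
  proof -
    have [measurable]: "(\<lambda>x::'a. h (norm x)) \<in> borel_measurable borel"
      by (rule measurable_compose[OF _ h]) measurable
    have "(indicator (cball (0::'a) b) :: 'a \<Rightarrow> ennreal) \<in> borel_measurable lborel"
      by (intro borel_measurable_indicator) auto
    then have "(\<integral>\<^sup>+x. h (norm x) \<partial>density lborel (indicator (cball (0::'a) b))) = (\<integral>\<^sup>+x. indicator (cball 0 b) x * h (norm (x :: 'a)) \<partial>lborel)"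
      by (rule nn_integral_density) measurable
    then show ?thesis unfolding M1_def by (subst nn_integral_distr) (auto simp: mult.commute)
  qed
  also have "\<dots> = (\<integral>\<^sup>+r. h r * ennreal (real ?n * ?\<omega> * r ^ (?n - 1)) * indicator {0..b} r \<partial>lborel)"
    unfolding \<open>M1 = M2\<close> M2_def by (subst nn_integral_density) (auto simp: ac_simps)
  finally show ?thesis .
qed

section \<open>Droplets\<close>

lemma c0_eq: "c0 = 2 * sqrt 2 / 3"
proof -
  have "((\<lambda>s. sqrt (2 * G s)) has_integral (1 - 1 ^ 3 / 3) / sqrt 2 - (- 1 - (- 1) ^ 3 / 3) / sqrt 2) {- 1..1}"
  proof (rule fundamental_theorem_of_calculus)
    fix s :: real assume s: "s \<in> {- 1..1}"
    have "\<bar>s\<bar> \<le> 1" using s unfolding atLeastAtMost_iff by linarith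
    then have "s\<^sup>2 \<le> 1" by (simp add: abs_square_le_1)
    have "2 * G s = ((1 - s\<^sup>2) / sqrt 2)\<^sup>2" by (simp add: G_def power_divide)
    then have "sqrt (2 * G s) = (1 - s\<^sup>2) / sqrt 2" using \<open>s\<^sup>2 \<le> 1\<close> by (simp add: real_sqrt_abs)
    moreover have "((\<lambda>s. (s - s ^ 3 / 3) / sqrt 2) has_real_derivative (1 - s\<^sup>2) / sqrt 2) (at s within {- 1..1})"
      by (intro DERIV_cdivide) (auto intro!: derivative_eq_intros)
    ultimately show "((\<lambda>s. (s - s ^ 3 / 3) / sqrt 2) has_vector_derivative sqrt (2 * G s)) (at s within {- 1..1})"
      by (simp add: has_real_derivative_iff_has_vector_derivative)
  qed simp
  then have "c0 = (1 - 1 ^ 3 / 3) / sqrt 2 - (- 1 - (- 1) ^ 3 / 3) / sqrt 2"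
    unfolding c0_def by (rule integral_unique)
  also have "\<dots> = 2 * sqrt 2 / 3" by (simp add: real_div_sqrt field_simps)
  finally show ?thesis .
qed

text \<open>\<open>b\<close> is the steepening factor and \<open>\<l>\<close> the half width of the
  resulting layer. Steepening multiplies the energy of the layer at most by
  \<open>b\<^sup>2\<close>, so \<open>b\<close> will be chosen close to 1 according to the tolerated
  error.\<close>

locale wall_profile =
  fixes b \<l> :: real
  assumes b: "1 < b" "b \<le> 2" and l: "0 < \<l>" and bl: "b * tanh (\<l> / sqrt 2) = 1"
begin

definition prof :: "real \<Rightarrow> real" where
  "prof s = max (- 1) (min 1 (b * tanh (s / sqrt 2)))"

definition dprof :: "real \<Rightarrow> real" where
  "dprof s = (if \<bar>s\<bar> < \<l> then b * (1 - (tanh (s / sqrt 2))\<^sup>2) / sqrt 2 else 0)"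

lemma prof_low: "s \<le> - \<l> \<Longrightarrow> prof s = - 1"
proof -
  assume "s \<le> - \<l>"
  then have "s / sqrt 2 \<le> - \<l> / sqrt 2" by (rule divide_right_mono) simp
  then have "tanh (s / sqrt 2) \<le> tanh (- \<l> / sqrt 2)" unfolding tanh_real_le_iff .
  then have "b * tanh (s / sqrt 2) \<le> b * tanh (- \<l> / sqrt 2)" using b by (intro mult_left_mono) auto
  then show ?thesis using bl by (simp add: prof_def)
qed

lemma prof_high: "\<l> \<le> s \<Longrightarrow> prof s = 1"
proof -
  assume "\<l> \<le> s"
  then have "tanh (\<l> / sqrt 2) \<le> tanh (s / sqrt 2)" by (simp add: divide_right_mono)
  then have "b * tanh (\<l> / sqrt 2) \<le> b * tanh (s / sqrt 2)" using b by (intro mult_left_mono) auto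
  then show ?thesis using bl by (simp add: prof_def)
qed

lemma prof_mid:
  assumes "\<bar>s\<bar> \<le> \<l>"
  shows "prof s = b * tanh (s / sqrt 2)"
proof -
  have "s \<le> \<l>" "- \<l> \<le> s" using assms by linarith+
  then have "s / sqrt 2 \<le> \<l> / sqrt 2" and "- \<l> / sqrt 2 \<le> s / sqrt 2"
    using divide_right_mono[of s "\<l>" "sqrt 2"] divide_right_mono[of "- \<l>" s "sqrt 2"] by auto
  then have t: "tanh (s / sqrt 2) \<le> tanh (\<l> / sqrt 2)" "tanh (- \<l> / sqrt 2) \<le> tanh (s / sqrt 2)"
    unfolding tanh_real_le_iff .
  have b0: "0 \<le> b" using b by simp
  from mult_left_mono[OF t(1) b0] mult_left_mono[OF t(2) b0]
  show ?thesis using bl by (simp add: prof_def)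
qed

lemma prof_bounds: "- 1 \<le> prof s" "prof s \<le> 1" by (auto simp: prof_def)

lemma dprof_bounds: "0 \<le> dprof s" "dprof s \<le> 2"
proof -
  let ?T = "tanh (s / sqrt 2)"
  have T: "?T\<^sup>2 \<le> 1" using tanh_real_lt_1[of "s / sqrt 2"] tanh_real_gt_neg1[of "s / sqrt 2"] by (simp add: abs_square_le_1)
  then show "0 \<le> dprof s" using b by (simp add: dprof_def)
  have "b * (1 - ?T\<^sup>2) \<le> 2 * 1" using b T by (intro mult_mono) auto
  then have "b * (1 - ?T\<^sup>2) / sqrt 2 \<le> 2 / 1" using b T by (intro frac_le) auto
  then show "dprof s \<le> 2" by (simp add: dprof_def)
qed

lemma tanh_prof_deriv: "((\<lambda>s. b * tanh (s / sqrt 2)) has_real_derivative b * (1 - (tanh (s / sqrt 2))\<^sup>2) / sqrt 2) (at s)"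
proof -
  have "((\<lambda>s. s / sqrt 2) has_real_derivative 1 / sqrt 2) (at s)" by (intro DERIV_cdivide DERIV_ident)
  then have "((\<lambda>s. tanh (s / sqrt 2)) has_real_derivative (1 - (tanh (s / sqrt 2))\<^sup>2) * (1 / sqrt 2)) (at s)"
    by (intro has_field_derivative_tanh) auto
  from DERIV_cmult[OF this, of b] show ?thesis by simp
qed

lemma prof_lipschitz: "\<bar>prof s - prof t\<bar> \<le> 2 * \<bar>s - t\<bar>"
proof -
  have "norm (b * tanh (s / sqrt 2) - b * tanh (t / sqrt 2)) \<le> 2 * norm (s - t)"
  proof (rule field_differentiable_bound[where S = UNIV])
    fix z :: real
    show "((\<lambda>s. b * tanh (s / sqrt 2)) has_field_derivative b * (1 - (tanh (z / sqrt 2))\<^sup>2) / sqrt 2) (at z within UNIV)"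
      using tanh_prof_deriv by simp
    let ?T = "tanh (z / sqrt 2)"
    have T: "?T\<^sup>2 \<le> 1" using tanh_real_lt_1[of "z / sqrt 2"] tanh_real_gt_neg1[of "z / sqrt 2"] by (simp add: abs_square_le_1)
    have "b * (1 - ?T\<^sup>2) \<le> 2 * 1" using b T by (intro mult_mono) auto
    then have "b * (1 - ?T\<^sup>2) / sqrt 2 \<le> 2 / 1" using b T by (intro frac_le) auto
    then show "norm (b * (1 - ?T\<^sup>2) / sqrt 2) \<le> 2" using b T by simp
  qed auto
  then have "\<bar>b * tanh (s / sqrt 2) - b * tanh (t / sqrt 2)\<bar> \<le> 2 * \<bar>s - t\<bar>" by simp
  moreover have "\<bar>prof s - prof t\<bar> \<le> \<bar>b * tanh (s / sqrt 2) - b * tanh (t / sqrt 2)\<bar>"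
    unfolding prof_def by (auto simp: max_def min_def)
  ultimately show ?thesis by linarith
qed

lemma prof_deriv:
  assumes "\<bar>s\<bar> \<noteq> \<l>"
  shows "(prof has_real_derivative dprof s) (at s)"
proof -
  consider "\<bar>s\<bar> < \<l>" | "\<l> < s" | "s < - \<l>" using assms by linarith
  then show ?thesis
  proof cases
    case 1
    have "((\<lambda>s. b * tanh (s / sqrt 2)) has_real_derivative dprof s) (at s)"
      using tanh_prof_deriv[of s] 1 by (simp add: dprof_def)
    then show ?thesis
      by (rule has_field_derivative_transform_within_open[where S = "{- \<l><..<\<l>}"])
        (use 1 prof_mid in \<open>auto simp: abs_less_iff\<close>)
  next
    case 2
    have "((\<lambda>s. 1) has_real_derivative dprof s) (at s)" using 2 l by (simp add: dprof_def)
    then show ?thesis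
      by (rule has_field_derivative_transform_within_open[where S = "{\<l><..}"])
        (use 2 prof_high in auto)
  next
    case 3
    have "((\<lambda>s. - 1) has_real_derivative dprof s) (at s)" using 3 l by (simp add: dprof_def)
    then show ?thesis
      by (rule has_field_derivative_transform_within_open[where S = "{..< - \<l>}"])
        (use 3 prof_low in auto)
  qed
qed

lemma dprof_isCont:
  assumes "\<bar>s\<bar> \<noteq> \<l>"
  shows "isCont dprof s"
proof -
  consider "\<bar>s\<bar> < \<l>" | "\<l> < \<bar>s\<bar>" using assms by linarith
  then show ?thesis
  proof cases
    case 1
    have "isCont (\<lambda>s. b * (1 - (tanh (s / sqrt 2))\<^sup>2) / sqrt 2) s" by (intro continuous_intros) auto
    moreover have "eventually (\<lambda>s. s \<in> {- \<l><..<\<l>}) (nhds s)"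
      using 1 by (intro eventually_nhds_in_open) (auto simp: abs_less_iff)
    then have "eventually (\<lambda>s. dprof s = b * (1 - (tanh (s / sqrt 2))\<^sup>2) / sqrt 2) (nhds s)"
      by eventually_elim (auto simp: dprof_def abs_less_iff)
    ultimately show ?thesis by (subst isCont_cong)
  next
    case 2
    have "open {s::real. \<l> < \<bar>s\<bar>}" by (intro open_Collect_less continuous_intros)
    then have "eventually (\<lambda>s. s \<in> {s. \<l> < \<bar>s\<bar>}) (nhds s)" using 2 by (intro eventually_nhds_in_open) auto
    then have "eventually (\<lambda>s. dprof s = 0) (nhds s)" by eventually_elim (auto simp: dprof_def)
    moreover have "isCont (\<lambda>s. 0 :: real) s" by simp
    ultimately show ?thesis by (subst isCont_cong)
  qed
qed

lemma dprof_measurable [measurable]: "dprof \<in> borel_measurable borel"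
proof -
  have [measurable]: "(\<lambda>s::real. tanh (s / sqrt 2)) \<in> borel_measurable borel"
    by (intro borel_measurable_continuous_onI continuous_intros) auto
  show ?thesis unfolding dprof_def[abs_def] by measurable
qed

text \<open>\<open>b\<^sup>2\<close> times the energy density of the profile
  \<open>tanh (s / sqrt 2)\<close>, whose gradient and potential parts are equal.\<close>

definition wall_energy :: "real \<Rightarrow> real" where
  "wall_energy s = b\<^sup>2 * (1 - (tanh (s / sqrt 2))\<^sup>2)\<^sup>2 / 2"

text \<open>Steepening multiplies the gradient part by \<open>b\<^sup>2\<close>, and it moves the
  values towards \<plusminus> 1, which lowers the potential part.\<close>

lemma wall_energy_bound:
  assumes "\<bar>s\<bar> \<le> \<l>"
  shows "(dprof s)\<^sup>2 / 2 + G (prof s) \<le> wall_energy s"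
proof -
  let ?T = "tanh (s / sqrt 2)"
  have T: "?T\<^sup>2 \<le> 1" using tanh_real_lt_1[of "s / sqrt 2"] tanh_real_gt_neg1[of "s / sqrt 2"] by (simp add: abs_square_le_1)
  have "(dprof s)\<^sup>2 \<le> (b * (1 - ?T\<^sup>2) / sqrt 2)\<^sup>2" by (simp add: dprof_def)
  then have d: "(dprof s)\<^sup>2 / 2 \<le> b\<^sup>2 * (1 - ?T\<^sup>2)\<^sup>2 / 4" by (simp add: power_divide power_mult_distrib)
  have "\<bar>prof s\<bar> \<le> 1" using prof_bounds[of s] by linarith
  then have "(b * ?T)\<^sup>2 \<le> 1" unfolding prof_mid[OF assms] by (simp add: abs_square_le_1)
  moreover have "1 * ?T\<^sup>2 \<le> b\<^sup>2 * ?T\<^sup>2" using b by (intro mult_right_mono) auto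
  ultimately have "(1 - (b * ?T)\<^sup>2)\<^sup>2 \<le> (1 - ?T\<^sup>2)\<^sup>2" by (intro power_mono) (auto simp: power_mult_distrib)
  also have "\<dots> \<le> b\<^sup>2 * (1 - ?T\<^sup>2)\<^sup>2"
    using b mult_right_mono[of 1 "b\<^sup>2" "(1 - ?T\<^sup>2)\<^sup>2"] by simp
  finally have "G (prof s) \<le> b\<^sup>2 * (1 - ?T\<^sup>2)\<^sup>2 / 4" unfolding prof_mid[OF assms] G_def by simp
  with d show ?thesis by (simp add: wall_energy_def)
qed

lemma wall_energy_nonneg: "0 \<le> wall_energy s" by (simp add: wall_energy_def)

lemma wall_energy_measurable [measurable]: "wall_energy \<in> borel_measurable borel"
  unfolding wall_energy_def[abs_def] by (intro borel_measurable_continuous_onI continuous_intros) auto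

lemma wall_energy_integral: "(\<integral>\<^sup>+s. ennreal (wall_energy (R - s)) * indicator {R - \<l>..R + \<l>} s \<partial>lborel) \<le> ennreal (b\<^sup>2 * c0)"
proof -
  \<comment> \<open>For \<open>T = tanh (s / sqrt 2)\<close> the derivative is
    \<open>(1 - T\<^sup>2) / sqrt 2\<close>, so \<open>T - T ^ 3 / 3\<close> has derivative
    \<open>(1 - T\<^sup>2)\<^sup>2 / sqrt 2\<close>. The minus sign compensates the reversed
    argument \<open>R - s\<close>.\<close>
  define F where "F s = - b\<^sup>2 * (tanh ((R - s) / sqrt 2) - tanh ((R - s) / sqrt 2) ^ 3 / 3) / sqrt 2" for s
  have "(\<integral>\<^sup>+s. ennreal (wall_energy (R - s)) * indicator {R - \<l>..R + \<l>} s \<partial>lborel) = ennreal (F (R + \<l>) - F (R - \<l>))"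
  proof (rule nn_integral_FTC_Icc)
    show "(\<lambda>s. wall_energy (R - s)) \<in> borel_measurable borel" by measurable
    show "DERIV F s :> wall_energy (R - s)" for s
    proof -
      let ?T = "tanh ((R - s) / sqrt 2)"
      define d where "d = (1 - ?T\<^sup>2) * (- 1 / sqrt 2)"
      have "((\<lambda>s. (R - s) / sqrt 2) has_real_derivative - 1 / sqrt 2) (at s)"
        by (intro DERIV_cdivide) (auto intro!: derivative_eq_intros)
      then have T: "((\<lambda>s. tanh ((R - s) / sqrt 2)) has_real_derivative d) (at s)"
        unfolding d_def by (intro has_field_derivative_tanh) auto
      have "DERIV (\<lambda>s. tanh ((R - s) / sqrt 2) ^ 3) s :> 3 * ?T\<^sup>2 * d"
        by (rule DERIV_cong[OF DERIV_power[OF T]]) simp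
      then have "DERIV F s :> - b\<^sup>2 * (d - 3 * ?T\<^sup>2 * d / 3) / sqrt 2"
        unfolding F_def by (intro DERIV_cdivide DERIV_cmult DERIV_diff T)
      also have "- b\<^sup>2 * (d - 3 * ?T\<^sup>2 * d / 3) / sqrt 2 = - b\<^sup>2 * (1 - ?T\<^sup>2) * (d / sqrt 2)"
        by (simp add: algebra_simps diff_divide_distrib)
      also have "d / sqrt 2 = - (1 - ?T\<^sup>2) / 2"
      proof -
        define q where "q = 1 - ?T\<^sup>2"
        have "d / sqrt 2 = - q / (sqrt 2 * sqrt 2)" by (simp only: d_def q_def[symmetric]) simp
        then show ?thesis by (simp add: q_def)
      qed
      also have "- b\<^sup>2 * (1 - ?T\<^sup>2) * (- (1 - ?T\<^sup>2) / 2) = wall_energy (R - s)"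
      proof -
        have "- B * q * (- q / 2) = B * q\<^sup>2 / 2" for B q :: real by (simp add: power2_eq_square)
        then show ?thesis unfolding wall_energy_def .
      qed
      finally show ?thesis .
    qed
  qed (use l wall_energy_nonneg in auto)
  also have "\<dots> \<le> ennreal (b\<^sup>2 * c0)"
  proof (rule ennreal_leI)
    let ?T = "tanh (\<l> / sqrt 2)"
    have T: "0 \<le> ?T" "?T \<le> 1" using l tanh_real_lt_1[of "\<l> / sqrt 2"] by auto
    define k where "k = ?T - ?T ^ 3 / 3"
    have cube: "(- ?T) ^ 3 = - (?T ^ 3)" by (simp add: power3_eq_cube)
    have "F (R + \<l>) = - b\<^sup>2 * (- k) / sqrt 2" "F (R - \<l>) = - b\<^sup>2 * k / sqrt 2"
      unfolding F_def k_def by (simp_all add: cube)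
    then have "F (R + \<l>) - F (R - \<l>) = b\<^sup>2 * (2 * (?T - ?T ^ 3 / 3) / sqrt 2)"
      unfolding k_def[symmetric] by simp
    moreover have "?T - ?T ^ 3 / 3 \<le> 2 / 3"
    proof -
      have "2 - 3 * ?T + ?T ^ 3 = (1 - ?T)\<^sup>2 * (2 + ?T)" by (simp add: power2_eq_square power3_eq_cube algebra_simps)
      also have "\<dots> \<ge> 0" using T by simp
      finally show ?thesis by simp
    qed
    then have "2 * (?T - ?T ^ 3 / 3) / sqrt 2 \<le> 2 * (2 / 3) / sqrt 2" by (intro divide_right_mono mult_left_mono) auto
    moreover have "2 * (2 / 3) / sqrt 2 = c0" unfolding c0_eq by (simp add: field_simps)
    ultimately show "F (R + \<l>) - F (R - \<l>) \<le> b\<^sup>2 * c0" by (metis mult_left_mono zero_le_power2)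
  qed
  finally show ?thesis .
qed

text \<open>Measured from the lower well, so that it has compact support and can be added to a
  constant background.\<close>

definition droplet :: "real \<Rightarrow> real^'n \<Rightarrow> real" where
  "droplet R x = 1 + prof (R - norm x)"

definition droplet_grad :: "real \<Rightarrow> real^'n \<Rightarrow> real^'n" where
  "droplet_grad R x = (- dprof (R - norm x)) *\<^sub>R sgn x"

lemma radial_profile_prof:
  assumes "0 < L" "R + \<l> < L / 2"
  shows "radial_profile L (R + \<l>) 2 (\<lambda>r. 1 + prof (R - r)) (\<lambda>r. - dprof (R - r)) {R - \<l>, R + \<l>}"
proof
  show "\<bar>(1 + prof (R - s)) - (1 + prof (R - t))\<bar> \<le> 2 * \<bar>s - t\<bar>" for s t
    using prof_lipschitz[of "R - s" "R - t"] by (simp add: abs_minus_commute)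
  show "1 + prof (R - s) = 0" if "R + \<l> \<le> s" for s using prof_low[of "R - s"] that by simp
  show "((\<lambda>r. 1 + prof (R - r)) has_real_derivative - dprof (R - s)) (at s)" if "s \<notin> {R - \<l>, R + \<l>}" for s
  proof -
    have "\<bar>R - s\<bar> \<noteq> \<l>" using that by auto
    from prof_deriv[OF this] have "((\<lambda>r. prof (R - r)) has_real_derivative dprof (R - s) * - 1) (at s)"
      by (rule DERIV_chain2[where f = prof and g = "\<lambda>r. R - r"]) (auto intro!: derivative_eq_intros)
    then show ?thesis by (auto intro!: derivative_eq_intros)
  qed
  show "\<bar>- dprof (R - s)\<bar> \<le> 2" for s using dprof_bounds[of "R - s"] by simp
qed (use assms in auto)

lemma droplet_bounds: "0 \<le> droplet R x" "droplet R x \<le> 2"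
  using prof_bounds[of "R - norm x"] by (auto simp: droplet_def)

lemma droplet_outside: "R + \<l> \<le> norm x \<Longrightarrow> droplet R x = 0"
  using prof_low[of "R - norm x"] by (simp add: droplet_def)

lemma droplet_inside: "norm x \<le> R - \<l> \<Longrightarrow> droplet R x = 2"
  using prof_high[of "R - norm x"] by (simp add: droplet_def)

lemma droplet_lipschitz_radius: "\<bar>droplet R x - droplet R' x\<bar> \<le> 2 * \<bar>R - R'\<bar>"
  using prof_lipschitz[of "R - norm x" "R' - norm x"] by (simp add: droplet_def)

lemma continuous_prof: "continuous_on UNIV prof"
  unfolding prof_def[abs_def] by (intro continuous_intros) auto

lemma continuous_droplet: "continuous_on UNIV (droplet R)"
  unfolding droplet_def[abs_def] by (intro continuous_intros continuous_on_compose2[OF continuous_prof]) auto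

context
  fixes L :: real
  assumes L: "0 < L"
begin

lemma
  assumes "R + \<l> < L / 2"
  shows droplet_weak_grad: "weak_grad L (\<lambda>x. c + droplet R x) (droplet_grad R :: real^'n \<Rightarrow> real^'n)"
    and droplet_wgrad: "AE x in torus_measure L. wgrad L (\<lambda>x. c + droplet R x) x = (droplet_grad R x :: real^'n)"
    and droplet_grad_measurable: "(droplet_grad R :: real^'n \<Rightarrow> real^'n) \<in> borel_measurable (torus_measure L)"
proof -
  interpret radial_profile L "R + \<l>" 2 "\<lambda>r. 1 + prof (R - r)" "\<lambda>r. - dprof (R - r)" "{R - \<l>, R + \<l>}"
    by (rule radial_profile_prof[OF L assms])
  have e: "radial = (droplet R :: real^'n \<Rightarrow> real)" "radial_grad = (droplet_grad R :: real^'n \<Rightarrow> real^'n)"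
    by (auto simp: fun_eq_iff radial_def radial_grad_def droplet_def droplet_grad_def)
  show "weak_grad L (\<lambda>x. c + droplet R x) (droplet_grad R :: real^'n \<Rightarrow> real^'n)"
  proof -
    have "weak_grad L (\<lambda>x. c + radial x) (radial_grad :: real^'n \<Rightarrow> real^'n)" by (rule weak_grad_radial)
    then show ?thesis unfolding e .
  qed
  show "AE x in torus_measure L. wgrad L (\<lambda>x. c + droplet R x) x = (droplet_grad R x :: real^'n)"
  proof -
    have "AE x in torus_measure L. wgrad L (\<lambda>x. c + radial x) x = (radial_grad x :: real^'n)" by (rule wgrad_radial)
    then show ?thesis unfolding e .
  qed
  show "(droplet_grad R :: real^'n \<Rightarrow> real^'n) \<in> borel_measurable (torus_measure L)"
  proof -
    have "(radial_grad :: real^'n \<Rightarrow> real^'n) \<in> borel_measurable (torus_measure L)"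
      by (rule measurable_borel_torus[OF measurable_radial_grad])
    then show ?thesis unfolding e .
  qed
qed

lemma droplet_grad_bound: "norm (droplet_grad R x) \<le> 2"
  using dprof_bounds[of "R - norm x"] by (simp add: droplet_grad_def norm_sgn)

definition droplet_mass :: "'n::finite itself \<Rightarrow> real \<Rightarrow> real" where
  "droplet_mass _ R = (LINT x|(torus_measure L :: (real^'n) measure). droplet R x)"

lemma integrable_droplet: "integrable (torus_measure L) (droplet R)"
  by (rule set_lborel_integrable_imp_torus(1)[OF continuous_droplet])

lemma cball_subset_torus: "r \<le> L / 2 \<Longrightarrow> cball (0 :: real^'n) r \<subseteq> torus L"
proof
  fix x :: "real^'n" assume "r \<le> L / 2" "x \<in> cball 0 r"
  then have n: "norm x \<le> L / 2" by simp
  have "- (L / 2) \<le> x $ i \<and> x $ i \<le> L / 2" for i using component_le_norm_cart[of x i] n by linarith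
  then show "x \<in> torus L" by (simp add: torus_def)
qed

lemma integral_cball_indicator:
  assumes "0 \<le> r" "r \<le> L / 2"
  shows "integrable (torus_measure L) (indicator (cball (0 :: real^'n) r) :: _ \<Rightarrow> real)"
    and "(LINT x|torus_measure L. indicator (cball (0 :: real^'n) r) x) = unit_ball_vol CARD('n) * r ^ CARD('n)"
proof -
  have sub: "cball (0 :: real^'n) r \<subseteq> torus L" by (rule cball_subset_torus[OF assms(2)])
  have s: "cball (0 :: real^'n) r \<in> sets (torus_measure L)"
    using sub by (subst sets_restrict_space_iff) auto
  then show "integrable (torus_measure L) (indicator (cball (0 :: real^'n) r) :: _ \<Rightarrow> real)"
    by (intro integrable_torus_bounded[where B = 1]) auto
  have "(LINT x|torus_measure L. indicator (cball (0 :: real^'n) r) x :: real) = measure (torus_measure L) (cball (0 :: real^'n) r)"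
    using s sets.sets_into_space[OF s] by (simp add: Int_absorb2)
  also have "\<dots> = measure lborel (cball (0 :: real^'n) r)"
    using sub by (simp add: measure_restrict_space)
  also have "\<dots> = unit_ball_vol CARD('n) * r ^ CARD('n)" using content_cball[OF assms(1), of "0 :: real^'n"] by simp
  finally show "(LINT x|torus_measure L. indicator (cball (0 :: real^'n) r) x) = unit_ball_vol CARD('n) * r ^ CARD('n)" .
qed

text \<open>The droplet lies between twice the indicators of the balls of radius
  \<open>R - \<l>\<close> and \<open>R + \<l>\<close>. Radii down to \<open>- \<l>\<close> are
  included because the path of droplets starts there; \<open>max 0\<close> covers those whose inner
  ball is empty.\<close>

lemma droplet_mass_bounds:
  assumes R: "- \<l> \<le> R" "R + \<l> < L / 2"
  shows "droplet_mass TYPE('n) R \<le> 2 * unit_ball_vol CARD('n) * (R + \<l>) ^ CARD('n)"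
    and "2 * unit_ball_vol CARD('n) * (max 0 (R - \<l>)) ^ CARD('n) \<le> droplet_mass TYPE('n::finite) R"
    and "0 \<le> droplet_mass TYPE('n) R"
proof -
  note I = integral_cball_indicator[where 'n = 'n, of "R + \<l>"]
  have "droplet_mass TYPE('n) R \<le> (LINT x|(torus_measure L :: (real^'n) measure). 2 * indicator (cball 0 (R + \<l>)) x)"
    unfolding droplet_mass_def
  proof (rule integral_mono)
    fix x :: "real^'n"
    show "droplet R x \<le> 2 * indicator (cball 0 (R + \<l>)) x"
      using droplet_bounds[of R x] droplet_outside[of R x] by (cases "norm x \<le> R + \<l>") auto
  qed (use I R integrable_droplet in auto)
  also have "\<dots> = 2 * unit_ball_vol CARD('n) * (R + \<l>) ^ CARD('n)" using I R by simp
  finally show "droplet_mass TYPE('n) R \<le> 2 * unit_ball_vol CARD('n) * (R + \<l>) ^ CARD('n)" .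
  show nn: "0 \<le> droplet_mass TYPE('n) R"
    unfolding droplet_mass_def using droplet_bounds by (intro Bochner_Integration.integral_nonneg) auto
  show "2 * unit_ball_vol CARD('n) * (max 0 (R - \<l>)) ^ CARD('n) \<le> droplet_mass TYPE('n) R"
  proof (cases "0 \<le> R - \<l>")
    case False
    then show ?thesis using nn by (simp add: max_def power_0_left)
  next
    case True
    note J = integral_cball_indicator[where 'n = 'n, of "R - \<l>"]
    have RL: "R - \<l> \<le> L / 2" using R l by linarith
    have "2 * unit_ball_vol CARD('n) * (R - \<l>) ^ CARD('n) = (LINT x|(torus_measure L :: (real^'n) measure). 2 * indicator (cball 0 (R - \<l>)) x)"
      using J[OF True RL] by simp
    also have "\<dots> \<le> droplet_mass TYPE('n) R"
      unfolding droplet_mass_def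
    proof (rule integral_mono)
      fix x :: "real^'n"
      show "2 * indicator (cball 0 (R - \<l>)) x \<le> droplet R x"
        using droplet_bounds[of R x] droplet_inside[of x R] by (cases "norm x \<le> R - \<l>") auto
    qed (use J[OF True RL] integrable_droplet in auto)
    finally show ?thesis using True by (simp add: max_def)
  qed
qed

end

end

section \<open>The energy of a single droplet\<close>

lemma G_shift_bound:
  assumes "\<bar>q\<bar> \<le> 1" "\<bar>c\<bar> \<le> 1"
  shows "G (q + c) \<le> G q + 6 * \<bar>c\<bar>"
proof -
  have "G (q + c) - G q = c * ((2 * q + c) * ((q + c)\<^sup>2 + q\<^sup>2 - 2) / 4)"
    by (simp add: G_def power2_eq_square field_simps)
  also have "\<dots> \<le> \<bar>c\<bar> * 6"
  proof -
    have q2: "q\<^sup>2 \<le> 1" using assms by (simp add: abs_square_le_1)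
    have "\<bar>q + c\<bar> \<le> 2" using assms by linarith
    then have "(q + c)\<^sup>2 \<le> 2\<^sup>2" by (metis abs_ge_zero power2_abs power_mono)
    then have "(q + c)\<^sup>2 \<le> 4" by simp
    then have "\<bar>(q + c)\<^sup>2 + q\<^sup>2 - 2\<bar> \<le> 8" using q2 zero_le_power2[of q] zero_le_power2[of "q + c"] by linarith
    moreover have "\<bar>2 * q + c\<bar> \<le> 3" using assms by linarith
    ultimately have "\<bar>2 * q + c\<bar> * \<bar>(q + c)\<^sup>2 + q\<^sup>2 - 2\<bar> \<le> 3 * 8" by (intro mult_mono) auto
    then have "\<bar>(2 * q + c) * ((q + c)\<^sup>2 + q\<^sup>2 - 2) / 4\<bar> \<le> 6" by (simp add: abs_mult)
    then have "\<bar>c * ((2 * q + c) * ((q + c)\<^sup>2 + q\<^sup>2 - 2) / 4)\<bar> \<le> \<bar>c\<bar> * 6"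
      unfolding abs_mult[of c] by (intro mult_left_mono) auto
    then show ?thesis by linarith
  qed
  finally show ?thesis by simp
qed

lemma G_nonneg: "0 \<le> G s" by (simp add: G_def)

text \<open>Since \<open>G (- 1 + c) = c\<^sup>2 - c ^ 3 + c ^ 4 / 4\<close>, lowering the
  background from \<phi> by \<open>t\<close> gains \<open>2 * \<phi> * t\<close> and costs
  \<open>t\<^sup>2\<close> up to relative errors. A droplet of volume \<open>A\<close> depletes the
  background by about \<open>t = 2 * A / L ^ n\<close>, which multiplied by the volume of the torus
  gives \<open>- 4 * \<phi> * A\<close> and \<open>4 * A\<^sup>2 / L ^ n\<close>.\<close>

lemma G_background_shift:
  assumes "0 < \<phi>" "\<phi> \<le> M" "M \<le> 1" "0 \<le> t" "t \<le> M"
  shows "G (- 1 + (\<phi> - t)) - G (- 1 + \<phi>) \<le> - 2 * \<phi> * (1 - 3 / 2 * \<phi>) * t + (1 + 3 * M) * t\<^sup>2"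
proof -
  have e: "G (- 1 + (\<phi> - t)) - G (- 1 + \<phi>) = - 2 * \<phi> * (1 - 3 / 2 * \<phi>) * t + t\<^sup>2
     + (- 3 * \<phi> * t\<^sup>2 + t * t\<^sup>2 - \<phi> ^ 3 * t + 3 / 2 * \<phi>\<^sup>2 * t\<^sup>2 - \<phi> * t ^ 3 + t\<^sup>2 / 4 * t\<^sup>2)"
    by (simp add: G_def power2_eq_square power3_eq_cube field_simps)
  have "t * t\<^sup>2 \<le> M * t\<^sup>2" using assms by (intro mult_right_mono) auto
  moreover have "3 / 2 * \<phi>\<^sup>2 * t\<^sup>2 \<le> 3 / 2 * M * t\<^sup>2"
  proof -
    have "\<phi>\<^sup>2 \<le> M" using assms by (simp add: power2_eq_square) (meson less_imp_le mult_left_le order_trans)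
    then show ?thesis by (intro mult_right_mono mult_left_mono) auto
  qed
  moreover have "t\<^sup>2 / 4 * t\<^sup>2 \<le> M / 2 * t\<^sup>2"
  proof -
    have "t\<^sup>2 \<le> M" using assms by (simp add: power2_eq_square) (meson mult_left_le order_trans)
    then have "t\<^sup>2 / 4 \<le> M / 2" using assms by simp
    then show ?thesis by (intro mult_right_mono) auto
  qed
  moreover have "0 \<le> 3 * \<phi> * t\<^sup>2" "0 \<le> \<phi> ^ 3 * t" "0 \<le> \<phi> * t ^ 3" using assms by auto
  moreover have "(1 + 3 * M) * t\<^sup>2 = t\<^sup>2 + M * t\<^sup>2 + 3 / 2 * M * t\<^sup>2 + M / 2 * t\<^sup>2" by (simp add: algebra_simps)
  ultimately show ?thesis unfolding e by linarith
qed

context wall_profile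
begin

text \<open>In the interior of the droplet both wells are shifted by the same \<open>c\<close>.
  Because \<open>G\<close> is even, the difference \<open>G (1 + c) - G (- 1 + c)\<close> is
  \<open>2 * c ^ 3\<close>, so the interior costs only a third order term. In the layer the shift
  changes the potential by at most \<open>6 * \<bar>c\<bar>\<close>.\<close>

lemma droplet_density_bound:
  assumes c: "\<bar>c\<bar> \<le> 1"
  shows "(norm (droplet_grad R x))\<^sup>2 / 2 + G (- 1 + c + droplet R x) - G (- 1 + c)
    \<le> (wall_energy (R - norm x) + 6 * \<bar>c\<bar>) * indicator {R - \<l>..R + \<l>} (norm x) + 2 * \<bar>c\<bar> ^ 3 * indicator (cball 0 (R + \<l>)) x"
proof -
  let ?s = "R - norm x"
  have ng: "norm (droplet_grad R x) \<le> dprof ?s"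
    by (cases "x = 0") (auto simp: droplet_grad_def norm_sgn dprof_bounds)
  then have g: "(norm (droplet_grad R x))\<^sup>2 \<le> (dprof ?s)\<^sup>2" by (intro power_mono) auto
  have c3: "0 \<le> 2 * \<bar>c\<bar> ^ 3 * indicator (cball 0 (R + \<l>)) x" by simp
  consider "\<bar>?s\<bar> \<le> \<l>" | "?s < - \<l>" | "\<l> < ?s" by linarith
  then show ?thesis
  proof cases
    case 1
    have p: "\<bar>prof ?s\<bar> \<le> 1" using prof_bounds[of ?s] by linarith
    have "G (- 1 + c + droplet R x) = G (prof ?s + c)" by (simp add: droplet_def add_ac)
    then have "G (- 1 + c + droplet R x) \<le> G (prof ?s) + 6 * \<bar>c\<bar>" using G_shift_bound[OF p c] by simp
    then have "(norm (droplet_grad R x))\<^sup>2 / 2 + G (- 1 + c + droplet R x) - G (- 1 + c) \<le> wall_energy ?s + 6 * \<bar>c\<bar>"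
      using wall_energy_bound[OF 1] g G_nonneg[of "- 1 + c"] by linarith
    moreover have "indicator {R - \<l>..R + \<l>} (norm x) = (1::real)" using 1 by (auto simp: abs_le_iff)
    ultimately have "(norm (droplet_grad R x))\<^sup>2 / 2 + G (- 1 + c + droplet R x) - G (- 1 + c)
      \<le> (wall_energy ?s + 6 * \<bar>c\<bar>) * indicator {R - \<l>..R + \<l>} (norm x)" by simp
    then show ?thesis using c3 by linarith
  next
    case 2
    then have "droplet R x = 0" "dprof ?s = 0" using l by (auto intro!: droplet_outside simp: dprof_def)
    then have "(norm (droplet_grad R x))\<^sup>2 / 2 + G (- 1 + c + droplet R x) - G (- 1 + c) \<le> 0" using g by simp
    moreover have "0 \<le> (wall_energy ?s + 6 * \<bar>c\<bar>) * indicator {R - \<l>..R + \<l>} (norm x)"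
      using wall_energy_nonneg by simp
    ultimately show ?thesis using c3 by linarith
  next
    case 3
    then have d: "droplet R x = 2" "dprof ?s = 0" using l by (auto intro!: droplet_inside simp: dprof_def)
    have "G (- 1 + c + 2) - G (- 1 + c) = 2 * c ^ 3"
      by (simp add: G_def power2_eq_square power3_eq_cube field_simps)
    also have "\<dots> \<le> 2 * \<bar>c\<bar> ^ 3" by (simp add: power_abs[symmetric])
    finally have "(norm (droplet_grad R x))\<^sup>2 / 2 + G (- 1 + c + droplet R x) - G (- 1 + c) \<le> 2 * \<bar>c\<bar> ^ 3"
      using g d by simp
    moreover have "indicator (cball 0 (R + \<l>)) x = (1::real)" using 3 l by simp
    moreover have "0 \<le> (wall_energy ?s + 6 * \<bar>c\<bar>) * indicator {R - \<l>..R + \<l>} (norm x)"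
      using wall_energy_nonneg by simp
    ultimately show ?thesis by simp
  qed
qed

lemma wall_energy_le: "wall_energy s \<le> 2"
proof -
  let ?T = "tanh (s / sqrt 2)"
  have T: "?T\<^sup>2 \<le> 1" using tanh_real_lt_1[of "s / sqrt 2"] tanh_real_gt_neg1[of "s / sqrt 2"] by (simp add: abs_square_le_1)
  have "b\<^sup>2 * (1 - ?T\<^sup>2)\<^sup>2 \<le> 2\<^sup>2 * 1\<^sup>2" using b T by (intro mult_mono power_mono) auto
  then show ?thesis by (simp add: wall_energy_def)
qed

context
  fixes L :: real
  assumes L: "0 < L"
begin

text \<open>In polar coordinates the area of the spheres in the layer is at most that of the
  outermost one. What remains is the one-dimensional wall energy, plus \<open>k\<close> times the
  width \<open>2 * \<l>\<close>.\<close>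

lemma shell_integral_bound:
  assumes R: "- \<l> \<le> R" and k: "0 \<le> k"
  shows "(LINT x|(torus_measure L :: (real^'n) measure). (wall_energy (R - norm x) + k) * indicator {R - \<l>..R + \<l>} (norm x))
     \<le> real CARD('n) * unit_ball_vol CARD('n) * (R + \<l>) ^ (CARD('n) - 1) * (b\<^sup>2 * c0 + 2 * \<l> * k)"
proof (rule integral_real_bounded)
  let ?n = "CARD('n)"
  define H where "H r = (wall_energy (R - r) + k) * indicator {R - \<l>..R + \<l>} r" for r
  define K where "K = real ?n * unit_ball_vol ?n * (R + \<l>) ^ (?n - 1)"
  have H0: "0 \<le> H r" for r using wall_energy_nonneg k by (simp add: H_def)
  have Hm[measurable]: "H \<in> borel_measurable borel" unfolding H_def[abs_def] by measurable
  have c00: "0 \<le> c0" by (simp add: c0_eq)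
  have K0: "0 \<le> K" using R by (simp add: K_def)
  show "0 \<le> real ?n * unit_ball_vol ?n * (R + \<l>) ^ (?n - 1) * (b\<^sup>2 * c0 + 2 * \<l> * k)"
    using R l k c00 by (intro mult_nonneg_nonneg add_nonneg_nonneg) auto
  have "(\<integral>\<^sup>+x. ennreal (H (norm x)) \<partial>(torus_measure L :: (real^'n) measure)) = (\<integral>\<^sup>+x. ennreal (H (norm x)) * indicator (torus L :: (real^'n) set) x \<partial>lborel)"
    by (rule nn_integral_torus) measurable
  also have "\<dots> \<le> (\<integral>\<^sup>+x. ennreal (H (norm x)) * indicator (cball (0 :: real^'n) (R + \<l>)) x \<partial>lborel)"
    by (intro nn_integral_mono) (auto simp: H_def split: split_indicator)
  also have "\<dots> = (\<integral>\<^sup>+r. ennreal (H r) * ennreal (real DIM(real^'n) * unit_ball_vol DIM(real^'n) * r ^ (DIM(real^'n) - 1)) * indicator {0..R + \<l>} r \<partial>lborel)"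
    by (rule polar_upper_bound[where h = "\<lambda>r. ennreal (H r)"]) (use R in auto)
  also have "\<dots> \<le> (\<integral>\<^sup>+r. ennreal K * ennreal (H r) \<partial>lborel)"
  proof (rule nn_integral_mono)
    fix r :: real
    show "ennreal (H r) * ennreal (real DIM(real^'n) * unit_ball_vol DIM(real^'n) * r ^ (DIM(real^'n) - 1)) * indicator {0..R + \<l>} r \<le> ennreal K * ennreal (H r)"
    proof (cases "r \<in> {0..R + \<l>}")
      case True
      have "real DIM(real^'n) * unit_ball_vol DIM(real^'n) * r ^ (DIM(real^'n) - 1) \<le> K"
        unfolding K_def using True by (auto intro!: mult_left_mono power_mono)
      then have "ennreal (H r) * ennreal (real DIM(real^'n) * unit_ball_vol DIM(real^'n) * r ^ (DIM(real^'n) - 1)) \<le> ennreal (H r) * ennreal K"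
        by (intro mult_left_mono ennreal_leI) auto
      then show ?thesis using True by (simp add: mult.commute)
    qed simp
  qed
  also have "\<dots> = ennreal K * (\<integral>\<^sup>+r. ennreal (H r) \<partial>lborel)" by (rule nn_integral_cmult) measurable
  also have "(\<integral>\<^sup>+r. ennreal (H r) \<partial>lborel) = (\<integral>\<^sup>+r. ennreal (wall_energy (R - r)) * indicator {R - \<l>..R + \<l>} r + ennreal k * indicator {R - \<l>..R + \<l>} r \<partial>lborel)"
    using wall_energy_nonneg k by (intro nn_integral_cong) (auto simp: H_def ennreal_plus split: split_indicator)
  also have "\<dots> = (\<integral>\<^sup>+r. ennreal (wall_energy (R - r)) * indicator {R - \<l>..R + \<l>} r \<partial>lborel) + (\<integral>\<^sup>+r. ennreal k * indicator {R - \<l>..R + \<l>} r \<partial>lborel)"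
    by (rule nn_integral_add) measurable
  also have "(\<integral>\<^sup>+r. ennreal k * indicator {R - \<l>..R + \<l>} r \<partial>lborel) = ennreal (2 * \<l> * k)"
    using l k by (simp add: nn_integral_cmult_indicator ennreal_mult[symmetric] mult.commute)
  also have "ennreal K * ((\<integral>\<^sup>+r. ennreal (wall_energy (R - r)) * indicator {R - \<l>..R + \<l>} r \<partial>lborel) + ennreal (2 * \<l> * k))
      \<le> ennreal K * (ennreal (b\<^sup>2 * c0) + ennreal (2 * \<l> * k))"
    by (intro mult_left_mono add_right_mono wall_energy_integral) auto
  also have "\<dots> = ennreal (K * (b\<^sup>2 * c0 + 2 * \<l> * k))"
    using K0 l k c00 by (simp add: ennreal_mult ennreal_plus)
  finally show "(\<integral>\<^sup>+x. ennreal ((wall_energy (R - norm x) + k) * indicator {R - \<l>..R + \<l>} (norm x)) \<partial>(torus_measure L :: (real^'n) measure))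
     \<le> ennreal (real ?n * unit_ball_vol ?n * (R + \<l>) ^ (?n - 1) * (b\<^sup>2 * c0 + 2 * \<l> * k))"
    by (simp add: H_def K_def)
qed

text \<open>The gradient chosen by \<open>wgrad\<close> agrees almost everywhere with the explicit
  one, so that the energy can be computed from \<open>droplet_grad\<close>.\<close>

lemma droplet_energy_eq:
  assumes R: "R + \<l> < L / 2"
  shows "energy L (\<lambda>x :: real^'n. c + droplet R x) = (LINT x|torus_measure L. (norm (droplet_grad R x :: real^'n))\<^sup>2 / 2 + G (c + droplet R x))"
    and "(\<lambda>x. (norm (droplet_grad R x :: real^'n))\<^sup>2 / 2 + G (c + droplet R x)) \<in> borel_measurable (torus_measure L)"
    and "weak_grad L (\<lambda>x. c + droplet R x) (wgrad L (\<lambda>x :: real^'n. c + droplet R x))"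
proof -
  have dm: "(droplet R :: real^'n \<Rightarrow> real) \<in> borel_measurable (torus_measure L)"
    by (intro measurable_borel_torus borel_measurable_continuous_onI continuous_droplet)
  have Gm: "(\<lambda>x. G (c + droplet R x)) \<in> borel_measurable (torus_measure L :: (real^'n) measure)"
    unfolding G_def using dm by auto
  have gm: "(droplet_grad R :: real^'n \<Rightarrow> real^'n) \<in> borel_measurable (torus_measure L)"
    by (rule droplet_grad_measurable[OF L R])
  show m: "(\<lambda>x. (norm (droplet_grad R x :: real^'n))\<^sup>2 / 2 + G (c + droplet R x)) \<in> borel_measurable (torus_measure L)"
    using gm Gm by auto
  have "weak_grad L (\<lambda>x :: real^'n. c + droplet R x) (droplet_grad R)" by (rule droplet_weak_grad[OF L R])
  then show w: "weak_grad L (\<lambda>x. c + droplet R x) (wgrad L (\<lambda>x :: real^'n. c + droplet R x))"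
    unfolding wgrad_def by (rule someI[of "weak_grad L (\<lambda>x :: real^'n. c + droplet R x)"])
  have wm: "(\<lambda>x. (norm (wgrad L (\<lambda>x :: real^'n. c + droplet R x) x))\<^sup>2 / 2 + G (c + droplet R x)) \<in> borel_measurable (torus_measure L)"
    using w Gm unfolding weak_grad_def by auto
  have "AE x in torus_measure L. wgrad L (\<lambda>x :: real^'n. c + droplet R x) x = droplet_grad R x" by (rule droplet_wgrad[OF L R])
  then have "AE x in torus_measure L. (norm (wgrad L (\<lambda>x :: real^'n. c + droplet R x) x))\<^sup>2 / 2 + G (c + droplet R x)
     = (norm (droplet_grad R x))\<^sup>2 / 2 + G (c + droplet R x)" by eventually_elim simp
  then show "energy L (\<lambda>x :: real^'n. c + droplet R x) = (LINT x|torus_measure L. (norm (droplet_grad R x :: real^'n))\<^sup>2 / 2 + G (c + droplet R x))"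
    unfolding energy_def by (intro integral_cong_AE wm m)
qed

lemma droplet_energy_bound:
  assumes R: "- \<l> \<le> R" "R + \<l> < L / 2" and c: "\<bar>c\<bar> \<le> 1"
  shows "energy L (\<lambda>x :: real^'n. - 1 + c + droplet R x) - L ^ CARD('n) * G (- 1 + c)
     \<le> real CARD('n) * unit_ball_vol CARD('n) * (R + \<l>) ^ (CARD('n) - 1) * (b\<^sup>2 * c0 + 12 * \<l> * \<bar>c\<bar>)
       + 2 * \<bar>c\<bar> ^ 3 * unit_ball_vol CARD('n) * (R + \<l>) ^ CARD('n)"
proof -
  let ?M = "torus_measure L :: (real^'n) measure"
  let ?e = "\<lambda>x :: real^'n. (norm (droplet_grad R x :: real^'n))\<^sup>2 / 2 + G (- 1 + c + droplet R x)"
  let ?s = "\<lambda>x :: real^'n. (wall_energy (R - norm x) + 6 * \<bar>c\<bar>) * indicator {R - \<l>..R + \<l>} (norm x)"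
  have ei: "integrable ?M ?e"
  proof (rule integrable_torus_bounded)
    show "?e \<in> borel_measurable ?M" by (rule droplet_energy_eq(2)[OF R(2)])
    fix x :: "real^'n"
    have "(norm (droplet_grad R x))\<^sup>2 \<le> 2\<^sup>2" by (intro power_mono droplet_grad_bound[OF L]) auto
    moreover have "G (- 1 + c + droplet R x) \<le> 9"
    proof -
      let ?y = "- 1 + c + droplet R x"
      have "\<bar>?y\<bar> \<le> 2" using c droplet_bounds[of R x] by linarith
      then have y2: "?y\<^sup>2 \<le> 2\<^sup>2" by (metis abs_ge_zero power2_abs power_mono)
      then have "\<bar>1 - ?y\<^sup>2\<bar> \<le> 6" using zero_le_power2[of ?y] unfolding power2_eq_square[of 2] by linarith
      then have "(1 - ?y\<^sup>2)\<^sup>2 \<le> 6\<^sup>2" by (metis abs_ge_zero power2_abs power_mono)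
      then show ?thesis by (simp add: G_def)
    qed
    ultimately show "\<bar>?e x\<bar> \<le> 11" using G_nonneg[of "- 1 + c + droplet R x"] by simp
  qed
  have sm: "?s \<in> borel_measurable borel" by measurable
  have si: "integrable ?M ?s"
  proof (rule integrable_torus_bounded[where B = 8])
    show "?s \<in> borel_measurable ?M" by (rule measurable_borel_torus[OF sm])
    fix x :: "real^'n"
    show "\<bar>?s x\<bar> \<le> 8" using wall_energy_le[of "R - norm x"] wall_energy_nonneg[of "R - norm x"] c
      by (auto split: split_indicator)
  qed
  have Rl: "0 \<le> R + \<l>" "R + \<l> \<le> L / 2" using R by auto
  note I = integral_cball_indicator[OF L Rl, where 'n = 'n]
  have "energy L (\<lambda>x :: real^'n. - 1 + c + droplet R x) - L ^ CARD('n) * G (- 1 + c) = (LINT x|?M. ?e x - G (- 1 + c))"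
    unfolding droplet_energy_eq(1)[OF R(2)] using ei L by (simp add: measure_torus_measure)
  also have "\<dots> \<le> (LINT x|?M. ?s x + 2 * \<bar>c\<bar> ^ 3 * indicator (cball 0 (R + \<l>)) x)"
  proof (rule integral_mono)
    show "integrable ?M (\<lambda>x. ?e x - G (- 1 + c))" using ei by simp
    show "integrable ?M (\<lambda>x. ?s x + 2 * \<bar>c\<bar> ^ 3 * indicator (cball 0 (R + \<l>)) x)"
      using si I(1) by simp
    show "?e x - G (- 1 + c) \<le> ?s x + 2 * \<bar>c\<bar> ^ 3 * indicator (cball 0 (R + \<l>)) x" for x
      by (rule droplet_density_bound[OF c])
  qed
  also have "\<dots> = (LINT x|?M. ?s x) + 2 * \<bar>c\<bar> ^ 3 * (unit_ball_vol CARD('n) * (R + \<l>) ^ CARD('n))"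
    using si I by simp
  also have "(LINT x|?M. ?s x) \<le> real CARD('n) * unit_ball_vol CARD('n) * (R + \<l>) ^ (CARD('n) - 1) * (b\<^sup>2 * c0 + 2 * \<l> * (6 * \<bar>c\<bar>))"
    by (rule shell_integral_bound[OF R(1)]) simp
  finally show ?thesis by (simp add: mult.assoc)
qed

text \<open>The mass of the droplet is withdrawn evenly from the torus, which keeps the mean at
  \<open>- 1 + \<phi>\<close>.\<close>

definition background :: "'n::finite itself \<Rightarrow> real \<Rightarrow> real \<Rightarrow> real" where
  "background T \<phi> R = \<phi> - droplet_mass L T R / L ^ CARD('n)"

definition droplet_state :: "real \<Rightarrow> real \<Rightarrow> real^'n \<Rightarrow> real" where
  "droplet_state \<phi> R x = - 1 + background TYPE('n) \<phi> R + droplet R x"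

text \<open>The quantity \<open>M\<close> bounds \<phi>, the depletion \<open>t\<close> and the
  modulus of the new background at the same time, so that all errors are expressed by it. The gain
  is estimated with the inner ball and the costs with the outer ball.\<close>

lemma droplet_state_energy:
  fixes \<phi> R M :: real
  defines "M \<equiv> \<phi> + 2 * unit_ball_vol CARD('n) * (R + \<l>) ^ CARD('n) / L ^ CARD('n)"
  assumes R: "- \<l> \<le> R" "R + \<l> < L / 2" and \<phi>: "0 < \<phi>" "\<phi> \<le> 1 / 2" and M: "M \<le> 1"
  shows "energy L (droplet_state \<phi> R :: real^'n \<Rightarrow> real) - energy L (\<lambda>x :: real^'n. - 1 + \<phi>)
     \<le> real CARD('n) * unit_ball_vol CARD('n) * (R + \<l>) ^ (CARD('n) - 1) * (b\<^sup>2 * c0 + 12 * \<l> * M)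
       + 2 * M ^ 3 * unit_ball_vol CARD('n) * (R + \<l>) ^ CARD('n)
       - 4 * \<phi> * (1 - 3 / 2 * \<phi>) * unit_ball_vol CARD('n) * (max 0 (R - \<l>)) ^ CARD('n)
       + 4 * (1 + 3 * M) * (unit_ball_vol CARD('n) * (R + \<l>) ^ CARD('n))\<^sup>2 / L ^ CARD('n)"
proof -
  let ?n = "CARD('n)" and ?\<omega> = "unit_ball_vol CARD('n)" and ?V = "L ^ CARD('n)"
  define m where "m = droplet_mass L TYPE('n) R"
  define t where "t = m / ?V"
  define c where "c = background TYPE('n) \<phi> R"
  have V: "0 < ?V" using L by simp
  have m: "m \<le> 2 * ?\<omega> * (R + \<l>) ^ ?n" "2 * ?\<omega> * (max 0 (R - \<l>)) ^ ?n \<le> m" "0 \<le> m"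
    unfolding m_def using droplet_mass_bounds[OF L R, where 'n = 'n] by auto
  have t0: "0 \<le> t" using m V by (simp add: t_def)
  have tM': "t \<le> 2 * ?\<omega> * (R + \<l>) ^ ?n / ?V" unfolding t_def using m V by (intro divide_right_mono) auto
  then have tM: "t \<le> M" using \<phi> by (simp add: M_def)
  have \<phi>M: "\<phi> \<le> M" using t0 tM' by (simp add: M_def)
  have M0: "0 \<le> M" using \<phi> \<phi>M by simp
  have ct: "c = \<phi> - t" by (simp add: c_def background_def t_def m_def)
  have cM: "\<bar>c\<bar> \<le> M" using t0 tM \<phi>M \<phi> by (simp add: ct)
  have c1: "\<bar>c\<bar> \<le> 1" using cM M by simp
  have c00: "0 \<le> c0" by (simp add: c0_eq)
  have Rl: "0 \<le> R + \<l>" using R by simp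
  have "energy L (droplet_state \<phi> R :: real^'n \<Rightarrow> real) - ?V * G (- 1 + c)
     \<le> real ?n * ?\<omega> * (R + \<l>) ^ (?n - 1) * (b\<^sup>2 * c0 + 12 * \<l> * \<bar>c\<bar>) + 2 * \<bar>c\<bar> ^ 3 * ?\<omega> * (R + \<l>) ^ ?n"
    using droplet_energy_bound[OF R c1, where 'n = 'n] unfolding droplet_state_def[abs_def] c_def .
  also have "\<dots> \<le> real ?n * ?\<omega> * (R + \<l>) ^ (?n - 1) * (b\<^sup>2 * c0 + 12 * \<l> * M) + 2 * M ^ 3 * ?\<omega> * (R + \<l>) ^ ?n"
    using cM l Rl c00 M0 by (intro add_mono mult_left_mono mult_right_mono power_mono mult_nonneg_nonneg) auto
  finally have 1: "energy L (droplet_state \<phi> R :: real^'n \<Rightarrow> real) - ?V * G (- 1 + c)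
     \<le> real ?n * ?\<omega> * (R + \<l>) ^ (?n - 1) * (b\<^sup>2 * c0 + 12 * \<l> * M) + 2 * M ^ 3 * ?\<omega> * (R + \<l>) ^ ?n" .
  have "?V * (G (- 1 + c) - G (- 1 + \<phi>)) \<le> ?V * (- 2 * \<phi> * (1 - 3 / 2 * \<phi>) * t + (1 + 3 * M) * t\<^sup>2)"
    unfolding ct using V by (intro mult_left_mono G_background_shift[OF \<phi>(1) \<phi>M M t0 tM]) auto
  also have "\<dots> = - (2 * \<phi> * (1 - 3 / 2 * \<phi>) * m) + (1 + 3 * M) * m\<^sup>2 / ?V"
  proof -
    have "?V * t = m" using V L by (simp add: t_def)
    moreover have "?V * t\<^sup>2 = m\<^sup>2 / ?V" using V L by (simp add: t_def power2_eq_square)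
    moreover have "?V * (- 2 * \<phi> * (1 - 3 / 2 * \<phi>) * t + (1 + 3 * M) * t\<^sup>2)
      = - 2 * \<phi> * (1 - 3 / 2 * \<phi>) * (?V * t) + (1 + 3 * M) * (?V * t\<^sup>2)" by (simp add: algebra_simps)
    ultimately show ?thesis by simp
  qed
  also have "\<dots> \<le> - (2 * \<phi> * (1 - 3 / 2 * \<phi>) * (2 * ?\<omega> * (max 0 (R - \<l>)) ^ ?n)) + (1 + 3 * M) * (2 * ?\<omega> * (R + \<l>) ^ ?n)\<^sup>2 / ?V"
    using \<phi> m M0 V
    by (intro add_mono le_imp_neg_le mult_left_mono divide_right_mono power_mono mult_nonneg_nonneg) auto
  finally have 2: "?V * G (- 1 + c) - ?V * G (- 1 + \<phi>) \<le> - (4 * \<phi> * (1 - 3 / 2 * \<phi>) * ?\<omega> * (max 0 (R - \<l>)) ^ ?n)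
       + 4 * (1 + 3 * M) * (?\<omega> * (R + \<l>) ^ ?n)\<^sup>2 / ?V"
  proof -
    assume le: "?V * (G (- 1 + c) - G (- 1 + \<phi>)) \<le> - (2 * \<phi> * (1 - 3 / 2 * \<phi>) * (2 * ?\<omega> * (max 0 (R - \<l>)) ^ ?n))
        + (1 + 3 * M) * (2 * ?\<omega> * (R + \<l>) ^ ?n)\<^sup>2 / ?V"
    have e1: "2 * \<phi> * (1 - 3 / 2 * \<phi>) * (2 * ?\<omega> * (max 0 (R - \<l>)) ^ ?n) = 4 * \<phi> * (1 - 3 / 2 * \<phi>) * ?\<omega> * (max 0 (R - \<l>)) ^ ?n"
      by simp
    have e2: "(1 + 3 * M) * (2 * ?\<omega> * (R + \<l>) ^ ?n)\<^sup>2 / ?V = 4 * (1 + 3 * M) * (?\<omega> * (R + \<l>) ^ ?n)\<^sup>2 / ?V"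
      by (simp add: power_mult_distrib)
    show ?thesis using le by (simp only: right_diff_distrib[of ?V] e1 e2)
  qed
  show ?thesis unfolding energy_const[OF L] using 1 2 by linarith
qed

lemma droplet_state_mem:
  assumes R: "R + \<l> < L / 2"
  shows "(droplet_state \<phi> R :: real^'n \<Rightarrow> real) \<in> X_phi L \<phi>"
proof -
  let ?M = "torus_measure L :: (real^'n) measure"
  let ?c = "- 1 + background TYPE('n) \<phi> R"
  have eq: "(droplet_state \<phi> R :: real^'n \<Rightarrow> real) = (\<lambda>x. ?c + droplet R x)" by (simp add: droplet_state_def fun_eq_iff)
  have ci: "continuous_on UNIV (\<lambda>x :: real^'n. ?c + droplet R x)" by (intro continuous_intros continuous_droplet)
  have "weak_grad L (\<lambda>x :: real^'n. ?c + droplet R x) (droplet_grad R)" by (rule droplet_weak_grad[OF L R])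
  then have "(droplet_state \<phi> R :: real^'n \<Rightarrow> real) \<in> H1L4 L"
    unfolding eq H1L4_def
    by (auto intro!: measurable_borel_torus borel_measurable_continuous_onI set_lborel_integrable_imp_torus(1) continuous_intros ci
        continuous_droplet)
  moreover have i: "integrable ?M (droplet R)" by (rule integrable_droplet[OF L])
  have "(1 / L ^ CARD('n)) * (LINT x|?M. droplet_state \<phi> R x) = - 1 + \<phi>"
    unfolding eq using i L
    by (simp add: measure_torus_measure background_def droplet_mass_def[OF L] field_simps)
  ultimately show ?thesis by (simp add: X_phi_def)
qed

end

end

section \<open>The path of growing droplets\<close>

context wall_profile
begin

context
  fixes L :: real
  assumes L: "0 < L"
begin

lemma droplet_state_lipschitz:
  shows "\<bar>droplet_state L \<phi> R x - droplet_state L \<phi> R' (x :: real^'n)\<bar> \<le> 4 * \<bar>R - R'\<bar>"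
proof -
  let ?M = "torus_measure L :: (real^'n) measure" and ?V = "L ^ CARD('n)"
  let ?m = "droplet_mass L TYPE('n)"
  have V: "0 < ?V" using L by simp
  have i: "integrable ?M (droplet R)" "integrable ?M (droplet R')" by (rule integrable_droplet[OF L])+
  have "\<bar>?m R - ?m R'\<bar> = \<bar>LINT x|?M. droplet R x - droplet R' x\<bar>"
    using i by (simp add: droplet_mass_def[OF L])
  also have "\<dots> \<le> (LINT x|?M. \<bar>droplet R x - droplet R' x\<bar>)"
    using integral_norm_bound[of ?M "\<lambda>x. droplet R x - droplet R' x"] unfolding real_norm_def .
  also have "\<dots> \<le> (LINT x|?M. 2 * \<bar>R - R'\<bar>)"
    using i droplet_lipschitz_radius by (intro integral_mono) auto
  also have "\<dots> = 2 * \<bar>R - R'\<bar> * ?V" using L by (simp add: measure_torus_measure)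
  finally have "\<bar>?m R - ?m R'\<bar> / ?V \<le> 2 * \<bar>R - R'\<bar>" using V by (simp add: divide_le_eq)
  then have "\<bar>?m R / ?V - ?m R' / ?V\<bar> \<le> 2 * \<bar>R - R'\<bar>"
    using V by (simp add: diff_divide_distrib[symmetric] abs_divide)
  moreover have "droplet_state L \<phi> R x - droplet_state L \<phi> R' x = (droplet R x - droplet R' x) - (?m R / ?V - ?m R' / ?V)"
    by (simp add: droplet_state_def[OF L] background_def[OF L])
  ultimately show ?thesis using droplet_lipschitz_radius[of R x R'] by linarith
qed

lemma continuous_droplet_state: "continuous_on UNIV (droplet_state L \<phi> R :: real^'n \<Rightarrow> real)"
  unfolding droplet_state_def[OF L, abs_def] by (intro continuous_intros continuous_droplet)

lemma wgrad_droplet_state: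
  assumes "R + \<l> < L / 2"
  shows "AE x in torus_measure L. wgrad L (droplet_state L \<phi> R) x = (droplet_grad R x :: real^'n)"
    and "wgrad L (droplet_state L \<phi> R :: real^'n \<Rightarrow> real) \<in> borel_measurable (torus_measure L)"
proof -
  have eq: "(droplet_state L \<phi> R :: real^'n \<Rightarrow> real) = (\<lambda>x. (- 1 + background L TYPE('n) \<phi> R) + droplet R x)"
    by (simp add: droplet_state_def[OF L] fun_eq_iff)
  show "AE x in torus_measure L. wgrad L (droplet_state L \<phi> R) x = (droplet_grad R x :: real^'n)"
    unfolding eq by (rule droplet_wgrad[OF L assms])
  show "wgrad L (droplet_state L \<phi> R :: real^'n \<Rightarrow> real) \<in> borel_measurable (torus_measure L)"
    unfolding eq using droplet_energy_eq(3)[OF L assms, where 'n = 'n] by (simp add: weak_grad_def)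
qed

text \<open>The limit gradient jumps only across the spheres of radius \<open>r0 - \<l>\<close> and
  \<open>r0 + \<l>\<close>, which are null sets. Elsewhere away from the origin the gradients
  converge pointwise, and they are uniformly bounded.\<close>

lemma droplet_grad_L2_tendsto:
  assumes r: "r \<longlonglongrightarrow> r0" and small: "\<And>k. r k + \<l> < L / 2" "r0 + \<l> < L / 2"
  shows "(\<lambda>k. LINT x|torus_measure L. (norm (droplet_grad (r k) x - droplet_grad r0 x :: real^'n))\<^sup>2) \<longlonglongrightarrow> 0"
proof -
  let ?M = "torus_measure L :: (real^'n) measure"
  have gm: "(droplet_grad (r k) :: real^'n \<Rightarrow> real^'n) \<in> borel_measurable ?M" "(droplet_grad r0 :: real^'n \<Rightarrow> real^'n) \<in> borel_measurable ?M" for k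
    using droplet_grad_measurable[OF L] small by blast+
  have "(\<lambda>k. LINT x|?M. (norm (droplet_grad (r k) x - droplet_grad r0 x :: real^'n))\<^sup>2) \<longlonglongrightarrow> (LINT x|?M. 0)"
  proof (rule integral_dominated_convergence[where w = "\<lambda>_. 4\<^sup>2"])
    show "AE x in ?M. (\<lambda>k. (norm (droplet_grad (r k) x - droplet_grad r0 x))\<^sup>2) \<longlonglongrightarrow> 0"
    proof -
      have "AE x in ?M. norm x \<notin> {r0 - \<l>, r0 + \<l>} \<and> x \<noteq> 0" by (rule AE_norm_not_in) simp
      then show ?thesis
      proof eventually_elim
        case (elim x)
        have "\<bar>r0 - norm x\<bar> \<noteq> \<l>" using elim by auto
        then have "isCont dprof (r0 - norm x)" by (rule dprof_isCont)
        then have "(\<lambda>k. dprof (r k - norm x)) \<longlonglongrightarrow> dprof (r0 - norm x)"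
          by (rule isCont_tendsto_compose) (intro tendsto_intros r)
        then have "(\<lambda>k. (norm (droplet_grad (r k) x - droplet_grad r0 x))\<^sup>2) \<longlonglongrightarrow> (norm (droplet_grad r0 x - droplet_grad r0 x))\<^sup>2"
          unfolding droplet_grad_def by (intro tendsto_intros)
        then show ?case by simp
      qed
    qed
    show "AE x in ?M. norm ((norm (droplet_grad (r k) x - droplet_grad r0 x))\<^sup>2) \<le> 4\<^sup>2" for k
    proof (rule AE_I2)
      fix x :: "real^'n"
      have "norm (droplet_grad (r k) x - droplet_grad r0 x) \<le> norm (droplet_grad (r k) x) + norm (droplet_grad r0 x)"
        by (rule norm_triangle_ineq4)
      also have "\<dots> \<le> 4" using droplet_grad_bound[OF L, of "r k" x] droplet_grad_bound[OF L, of r0 x] by simp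
      finally have "(norm (droplet_grad (r k) x - droplet_grad r0 x))\<^sup>2 \<le> 4\<^sup>2" by (intro power_mono) auto
      then show "norm ((norm (droplet_grad (r k) x - droplet_grad r0 x))\<^sup>2) \<le> 4\<^sup>2" by simp
    qed
  qed (use gm in auto)
  then show ?thesis by simp
qed

lemma hdist_droplet_tendsto:
  assumes r: "r \<longlonglongrightarrow> r0" and small: "\<And>k. r k + \<l> < L / 2" "r0 + \<l> < L / 2"
  shows "(\<lambda>k. hdist L (droplet_state L \<phi> (r k)) (droplet_state L \<phi> r0 :: real^'n \<Rightarrow> real)) \<longlonglongrightarrow> 0"
proof -
  let ?M = "torus_measure L :: (real^'n) measure" and ?V = "L ^ CARD('n)"
  let ?u = "\<lambda>k. (droplet_state L \<phi> (r k) :: real^'n \<Rightarrow> real)" and ?v = "droplet_state L \<phi> r0 :: real^'n \<Rightarrow> real"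
  have power_lim: "(\<lambda>k. LINT x|?M. (?u k x - ?v x) ^ p) \<longlonglongrightarrow> 0" if p: "even p" "p > 0" for p
  proof (rule real_tendsto_sandwich[where f = "\<lambda>_. 0" and h = "\<lambda>k. (4 * \<bar>r k - r0\<bar>) ^ p * ?V"])
    show "\<forall>\<^sub>F k in sequentially. 0 \<le> (LINT x|?M. (?u k x - ?v x) ^ p)"
      using p by (intro always_eventually allI Bochner_Integration.integral_nonneg) (simp add: zero_le_even_power)
    show "\<forall>\<^sub>F k in sequentially. (LINT x|?M. (?u k x - ?v x) ^ p) \<le> (4 * \<bar>r k - r0\<bar>) ^ p * ?V"
    proof (intro always_eventually allI)
      fix k
      have "(LINT x|?M. (?u k x - ?v x) ^ p) \<le> (LINT x|?M. (4 * \<bar>r k - r0\<bar>) ^ p)"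
      proof (rule integral_mono)
        show "integrable ?M (\<lambda>x. (?u k x - ?v x) ^ p)"
          by (intro set_lborel_integrable_imp_torus(1) continuous_intros continuous_droplet_state)
        fix x
        have "(?u k x - ?v x) ^ p = \<bar>?u k x - ?v x\<bar> ^ p" using p by (simp add: power_even_abs)
        also have "\<dots> \<le> (4 * \<bar>r k - r0\<bar>) ^ p" by (intro power_mono droplet_state_lipschitz) auto
        finally show "(?u k x - ?v x) ^ p \<le> (4 * \<bar>r k - r0\<bar>) ^ p" .
      qed simp
      also have "\<dots> = (4 * \<bar>r k - r0\<bar>) ^ p * ?V" using L by (simp add: measure_torus_measure)
      finally show "(LINT x|?M. (?u k x - ?v x) ^ p) \<le> (4 * \<bar>r k - r0\<bar>) ^ p * ?V" .
    qed
    have "(\<lambda>k. (4 * \<bar>r k - r0\<bar>) ^ p * ?V) \<longlonglongrightarrow> (4 * \<bar>r0 - r0\<bar>) ^ p * ?V" by (intro tendsto_intros r)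
    then show "(\<lambda>k. (4 * \<bar>r k - r0\<bar>) ^ p * ?V) \<longlonglongrightarrow> 0" using p by (simp add: power_0_left)
  qed simp
  have grad: "(LINT x|?M. (norm (wgrad L (?u k) x - wgrad L ?v x))\<^sup>2) = (LINT x|?M. (norm (droplet_grad (r k) x - droplet_grad r0 x :: real^'n))\<^sup>2)" for k
  proof (rule integral_cong_AE)
    show "(\<lambda>x. (norm (wgrad L (?u k) x - wgrad L ?v x))\<^sup>2) \<in> borel_measurable ?M"
      by (intro borel_measurable_power measurable_compose[OF _ borel_measurable_norm] borel_measurable_diff wgrad_droplet_state(2)[OF small(1)] wgrad_droplet_state(2)[OF small(2)])
    show "(\<lambda>x. (norm (droplet_grad (r k) x - droplet_grad r0 x :: real^'n))\<^sup>2) \<in> borel_measurable ?M"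
      by (intro borel_measurable_power measurable_compose[OF _ borel_measurable_norm] borel_measurable_diff droplet_grad_measurable[OF L small(1)] droplet_grad_measurable[OF L small(2)])
    show "AE x in ?M. (norm (wgrad L (?u k) x - wgrad L ?v x))\<^sup>2 = (norm (droplet_grad (r k) x - droplet_grad r0 x))\<^sup>2"
      using wgrad_droplet_state(1)[OF small(1)[of k], of \<phi>] wgrad_droplet_state(1)[OF small(2), of \<phi>] by eventually_elim simp
  qed
  have "(\<lambda>k. sqrt ((LINT x|?M. (?u k x - ?v x)\<^sup>2) + (LINT x|?M. (norm (wgrad L (?u k) x - wgrad L ?v x))\<^sup>2))) \<longlonglongrightarrow> sqrt (0 + 0)"
    unfolding grad by (intro tendsto_intros power_lim droplet_grad_L2_tendsto r small) auto
  moreover have "(\<lambda>k. (LINT x|?M. (?u k x - ?v x) ^ 4) powr (1 / 4)) \<longlonglongrightarrow> 0 powr (1 / 4)"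
  proof (rule tendsto_powr'[OF power_lim tendsto_const])
    show "0 \<noteq> (0::real) \<or> 0 < (1 / 4 :: real) \<and> (\<forall>\<^sub>F k in sequentially. 0 \<le> (LINT x|?M. (?u k x - ?v x) ^ 4))"
      by (auto intro!: always_eventually Bochner_Integration.integral_nonneg)
  qed auto
  ultimately have "(\<lambda>k. sqrt ((LINT x|?M. (?u k x - ?v x)\<^sup>2) + (LINT x|?M. (norm (wgrad L (?u k) x - wgrad L ?v x))\<^sup>2))
     + (LINT x|?M. (?u k x - ?v x) ^ 4) powr (1 / 4)) \<longlonglongrightarrow> sqrt (0 + 0) + 0 powr (1 / 4)"
    by (rule tendsto_add)
  then show ?thesis by (simp add: hdist_def)
qed

text \<open>At the radius \<open>- \<l>\<close> the droplet is empty, so the path starts at the constant state.\<close>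
lemma droplet_path_admissible:
  assumes Rm: "- \<l> \<le> Rm" "Rm + \<l> < L / 2"
    and E: "energy L (droplet_state L \<phi> Rm :: real^'n \<Rightarrow> real) < energy L (\<lambda>x :: real^'n. - 1 + \<phi>)"
  shows "(\<lambda>t. droplet_state L \<phi> (- \<l> + t * (Rm + \<l>)) :: real^'n \<Rightarrow> real) \<in> admissible_paths L \<phi>"
  unfolding admissible_paths_def
proof (intro CollectI conjI ballI)
  let ?R = "\<lambda>t. - \<l> + t * (Rm + \<l>)"
  have small: "?R t + \<l> < L / 2" if "t \<in> {0..1}" for t
  proof -
    have "t * (Rm + \<l>) \<le> 1 * (Rm + \<l>)" using that Rm by (intro mult_right_mono) auto
    then show ?thesis using Rm by simp
  qed
  show "(droplet_state L \<phi> (?R t) :: real^'n \<Rightarrow> real) \<in> X_phi L \<phi>" if "t \<in> {0..1}" for t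
    by (rule droplet_state_mem[OF L small[OF that]])
  show "((\<lambda>s. hdist L (droplet_state L \<phi> (?R s)) (droplet_state L \<phi> (?R t) :: real^'n \<Rightarrow> real)) \<longlongrightarrow> 0) (at t within {0..1})"
    if t: "t \<in> {0..1}" for t
    unfolding tendsto_at_iff_sequentially
  proof (intro allI impI)
    fix X :: "nat \<Rightarrow> real" assume X: "\<forall>i. X i \<in> {0..1} - {t}" "X \<longlonglongrightarrow> t"
    have "(\<lambda>k. hdist L (droplet_state L \<phi> (?R (X k))) (droplet_state L \<phi> (?R t) :: real^'n \<Rightarrow> real)) \<longlonglongrightarrow> 0"
    proof (rule hdist_droplet_tendsto)
      show "(\<lambda>k. ?R (X k)) \<longlonglongrightarrow> ?R t" by (intro tendsto_intros X)
      show "?R (X k) + \<l> < L / 2" for k using X(1) by (intro small) blast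
    qed (rule small[OF t])
    then show "((\<lambda>s. hdist L (droplet_state L \<phi> (?R s)) (droplet_state L \<phi> (?R t) :: real^'n \<Rightarrow> real)) \<circ> X) \<longlonglongrightarrow> 0"
      by (simp add: comp_def)
  qed
  show "(droplet_state L \<phi> (?R 0) :: real^'n \<Rightarrow> real) = (\<lambda>x. - 1 + \<phi>)"
  proof -
    have z: "droplet (- \<l>) x = 0" for x :: "real^'n" by (rule droplet_outside) simp
    then have "droplet_mass L TYPE('n) (- \<l>) = 0" by (simp add: droplet_mass_def[OF L])
    then show ?thesis using z by (simp add: droplet_state_def[OF L] background_def[OF L] fun_eq_iff)
  qed
  show "energy L (droplet_state L \<phi> (?R 1) :: real^'n \<Rightarrow> real) < energy L (\<lambda>x :: real^'n. - 1 + \<phi>)" using E by simp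
qed

lemma energy_barrier_le:
  assumes Rm: "- \<l> \<le> Rm" "Rm + \<l> < L / 2"
    and E: "energy L (droplet_state L \<phi> Rm :: real^'n \<Rightarrow> real) < energy L (\<lambda>x :: real^'n. - 1 + \<phi>)"
    and B: "\<And>R. - \<l> \<le> R \<Longrightarrow> R \<le> Rm \<Longrightarrow>
      energy L (droplet_state L \<phi> R :: real^'n \<Rightarrow> real) - energy L (\<lambda>x :: real^'n. - 1 + \<phi>) \<le> B"
  shows "energy_barrier TYPE('n) L \<phi> \<le> ereal B"
  unfolding energy_barrier_def
proof (rule INF_lower2[OF droplet_path_admissible[OF Rm E]], rule SUP_least)
  fix t :: real assume t: "t \<in> {0..1}"
  have "t * (Rm + \<l>) \<le> 1 * (Rm + \<l>)" using t Rm by (intro mult_right_mono) auto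
  moreover have "0 \<le> t * (Rm + \<l>)" using t Rm by (intro mult_nonneg_nonneg) auto
  ultimately show "ereal (energy L (droplet_state L \<phi> (- \<l> + t * (Rm + \<l>)) :: real^'n \<Rightarrow> real) - energy L (\<lambda>x :: real^'n. - 1 + \<phi>)) \<le> ereal B"
    using B[of "- \<l> + t * (Rm + \<l>)"] by simp
qed

end

end

section \<open>The scaled energy barrier\<close>

lemma droplet_volume_nonneg: "0 \<le> droplet_volume L a r u"
  unfolding droplet_volume_def by (intro Bochner_Integration.integral_nonneg ramp_bounds)

lemma X_phi_sq_int: "u \<in> X_phi L \<phi> \<Longrightarrow> sq_int L u"
  by (simp add: X_phi_def H1L4_def sq_int_def)

lemma continuous_droplet_volume_path:
  fixes \<gamma> :: "real \<Rightarrow> real^'n \<Rightarrow> real"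
  assumes L: "0 < L" and ar: "a < r" and \<gamma>: "\<gamma> \<in> admissible_paths L \<phi>"
  shows "continuous_on {0..1} (\<lambda>t. droplet_volume L a r (\<gamma> t))"
  unfolding continuous_on_def
proof
  fix t :: real assume t: "t \<in> {0..1}"
  let ?M = "torus_measure L :: (real^'n) measure"
  have lim: "((\<lambda>s. hdist L (\<gamma> s) (\<gamma> t)) \<longlongrightarrow> 0) (at t within {0..1})"
    using \<gamma> t by (simp add: admissible_paths_def)
  have mem: "sq_int L (\<gamma> s)" if "s \<in> {0..1}" for s
    using \<gamma> that by (intro X_phi_sq_int[of _ L \<phi>]) (simp add: admissible_paths_def)
  have "((\<lambda>s. droplet_volume L a r (\<gamma> s) - droplet_volume L a r (\<gamma> t)) \<longlongrightarrow> 0) (at t within {0..1})"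
  proof (rule tendsto_0_le[OF lim, where K = "sqrt (L ^ CARD('n)) / (r - a)"])
    have "\<forall>\<^sub>F s in at t within {0..1}. s \<in> {0..1}" by (auto simp: eventually_at_filter)
    then show "\<forall>\<^sub>F s in at t within {0..1}. norm (droplet_volume L a r (\<gamma> s) - droplet_volume L a r (\<gamma> t))
        \<le> norm (hdist L (\<gamma> s) (\<gamma> t)) * (sqrt (L ^ CARD('n)) / (r - a))"
    proof eventually_elim
      case (elim s)
      let ?I = "LINT x|?M. (\<gamma> s x - \<gamma> t x)\<^sup>2"
      let ?J = "LINT x|?M. (norm (wgrad L (\<gamma> s) x - wgrad L (\<gamma> t) x))\<^sup>2"
      have "0 \<le> ?J" by (intro Bochner_Integration.integral_nonneg) simp
      then have "sqrt ?I \<le> sqrt (?I + ?J)" by simp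
      also have "\<dots> \<le> hdist L (\<gamma> s) (\<gamma> t)" by (simp add: hdist_def)
      finally have h: "sqrt ?I \<le> \<bar>hdist L (\<gamma> s) (\<gamma> t)\<bar>" by simp
      have "\<bar>droplet_volume L a r (\<gamma> s) - droplet_volume L a r (\<gamma> t)\<bar> \<le> sqrt (L ^ CARD('n) * ?I) / (r - a)"
        by (rule droplet_volume_lipschitz[OF L mem[OF elim] mem[OF t] ar])
      also have "\<dots> = sqrt ?I * (sqrt (L ^ CARD('n)) / (r - a))" by (simp add: real_sqrt_mult)
      also have "\<dots> \<le> \<bar>hdist L (\<gamma> s) (\<gamma> t)\<bar> * (sqrt (L ^ CARD('n)) / (r - a))"
        using ar L by (intro mult_right_mono h) auto
      finally show ?case by simp
    qed
  qed
  then show "((\<lambda>s. droplet_volume L a r (\<gamma> s)) \<longlongrightarrow> droplet_volume L a r (\<gamma> t)) (at t within {0..1})"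
    by (rule LIM_zero_cancel)
qed

lemma energy_barrier_ge:
  assumes L: "0 < L" and ar: "a < r" "- 1 + \<phi> \<le> a" and A: "0 < A"
    and below: "\<And>u :: real^'n \<Rightarrow> real. u \<in> X_phi L \<phi> \<Longrightarrow> droplet_volume L a r u < A \<Longrightarrow>
      energy L (\<lambda>x :: real^'n. - 1 + \<phi>) \<le> energy L u"
    and at: "\<And>u :: real^'n \<Rightarrow> real. u \<in> X_phi L \<phi> \<Longrightarrow> droplet_volume L a r u = A \<Longrightarrow>
      B \<le> energy L u - energy L (\<lambda>x :: real^'n. - 1 + \<phi>)"
  shows "ereal B \<le> energy_barrier TYPE('n) L \<phi>"
  unfolding energy_barrier_def
proof (rule INF_greatest)
  fix \<gamma> :: "real \<Rightarrow> real^'n \<Rightarrow> real" assume \<gamma>: "\<gamma> \<in> admissible_paths L \<phi>"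
  let ?v = "\<lambda>t. droplet_volume L a r (\<gamma> t)"
  have mem: "\<gamma> t \<in> X_phi L \<phi>" if "t \<in> {0..1}" for t using \<gamma> that by (simp add: admissible_paths_def)
  have "?v 0 = 0" using \<gamma> ramp_low[OF ar] by (simp add: admissible_paths_def droplet_volume_def)
  moreover have "A \<le> ?v 1"
  proof (rule ccontr)
    assume "\<not> A \<le> ?v 1"
    then have "energy L (\<lambda>x :: real^'n. - 1 + \<phi>) \<le> energy L (\<gamma> 1)" by (intro below mem) auto
    then show False using \<gamma> by (simp add: admissible_paths_def)
  qed
  ultimately obtain t where t: "0 \<le> t" "t \<le> 1" "?v t = A"
    using IVT'[of ?v 0 A 1] A continuous_droplet_volume_path[OF L ar(1) \<gamma>] by auto
  show "ereal B \<le> (SUP t\<in>{0..1}. ereal (energy L (\<gamma> t) - energy L (\<lambda>x :: real^'n. - 1 + \<phi>)))"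
    using at[OF mem t(3)] t by (intro SUP_upper2[of t]) auto
qed

text \<open>For droplets with radius of order \<open>1 / \<phi>\<close> the surface, bulk and
  depletion terms all carry the factor \<open>\<phi> ^ (1 - n)\<close>. The depletion term keeps the
  further coefficient \<open>1 / (\<phi> ^ (n + 1) * L ^ n)\<close>, and it alone distinguishes the
  two regimes.\<close>

lemma scaled_energy_lower_bound:
  fixes u :: "real^'n \<Rightarrow> real"
  assumes L: "L > 0" and n: "CARD('n) \<ge> 2" and u: "u \<in> X_phi L \<phi>"
    and r: "3 / 5 \<le> a" "a < r" "r < 1" and \<phi>: "0 < \<phi>" "\<phi> \<le> 1 - r"
    and K: "5 * \<phi> + 2 * real CARD('n) / L \<le> (1 - r\<^sup>2)\<^sup>2 / 4"
    and x: "x = \<phi> * root CARD('n) (droplet_volume L a r u)"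
  shows "\<phi> ^ (CARD('n) - 1) * (energy L u - energy L (\<lambda>x :: real^'n. - 1 + \<phi>))
    \<ge> x ^ (CARD('n) - 1) * (real CARD('n) * root CARD('n) (unit_ball_vol CARD('n)) * wall_cost r a
      - (4 + 5 * \<phi> + 2 * real CARD('n) / (\<phi> * L)) * x
      + (3 * r\<^sup>2 - 1) / 2 * (a + 1 - \<phi>)\<^sup>2 * (1 / (\<phi> ^ (CARD('n) + 1) * L ^ CARD('n))) * x ^ (CARD('n) + 1))"
proof -
  obtain m where m: "CARD('n) = Suc m" using n by (cases "CARD('n)") auto
  define \<rho> where "\<rho> = root (Suc m) (droplet_volume L a r u)"
  have \<rho>0: "0 \<le> \<rho>" by (simp add: \<rho>_def droplet_volume_nonneg)
  have A: "droplet_volume L a r u = \<rho> ^ Suc m" unfolding \<rho>_def by (rule real_root_pow_pos2[symmetric]) (auto simp: droplet_volume_nonneg)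
  have pw: "(\<rho> ^ Suc m) powr ((real (Suc m) - 1) / real (Suc m)) = \<rho> ^ m"
  proof (cases "\<rho> = 0")
    case False
    then have "0 < \<rho>" using \<rho>0 by simp
    have "\<rho> ^ Suc m = \<rho> powr real (Suc m)" by (rule powr_realpow[OF \<open>0 < \<rho>\<close>, symmetric])
    then have "(\<rho> ^ Suc m) powr ((real (Suc m) - 1) / real (Suc m)) = \<rho> powr (real (Suc m) * ((real (Suc m) - 1) / real (Suc m)))"
      by (simp only: powr_powr)
    also have "real (Suc m) * ((real (Suc m) - 1) / real (Suc m)) = real m" by simp
    finally show ?thesis using \<open>0 < \<rho>\<close> by (simp add: powr_realpow)
  next
    case True
    \<comment> \<open>For \<open>\<rho> = 0\<close> the left side is a power of 0 with value 0, and
      the right side agrees only because \<open>m\<close> is positive.\<close>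
    have "0 < m" using n m by simp
    then show ?thesis using True by (simp add: power_0_left)
  qed
  note E = energy_lower_bound[OF L n u r \<phi> K refl, unfolded A m pw]
  have "\<phi> ^ m * (real (Suc m) * root (Suc m) (unit_ball_vol (real (Suc m))) * \<rho> ^ m * wall_cost r a
      - (4 * \<phi> + 5 * \<phi>\<^sup>2 + 2 * real (Suc m) / L) * \<rho> ^ Suc m
      + (3 * r\<^sup>2 - 1) / 2 * ((a + 1 - \<phi>)\<^sup>2 * (\<rho> ^ Suc m)\<^sup>2 / L ^ Suc m)) \<le> \<phi> ^ m * (energy L u - L ^ Suc m * G (- 1 + \<phi>))"
    using E \<phi> by (intro mult_left_mono) auto
  moreover have "\<phi> ^ m * (real (Suc m) * root (Suc m) (unit_ball_vol (real (Suc m))) * \<rho> ^ m * wall_cost r a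
      - (4 * \<phi> + 5 * \<phi>\<^sup>2 + 2 * real (Suc m) / L) * \<rho> ^ Suc m
      + (3 * r\<^sup>2 - 1) / 2 * ((a + 1 - \<phi>)\<^sup>2 * (\<rho> ^ Suc m)\<^sup>2 / L ^ Suc m))
    = x ^ m * (real (Suc m) * root (Suc m) (unit_ball_vol (real (Suc m))) * wall_cost r a
      - (4 + 5 * \<phi> + 2 * real (Suc m) / (\<phi> * L)) * x
      + (3 * r\<^sup>2 - 1) / 2 * (a + 1 - \<phi>)\<^sup>2 * (1 / (\<phi> ^ (Suc m + 1) * L ^ Suc m)) * x ^ (Suc m + 1))"
  proof -
    have x: "x = \<phi> * \<rho>" by (simp add: x \<rho>_def m)
    have 1: "\<phi> ^ m * (w * \<rho> ^ m * c) = x ^ m * (w * c)" for w c by (simp add: x power_mult_distrib)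
    have 2: "\<phi> ^ m * ((4 * \<phi> + 5 * \<phi>\<^sup>2 + N / L) * \<rho> ^ Suc m) = x ^ m * ((4 + 5 * \<phi> + N / (\<phi> * L)) * x)" for N
      using \<phi> L by (simp add: x power_mult_distrib field_simps power2_eq_square)
    have 3: "\<phi> ^ m * (c * (d * (\<rho> ^ Suc m)\<^sup>2 / L ^ Suc m)) = x ^ m * (c * d * (1 / (\<phi> ^ (Suc m + 1) * L ^ Suc m)) * x ^ (Suc m + 1))" for c d
      using \<phi> L by (simp add: x power_mult_distrib field_simps power2_eq_square)
    show ?thesis by (simp only: right_diff_distrib distrib_left 1 2 3)
  qed
  ultimately show ?thesis by (simp only: m energy_const[OF L] diff_Suc_1)
qed

text \<open>One parameter suffices: with \<open>r = 1 - s\<close> and \<open>a = 1 - 2 * s\<close>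
  the wall cost tends to \<open>c0\<close> and the depletion coefficient to
  \<open>4 * \<beta>\<close> as \<open>s\<close> decreases to 0.\<close>

lemma wall_parameters_exist:
  assumes \<eta>: "0 < \<eta>"
  obtains a r where "3 / 5 \<le> a" "a < r" "r < 1" "c0 - \<eta> \<le> wall_cost r a" "4 * \<beta> - \<eta> < (3 * r\<^sup>2 - 1) / 2 * (a + 1)\<^sup>2 * \<beta>"
proof -
  let ?w = "\<lambda>s :: real. ((1 - s)\<^sup>2 * (1 - 2 * s) - (1 - 2 * s) ^ 3 / 3 + 2 * (1 - s) ^ 3 / 3) / sqrt 2"
  let ?q = "\<lambda>s :: real. (3 * (1 - s)\<^sup>2 - 1) / 2 * ((1 - 2 * s) + 1)\<^sup>2 * \<beta>"
  have "(?w \<longlongrightarrow> ?w 0) (at_right 0)" "(?q \<longlongrightarrow> ?q 0) (at_right 0)" by (intro tendsto_intros; simp)+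
  moreover have "?w 0 = c0" by (simp add: c0_eq real_div_sqrt field_simps)
  moreover have "?q 0 = 4 * \<beta>" by simp
  ultimately have "\<forall>\<^sub>F s in at_right 0. c0 - \<eta> < ?w s" "\<forall>\<^sub>F s in at_right 0. 4 * \<beta> - \<eta> < ?q s"
    using \<eta> order_tendstoD(1)[of ?w c0 "at_right 0" "c0 - \<eta>"] order_tendstoD(1)[of ?q "4 * \<beta>" "at_right 0" "4 * \<beta> - \<eta>"] by auto
  moreover have "\<forall>\<^sub>F s :: real in at_right 0. 0 < s \<and> s < 1 / 5"
    by (auto simp: eventually_at_right_field intro!: exI[of _ "1 / 5"])
  ultimately have "\<forall>\<^sub>F s in at_right 0. (c0 - \<eta> < ?w s \<and> 4 * \<beta> - \<eta> < ?q s) \<and> (0 < s \<and> s < 1 / 5)"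
    by (simp add: eventually_conj_iff)
  then obtain s where s: "c0 - \<eta> < ?w s" "4 * \<beta> - \<eta> < ?q s" "0 < s" "s < 1 / 5"
    using eventually_happens'[of "at_right (0 :: real)"] by fastforce
  have "clip (1 - s) (1 - 2 * s) = 1 - 2 * s" using s by (simp add: clip_def)
  then have "wall_cost (1 - s) (1 - 2 * s) = ?w s" by (simp add: wall_cost_def)
  then show thesis using s by (intro that[of "1 - 2 * s" "1 - s"]) auto
qed

text \<open>Both regimes at once: \<beta> is 0 in the off-critical one and
  \<open>\<xi> powr (- (d + 1))\<close> in the critical one. The filter is a parameter because one
  limit runs over sequences and the other over \<open>L\<close> itself. The condition that
  \<open>\<phi> k * L k\<close> tends to infinity makes the isoperimetric correction small relative
  to \<phi>, and it leaves room for droplets of radius of order \<open>1 / \<phi>\<close> in the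
  cell.\<close>

locale droplet_scaling =
  fixes T :: "'n::finite itself" and F :: "'k filter" and L \<phi> :: "'k \<Rightarrow> real" and \<beta> :: real
  assumes dim: "2 \<le> CARD('n)" and L_inf: "filterlim L at_top F"
    and \<phi>_pos: "\<forall>\<^sub>F k in F. 0 < \<phi> k" and \<phi>_0: "(\<phi> \<longlongrightarrow> 0) F"
    and \<phi>L_inf: "filterlim (\<lambda>k. \<phi> k * L k) at_top F"
    and \<beta>_lim: "((\<lambda>k. 1 / (\<phi> k ^ (CARD('n) + 1) * L k ^ CARD('n))) \<longlongrightarrow> \<beta>) F"
begin

text \<open>The function \<open>f\<close> of the paper in the variable \<open>x = \<nu> powr (1 / d)\<close> is
  \<open>x ^ (d - 1) * slope x\<close>.\<close>

definition slope :: "real \<Rightarrow> real" where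
  "slope x = c0 * (real CARD('n) * root CARD('n) (unit_ball_vol CARD('n))) - 4 * x + 4 * \<beta> * x ^ (CARD('n) + 1)"

definition profile :: "real \<Rightarrow> real" where
  "profile x = x ^ (CARD('n) - 1) * slope x"

lemma inverse_\<phi>L_tendsto: "((\<lambda>k. 1 / (\<phi> k * L k)) \<longlongrightarrow> 0) F"
  using tendsto_divide_0[OF tendsto_const filterlim_at_top_imp_at_infinity[OF \<phi>L_inf]] .

lemma inverse_L_tendsto: "((\<lambda>k. 1 / L k) \<longlongrightarrow> 0) F"
  using tendsto_divide_0[OF tendsto_const filterlim_at_top_imp_at_infinity[OF L_inf]] .

text \<open>On \<open>{0..xm}\<close> the limit slope has a positive minimum. Once the errors are
  smaller than this minimum, no state of smaller volume lies below the background, so every path has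
  to reach the volume \<open>(xm / \<phi>) ^ n\<close>, where its energy is almost
  \<open>profile xm\<close>.\<close>

lemma energy_barrier_lower:
  assumes xm: "0 < xm" and pos: "\<And>x. 0 \<le> x \<Longrightarrow> x \<le> xm \<Longrightarrow> 0 < slope x" and \<epsilon>: "0 < \<epsilon>"
  shows "\<forall>\<^sub>F k in F. ereal ((profile xm - \<epsilon>) / \<phi> k ^ (CARD('n) - 1)) \<le> energy_barrier TYPE('n) (L k) (\<phi> k)"
proof -
  let ?n = "CARD('n)"
  let ?m = "?n - 1"
  define K where "K = real ?n * root ?n (unit_ball_vol ?n)"
  have K0: "0 \<le> K" by (simp add: K_def)
  have n0: "0 < ?n" using dim by simp
  have "continuous_on {0..xm} slope" unfolding slope_def[abs_def] by (intro continuous_intros)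
  then obtain x0 where x0: "x0 \<in> {0..xm}" "\<And>x. x \<in> {0..xm} \<Longrightarrow> slope x0 \<le> slope x"
    using continuous_attains_inf[of "{0..xm}" slope] xm by auto
  define \<delta> where "\<delta> = slope x0"
  have \<delta>0: "0 < \<delta>" using pos x0 by (simp add: \<delta>_def)
  \<comment> \<open>The sum of the factors with which an error \<eta> in the surface, bulk and
    depletion coefficients enters the slope, for arguments up to \<open>xm\<close>.\<close>
  define W where "W = K + xm + xm ^ (?n + 1)"
  have W0: "0 < W" using K0 xm by (simp add: W_def add_nonneg_pos add_pos_pos)
  \<comment> \<open>The bound by \<delta> keeps the slope nonnegative up to \<open>xm\<close>; the
    other one makes the error at \<open>xm\<close> at most \<epsilon> after multiplication by
    \<open>xm ^ ?m\<close>.\<close>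
  define \<eta> where "\<eta> = min \<delta> (\<epsilon> / xm ^ ?m) / W"
  have \<eta>0: "0 < \<eta>" using \<delta>0 \<epsilon> xm W0 by (simp add: \<eta>_def)
  have \<eta>W: "\<eta> * W \<le> \<delta>" "\<eta> * W \<le> \<epsilon> / xm ^ ?m" using W0 by (simp_all add: \<eta>_def)
  obtain a r where ar: "3 / 5 \<le> a" "a < r" "r < 1" "c0 - \<eta> \<le> wall_cost r a"
      "4 * \<beta> - \<eta> < (3 * r\<^sup>2 - 1) / 2 * (a + 1)\<^sup>2 * \<beta>"
    using wall_parameters_exist[OF \<eta>0] by blast
  let ?q = "\<lambda>k. (3 * r\<^sup>2 - 1) / 2 * (a + 1 - \<phi> k)\<^sup>2 * (1 / (\<phi> k ^ (?n + 1) * L k ^ ?n))"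
  have "r * r < 1 * 1" using ar by (intro mult_strict_mono) auto
  then have r2: "0 < (1 - r\<^sup>2)\<^sup>2 / 4" by (simp add: power2_eq_square)
  have "((\<lambda>k. 5 * \<phi> k + 2 * real ?n * (1 / L k)) \<longlongrightarrow> 5 * 0 + 2 * real ?n * 0) F"
    by (intro tendsto_intros \<phi>_0 inverse_L_tendsto)
  then have ev1: "\<forall>\<^sub>F k in F. 5 * \<phi> k + 2 * real ?n * (1 / L k) < (1 - r\<^sup>2)\<^sup>2 / 4"
    using r2 by (intro order_tendstoD(2)) auto
  have "((\<lambda>k. 5 * \<phi> k + 2 * real ?n * (1 / (\<phi> k * L k))) \<longlongrightarrow> 5 * 0 + 2 * real ?n * 0) F"
    by (intro tendsto_intros \<phi>_0 inverse_\<phi>L_tendsto)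
  then have ev2: "\<forall>\<^sub>F k in F. 5 * \<phi> k + 2 * real ?n * (1 / (\<phi> k * L k)) < \<eta>"
    using order_tendstoD(2)[OF _ \<eta>0] by simp
  have "(?q \<longlongrightarrow> (3 * r\<^sup>2 - 1) / 2 * (a + 1 - 0)\<^sup>2 * \<beta>) F"
    by (intro tendsto_intros \<phi>_0 \<beta>_lim) auto
  then have ev3: "\<forall>\<^sub>F k in F. 4 * \<beta> - \<eta> < ?q k"
    using order_tendstoD(1) ar(5) by fastforce
  have ev4: "\<forall>\<^sub>F k in F. \<phi> k < 1 - r" using order_tendstoD(2)[OF \<phi>_0, of "1 - r"] ar by simp
  have ev5: "\<forall>\<^sub>F k in F. 0 < L k" using L_inf by (rule filterlim_at_top_dense[THEN iffD1, rule_format])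
  show ?thesis using ev1 ev2 ev3 ev4 ev5 \<phi>_pos
  proof eventually_elim
    case (elim k)
    note L = elim(5) and \<phi> = elim(6)
    have c: "5 * \<phi> k + 2 * real ?n / L k \<le> (1 - r\<^sup>2)\<^sup>2 / 4" using elim(1) by simp
    have lower: "x ^ ?m * (slope x - \<eta> * W) \<le> \<phi> k ^ ?m * (energy (L k) u - energy (L k) (\<lambda>x :: real^'n. - 1 + \<phi> k))"
      if u: "u \<in> X_phi (L k) (\<phi> k)" and x: "x = \<phi> k * root ?n (droplet_volume (L k) a r u)" "x \<le> xm"
      for u :: "real^'n \<Rightarrow> real" and x
    proof -
      have x0: "0 \<le> x" using x \<phi> by (simp add: droplet_volume_nonneg)
      have c1: "4 + 5 * \<phi> k + 2 * real ?n / (\<phi> k * L k) \<le> 4 + \<eta>" using elim(2) by simp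
      have "slope x - \<eta> * W \<le> slope x - \<eta> * (K + x + x ^ (?n + 1))"
        unfolding W_def using \<eta>0 x x0 by (intro diff_left_mono mult_left_mono add_mono power_mono) auto
      also have "\<dots> = K * (c0 - \<eta>) - (4 + \<eta>) * x + (4 * \<beta> - \<eta>) * x ^ (?n + 1)"
        by (simp add: slope_def K_def algebra_simps)
      also have "\<dots> \<le> K * wall_cost r a - (4 + 5 * \<phi> k + 2 * real ?n / (\<phi> k * L k)) * x + ?q k * x ^ (?n + 1)"
        by (intro add_mono diff_mono mult_left_mono[OF ar(4) K0] mult_right_mono[OF c1 x0]
            mult_right_mono[OF less_imp_le[OF elim(3)]] zero_le_power x0)
      finally have "x ^ ?m * (slope x - \<eta> * W) \<le> x ^ ?m * (K * wall_cost r a - (4 + 5 * \<phi> k + 2 * real ?n / (\<phi> k * L k)) * x + ?q k * x ^ (?n + 1))"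
        using x0 by (intro mult_left_mono) auto
      also have "\<dots> \<le> \<phi> k ^ ?m * (energy (L k) u - energy (L k) (\<lambda>x :: real^'n. - 1 + \<phi> k))"
        unfolding K_def using scaled_energy_lower_bound[OF L dim u ar(1,2,3) \<phi> less_imp_le[OF elim(4)] c x(1)] .
      finally show ?thesis .
    qed
    show ?case
    proof (rule energy_barrier_ge[OF L ar(2)])
      show "- 1 + \<phi> k \<le> a" using elim(4) ar by simp
      show "0 < (xm / \<phi> k) ^ ?n" using xm \<phi> by simp
    next
      fix u :: "real^'n \<Rightarrow> real" assume u: "u \<in> X_phi (L k) (\<phi> k)" "droplet_volume (L k) a r u < (xm / \<phi> k) ^ ?n"
      let ?x = "\<phi> k * root ?n (droplet_volume (L k) a r u)"
      have "root ?n (droplet_volume (L k) a r u) \<le> root ?n ((xm / \<phi> k) ^ ?n)"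
        using u n0 by (intro real_root_le_mono) auto
      also have "\<dots> = xm / \<phi> k" using xm \<phi> n0 by (intro real_root_power_cancel) auto
      finally have x: "?x \<le> xm" using \<phi> by (simp add: field_simps)
      have "0 \<le> ?x" using \<phi> by (simp add: droplet_volume_nonneg)
      then have "0 \<le> ?x ^ ?m * (slope ?x - \<eta> * W)"
        using x0(2)[of ?x] x \<eta>W by (intro mult_nonneg_nonneg) (auto simp: \<delta>_def)
      also note lower[OF u(1) refl x]
      finally show "energy (L k) (\<lambda>x :: real^'n. - 1 + \<phi> k) \<le> energy (L k) u"
        using zero_less_power[OF \<phi>, of ?m] by (simp add: zero_le_mult_iff)
    next
      fix u :: "real^'n \<Rightarrow> real" assume u: "u \<in> X_phi (L k) (\<phi> k)" "droplet_volume (L k) a r u = (xm / \<phi> k) ^ ?n"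
      have x: "xm = \<phi> k * root ?n (droplet_volume (L k) a r u)"
        using xm \<phi> n0 by (simp add: u(2) real_root_power_cancel)
      have "profile xm - \<epsilon> \<le> xm ^ ?m * (slope xm - \<eta> * W)"
      proof -
        have "xm ^ ?m * (\<eta> * W) \<le> xm ^ ?m * (\<epsilon> / xm ^ ?m)" using \<eta>W xm by (intro mult_left_mono) auto
        also have "\<dots> = \<epsilon>" using xm by simp
        finally show ?thesis by (simp add: profile_def right_diff_distrib)
      qed
      also note lower[OF u(1) x order_refl]
      finally show "(profile xm - \<epsilon>) / \<phi> k ^ ?m \<le> energy (L k) u - energy (L k) (\<lambda>x :: real^'n. - 1 + \<phi> k)"
        using \<phi> by (simp add: divide_le_eq mult.commute)
    qed
  qed
qed

end

section \<open>The upper bound in scaled variables\<close>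

lemma power_diff_le:
  fixes p y Y :: real
  assumes "0 \<le> p" "p \<le> y" "y \<le> Y"
  shows "y ^ n - p ^ n \<le> real n * Y ^ (n - 1) * (y - p)"
proof (induction n)
  case (Suc n)
  have "y ^ Suc n - p ^ Suc n = y * (y ^ n - p ^ n) + p ^ n * (y - p)" by (simp add: algebra_simps)
  also have "\<dots> \<le> Y * (real n * Y ^ (n - 1) * (y - p)) + Y ^ n * (y - p)"
    using assms Suc power_mono[of p y n] by (intro add_mono mult_mono mult_right_mono power_mono) auto
  also have "\<dots> = real (Suc n) * Y ^ (Suc n - 1) * (y - p)"
    by (cases n) (simp_all add: algebra_simps)
  finally show ?case .
qed simp

lemma wall_profile_exists:
  assumes "1 < b" "b \<le> 2"
  obtains \<l> where "wall_profile b \<l>"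
proof
  \<comment> \<open>Chosen such that \<open>ln z\<close> is the inverse hyperbolic tangent of
    \<open>1 / b\<close>.\<close>
  define z where "z = sqrt ((b + 1) / (b - 1))"
  have z2: "z\<^sup>2 = (b + 1) / (b - 1)" using assms by (simp add: z_def)
  have z: "1 < z" unfolding z_def using assms by (intro real_less_rsqrt) simp
  have "tanh (ln z) = (z\<^sup>2 - 1) / (z\<^sup>2 + 1)" using z by (intro tanh_ln_real) simp
  also have "\<dots> = 1 / b" unfolding z2 using assms by (simp add: field_simps)
  finally show "wall_profile b (sqrt 2 * ln z)" using assms z by unfold_locales auto
qed

context wall_profile
begin

text \<open>\<open>y\<close> is the scaled outer radius, and \<open>P\<close> bounds the quotient of
  the error quantity \<open>M\<close> by \<phi>. Thus every error except the price of the steepening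
  carries a factor \<phi>, uniformly for \<open>y\<close> up to \<open>Y\<close>.\<close>

lemma scaled_droplet_state_energy:
  fixes \<phi> R Y B L :: real
  defines "\<omega> \<equiv> unit_ball_vol CARD('n::finite)" and "n \<equiv> CARD('n)"
  defines "y \<equiv> \<phi> * (R + \<l>)" and "\<beta> \<equiv> 1 / (\<phi> ^ (n + 1) * L ^ n)"
  defines "P \<equiv> 1 + 2 * \<omega> * Y ^ n * B"
  assumes L: "0 < L" and R: "- \<l> \<le> R" "R + \<l> < L / 2" and \<phi>: "0 < \<phi>" "\<phi> \<le> 1 / 2"
    and Y: "y \<le> Y" and B: "\<beta> \<le> B" and P: "\<phi> * P \<le> 1"
  shows "\<phi> ^ (n - 1) * (energy L (droplet_state L \<phi> R :: real^'n \<Rightarrow> real) - energy L (\<lambda>x :: real^'n. - 1 + \<phi>))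
     \<le> c0 * (real n * \<omega>) * y ^ (n - 1) - 4 * (\<omega> * y ^ n) + 4 * \<beta> * (\<omega> * y ^ n)\<^sup>2
       + (b\<^sup>2 - 1) * (c0 * (real n * \<omega>) * Y ^ (n - 1))
       + \<phi> * (12 * \<l> * P * (real n * \<omega>) * Y ^ (n - 1) + 2 * P ^ 3 * (\<omega> * Y ^ n) + 6 * (\<omega> * Y ^ n)
            + 8 * \<l> * (real n * \<omega>) * Y ^ (n - 1) + 12 * P * B * (\<omega> * Y ^ n)\<^sup>2)"
proof -
  obtain m where m: "n = Suc m" unfolding n_def by (cases "CARD('n)") auto
  define M where "M = \<phi> + 2 * \<omega> * (R + \<l>) ^ n / L ^ n"
  define q where "q = \<phi> * max 0 (R - \<l>)"
  have \<omega>: "0 < \<omega>" by (simp add: \<omega>_def)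
  have y0: "0 \<le> y" using R \<phi> by (simp add: y_def)
  have Y0: "0 \<le> Y" using y0 Y by simp
  have \<beta>0: "0 \<le> \<beta>" using \<phi> L by (simp add: \<beta>_def)
  have B0: "0 \<le> B" using \<beta>0 B by simp
  have yY: "y ^ j \<le> Y ^ j" for j using y0 Y by (intro power_mono)
  have c00: "0 \<le> c0" by (simp add: c0_eq)
  have "M = \<phi> * (1 + 2 * \<omega> * y ^ n * \<beta>)"
    using \<phi> L unfolding M_def \<beta>_def y_def power_mult_distrib[of \<phi>] distrib_left[of \<phi> 1] by simp
  also have "\<dots> \<le> \<phi> * P"
    unfolding P_def using \<phi> \<omega> yY B \<beta>0 B0 Y0 by (intro mult_left_mono add_left_mono mult_mono) auto
  finally have MP: "M \<le> \<phi> * P" .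
  have M0: "0 \<le> M" unfolding M_def using \<phi> \<omega> R L by (intro add_nonneg_nonneg mult_nonneg_nonneg divide_nonneg_nonneg) auto
  have P0: "0 \<le> P" using \<omega> Y0 B0 by (simp add: P_def)
  have q: "0 \<le> q" "q \<le> y" "y - q \<le> 2 * \<l> * \<phi>"
  proof -
    show "0 \<le> q" using \<phi> by (simp add: q_def)
    show "q \<le> y" unfolding q_def y_def using \<phi> R l by (intro mult_left_mono) auto
    have "\<phi> * (R - \<l>) \<le> q" unfolding q_def using \<phi> by (intro mult_left_mono) auto
    then show "y - q \<le> 2 * \<l> * \<phi>" by (simp add: y_def algebra_simps)
  qed
  have "\<phi> ^ m * (energy L (droplet_state L \<phi> R :: real^'n \<Rightarrow> real) - energy L (\<lambda>x :: real^'n. - 1 + \<phi>))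
    \<le> \<phi> ^ m * (real n * \<omega> * (R + \<l>) ^ (n - 1) * (b\<^sup>2 * c0 + 12 * \<l> * M)
       + 2 * M ^ 3 * \<omega> * (R + \<l>) ^ n
       - 4 * \<phi> * (1 - 3 / 2 * \<phi>) * \<omega> * (max 0 (R - \<l>)) ^ n
       + 4 * (1 + 3 * M) * (\<omega> * (R + \<l>) ^ n)\<^sup>2 / L ^ n)"
    unfolding M_def \<omega>_def n_def using \<phi> MP P
    by (intro mult_left_mono droplet_state_energy[OF L R \<phi>]) (auto simp: M_def \<omega>_def n_def)
  also have "\<dots> = real n * \<omega> * y ^ m * (b\<^sup>2 * c0 + 12 * \<l> * M) + 2 * M ^ 3 / \<phi> * (\<omega> * y ^ n)
      - 4 * (1 - 3 / 2 * \<phi>) * (\<omega> * q ^ n) + 4 * (1 + 3 * M) * (\<omega> * y ^ n)\<^sup>2 * \<beta>"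
  proof -
    have 1: "\<phi> ^ m * (K * (R + \<l>) ^ (n - 1) * c) = K * y ^ m * c" for K c by (simp add: m y_def power_mult_distrib)
    have 2: "\<phi> ^ m * (K * \<omega> * (R + \<l>) ^ n) = K / \<phi> * (\<omega> * y ^ n)" for K
      using \<phi> by (simp add: m y_def power_mult_distrib)
    have 3: "\<phi> ^ m * (4 * \<phi> * K * \<omega> * (max 0 (R - \<l>)) ^ n) = 4 * K * (\<omega> * q ^ n)" for K
      unfolding m q_def power_mult_distrib by simp
    have 4: "\<phi> ^ m * (K * (\<omega> * z ^ n)\<^sup>2 / L ^ n) = K * (\<omega> * (\<phi> * z) ^ n)\<^sup>2 * \<beta>" for K z
      using \<phi> L by (simp add: m \<beta>_def power_mult_distrib field_simps power2_eq_square)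
    show ?thesis by (simp only: right_diff_distrib[of "\<phi> ^ m"] distrib_left[of "\<phi> ^ m"] 1 2 3 4 y_def[symmetric])
  qed
  finally have "\<phi> ^ m * (energy L (droplet_state L \<phi> R :: real^'n \<Rightarrow> real) - energy L (\<lambda>x :: real^'n. - 1 + \<phi>))
    \<le> real n * \<omega> * y ^ m * (b\<^sup>2 * c0 + 12 * \<l> * M) + 2 * M ^ 3 / \<phi> * (\<omega> * y ^ n)
      - 4 * (1 - 3 / 2 * \<phi>) * (\<omega> * q ^ n) + 4 * (1 + 3 * M) * (\<omega> * y ^ n)\<^sup>2 * \<beta>" .
  moreover have "real n * \<omega> * y ^ m * (b\<^sup>2 * c0 + 12 * \<l> * M)
      \<le> c0 * (real n * \<omega>) * y ^ m + (b\<^sup>2 - 1) * (c0 * (real n * \<omega>) * Y ^ m) + \<phi> * (12 * \<l> * P * (real n * \<omega>) * Y ^ m)"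
  proof -
    have b1: "0 \<le> b\<^sup>2 - 1" using b by simp
    have "(b\<^sup>2 - 1) * (c0 * (real n * \<omega>) * y ^ m) \<le> (b\<^sup>2 - 1) * (c0 * (real n * \<omega>) * Y ^ m)"
      using b1 c00 \<omega> yY by (intro mult_left_mono) auto
    moreover have "12 * \<l> * M * (real n * \<omega>) * y ^ m \<le> 12 * \<l> * (\<phi> * P) * (real n * \<omega>) * Y ^ m"
      using l M0 MP \<omega> yY y0 \<phi> P0 by (intro mult_mono mult_right_mono mult_left_mono mult_nonneg_nonneg) auto
    moreover have "real n * \<omega> * y ^ m * (b\<^sup>2 * c0 + 12 * \<l> * M) = c0 * (real n * \<omega>) * y ^ m
        + (b\<^sup>2 - 1) * (c0 * (real n * \<omega>) * y ^ m) + 12 * \<l> * M * (real n * \<omega>) * y ^ m" by (simp add: algebra_simps)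
    moreover have "12 * \<l> * (\<phi> * P) * (real n * \<omega>) * Y ^ m = \<phi> * (12 * \<l> * P * (real n * \<omega>) * Y ^ m)" by simp
    ultimately show ?thesis by linarith
  qed
  moreover have "2 * M ^ 3 / \<phi> * (\<omega> * y ^ n) \<le> \<phi> * (2 * P ^ 3 * (\<omega> * Y ^ n))"
  proof -
    have "M ^ 3 \<le> (\<phi> * P) ^ 3" using M0 MP by (intro power_mono)
    \<comment> \<open>One power of \<phi> is given away here, so that after division by \<phi> this
      error is linear in \<phi> like the others.\<close>
    also have "\<dots> \<le> \<phi>\<^sup>2 * P ^ 3"
    proof -
      have "\<phi> ^ 3 \<le> \<phi>\<^sup>2" using \<phi> by (intro power_decreasing) auto
      then show ?thesis using P0 by (simp add: power_mult_distrib mult_right_mono)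
    qed
    finally have "2 * M ^ 3 / \<phi> \<le> 2 * (\<phi>\<^sup>2 * P ^ 3) / \<phi>" using \<phi> by (intro divide_right_mono) auto
    also have "\<dots> = \<phi> * (2 * P ^ 3)" using \<phi> by (simp add: power2_eq_square)
    finally have "2 * M ^ 3 / \<phi> * (\<omega> * y ^ n) \<le> \<phi> * (2 * P ^ 3) * (\<omega> * Y ^ n)"
      using \<omega> yY \<phi> P0 y0 by (intro mult_mono mult_left_mono) auto
    then show ?thesis by simp
  qed
  moreover have "- (4 * (1 - 3 / 2 * \<phi>) * (\<omega> * q ^ n)) \<le> - (4 * (\<omega> * y ^ n)) + (\<phi> * (6 * (\<omega> * Y ^ n)) + \<phi> * (8 * \<l> * (real n * \<omega>) * Y ^ m))"
  proof -
    \<comment> \<open>The gain of the bulk is known only for the inner ball. The shell of width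
      \<open>2 * \<l>\<close> between the two radii becomes one of width
      \<open>2 * \<l> * \<phi>\<close> after scaling, hence a vanishing error.\<close>
    have "y ^ n - q ^ n \<le> real n * Y ^ (n - 1) * (y - q)" by (rule power_diff_le[OF q(1,2) Y])
    also have "\<dots> \<le> real n * Y ^ (n - 1) * (2 * \<l> * \<phi>)" using q Y0 by (intro mult_left_mono) auto
    finally have "\<omega> * (y ^ n - q ^ n) \<le> \<omega> * (real n * Y ^ (n - 1) * (2 * \<l> * \<phi>))" using \<omega> by (intro mult_left_mono) auto
    then have 1: "\<omega> * y ^ n - \<omega> * q ^ n \<le> 2 * \<l> * \<phi> * (real n * \<omega>) * Y ^ m" by (simp add: m algebra_simps)
    have "q ^ n \<le> Y ^ n" using q Y by (intro power_mono) auto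
    then have "6 * \<phi> * (\<omega> * q ^ n) \<le> 6 * \<phi> * (\<omega> * Y ^ n)" using \<phi> \<omega> by (intro mult_left_mono) auto
    moreover have "- (4 * (1 - 3 / 2 * \<phi>) * (\<omega> * q ^ n)) = - (4 * (\<omega> * q ^ n)) + 6 * \<phi> * (\<omega> * q ^ n)" by (simp add: algebra_simps)
    moreover have "6 * \<phi> * (\<omega> * Y ^ n) = \<phi> * (6 * (\<omega> * Y ^ n))" "4 * (2 * \<l> * \<phi> * (real n * \<omega>) * Y ^ m) = \<phi> * (8 * \<l> * (real n * \<omega>) * Y ^ m)" by simp_all
    ultimately show ?thesis using 1 by linarith
  qed
  moreover have "4 * (1 + 3 * M) * (\<omega> * y ^ n)\<^sup>2 * \<beta> \<le> 4 * \<beta> * (\<omega> * y ^ n)\<^sup>2 + \<phi> * (12 * P * B * (\<omega> * Y ^ n)\<^sup>2)"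
  proof -
    have "(\<omega> * y ^ n)\<^sup>2 \<le> (\<omega> * Y ^ n)\<^sup>2" using \<omega> Y y0 by (intro power_mono mult_left_mono) auto
    then have "12 * M * \<beta> * (\<omega> * y ^ n)\<^sup>2 \<le> 12 * (\<phi> * P) * B * (\<omega> * Y ^ n)\<^sup>2"
      using M0 MP \<beta>0 B \<phi> P0 B0 by (intro mult_mono mult_left_mono mult_nonneg_nonneg) auto
    moreover have "4 * (1 + 3 * M) * (\<omega> * y ^ n)\<^sup>2 * \<beta> = 4 * \<beta> * (\<omega> * y ^ n)\<^sup>2 + 12 * M * \<beta> * (\<omega> * y ^ n)\<^sup>2" by (simp add: algebra_simps)
    moreover have "12 * (\<phi> * P) * B * (\<omega> * Y ^ n)\<^sup>2 = \<phi> * (12 * P * B * (\<omega> * Y ^ n)\<^sup>2)" by simp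
    ultimately show ?thesis by linarith
  qed
  ultimately show ?thesis unfolding m diff_Suc_1 distrib_left[of \<phi>] by linarith
qed

end

context droplet_scaling
begin

text \<open>Translates between the two scaled variables: \<open>y\<close> is a radius, whereas the
  argument of \<open>profile\<close> is the \<open>n\<close>-th root of a volume. The factor
  \<open>n * \<omega>\<close> of the surface term is the area of the unit sphere.\<close>

lemma profile_droplet:
  "profile (root CARD('n) (unit_ball_vol CARD('n)) * y) =
    c0 * (real CARD('n) * unit_ball_vol CARD('n)) * y ^ (CARD('n) - 1) - 4 * (unit_ball_vol CARD('n) * y ^ CARD('n))
      + 4 * \<beta> * (unit_ball_vol CARD('n) * y ^ CARD('n))\<^sup>2"
proof -
  obtain m where m: "CARD('n) = Suc m" using dim by (cases "CARD('n)") auto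
  define c where "c = root (Suc m) (unit_ball_vol (real (Suc m)))"
  have c: "unit_ball_vol (real (Suc m)) = c ^ Suc m" unfolding c_def by (rule real_root_pow_pos2[symmetric]) auto
  show ?thesis unfolding profile_def slope_def m c_def[symmetric] unfolding c
    by (simp add: power_mult_distrib algebra_simps power2_eq_square)
qed

text \<open>Along the droplets of scaled outer radius up to \<open>xe / c\<close> the scaled energy
  follows \<open>profile\<close> within a small error. The last droplet witnesses that the
  background is not a global minimiser.\<close>

lemma energy_barrier_upper:
  assumes xe: "0 < xe" and max: "\<And>x. 0 \<le> x \<Longrightarrow> x \<le> xe \<Longrightarrow> profile x \<le> profile xm"
    and neg: "profile xe < 0" and \<epsilon>: "0 < \<epsilon>"
  shows "\<forall>\<^sub>F k in F. energy_barrier TYPE('n) (L k) (\<phi> k) \<le> ereal ((profile xm + \<epsilon>) / \<phi> k ^ (CARD('n) - 1))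
    \<and> (\<exists>u \<in> (X_phi (L k) (\<phi> k) :: (real^'n \<Rightarrow> real) set). energy (L k) u < energy (L k) (\<lambda>x :: real^'n. - 1 + \<phi> k))"
proof -
  let ?n = "CARD('n)"
  define \<omega> where "\<omega> = unit_ball_vol ?n"
  define c where "c = root ?n \<omega>"
  define Y where "Y = xe / c"
  have n0: "0 < ?n" using dim by simp
  have \<omega>0: "0 < \<omega>" by (simp add: \<omega>_def)
  have c: "0 < c" using \<omega>0 n0 by (simp add: c_def)
  have Y: "0 < Y" using xe c by (simp add: Y_def)
  \<comment> \<open>The second bound keeps the energy of the last droplet below that of the
    background in spite of the errors.\<close>
  define \<epsilon>' where "\<epsilon>' = min \<epsilon> (- profile xe / 2)"
  have e: "0 < \<epsilon>'" "\<epsilon>' \<le> \<epsilon>" "profile xe + \<epsilon>' < 0" using \<epsilon> neg by (auto simp: \<epsilon>'_def min_def)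
  define \<kappa> where "\<kappa> = c0 * (real ?n * \<omega>) * Y ^ (?n - 1)"
  have \<kappa>: "0 \<le> \<kappa>" using \<omega>0 Y by (simp add: \<kappa>_def c0_eq)
  \<comment> \<open>As \<open>b + 1\<close> is at most 3, the difference
    \<open>b\<^sup>2 - 1\<close> is at most \<open>3 * (b - 1)\<close>; the denominator is chosen so
    that the price of the steepening is at most \<open>\<epsilon>' / 2\<close>.\<close>
  define b where "b = 1 + min 1 (\<epsilon>' / (6 * (\<kappa> + 1)))"
  have b: "1 < b" "b \<le> 2" using e \<kappa> by (auto simp: b_def)
  have b\<kappa>: "(b\<^sup>2 - 1) * \<kappa> \<le> \<epsilon>' / 2"
  proof -
    have "b\<^sup>2 - 1 = (b - 1) * (b + 1)" by (simp add: algebra_simps power2_eq_square)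
    also have "\<dots> \<le> (\<epsilon>' / (6 * (\<kappa> + 1))) * 3" using b by (intro mult_mono) (auto simp: b_def)
    finally have "(b\<^sup>2 - 1) * \<kappa> \<le> (\<epsilon>' / (6 * (\<kappa> + 1))) * 3 * (\<kappa> + 1)"
      using \<kappa> b by (intro mult_mono) (auto simp: e less_imp_le)
    also have "\<dots> = \<epsilon>' / 2" using \<kappa> by (simp add: field_simps)
    finally show ?thesis .
  qed
  obtain \<l> where "wall_profile b \<l>" using wall_profile_exists[OF b] .
  then interpret wall_profile b \<l> .
  let ?\<beta> = "\<lambda>k. 1 / (\<phi> k ^ (?n + 1) * L k ^ ?n)"
  define B where "B = \<beta> + 1"
  define P where "P = 1 + 2 * \<omega> * Y ^ ?n * B"
  define D where "D = 12 * \<l> * P * (real ?n * \<omega>) * Y ^ (?n - 1) + 2 * P ^ 3 * (\<omega> * Y ^ ?n) + 6 * (\<omega> * Y ^ ?n)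
            + 8 * \<l> * (real ?n * \<omega>) * Y ^ (?n - 1) + 12 * P * B * (\<omega> * Y ^ ?n)\<^sup>2"
  have "((\<lambda>k. \<phi> k * D + 4 * \<bar>?\<beta> k - \<beta>\<bar> * (\<omega> * Y ^ ?n)\<^sup>2) \<longlongrightarrow> 0 * D + 4 * \<bar>\<beta> - \<beta>\<bar> * (\<omega> * Y ^ ?n)\<^sup>2) F"
    by (intro tendsto_intros \<phi>_0 \<beta>_lim)
  then have ev1: "\<forall>\<^sub>F k in F. \<phi> k * D + 4 * \<bar>?\<beta> k - \<beta>\<bar> * (\<omega> * Y ^ ?n)\<^sup>2 < \<epsilon>' / 2"
    using e by (intro order_tendstoD(2)) auto
  have "((\<lambda>k. \<phi> k * P) \<longlongrightarrow> 0 * P) F" by (intro tendsto_intros \<phi>_0)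
  then have ev2: "\<forall>\<^sub>F k in F. \<phi> k * P < 1" by (intro order_tendstoD(2)) auto
  have ev3: "\<forall>\<^sub>F k in F. ?\<beta> k < B" by (rule order_tendstoD(2)[OF \<beta>_lim]) (simp add: B_def)
  have ev4: "\<forall>\<^sub>F k in F. \<phi> k < 1 / 2" by (rule order_tendstoD(2)[OF \<phi>_0]) simp
  have ev5: "\<forall>\<^sub>F k in F. 0 < L k" using L_inf by (rule filterlim_at_top_dense[THEN iffD1, rule_format])
  \<comment> \<open>Room for the largest droplet: its outer radius \<open>Y / \<phi> k\<close> stays
    below \<open>L k / 2\<close>.\<close>
  have ev6: "\<forall>\<^sub>F k in F. 2 * Y < \<phi> k * L k" using \<phi>L_inf by (rule filterlim_at_top_dense[THEN iffD1, rule_format])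
  show ?thesis using ev1 ev2 ev3 ev4 ev5 ev6 \<phi>_pos
  proof eventually_elim
    case (elim k)
    note L = elim(5) and \<phi> = elim(7)
    let ?E = "\<lambda>R. energy (L k) (droplet_state (L k) (\<phi> k) R :: real^'n \<Rightarrow> real) - energy (L k) (\<lambda>x :: real^'n. - 1 + \<phi> k)"
    define Rm where "Rm = Y / \<phi> k - \<l>"
    have Rm: "- \<l> \<le> Rm" "Rm + \<l> < L k / 2" using Y \<phi> elim(6) by (simp_all add: Rm_def field_simps)
    have key: "\<phi> k ^ (?n - 1) * ?E R \<le> profile (c * (\<phi> k * (R + \<l>))) + \<epsilon>'" if R: "- \<l> \<le> R" "R \<le> Rm" for R
    proof -
      define y where "y = \<phi> k * (R + \<l>)"
      have y: "0 \<le> y" "y \<le> Y"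
        using R \<phi> by (simp add: y_def, simp add: y_def Rm_def field_simps)
      have R2: "R + \<l> < L k / 2" using R Rm by linarith
      have "\<phi> k ^ (?n - 1) * ?E R \<le> c0 * (real ?n * \<omega>) * y ^ (?n - 1) - 4 * (\<omega> * y ^ ?n) + 4 * ?\<beta> k * (\<omega> * y ^ ?n)\<^sup>2
       + (b\<^sup>2 - 1) * \<kappa> + \<phi> k * D"
        using scaled_droplet_state_energy[OF L R(1) R2 \<phi> less_imp_le[OF elim(4)], where 'n = 'n, of Y B]
          y(2) elim(2,3) unfolding y_def \<kappa>_def D_def P_def \<omega>_def by (simp only: less_imp_le)
      also have "\<dots> \<le> profile (c * y) + 4 * \<bar>?\<beta> k - \<beta>\<bar> * (\<omega> * Y ^ ?n)\<^sup>2 + \<epsilon>' / 2 + \<phi> k * D"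
      proof -
        have "4 * ?\<beta> k * (\<omega> * y ^ ?n)\<^sup>2 - 4 * \<beta> * (\<omega> * y ^ ?n)\<^sup>2 \<le> 4 * \<bar>?\<beta> k - \<beta>\<bar> * (\<omega> * y ^ ?n)\<^sup>2"
        proof -
          have "4 * z - 4 * \<beta> \<le> 4 * \<bar>z - \<beta>\<bar>" for z :: real
            unfolding right_diff_distrib[symmetric] by (intro mult_left_mono) auto
          then have "(4 * ?\<beta> k - 4 * \<beta>) * (\<omega> * y ^ ?n)\<^sup>2 \<le> (4 * \<bar>?\<beta> k - \<beta>\<bar>) * (\<omega> * y ^ ?n)\<^sup>2"
            by (rule mult_right_mono[OF _ zero_le_power2])
          then show ?thesis by (simp only: left_diff_distrib)
        qed
        also have "\<dots> \<le> 4 * \<bar>?\<beta> k - \<beta>\<bar> * (\<omega> * Y ^ ?n)\<^sup>2"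
          using y \<omega>0 by (intro mult_left_mono power_mono) auto
        finally show ?thesis using b\<kappa> unfolding c_def \<omega>_def profile_droplet by linarith
      qed
      finally show ?thesis using elim(1) by (simp only: y_def[symmetric])
    qed
    have cY: "c * Y = xe" using c by (simp add: Y_def)
    have "\<phi> k ^ (?n - 1) * ?E Rm \<le> profile xe + \<epsilon>'"
      using key[OF Rm(1) order_refl] \<phi> by (simp add: Rm_def cY)
    then have "\<phi> k ^ (?n - 1) * ?E Rm < 0" using e by linarith
    then have E: "energy (L k) (droplet_state (L k) (\<phi> k) Rm :: real^'n \<Rightarrow> real) < energy (L k) (\<lambda>x :: real^'n. - 1 + \<phi> k)"
      using \<phi> by (simp add: mult_less_0_iff)
    show ?case
    proof
      show "energy_barrier TYPE('n) (L k) (\<phi> k) \<le> ereal ((profile xm + \<epsilon>) / \<phi> k ^ (?n - 1))"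
      proof (rule energy_barrier_le[OF L Rm E])
        fix R assume R: "- \<l> \<le> R" "R \<le> Rm"
        have "c * (\<phi> k * (R + \<l>)) \<le> c * Y" using R \<phi> c by (intro mult_left_mono) (auto simp: Rm_def field_simps)
        then have "profile (c * (\<phi> k * (R + \<l>))) \<le> profile xm" using R \<phi> c by (intro max) (auto simp: cY)
        then have "\<phi> k ^ (?n - 1) * ?E R \<le> profile xm + \<epsilon>" using key[OF R] e by linarith
        then show "?E R \<le> (profile xm + \<epsilon>) / \<phi> k ^ (?n - 1)"
          using zero_less_power[OF \<phi>, of "?n - 1"] by (simp add: le_divide_eq mult.commute)
      qed
      show "\<exists>u \<in> (X_phi (L k) (\<phi> k) :: (real^'n \<Rightarrow> real) set). energy (L k) u < energy (L k) (\<lambda>x :: real^'n. - 1 + \<phi> k)"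
        using E droplet_state_mem[OF L Rm(2)] by blast
    qed
  qed
qed

text \<open>The same \<open>xm\<close> serves both bounds: every path has to cross its volume, and
  the path of droplets never rises above its value.\<close>

theorem energy_barrier_tendsto:
  assumes xm: "0 < xm" "\<And>x. 0 \<le> x \<Longrightarrow> x \<le> xm \<Longrightarrow> 0 < slope x"
    and xe: "0 < xe" "\<And>x. 0 \<le> x \<Longrightarrow> x \<le> xe \<Longrightarrow> profile x \<le> profile xm" "profile xe < 0"
  shows "((\<lambda>k. energy_barrier TYPE('n) (L k) (\<phi> k) * ereal (\<phi> k ^ (CARD('n) - 1))) \<longlongrightarrow> ereal (profile xm)) F"
proof -
  let ?g = "\<lambda>k. energy_barrier TYPE('n) (L k) (\<phi> k) * ereal (\<phi> k ^ (CARD('n) - 1))"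
  have bounds: "\<forall>\<^sub>F k in F. ereal (profile xm - \<epsilon>) \<le> ?g k \<and> ?g k \<le> ereal (profile xm + \<epsilon>)" if "0 < \<epsilon>" for \<epsilon>
  proof -
    have "\<forall>\<^sub>F k in F. ereal ((profile xm - \<epsilon>) / \<phi> k ^ (CARD('n) - 1)) \<le> energy_barrier TYPE('n) (L k) (\<phi> k)"
      by (rule energy_barrier_lower) (use xm that in auto)
    moreover have "\<forall>\<^sub>F k in F. energy_barrier TYPE('n) (L k) (\<phi> k) \<le> ereal ((profile xm + \<epsilon>) / \<phi> k ^ (CARD('n) - 1))
      \<and> (\<exists>u \<in> (X_phi (L k) (\<phi> k) :: (real^'n \<Rightarrow> real) set). energy (L k) u < energy (L k) (\<lambda>x :: real^'n. - 1 + \<phi> k))"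
      by (rule energy_barrier_upper) (use xe that in auto)
    ultimately show ?thesis using \<phi>_pos
    proof eventually_elim
      case (elim k)
      have p: "0 < \<phi> k ^ (CARD('n) - 1)" using elim(3) by simp
      have eq: "ereal (a / \<phi> k ^ (CARD('n) - 1)) * ereal (\<phi> k ^ (CARD('n) - 1)) = ereal a" for a using elim(3) by simp
      have "ereal ((profile xm - \<epsilon>) / \<phi> k ^ (CARD('n) - 1)) * ereal (\<phi> k ^ (CARD('n) - 1)) \<le> ?g k"
        using elim(1) p by (intro ereal_mult_right_mono) auto
      moreover have "?g k \<le> ereal ((profile xm + \<epsilon>) / \<phi> k ^ (CARD('n) - 1)) * ereal (\<phi> k ^ (CARD('n) - 1))"
        using elim(2) p by (intro ereal_mult_right_mono) auto
      ultimately show ?case by (simp only: eq)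
    qed
  qed
  show ?thesis
  proof (rule order_tendstoI)
    fix a assume "a < ereal (profile xm)"
    then obtain z where z: "a < ereal z" "z < profile xm" using ereal_dense2 by (metis less_ereal.simps(1))
    show "\<forall>\<^sub>F k in F. a < ?g k"
      using bounds[of "profile xm - z"] z by (auto elim!: eventually_mono)
  next
    fix a assume "ereal (profile xm) < a"
    then obtain z where z: "ereal z < a" "profile xm < z" using ereal_dense2 by (metis less_ereal.simps(1))
    show "\<forall>\<^sub>F k in F. ?g k < a"
      using bounds[of "z - profile xm"] z by (auto elim!: eventually_mono)
  qed
qed

end

section \<open>The limit profiles\<close>

lemma sphere_area_eq: "0 < d \<Longrightarrow> sphere_area d = real d * unit_ball_vol d"
proof -
  assume d: "0 < d"
  have G: "Gamma (real d / 2 + 1) = real d / 2 * Gamma (real d / 2)"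
    using d by (intro Gamma_plus1) (auto simp: nonpos_Ints_def)
  show ?thesis unfolding sphere_area_def unit_ball_vol_def G using d by simp
qed

lemma powr_divide_power: "0 < (a :: real) \<Longrightarrow> 0 < m \<Longrightarrow> (a powr (real j / real m)) ^ m = a ^ j"
  by (simp add: powr_realpow[symmetric] powr_powr)

lemma sphere_area_pos: "0 < d \<Longrightarrow> 0 < sphere_area d"
  by (simp add: sphere_area_eq)

lemma c0_pos: "0 < c0"
  by (simp add: c0_eq)

lemma Cbar1_pos: "0 < d \<Longrightarrow> 0 < Cbar1 d"
  using sphere_area_pos[of d] by (simp add: Cbar1_def c0_pos)

lemma Cbar1_power:
  assumes "0 < d"
  shows "Cbar1 d ^ d = c0 ^ d * sphere_area d * real d ^ (d - 1)"
proof -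
  have "real d - 1 = real (d - 1)" using assms by simp
  then show ?thesis
    using powr_divide_power[OF sphere_area_pos[OF assms] assms, of 1] powr_divide_power[of "real d" d "d - 1"] assms
    by (simp add: Cbar1_def power_mult_distrib)
qed

text \<open>Identifies \<open>Cbar1\<close> with \<open>c0\<close> times the Euclidean isoperimetric
  constant in the form in which Brunn--Minkowski delivers it. Comparing \<open>d\<close>-th powers
  turns the real exponents into integers.\<close>

lemma Cbar1_eq:
  assumes "0 < d"
  shows "Cbar1 d = c0 * (real d * root d (unit_ball_vol d))"
proof (rule power_eq_imp_eq_base[OF _ _ _ assms])
  have "(c0 * (real d * root d (unit_ball_vol d))) ^ d = c0 ^ d * (real d ^ d * unit_ball_vol d)"
    using assms by (simp add: power_mult_distrib real_root_pow_pos2)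
  moreover have "real d ^ d = real d * real d ^ (d - 1)" using assms by (cases d) auto
  ultimately show "Cbar1 d ^ d = (c0 * (real d * root d (unit_ball_vol d))) ^ d"
    by (simp only: Cbar1_power[OF assms] sphere_area_eq[OF assms] mult_ac)
qed (use Cbar1_pos[OF assms] c0_pos in \<open>auto intro!: mult_nonneg_nonneg real_root_ge_zero\<close>)

lemma f_xi_power:
  assumes "2 \<le> d" "0 \<le> x"
  shows "f_xi d \<xi> (x ^ d) = x ^ (d - 1) * (Cbar1 d - 4 * x + 4 * \<xi> powr (- (real d + 1)) * x ^ (d + 1))"
proof -
  obtain m where m: "d = Suc m" "0 < m" using assms(1) by (cases d) auto
  have "(x ^ d) powr ((real d - 1) / real d) = x ^ (d - 1)"
  proof (cases "x = 0")
    case False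
    then have x: "0 < x" using assms by simp
    have "(x ^ d) powr ((real d - 1) / real d) = x powr (real d * ((real d - 1) / real d))"
      unfolding powr_realpow[OF x, symmetric] by (rule powr_powr)
    also have "real d * ((real d - 1) / real d) = real m" using m by simp
    finally show ?thesis using x m by (simp add: powr_realpow)
  qed (use m in simp)
  then show ?thesis by (simp add: f_xi_def m algebra_simps power2_eq_square)
qed

lemma xi_crit_power:
  assumes "0 < d"
  shows "xi_crit d ^ (d + 1) = c0 ^ d * sphere_area d * real (d + 1) ^ (d + 1) / (4 ^ d * real d)"
proof -
  have 1: "(a powr (real d / (real d + 1))) ^ (d + 1) = a ^ d" "(a powr (1 / (real d + 1))) ^ (d + 1) = a" if "0 < a" for a :: real
    using powr_divide_power[OF that, of "d + 1" d] powr_divide_power[OF that, of "d + 1" 1] by (simp_all add: add.commute)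
  have "xi_crit d ^ (d + 1) = (c0 powr (real d / (real d + 1))) ^ (d + 1) * (sphere_area d powr (1 / (real d + 1))) ^ (d + 1)
     * (real d + 1) ^ (d + 1) / ((4 powr (real d / (real d + 1))) ^ (d + 1) * (real d powr (1 / (real d + 1))) ^ (d + 1))"
    unfolding xi_crit_def by (simp only: power_mult_distrib power_divide)
  also have "\<dots> = c0 ^ d * sphere_area d * (real d + 1) ^ (d + 1) / (4 ^ d * real d)"
    using assms by (simp only: 1 c0_pos sphere_area_pos of_nat_0_less_iff zero_less_numeral)
  finally show ?thesis by (simp add: add.commute)
qed

lemma xi_crit_pos: "0 < d \<Longrightarrow> 0 < xi_crit d"
  using sphere_area_pos[of d] c0_pos by (simp add: xi_crit_def)

text \<open>Here the slope is linear, so the maximiser is explicit and its value is a closed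
  expression in \<open>Cbar1 d ^ d\<close>, which turns into \<open>C_star d\<close>.\<close>

lemma offcritical_profile:
  assumes d: "2 \<le> d"
  defines "s \<equiv> \<lambda>x. Cbar1 d - 4 * x"
  obtains xm xe where "0 < xm" "\<And>x. 0 \<le> x \<Longrightarrow> x \<le> xm \<Longrightarrow> 0 < s x"
    "0 < xe" "\<And>x. 0 \<le> x \<Longrightarrow> x \<le> xe \<Longrightarrow> x ^ (d - 1) * s x \<le> xm ^ (d - 1) * s xm" "xe ^ (d - 1) * s xe < 0"
    "xm ^ (d - 1) * s xm = C_star d"
proof
  define m where "m = d - 1"
  have m: "d = Suc m" "0 < m" using d by (simp_all add: m_def)
  define C where "C = Cbar1 d"
  have s_eq: "s x = C - 4 * x" for x by (simp add: s_def C_def)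
  have C: "0 < C" unfolding C_def using m by (intro Cbar1_pos) simp
  \<comment> \<open>The positive zero of the derivative of
    \<open>x ^ m * (C - 4 * x)\<close>.\<close>
  define z where "z = C * real m / (4 * real d)"
  have z: "0 < z" using C m by (simp add: z_def)
  have Cz: "C = 4 * real d / real m * z" using m by (simp add: z_def)
  show "0 < z" by (rule z)
  show spos: "0 < s x" if "x \<le> z" for x
  proof -
    have "4 * z < C" using C m by (simp add: z_def field_simps)
    then show ?thesis using that by (simp add: s_eq)
  qed
  \<comment> \<open>The path may end at any point beyond the zero \<open>C / 4\<close> of the
    slope.\<close>
  show "0 < C / 4 + 1" using C by simp
  show "(C / 4 + 1) ^ (d - 1) * s (C / 4 + 1) < 0"
    using C by (intro mult_pos_neg) (simp_all add: s_eq)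
  show "x ^ (d - 1) * s x \<le> z ^ (d - 1) * s z" if x: "0 \<le> x" for x
  proof (cases "x = 0")
    case True
    then show ?thesis using m z spos[of z] by (simp add: power_0_left less_imp_le)
  next
    case False
    then have x: "0 < x" using x by simp
    \<comment> \<open>Bernoulli's inequality for \<open>z / x\<close>, multiplied by
      \<open>x ^ d\<close> and by \<open>4 / real m\<close>, is exactly the maximality of
      \<open>z\<close>; this gives a global maximum without calculus.\<close>
    have "1 + real d * (z / x - 1) \<le> (1 + (z / x - 1)) ^ d"
      using x z by (intro Bernoulli_inequality) simp
    then have "x ^ d * (1 + real d * (z / x - 1)) \<le> x ^ d * (z / x) ^ d" using x by (intro mult_left_mono) auto
    moreover have "x ^ d * (z / x) ^ d = z ^ d" using x by (simp add: power_mult_distrib[symmetric])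
    moreover have "x ^ d * (1 + real d * (z / x - 1)) = real d * z * x ^ m - real m * x ^ d"
      using x by (simp add: m field_simps)
    ultimately have "real d * z * x ^ m - real m * x ^ d \<le> z ^ d" by simp
    then have "4 / real m * (real d * z * x ^ m - real m * x ^ d) \<le> 4 / real m * z ^ d" by (intro mult_left_mono) auto
    moreover have "4 / real m * (real d * z * x ^ m - real m * x ^ d) = x ^ m * (C - 4 * x)"
      using m by (simp add: Cz field_simps)
    moreover have "4 / real m * z ^ d = z ^ m * (C - 4 * z)"
      using m by (simp add: Cz field_simps)
    ultimately show ?thesis by (simp add: s_eq m)
  qed
  show "z ^ (d - 1) * s z = C_star d"
  proof -
    have "s z = C / real d" using m by (simp add: s_eq z_def field_simps)
    then have "z ^ (d - 1) * s z = z ^ m * (C / real d)" by (simp add: m_def)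
    also have "\<dots> = C ^ d * (real m / 4) ^ m / real d ^ d"
    proof -
      have "z = C * (real m / 4) / real d" by (simp add: z_def)
      then have "z ^ m = C ^ m * (real m / 4) ^ m / real d ^ m" by (simp only: power_mult_distrib power_divide)
      moreover have "real d ^ d = real d * real d ^ m" "C ^ d = C * C ^ m" by (simp_all add: m)
      ultimately show ?thesis by (simp add: mult_ac)
    qed
    also have "\<dots> = C_star d"
    proof -
      have e: "d - 1 = m" "real d - 1 = real m" "real d ^ d = real d * real d ^ m" and d0: "0 < d" by (simp_all add: m)
      show ?thesis unfolding C_def Cbar1_power[OF d0] C_star_def e using d0 by (simp add: mult_ac)
    qed
    finally show ?thesis .
  qed
qed

text \<open>On \<open>{0..xe}\<close> the slope decreases from a positive to a negative value, so it
  has one zero \<open>x0\<close> there, and \<open>x0 ^ d\<close> is \<open>nu_xi d \<xi>\<close>.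
  Between \<open>x0\<close> and \<open>xe\<close> the profile is nonpositive. Hence the path may be
  continued to \<open>xe\<close>, where it ends strictly below the background, without exceeding the
  maximum on \<open>{0..x0}\<close>.\<close>

lemma critical_profile:
  assumes d: "2 \<le> d" and \<xi>: "xi_crit d < \<xi>"
  defines "s \<equiv> \<lambda>x. Cbar1 d - 4 * x + 4 * \<xi> powr (- (real d + 1)) * x ^ (d + 1)"
  obtains xm xe where "0 < xm" "\<And>x. 0 \<le> x \<Longrightarrow> x \<le> xm \<Longrightarrow> 0 < s x"
    "0 < xe" "\<And>x. 0 \<le> x \<Longrightarrow> x \<le> xe \<Longrightarrow> x ^ (d - 1) * s x \<le> xm ^ (d - 1) * s xm" "xe ^ (d - 1) * s xe < 0"
    "xm ^ (d - 1) * s xm = C_xi d \<xi>"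
proof -
  have d0: "0 < d" using d by simp
  have \<xi>0: "0 < \<xi>" using xi_crit_pos[OF d0] \<xi> by simp
  define C where "C = Cbar1 d"
  have C: "0 < C" unfolding C_def by (rule Cbar1_pos[OF d0])
  define \<beta> where "\<beta> = \<xi> powr (- (real d + 1))"
  have \<beta>: "\<beta> = 1 / \<xi> ^ (d + 1)"
  proof -
    have "real d + 1 = real (d + 1)" by simp
    then show ?thesis unfolding \<beta>_def powr_minus using \<xi>0 by (simp only: powr_realpow) (simp add: divide_inverse)
  qed
  have \<beta>0: "0 < \<beta>" using \<xi>0 by (simp add: \<beta>)
  have s: "s x = C - 4 * x + 4 * \<beta> * x ^ (d + 1)" for x by (simp add: s_def C_def \<beta>_def)
  \<comment> \<open>The zero of the derivative \<open>- 4 + 4 * \<beta> * (d + 1) * x ^ d\<close> of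
    the slope. The assumption that \<xi> exceeds \<open>xi_crit d\<close> makes the slope negative
    at this point.\<close>
  define xe where "xe = root d (\<xi> ^ (d + 1) / real (d + 1))"
  have xe0: "0 < xe" using \<xi>0 d0 by (simp add: xe_def)
  have xed: "xe ^ d = \<xi> ^ (d + 1) / real (d + 1)" unfolding xe_def using \<xi>0 d0 by (intro real_root_pow_pos2) auto
  then have bxe: "\<beta> * real (d + 1) * xe ^ d = 1" using \<xi>0 by (simp add: \<beta>)
  have sxe: "s xe < 0"
  proof -
    have "\<beta> * xe ^ (d + 1) = (\<beta> * real (d + 1) * xe ^ d) * xe / real (d + 1)" by (simp del: of_nat_Suc)
    then have "s xe = C - 4 * xe * real d / real (d + 1)"
      unfolding s bxe by (simp add: field_simps)
    moreover have "C < 4 * xe * real d / real (d + 1)"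
    proof (rule power_less_imp_less_base)
      have "xi_crit d ^ (d + 1) < \<xi> ^ (d + 1)" using \<xi> xi_crit_pos[OF d0] by (intro power_strict_mono) auto
      then have "c0 ^ d * sphere_area d * real (d + 1) ^ (d + 1) / (4 ^ d * real d) * (4 ^ d * real d ^ d / real (d + 1) ^ (d + 1))
          < \<xi> ^ (d + 1) * (4 ^ d * real d ^ d / real (d + 1) ^ (d + 1))"
        unfolding xi_crit_power[OF d0] using d0 by (intro mult_strict_right_mono) auto
      moreover have "c0 ^ d * sphere_area d * real (d + 1) ^ (d + 1) / (4 ^ d * real d) * (4 ^ d * real d ^ d / real (d + 1) ^ (d + 1))
          = C ^ d"
      proof -
        have "real d ^ d = real d * real d ^ (d - 1)" using d0 by (cases d) auto
        then show ?thesis unfolding C_def Cbar1_power[OF d0] using d0 by (simp del: power_Suc of_nat_Suc of_nat_add)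
      qed
      moreover have "\<xi> ^ (d + 1) * (4 ^ d * real d ^ d / real (d + 1) ^ (d + 1)) = (4 * xe * real d / real (d + 1)) ^ d"
        unfolding power_mult_distrib power_divide xed by (simp del: of_nat_Suc)
      ultimately show "C ^ d < (4 * xe * real d / real (d + 1)) ^ d" by simp
    qed (use xe0 in auto)
    ultimately show ?thesis by simp
  qed
  have cont: "continuous_on A s" for A unfolding s by (intro continuous_intros)
  have decr: "s y < s x" if "0 \<le> x" "x < y" "y \<le> xe" for x y
  proof (rule DERIV_neg_imp_decreasing_open[OF that(2)])
    fix t assume t: "x < t" "t < y"
    have "t ^ d < xe ^ d" using t that d0 by (intro power_strict_mono) auto
    then have "\<beta> * real (d + 1) * t ^ d < \<beta> * real (d + 1) * xe ^ d" using \<beta>0 by (intro mult_strict_left_mono) auto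
    then have "\<beta> * real (d + 1) * t ^ d < 1" by (simp only: bxe)
    moreover have "((\<lambda>x. x ^ (d + 1)) has_real_derivative real (d + 1) * t ^ d) (at t)"
      using DERIV_pow[of "d + 1" t] by simp
    then have "(s has_real_derivative - 4 + 4 * (\<beta> * real (d + 1) * t ^ d)) (at t)"
      unfolding s by (auto intro!: derivative_eq_intros simp del: power_Suc)
    ultimately show "\<exists>l. (s has_real_derivative l) (at t) \<and> l < 0" by (intro exI conjI) auto
  qed (rule cont)
  have "s 0 = C" by (simp add: s)
  then obtain x0 where x0: "0 \<le> x0" "x0 \<le> xe" "s x0 = 0"
    using IVT2'[of s xe 0 0] sxe C xe0 cont by auto
  have x0pos: "0 < x0" using x0 \<open>s 0 = C\<close> C by (cases "x0 = 0") auto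
  have spos: "0 < s x" if "0 \<le> x" "x < x0" for x using decr[of x x0] that x0 by simp
  have sneg: "s x \<le> 0" if "x0 \<le> x" "x \<le> xe" for x using decr[of x0 x] that x0 by (cases "x = x0") auto
  define p where "p x = x ^ (d - 1) * s x" for x
  have fp: "f_xi d \<xi> (x ^ d) = p x" if "0 \<le> x" for x using f_xi_power[OF d that] by (simp add: p_def s_def)
  have fp': "f_xi d \<xi> \<nu> = p (root d \<nu>)" if "0 \<le> \<nu>" for \<nu>
    using fp[of "root d \<nu>"] that d0 by (simp add: real_root_pow_pos2)
  \<comment> \<open>Below \<open>x0\<close> the slope is positive, so \<open>x0 ^ d\<close> is the
    least positive zero and the infimum is attained.\<close>
  have nu: "nu_xi d \<xi> = x0 ^ d"
    unfolding nu_xi_def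
  proof (rule cInf_eq_minimum)
    show "x0 ^ d \<in> {\<nu>. 0 < \<nu> \<and> f_xi d \<xi> \<nu> = 0}" using x0 x0pos fp[of x0] by (simp add: p_def)
    fix \<nu> assume \<nu>: "\<nu> \<in> {\<nu>. 0 < \<nu> \<and> f_xi d \<xi> \<nu> = 0}"
    show "x0 ^ d \<le> \<nu>"
    proof (rule ccontr)
      assume "\<not> x0 ^ d \<le> \<nu>"
      then have "root d \<nu> < root d (x0 ^ d)" using d0 by (intro real_root_less_mono) auto
      then have "root d \<nu> < x0" using x0pos d0 by (simp add: real_root_power_cancel)
      moreover have "0 < root d \<nu>" using \<nu> d0 by simp
      ultimately have "0 < p (root d \<nu>)" using spos[of "root d \<nu>"] by (simp add: p_def)
      then show False using \<nu> fp'[of \<nu>] by simp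
    qed
  qed
  have "continuous_on {0..x0} p" unfolding p_def by (intro continuous_intros cont)
  then obtain xm where xm: "xm \<in> {0..x0}" "\<And>x. x \<in> {0..x0} \<Longrightarrow> p x \<le> p xm"
    using continuous_attains_sup[of "{0..x0}" p] x0 by auto
  have "0 < p (x0 / 2)" using x0pos spos[of "x0 / 2"] by (simp add: p_def)
  then have pm: "0 < p xm" using xm(2)[of "x0 / 2"] x0pos by simp
  have xm0: "0 < xm" "xm < x0"
  proof -
    have "p 0 = 0" "p x0 = 0" using d x0 by (simp_all add: p_def)
    then show "0 < xm" "xm < x0" using pm xm(1) by (cases "xm = 0"; cases "xm = x0"; auto)+
  qed
  have img: "f_xi d \<xi> ` {0..nu_xi d \<xi>} = p ` {0..x0}"
  proof -
    have "{0..x0 ^ d} = (\<lambda>x. x ^ d) ` {0..x0}"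
    proof
      show "{0..x0 ^ d} \<subseteq> (\<lambda>x. x ^ d) ` {0..x0}"
      proof
        fix \<nu> assume \<nu>: "\<nu> \<in> {0..x0 ^ d}"
        have "root d \<nu> \<le> root d (x0 ^ d)" using \<nu> d0 by (intro real_root_le_mono) auto
        also have "\<dots> = x0" using x0 d0 by (intro real_root_power_cancel) auto
        finally have "root d \<nu> \<in> {0..x0}" using \<nu> by (simp add: real_root_ge_zero)
        moreover have "\<nu> = root d \<nu> ^ d" using \<nu> d0 by (simp add: real_root_pow_pos2)
        ultimately show "\<nu> \<in> (\<lambda>x. x ^ d) ` {0..x0}" by blast
      qed
    qed (auto intro: power_mono)
    then show ?thesis unfolding nu by (auto simp: image_image fp intro!: image_cong)
  qed
  have Cx: "C_xi d \<xi> = p xm"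
    unfolding C_xi_def img by (rule cSup_eq_maximum) (use xm in auto)
  show thesis
  proof (rule that[of xm xe])
    show "0 < s x" if "0 \<le> x" "x \<le> xm" for x using spos that xm0 by simp
    show "x ^ (d - 1) * s x \<le> xm ^ (d - 1) * s xm" if "0 \<le> x" "x \<le> xe" for x
    proof (cases "x \<le> x0")
      case True
      then show ?thesis using xm(2)[of x] that by (simp add: p_def)
    next
      case False
      then have "p x \<le> 0" unfolding p_def using sneg[of x] that by (intro mult_nonneg_nonpos) auto
      then show ?thesis using pm by (simp add: p_def)
    qed
    show "xe ^ (d - 1) * s xe < 0" using sxe xe0 by (intro mult_pos_neg) auto
    show "xm ^ (d - 1) * s xm = C_xi d \<xi>" using Cx by (simp add: p_def)
  qed (use xm0 xe0 in auto)
qed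

lemma filterlim_powr_at_top: "0 < (p :: real) \<Longrightarrow> filterlim (\<lambda>x. x powr p) at_top at_top"
proof -
  assume "0 < p"
  then have "filterlim (\<lambda>x. exp (p * ln x)) at_top at_top"
    by (intro filterlim_compose[OF exp_at_top] filterlim_tendsto_pos_mult_at_top[OF tendsto_const] ln_at_top)
  moreover have "\<forall>\<^sub>F x in at_top. exp (p * ln x) \<le> x powr p"
    using eventually_gt_at_top[of 0] by eventually_elim (simp add: powr_def)
  ultimately show ?thesis by (rule filterlim_at_top_mono)
qed

theorem theorem1p2:
  assumes "CARD('n::finite) \<ge> 2"
  shows
   "(\<forall>(Ls :: nat \<Rightarrow> real) (phis :: nat \<Rightarrow> real).
       filterlim Ls at_top sequentially \<and> (\<forall>k. phis k > 0) \<and> phis \<longlonglongrightarrow> 0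
       \<and> filterlim (\<lambda>k. phis k * Ls k powr (real CARD('n) / (real CARD('n) + 1))) at_top sequentially
       \<longrightarrow> (\<lambda>k. energy_barrier TYPE('n) (Ls k) (phis k) * ereal (phis k ^ (CARD('n) - 1)))
             \<longlonglongrightarrow> ereal (C_star CARD('n)))
    \<and> (\<forall>\<xi>::real. \<xi> > xi_crit CARD('n) \<longrightarrow>
         (\<forall>\<^sub>F L in at_top.
            \<exists>u \<in> (X_phi L (\<xi> * L powr (- (real CARD('n) / (real CARD('n) + 1))))
                     :: (real^'n \<Rightarrow> real) set).
              energy L u < energy L (\<lambda>x::real^'n. -1 + \<xi> * L powr (- (real CARD('n) / (real CARD('n) + 1)))))
       \<and> ((\<lambda>L. energy_barrier TYPE('n) L (\<xi> * L powr (- (real CARD('n) / (real CARD('n) + 1))))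
               * ereal ((\<xi> * L powr (- (real CARD('n) / (real CARD('n) + 1)))) ^ (CARD('n) - 1)))
           \<longlongrightarrow> ereal (C_xi CARD('n) \<xi>)) at_top)"
proof (intro conjI[of "All _"] allI impI)
  let ?n = "CARD('n)"
  let ?p = "real ?n / (real ?n + 1)"
  have n0: "0 < ?n" using assms by simp
  have pow: "(x powr ?p) ^ (?n + 1) = x ^ ?n" if "0 < x" for x
    using powr_divide_power[OF that, of "?n + 1" ?n] by (simp add: add.commute)
  {
    fix Ls phis :: "nat \<Rightarrow> real"
    assume "filterlim Ls at_top sequentially \<and> (\<forall>k. phis k > 0) \<and> phis \<longlonglongrightarrow> 0
       \<and> filterlim (\<lambda>k. phis k * Ls k powr ?p) at_top sequentially"
    then have Ls: "filterlim Ls at_top sequentially" and phis: "\<And>k. phis k > 0" "phis \<longlonglongrightarrow> 0"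
      and x: "filterlim (\<lambda>k. phis k * Ls k powr ?p) at_top sequentially" by auto
    have L1: "\<forall>\<^sub>F k in sequentially. 1 < Ls k" using Ls by (rule filterlim_at_top_dense[THEN iffD1, rule_format])
    \<comment> \<open>The off-critical regime is \<beta> = 0: the product
      \<open>phis k ^ (n + 1) * Ls k ^ n\<close> is the \<open>(n + 1)\<close>-th power of the
      quantity assumed to tend to infinity.\<close>
    interpret droplet_scaling "TYPE('n)" sequentially Ls phis 0
    proof
      show "filterlim (\<lambda>k. phis k * Ls k) at_top sequentially"
      proof (rule filterlim_at_top_mono[OF x])
        show "\<forall>\<^sub>F k in sequentially. phis k * Ls k powr ?p \<le> phis k * Ls k"
          using L1
        proof eventually_elim
          case (elim k)
          have "Ls k powr ?p \<le> Ls k powr 1" using elim by (intro powr_mono) auto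
          then show ?case using phis(1)[of k] elim by simp
        qed
      qed
      have "(\<lambda>k. 1 / (phis k * Ls k powr ?p) ^ (?n + 1)) \<longlonglongrightarrow> 0"
        by (intro tendsto_divide_0[OF tendsto_const] filterlim_at_top_imp_at_infinity filterlim_pow_at_top x) simp
      moreover have "\<forall>\<^sub>F k in sequentially. 1 / (phis k * Ls k powr ?p) ^ (?n + 1) = 1 / (phis k ^ (?n + 1) * Ls k ^ ?n)"
        using L1 by eventually_elim (simp only: power_mult_distrib pow)
      ultimately show "(\<lambda>k. 1 / (phis k ^ (?n + 1) * Ls k ^ ?n)) \<longlonglongrightarrow> 0" by (rule Lim_transform_eventually)
    qed (use assms Ls phis in auto)
    have s: "slope x = Cbar1 ?n - 4 * x" for x by (simp add: slope_def Cbar1_eq[OF n0])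
    obtain xm xe where "0 < xm" "\<And>x. 0 \<le> x \<Longrightarrow> x \<le> xm \<Longrightarrow> 0 < slope x"
      "0 < xe" "\<And>x. 0 \<le> x \<Longrightarrow> x \<le> xe \<Longrightarrow> profile x \<le> profile xm" "profile xe < 0" "profile xm = C_star ?n"
      using offcritical_profile[OF assms] unfolding profile_def s by blast
    then show "(\<lambda>k. energy_barrier TYPE('n) (Ls k) (phis k) * ereal (phis k ^ (?n - 1))) \<longlonglongrightarrow> ereal (C_star ?n)"
      using energy_barrier_tendsto[of xm xe] by simp
  }
  fix \<xi> assume \<xi>: "xi_crit ?n < \<xi>"
  have \<xi>0: "0 < \<xi>" using xi_crit_pos[OF n0] \<xi> by simp
  define \<beta> where "\<beta> = \<xi> powr (- (real ?n + 1))"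
  define \<phi> where "\<phi> L = \<xi> * L powr (- ?p)" for L :: real
  have \<phi>: "\<phi> L ^ (?n + 1) * L ^ ?n = \<xi> ^ (?n + 1)" if "0 < L" for L
  proof -
    have "\<phi> L ^ (?n + 1) = \<xi> ^ (?n + 1) * inverse (L ^ ?n)"
      by (simp only: \<phi>_def powr_minus power_mult_distrib power_inverse pow[OF that])
    then show ?thesis using that by simp
  qed
  \<comment> \<open>In the critical regime \<open>\<phi> L ^ (n + 1) * L ^ n\<close> is the constant
    \<open>\<xi> ^ (n + 1)\<close>, so the coefficient of the depletion equals its limit \<beta> for
    all positive \<open>L\<close>.\<close>
  interpret droplet_scaling "TYPE('n)" at_top "\<lambda>L. L" \<phi> \<beta>
  proof
    show "\<forall>\<^sub>F L in at_top. 0 < \<phi> L" using eventually_gt_at_top[of 0] by eventually_elim (simp add: \<phi>_def \<xi>0)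
    have "((\<lambda>L. \<xi> * L powr (- ?p)) \<longlongrightarrow> \<xi> * 0) at_top"
      by (intro tendsto_mult tendsto_const tendsto_neg_powr filterlim_ident) (use n0 in simp)
    then show "(\<phi> \<longlongrightarrow> 0) at_top" by (simp add: \<phi>_def[abs_def])
    have "filterlim (\<lambda>L. \<xi> * L powr (1 / (real ?n + 1))) at_top at_top"
      by (intro filterlim_tendsto_pos_mult_at_top[OF tendsto_const \<xi>0] filterlim_powr_at_top) simp
    moreover have "\<forall>\<^sub>F L in at_top. \<xi> * L powr (1 / (real ?n + 1)) \<le> \<phi> L * L"
      using eventually_gt_at_top[of 0]
    proof eventually_elim
      case (elim L)
      have "1 / (real ?n + 1) = - ?p + 1" by (simp add: field_simps)
      then have "L powr (1 / (real ?n + 1)) = L powr (- ?p) * L" using elim by (simp only: powr_add powr_one)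
      then show ?case by (simp add: \<phi>_def)
    qed
    ultimately show "filterlim (\<lambda>L. \<phi> L * L) at_top at_top" by (rule filterlim_at_top_mono)
    have \<beta>: "\<beta> = 1 / \<xi> ^ (?n + 1)"
    proof -
      have "real ?n + 1 = real (?n + 1)" by simp
      then show ?thesis unfolding \<beta>_def powr_minus using \<xi>0 by (simp only: powr_realpow) (simp add: divide_inverse)
    qed
    have "\<forall>\<^sub>F L in at_top. 1 / \<xi> ^ (?n + 1) = 1 / (\<phi> L ^ (?n + 1) * L ^ ?n)"
      using eventually_gt_at_top[of 0] by eventually_elim (simp only: \<phi>)
    then show "((\<lambda>L. 1 / (\<phi> L ^ (?n + 1) * L ^ ?n)) \<longlongrightarrow> \<beta>) at_top"
      unfolding \<beta> by (rule Lim_transform_eventually[OF tendsto_const])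
  qed (use assms filterlim_ident in auto)
  have s: "slope x = Cbar1 ?n - 4 * x + 4 * \<xi> powr (- (real ?n + 1)) * x ^ (?n + 1)" for x
    unfolding slope_def Cbar1_eq[OF n0] by (simp only: \<beta>_def)
  obtain xm xe where x: "0 < xm" "\<And>x. 0 \<le> x \<Longrightarrow> x \<le> xm \<Longrightarrow> 0 < slope x"
    "0 < xe" "\<And>x. 0 \<le> x \<Longrightarrow> x \<le> xe \<Longrightarrow> profile x \<le> profile xm" "profile xe < 0" "profile xm = C_xi ?n \<xi>"
    using critical_profile[OF assms \<xi>] unfolding profile_def s by blast
  have "\<forall>\<^sub>F L in at_top. \<exists>u \<in> (X_phi L (\<phi> L) :: (real^'n \<Rightarrow> real) set). energy L u < energy L (\<lambda>x::real^'n. -1 + \<phi> L)"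
    using energy_barrier_upper[of xe xm 1] x(3-5) by (auto elim: eventually_mono)
  moreover have "((\<lambda>L. energy_barrier TYPE('n) L (\<phi> L) * ereal (\<phi> L ^ (?n - 1))) \<longlongrightarrow> ereal (C_xi ?n \<xi>)) at_top"
    using energy_barrier_tendsto[of xm xe] x by simp
  ultimately show "(\<forall>\<^sub>F L in at_top. \<exists>u \<in> (X_phi L (\<xi> * L powr (- ?p)) :: (real^'n \<Rightarrow> real) set).
        energy L u < energy L (\<lambda>x::real^'n. -1 + \<xi> * L powr (- ?p)))
     \<and> ((\<lambda>L. energy_barrier TYPE('n) L (\<xi> * L powr (- ?p)) * ereal ((\<xi> * L powr (- ?p)) ^ (?n - 1)))
         \<longlongrightarrow> ereal (C_xi ?n \<xi>)) at_top"
    unfolding \<phi>_def by (rule conjI)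
qed

end
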